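(* Let $1<p<s<\infty$, $n\ge2$, let $\Omega\subseteq\mathbb{R}^n$ be a domain, let $a=(a_1,\dots,a_n)$ be a weight vector and $V\in M^q_{\mathrm{loc}}(p;\Omega)$ as in the context, and suppose that $Q_{p,s,a,V}\ge0$ on $C_c^\infty(\Omega)$. Put $m=\min\{s,2\}$. Fix a positive solution $u\in W^{1,p}_{\mathrm{loc}}(\Omega)\cap C(\Omega)$ of $Q'_{p,s,a,V}[v]=0$ in $\Omega$. Then there are positive constants $c(p,s)$ and $C(p,s)$, depending only on $p$ and $s$, such that for all nonnegative $\psi,\varphi\in W^{1,p}(\Omega)\cap C_c(\Omega)$, $$Q_{p,s,a,V}[u\psi]\ge c(p,s)\int_{\Omega_1}R_1(\psi\nabla u,u\nabla\psi;m)\,dx+c(p,s)\int_{\Omega_2}R_2(\psi\nabla u,u\nabla\psi)\,dx$$ and $$Q_{p,s,a,V}[u\varphi]\le C(p,s)\int_{\Omega_1}R_1(\varphi\nabla u,u\nabla\varphi;m)\,dx+C(p,s)\int_{\Omega_2'}R_2(\varphi\nabla u,u\nabla\varphi)\,dx,$$ where $\Omega_1=\{x\in\Omega:|\psi\nabla u|_{s,a}\le|u\nabla\psi|_{s,a}\}$, $\Omega_2=\{x\in\Omega:|\psi\nabla u|_{s,a}>|u\nabla\psi|_{s,a}\}$ and $\Omega_2'=\Omega_2\setminus\{x\in\Omega:\varphi\nabla u=0\}$. In particular, there are constants $0<c\le C<\infty$ depending only on $p$ and $s$ such that for all nonnegative $\psi\in W^{1,p}(\Omega)\cap C_c(\Omega)$,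 with $\Omega_2''=\Omega_2\setminus\{x\in\Omega:\psi\nabla u=0\}$ and $E(\psi)=\int_{\Omega_1}R_1(\psi\nabla u,u\nabla\psi;m)\,dx+\int_{\Omega_2''}R_2(\psi\nabla u,u\nabla\psi)\,dx$, $$c\,E(\psi)\le Q_{p,s,a,V}[u\psi]\le C\,E(\psi).$$
   Context: $\omega\Subset\Omega$ means that the closure of $\omega$ is a compact subset of $\Omega$. $C_c(\Omega)$: continuous functions with compact support in $\Omega$. Weights: $a_1,\dots,a_n:\Omega\to(0,\infty)$ are Lebesgue measurable and for every domain $\omega\Subset\Omega$ there are constants $0<c_\omega\le C_\omega<\infty$ with $c_\omega\le a_i\le C_\omega$ a.e. in $\omega$. $|\xi|_{s,a}=(\sum_i a_i(x)|\xi_i|^s)^{1/s}$ and $\xi_i'=a_i(x)^{1/s}\xi_i$. For $\xi,\eta\in\mathbb{R}^n$ and $1<l<\infty$, $$R_1(\xi,\eta;l)=|\eta|_{s,a}^{l}(|\eta|_{s,a}+|\xi|_{s,a})^{p-l},\qquad R_2(\xi,\eta)=|\xi|_{s,a}^{p-s}\sum_{i=1}^n|\eta_i'|^2(|\eta_i'|+|\xi_i'|)^{s-2}\ \ (\xi\ne0).$$ Morrey space: for a domain $\omega\Subset\Omega$ and measurable $f$ on $\omega$: if $p<n$ and $q>n/p$, $\|f\|_{M^q(p;\omega)}=\sup_{y\in\omega,\,0<r<\mathrm{diam}(\omega)}r^{-n/q'}\int_{\omega\cap B_r(y)}|f|\,dx$ with $q'=q/(q-1)$; if $p=n$ and $q>n$,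 $\|f\|_{M^q(n;\omega)}=\sup_{y\in\omega,\,0<r<\mathrm{diam}(\omega)}(\log(\mathrm{diam}(\omega)/r))^{q/n'}\int_{\omega\cap B_r(y)}|f|\,dx$ with $n'=n/(n-1)$; in these cases $M^q(p;\omega)$ is the set of $f\in L^1_{\mathrm{loc}}(\omega)$ with finite norm. If $p>n$, $q=1$ and $M^q(p;\omega)=L^1(\omega)$. $M^q_{\mathrm{loc}}(p;\Omega)$ consists of functions lying in $M^q(p;\omega)$ for all domains $\omega\Subset\Omega$. Functional: $Q_{p,s,a,V}[\phi]=\int_\Omega(|\nabla\phi|_{s,a}^p+V|\phi|^p)\,dx$. A positive solution of $Q'_{p,s,a,V}[v]=0$ in $\Omega$ is a positive $v\in W^{1,p}_{\mathrm{loc}}(\Omega)$ with $\int_\Omega|\nabla v|_{s,a}^{p-s}\sum_i a_i|\partial_iv|^{s-2}\partial_iv\,\partial_i\phi\,dx+\int_\Omega V|v|^{p-2}v\phi\,dx=0$ for all $\phi\in C_c^\infty(\Omega)$ (the first integrand is $0$ where $\nabla v=0$). Conventions: $|t|^{s-2}t=0$ for $t=0$; $t^2(t+\tau)^{s-2}=0$ when $t=\tau=0$; $R_1(0,0;l)=0$. *)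

theory Defs
  imports "HOL-Analysis.Analysis"
begin

text \<open>
  The dimension \<open>n\<close> is a natural number and not a type, so that constants can be chosen before
  \<open>n\<close> is: \<open>\<real>\<^sup>n\<close> is the set of functions \<open>nat \<Rightarrow> real\<close> that are \<^const>\<open>undefined\<close> outside
  \<open>{..<n}\<close>. That set is both the carrier of the topology \<open>Rn n\<close> and the space of the
  Lebesgue measure \<open>Leb n\<close>. Functions on a domain are total functions whose values
  outside the domain are never used.
\<close>

type_synonym pt = "nat \<Rightarrow> real"

abbreviation Rn :: "nat \<Rightarrow> pt topology" where
  "Rn n \<equiv> powertop_real {..<n}"

abbreviation Leb :: "nat \<Rightarrow> pt measure" where
  "Leb n \<equiv> completion (\<Pi>\<^sub>M i\<in>{..<n}. lborel)"

definition edist :: "nat \<Rightarrow> pt \<Rightarrow> pt \<Rightarrow> real" where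
  "edist n x y = L2_set (\<lambda>i. x i - y i) {..<n}"

definition eball :: "nat \<Rightarrow> pt \<Rightarrow> real \<Rightarrow> pt set" where
  "eball n y r = {x \<in> topspace (Rn n). edist n y x < r}"

definition ediam :: "nat \<Rightarrow> pt set \<Rightarrow> real" where
  "ediam n \<omega> = Sup {edist n x y | x y. x \<in> \<omega> \<and> y \<in> \<omega>}"

definition is_domain :: "nat \<Rightarrow> pt set \<Rightarrow> bool" where
  "is_domain n \<Omega> \<longleftrightarrow> openin (Rn n) \<Omega> \<and> connectedin (Rn n) \<Omega> \<and> \<Omega> \<noteq> {}"

definition cinside :: "nat \<Rightarrow> pt set \<Rightarrow> pt set \<Rightarrow> bool" where
  "cinside n A \<Omega> \<longleftrightarrow>
     A \<subseteq> \<Omega> \<and> compactin (Rn n) (Rn n closure_of A) \<and> Rn n closure_of A \<subseteq> \<Omega>"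


subsection \<open>Function spaces\<close>

definition cont_on :: "nat \<Rightarrow> pt set \<Rightarrow> (pt \<Rightarrow> real) \<Rightarrow> bool" where
  "cont_on n \<Omega> f \<longleftrightarrow> continuous_map (subtopology (Rn n) \<Omega>) euclideanreal f"

definition Cc :: "nat \<Rightarrow> pt set \<Rightarrow> (pt \<Rightarrow> real) set" where
  "Cc n \<Omega> = {f. cont_on n \<Omega> f \<and> cinside n {x \<in> \<Omega>. f x \<noteq> 0} \<Omega>}"

definition partial :: "nat \<Rightarrow> (pt \<Rightarrow> real) \<Rightarrow> pt \<Rightarrow> real" where
  "partial i f x = deriv (\<lambda>t. f (x(i := t))) (x i)"

primrec Ck :: "nat \<Rightarrow> pt set \<Rightarrow> nat \<Rightarrow> (pt \<Rightarrow> real) \<Rightarrow> bool" where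
  "Ck n \<Omega> 0 f \<longleftrightarrow> cont_on n \<Omega> f"
| "Ck n \<Omega> (Suc k) f \<longleftrightarrow> cont_on n \<Omega> f \<and>
     (\<forall>i<n. (\<forall>x\<in>\<Omega>. (\<lambda>t. f (x(i := t))) differentiable (at (x i))) \<and> Ck n \<Omega> k (partial i f))"

definition Cc_inf :: "nat \<Rightarrow> pt set \<Rightarrow> (pt \<Rightarrow> real) set" where
  "Cc_inf n \<Omega> = {f \<in> Cc n \<Omega>. \<forall>k. Ck n \<Omega> k f}"

definition Lp :: "nat \<Rightarrow> real \<Rightarrow> pt set \<Rightarrow> (pt \<Rightarrow> real) set" where
  "Lp n p A = {f. set_borel_measurable (Leb n) A f \<and>
                  set_integrable (Leb n) A (\<lambda>x. \<bar>f x\<bar> powr p)}"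

definition Lp_loc :: "nat \<Rightarrow> real \<Rightarrow> pt set \<Rightarrow> (pt \<Rightarrow> real) set" where
  "Lp_loc n p \<Omega> = {f. \<forall>K. compactin (Rn n) K \<and> K \<subseteq> \<Omega> \<longrightarrow> f \<in> Lp n p K}"

definition weak_partial :: "nat \<Rightarrow> pt set \<Rightarrow> nat \<Rightarrow> (pt \<Rightarrow> real) \<Rightarrow> (pt \<Rightarrow> real) \<Rightarrow> bool" where
  "weak_partial n \<Omega> i f g \<longleftrightarrow> f \<in> Lp_loc n 1 \<Omega> \<and> g \<in> Lp_loc n 1 \<Omega> \<and>
     (\<forall>\<phi>\<in>Cc_inf n \<Omega>. (LINT x:\<Omega>|Leb n. f x * partial i \<phi> x) = - (LINT x:\<Omega>|Leb n. g x * \<phi> x))"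

definition W1p :: "nat \<Rightarrow> real \<Rightarrow> pt set \<Rightarrow> (pt \<Rightarrow> real) set" where
  "W1p n p \<Omega> = {f \<in> Lp n p \<Omega>. \<forall>i<n. \<exists>g\<in>Lp n p \<Omega>. weak_partial n \<Omega> i f g}"

definition W1p_loc :: "nat \<Rightarrow> real \<Rightarrow> pt set \<Rightarrow> (pt \<Rightarrow> real) set" where
  "W1p_loc n p \<Omega> = {f \<in> Lp_loc n p \<Omega>. \<forall>i<n. \<exists>g\<in>Lp_loc n p \<Omega>. weak_partial n \<Omega> i f g}"

text \<open>
  A representative of the weak gradient. It is determined up to null sets, so no integral
  below depends on the choice.
\<close>

definition wgrad :: "nat \<Rightarrow> pt set \<Rightarrow> (pt \<Rightarrow> real) \<Rightarrow> pt \<Rightarrow> nat \<Rightarrow> real" where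
  "wgrad n \<Omega> f x i = (SOME g. weak_partial n \<Omega> i f g) x"


subsection \<open>Weights and Morrey spaces\<close>

definition weight :: "nat \<Rightarrow> pt set \<Rightarrow> (nat \<Rightarrow> pt \<Rightarrow> real) \<Rightarrow> bool" where
  "weight n \<Omega> a \<longleftrightarrow>
     (\<forall>i<n. set_borel_measurable (Leb n) \<Omega> (a i) \<and> (\<forall>x\<in>\<Omega>. 0 < a i x)) \<and>
     (\<forall>\<omega>. is_domain n \<omega> \<and> cinside n \<omega> \<Omega> \<longrightarrow>
        (\<exists>c C. 0 < c \<and> c \<le> C \<and>
           (\<forall>i<n. AE x in Leb n. x \<in> \<omega> \<longrightarrow> c \<le> a i x \<and> a i x \<le> C)))"

definition morrey_norm_sub :: "nat \<Rightarrow> real \<Rightarrow> pt set \<Rightarrow> (pt \<Rightarrow> real) \<Rightarrow> ennreal" where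
  "morrey_norm_sub n q \<omega> f = (let q' = q / (q - 1) in
     SUP y\<in>\<omega>. SUP r\<in>{0<..<ediam n \<omega>}.
       ennreal (r powr (- (real n / q'))) * (\<integral>\<^sup>+x\<in>\<omega> \<inter> eball n y r. ennreal \<bar>f x\<bar> \<partial>Leb n))"

definition morrey_norm_crit :: "nat \<Rightarrow> real \<Rightarrow> pt set \<Rightarrow> (pt \<Rightarrow> real) \<Rightarrow> ennreal" where
  "morrey_norm_crit n q \<omega> f = (let n' = real n / (real n - 1) in
     SUP y\<in>\<omega>. SUP r\<in>{0<..<ediam n \<omega>}.
       ennreal (ln (ediam n \<omega> / r) powr (q / n')) *
       (\<integral>\<^sup>+x\<in>\<omega> \<inter> eball n y r. ennreal \<bar>f x\<bar> \<partial>Leb n))"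

definition morrey :: "nat \<Rightarrow> real \<Rightarrow> real \<Rightarrow> pt set \<Rightarrow> (pt \<Rightarrow> real) set" where
  "morrey n q p \<omega> =
     (if p < real n then {f \<in> Lp_loc n 1 \<omega>. morrey_norm_sub n q \<omega> f < \<infinity>}
      else if p = real n then {f \<in> Lp_loc n 1 \<omega>. morrey_norm_crit n q \<omega> f < \<infinity>}
      else Lp n 1 \<omega>)"

definition morrey_exponent :: "nat \<Rightarrow> real \<Rightarrow> real \<Rightarrow> bool" where
  "morrey_exponent n q p \<longleftrightarrow>
     (if p < real n then real n / p < q else if p = real n then real n < q else q = 1)"

definition morrey_loc :: "nat \<Rightarrow> real \<Rightarrow> real \<Rightarrow> pt set \<Rightarrow> (pt \<Rightarrow> real) set" where
  "morrey_loc n q p \<Omega> = {f. \<forall>\<omega>. is_domain n \<omega> \<and> cinside n \<omega> \<Omega> \<longrightarrow> f \<in> morrey n q p \<omega>}"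


subsection \<open>The functional and its Euler--Lagrange equation\<close>

definition anorm :: "nat \<Rightarrow> real \<Rightarrow> (nat \<Rightarrow> pt \<Rightarrow> real) \<Rightarrow> pt \<Rightarrow> (nat \<Rightarrow> real) \<Rightarrow> real" where
  "anorm n s a x \<xi> = (\<Sum>i<n. a i x * \<bar>\<xi> i\<bar> powr s) powr (1 / s)"

definition Q_fun :: "nat \<Rightarrow> real \<Rightarrow> real \<Rightarrow> (nat \<Rightarrow> pt \<Rightarrow> real) \<Rightarrow> (pt \<Rightarrow> real) \<Rightarrow> pt set \<Rightarrow>
    (pt \<Rightarrow> real) \<Rightarrow> real" where
  "Q_fun n p s a V \<Omega> \<phi> =
     (LINT x:\<Omega>|Leb n. anorm n s a x (wgrad n \<Omega> \<phi> x) powr p + V x * \<bar>\<phi> x\<bar> powr p)"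

text \<open>
  The conventions at zero in the next three definitions hold because \<open>0 powr r = 0\<close> for
  every exponent \<open>r\<close>, including negative ones.
\<close>

definition positive_solution :: "nat \<Rightarrow> real \<Rightarrow> real \<Rightarrow> (nat \<Rightarrow> pt \<Rightarrow> real) \<Rightarrow> (pt \<Rightarrow> real) \<Rightarrow>
    pt set \<Rightarrow> (pt \<Rightarrow> real) \<Rightarrow> bool" where
  "positive_solution n p s a V \<Omega> v \<longleftrightarrow>
     v \<in> W1p_loc n p \<Omega> \<and> (\<forall>x\<in>\<Omega>. 0 < v x) \<and>
     (\<forall>\<phi>\<in>Cc_inf n \<Omega>.
        (LINT x:\<Omega>|Leb n. anorm n s a x (wgrad n \<Omega> v x) powr (p - s) *
           (\<Sum>i<n. a i x * \<bar>wgrad n \<Omega> v x i\<bar> powr (s - 2) * wgrad n \<Omega> v x i * partial i \<phi> x)) +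
        (LINT x:\<Omega>|Leb n. V x * \<bar>v x\<bar> powr (p - 2) * v x * \<phi> x) = 0)"

definition R1 :: "nat \<Rightarrow> real \<Rightarrow> real \<Rightarrow> (nat \<Rightarrow> pt \<Rightarrow> real) \<Rightarrow> real \<Rightarrow> pt \<Rightarrow>
    (nat \<Rightarrow> real) \<Rightarrow> (nat \<Rightarrow> real) \<Rightarrow> real" where
  "R1 n p s a l x \<xi> \<eta> =
     anorm n s a x \<eta> powr l * (anorm n s a x \<eta> + anorm n s a x \<xi>) powr (p - l)"

definition R2 :: "nat \<Rightarrow> real \<Rightarrow> real \<Rightarrow> (nat \<Rightarrow> pt \<Rightarrow> real) \<Rightarrow> pt \<Rightarrow>
    (nat \<Rightarrow> real) \<Rightarrow> (nat \<Rightarrow> real) \<Rightarrow> real" where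
  "R2 n p s a x \<xi> \<eta> = anorm n s a x \<xi> powr (p - s) *
     (\<Sum>i<n. let \<xi>' = a i x powr (1 / s) * \<xi> i; \<eta>' = a i x powr (1 / s) * \<eta> i
        in \<bar>\<eta>'\<bar>\<^sup>2 * (\<bar>\<eta>'\<bar> + \<bar>\<xi>'\<bar>) powr (s - 2))"

definition cgrad :: "nat \<Rightarrow> pt set \<Rightarrow> (pt \<Rightarrow> real) \<Rightarrow> (pt \<Rightarrow> real) \<Rightarrow> pt \<Rightarrow> nat \<Rightarrow> real" where
  "cgrad n \<Omega> f g x = (\<lambda>i. f x * wgrad n \<Omega> g x i)"

definition Omega1 :: "nat \<Rightarrow> real \<Rightarrow> (nat \<Rightarrow> pt \<Rightarrow> real) \<Rightarrow> pt set \<Rightarrow> (pt \<Rightarrow> real) \<Rightarrow>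
    (pt \<Rightarrow> real) \<Rightarrow> pt set" where
  "Omega1 n s a \<Omega> u \<psi> =
     {x \<in> \<Omega>. anorm n s a x (cgrad n \<Omega> \<psi> u x) \<le> anorm n s a x (cgrad n \<Omega> u \<psi> x)}"

definition Omega2 :: "nat \<Rightarrow> real \<Rightarrow> (nat \<Rightarrow> pt \<Rightarrow> real) \<Rightarrow> pt set \<Rightarrow> (pt \<Rightarrow> real) \<Rightarrow>
    (pt \<Rightarrow> real) \<Rightarrow> pt set" where
  "Omega2 n s a \<Omega> u \<psi> =
     {x \<in> \<Omega>. anorm n s a x (cgrad n \<Omega> \<psi> u x) > anorm n s a x (cgrad n \<Omega> u \<psi> x)}"

definition zero_set :: "nat \<Rightarrow> pt set \<Rightarrow> (pt \<Rightarrow> real) \<Rightarrow> (pt \<Rightarrow> real) \<Rightarrow> pt set" where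
  "zero_set n \<Omega> u \<phi> = {x \<in> \<Omega>. \<forall>i<n. cgrad n \<Omega> \<phi> u x i = 0}"

text \<open>
  The integrals of \<open>R1\<close> and \<open>R2\<close> have nonnegative integrands and may be infinite (when the
  region comes from one function and the integrand from another), so they take values in
  \<^typ>\<open>ereal\<close>.
\<close>

definition nint :: "nat \<Rightarrow> pt set \<Rightarrow> (pt \<Rightarrow> real) \<Rightarrow> ereal" where
  "nint n A f = enn2ereal (\<integral>\<^sup>+x\<in>A. ennreal (f x) \<partial>Leb n)"

definition int_R1 :: "nat \<Rightarrow> real \<Rightarrow> real \<Rightarrow> (nat \<Rightarrow> pt \<Rightarrow> real) \<Rightarrow> pt set \<Rightarrow> (pt \<Rightarrow> real) \<Rightarrow>
    pt set \<Rightarrow> (pt \<Rightarrow> real) \<Rightarrow> ereal" where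
  "int_R1 n p s a \<Omega> u A \<psi> =
     nint n A (\<lambda>x. R1 n p s a (min s 2) x (cgrad n \<Omega> \<psi> u x) (cgrad n \<Omega> u \<psi> x))"

definition int_R2 :: "nat \<Rightarrow> real \<Rightarrow> real \<Rightarrow> (nat \<Rightarrow> pt \<Rightarrow> real) \<Rightarrow> pt set \<Rightarrow> (pt \<Rightarrow> real) \<Rightarrow>
    pt set \<Rightarrow> (pt \<Rightarrow> real) \<Rightarrow> ereal" where
  "int_R2 n p s a \<Omega> u A \<psi> =
     nint n A (\<lambda>x. R2 n p s a x (cgrad n \<Omega> \<psi> u x) (cgrad n \<Omega> u \<psi> x))"

definition E_fun :: "nat \<Rightarrow> real \<Rightarrow> real \<Rightarrow> (nat \<Rightarrow> pt \<Rightarrow> real) \<Rightarrow> pt set \<Rightarrow> (pt \<Rightarrow> real) \<Rightarrow>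
    (pt \<Rightarrow> real) \<Rightarrow> ereal" where
  "E_fun n p s a \<Omega> u \<psi> =
     int_R1 n p s a \<Omega> u (Omega1 n s a \<Omega> u \<psi>) \<psi> +
     int_R2 n p s a \<Omega> u (Omega2 n s a \<Omega> u \<psi> - zero_set n \<Omega> u \<psi>) \<psi>"

definition nonneg_tests :: "nat \<Rightarrow> real \<Rightarrow> pt set \<Rightarrow> (pt \<Rightarrow> real) set" where
  "nonneg_tests n p \<Omega> = {\<psi> \<in> W1p n p \<Omega> \<inter> Cc n \<Omega>. \<forall>x\<in>\<Omega>. 0 \<le> \<psi> x}"

end

theory Submission
  imports Defs "HOL-Real_Asymp.Real_Asymp"
begin

text \<open>
  Mollification shows that the equation for \<open>u\<close> may be tested with \<open>u\<psi>\<^sup>p\<close>, although \<open>u\<close> and \<open>\<psi>\<close> are only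
  continuous Sobolev functions. Subtracting the result from \<open>Q[u\<psi>]\<close> removes the potential \<open>V\<close> and leaves the
  integral of the Bregman remainder
  \<open>\<bar>\<xi> + \<eta>\<bar>\<^sup>p - \<bar>\<xi>\<bar>\<^sup>p - p\<bar>\<xi>\<bar>\<^sup>p\<^sup>-\<^sup>s \<Sum> a\<^sub>i\<bar>\<xi>\<^sub>i\<bar>\<^sup>s\<^sup>-\<^sup>2\<xi>\<^sub>i\<eta>\<^sub>i\<close> at \<open>\<xi> = \<psi>\<nabla>u\<close> and \<open>\<eta> = u\<nabla>\<psi>\<close>.
  After rescaling the coordinates by \<open>a\<^sub>i\<^sup>1\<^sup>/\<^sup>s\<close>, this remainder is compared pointwise with \<open>R1\<close> and \<open>R2\<close>. On the
  zero set of \<open>\<phi>\<close> the gradient of \<open>\<phi>\<close> vanishes almost everywhere, so the remainder vanishes there too.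
\<close>

subsection \<open>The remainder of powers of the norm\<close>

text \<open>The pointwise lower bound is the hard half. The p-th power of the norm is the power p/s
  < 1 of the separable sum of |t|^s, and a concave outer function works against convexity; what
  survives is the gap (s - 1) - (s - p) = p - 1 > 0. All vector estimates are proved without weights
  and for every dimension at once, so their constants see only p and s. The upper bounds cannot
  assume that one of |\<xi>|, |\<eta>| is the larger: \<psi> cuts out the regions while the
  integrand belongs to \<phi>. On the analytic side the flux lies locally in the space dual to L^p,
  but V is only known to be locally integrable. Approximations of a test function must therefore
  stay uniformly bounded and converge pointwise, while their gradients converge against every field
  of exponent p/(p - 1); mollifying a continuous Sobolev function with compact support achieves
  both.\<close>

definition breg :: "real \<Rightarrow> real \<Rightarrow> real \<Rightarrow> real" where
  "breg s a b = \<bar>a + b\<bar> powr s - \<bar>a\<bar> powr s - s * (\<bar>a\<bar> powr (s - 2) * a) * b"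

lemma has_derivative_abs_powr:
  fixes s x :: real assumes "1 < s"
  shows "((\<lambda>x. \<bar>x\<bar> powr s) has_real_derivative s * (\<bar>x\<bar> powr (s - 2) * x)) (at x)"
proof -
  consider "x > 0" | "x < 0" | "x = 0" by linarith
  then show ?thesis
  proof cases
    case 1
    have "((\<lambda>x. x powr s) has_real_derivative s * (\<bar>x\<bar> powr (s - 2) * x)) (at x)"
      using 1 by (auto intro!: derivative_eq_intros simp: powr_diff power2_eq_square field_simps)
    then show ?thesis
      by (rule has_field_derivative_transform_within[where d=x]) (use 1 in \<open>auto simp: dist_real_def\<close>)
  next
    case 2
    have "((\<lambda>x. (-x) powr s) has_real_derivative s * (\<bar>x\<bar> powr (s - 2) * x)) (at x)"
      using 2 by (auto intro!: derivative_eq_intros simp: powr_diff power2_eq_square field_simps)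
    then show ?thesis
      by (rule has_field_derivative_transform_within[where d="-x"]) (use 2 in \<open>auto simp: dist_real_def\<close>)
  next
    case 3
    have "((\<lambda>h::real. \<bar>h\<bar> powr s / h) \<longlongrightarrow> 0) (at 0)" using assms by real_asymp
    then show ?thesis using 3 by (simp add: DERIV_def)
  qed
qed

text \<open>The derivative s((1 + y)^(s-1) - 1) has the sign of y for y > -1, so the mean value
  theorem on the interval between 0 and x settles x > -1. For x \<le> -1 the linear term alone gives
  -1 - s x \<ge> s - 1 > 0.\<close>

lemma powr_bernoulli_strict:
  fixes s x :: real assumes "1 < s" "x \<noteq> 0"
  shows "0 < \<bar>1 + x\<bar> powr s - 1 - s * x"
proof (cases "x > -1")
  case True
  define f where "f = (\<lambda>y. \<bar>1 + y\<bar> powr s - s * y)"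
  have D: "(f has_real_derivative s * (\<bar>1+y\<bar> powr (s-2) * (1+y)) - s) (at y)" for y
  proof -
    have "((\<lambda>y. 1 + y) has_real_derivative 1) (at y)" by (auto intro!: derivative_eq_intros)
    from DERIV_chain2[OF has_derivative_abs_powr[OF assms(1)] this]
    have "((\<lambda>y. \<bar>1 + y\<bar> powr s) has_real_derivative s * (\<bar>1+y\<bar> powr (s-2) * (1+y))) (at y)" by simp
    from DERIV_diff[OF this DERIV_cmult_Id] show ?thesis unfolding f_def .
  qed
  have pr: "\<bar>1+y\<bar> powr (s-2) * (1+y) = (1+y) powr (s-1)" if "y > -1" for y
    using that powr_add[of "1+y" "s-2" 1] by simp
  have "f x > f 0"
  proof (cases "x > 0")
    case True
    obtain z where z: "0 < z" "z < x" "f x - f 0 = (x - 0) * (s * (\<bar>1+z\<bar> powr (s-2) * (1+z)) - s)"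
      using MVT2[OF True, of f, OF D] by blast
    have "(1+z) powr (s-1) > 1" using z assms by (simp add: gr_one_powr)
    then have "(x - 0) * (s * (\<bar>1+z\<bar> powr (s-2) * (1+z)) - s) > 0" using pr[of z] z assms
      by (intro mult_pos_pos) auto
    then show ?thesis using z by simp
  next
    case False
    then have x: "x < 0" using assms by simp
    obtain z where z: "x < z" "z < 0" "f 0 - f x = (0 - x) * (s * (\<bar>1+z\<bar> powr (s-2) * (1+z)) - s)"
      using MVT2[OF x, of f, OF D] by blast
    have "(1+z) powr (s-1) < 1 powr (s-1)" using z assms \<open>x > -1\<close> by (intro powr_less_mono2) auto
    then have "(0 - x) * (s * (\<bar>1+z\<bar> powr (s-2) * (1+z)) - s) < 0" using pr[of z] z x assms \<open>x > -1\<close>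
      by (intro mult_pos_neg) auto
    then show ?thesis using z by simp
  qed
  then show ?thesis by (simp add: f_def)
next
  case False
  then have "s * x \<le> - s" using assms by (simp add: mult_le_cancel_left_pos[of s x "-1", simplified])
  then show ?thesis using assms powr_ge_zero[of "\<bar>1+x\<bar>" s] by linarith
qed

text \<open>The quotient of the two expressions is continuous and positive on the whole line once
  its singularity at 0 is filled, and it tends to 1 at both ends. Compactness of a large interval
  then yields the constants.\<close>

lemma breg_ratio_bounds:
  fixes s :: real assumes s: "1 < s"
  shows "\<exists>c C. 0 < c \<and> 0 < C \<and> (\<forall>x. c * (x\<^sup>2 * (1 + \<bar>x\<bar>) powr (s-2)) \<le> \<bar>1+x\<bar> powr s - 1 - s*x
     \<and> \<bar>1+x\<bar> powr s - 1 - s*x \<le> C * (x\<^sup>2 * (1 + \<bar>x\<bar>) powr (s-2)))"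
proof -
  define q where "q = (\<lambda>x. (\<bar>1+x\<bar> powr s - 1 - s*x) / (x\<^sup>2 * (1+\<bar>x\<bar>) powr (s-2)))"
  \<comment> \<open>The value at 0 is half the second derivative of |1 + x|^s there, which is the
    limit of \<open>q\<close>.\<close>
  define r where "r = (\<lambda>x. if x = 0 then s*(s-1)/2 else q x)"
  have pos: "0 < r x" for x using powr_bernoulli_strict[OF s, of x] s by (auto simp: r_def q_def)
  have "(q \<longlongrightarrow> s*(s-1)/2) (at 0)" unfolding q_def using s by real_asymp
  then have "(q \<longlongrightarrow> r 0) (at 0)" by (simp add: r_def)
  then have "isCont r 0"
    unfolding isCont_def by (rule Lim_transform_eventually) (auto simp: r_def eventually_at_filter)
  moreover have "isCont r x" if "x \<noteq> 0" for x
  proof -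
    have "isCont q x" unfolding q_def using that s by (auto intro!: continuous_intros)
    moreover have "eventually (\<lambda>y. q y = r y) (nhds x)"
      using t1_space_nhds[OF that] by eventually_elim (simp add: r_def)
    ultimately show ?thesis using isCont_cong by blast
  qed
  ultimately have cont: "continuous_on UNIV r" by (metis continuous_at_imp_continuous_on)
  have "(q \<longlongrightarrow> 1) at_top" unfolding q_def using s by real_asymp
  then have "eventually (\<lambda>x. q x > 1/2 \<and> q x < 2) at_top"
    by (intro eventually_conj order_tendstoD[where y=1]) auto
  then obtain K1 where K1: "\<And>x. x \<ge> K1 \<Longrightarrow> q x > 1/2 \<and> q x < 2"
    by (auto simp: eventually_at_top_linorder)
  have "(q \<longlongrightarrow> 1) at_bot" unfolding q_def using s by real_asymp
  then have "eventually (\<lambda>x. q x > 1/2 \<and> q x < 2) at_bot"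
    by (intro eventually_conj order_tendstoD[where y=1]) auto
  then obtain K2 where K2: "\<And>x. x \<le> K2 \<Longrightarrow> q x > 1/2 \<and> q x < 2"
    by (auto simp: eventually_at_bot_linorder)
  define K where "K = \<bar>K1\<bar> + \<bar>K2\<bar> + 1"
  have cK: "compact {-K..K}" "{-K..K} \<noteq> {}" "continuous_on {-K..K} r"
    using cont continuous_on_subset by (auto simp: K_def)
  obtain x1 where x1: "\<And>y. y \<in> {-K..K} \<Longrightarrow> r x1 \<le> r y"
    using continuous_attains_inf[OF cK] by blast
  obtain x2 where x2: "\<And>y. y \<in> {-K..K} \<Longrightarrow> r y \<le> r x2"
    using continuous_attains_sup[OF cK] by blast
  define c C where "c = min (r x1) (1/2)" and "C = max (r x2) 2"
  have rb: "c \<le> r x \<and> r x \<le> C" for x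
  proof (cases "x \<in> {-K..K}")
    case True then show ?thesis using x1[of x] x2[of x] by (simp add: c_def C_def min_le_iff_disj le_max_iff_disj)
  next
    case False
    then have "x \<noteq> 0" "x \<ge> K1 \<or> x \<le> K2" by (auto simp: K_def)
    then have "1/2 < q x \<and> q x < 2" using K1 K2 by blast
    then show ?thesis using \<open>x \<noteq> 0\<close> by (auto simp: c_def C_def r_def)
  qed
  have "c * (x\<^sup>2 * (1 + \<bar>x\<bar>) powr (s-2)) \<le> \<bar>1+x\<bar> powr s - 1 - s*x
     \<and> \<bar>1+x\<bar> powr s - 1 - s*x \<le> C * (x\<^sup>2 * (1 + \<bar>x\<bar>) powr (s-2))" for x
  proof (cases "x = 0")
    case False
    then have p: "x\<^sup>2 * (1 + \<bar>x\<bar>) powr (s-2) > 0" by simp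
    have "\<bar>1+x\<bar> powr s - 1 - s*x = r x * (x\<^sup>2 * (1 + \<bar>x\<bar>) powr (s-2))"
      using False p by (simp add: r_def q_def)
    then show ?thesis using rb[of x] p by (simp add: mult_right_mono)
  qed simp
  moreover have "0 < c" "0 < C" using pos by (auto simp: c_def C_def)
  ultimately show ?thesis by blast
qed

text \<open>Both expressions are homogeneous of degree s in (a, b), so for a \<noteq> 0 division by
  |a|^s leaves the one-variable estimate at b/a.\<close>

lemma breg_bounds:
  fixes s :: real assumes s: "1 < s"
  shows "\<exists>c C. 0 < c \<and> 0 < C \<and> (\<forall>a b. c * (b\<^sup>2 * (\<bar>b\<bar> + \<bar>a\<bar>) powr (s-2)) \<le> breg s a b
     \<and> breg s a b \<le> C * (b\<^sup>2 * (\<bar>b\<bar> + \<bar>a\<bar>) powr (s-2)))"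
proof -
  obtain c C where cC: "0 < c" "0 < C" and
    b: "\<And>x. c * (x\<^sup>2 * (1 + \<bar>x\<bar>) powr (s-2)) \<le> \<bar>1+x\<bar> powr s - 1 - s*x"
       "\<And>x. \<bar>1+x\<bar> powr s - 1 - s*x \<le> C * (x\<^sup>2 * (1 + \<bar>x\<bar>) powr (s-2))"
    using breg_ratio_bounds[OF s] by blast
  have e0: "breg s 0 b = b\<^sup>2 * (\<bar>b\<bar> + \<bar>0\<bar>) powr (s-2)" for b
    using s by (cases "b = 0") (auto simp: breg_def powr_diff)
  have e1: "breg s a b = \<bar>a\<bar> powr s * (\<bar>1+b/a\<bar> powr s - 1 - s*(b/a))"
     "b\<^sup>2 * (\<bar>b\<bar> + \<bar>a\<bar>) powr (s-2) = \<bar>a\<bar> powr s * ((b/a)\<^sup>2 * (1 + \<bar>b/a\<bar>) powr (s-2))" if "a \<noteq> 0" for a b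
  proof -
    have "\<bar>a+b\<bar> = \<bar>a\<bar> * \<bar>1+b/a\<bar>" using that by (simp add: abs_mult[symmetric] field_simps)
    then have "\<bar>a+b\<bar> powr s = \<bar>a\<bar> powr s * \<bar>1+b/a\<bar> powr s" by (simp add: powr_mult)
    moreover have "s * (\<bar>a\<bar> powr (s-2) * a) * b = \<bar>a\<bar> powr s * (s*(b/a))"
      using that by (simp add: powr_diff power2_eq_square field_simps)
    ultimately show "breg s a b = \<bar>a\<bar> powr s * (\<bar>1+b/a\<bar> powr s - 1 - s*(b/a))"
      by (simp add: breg_def algebra_simps)
    have "\<bar>b\<bar> + \<bar>a\<bar> = \<bar>a\<bar> * (1 + \<bar>b/a\<bar>)" using that by (simp add: field_simps abs_mult)
    then have "(\<bar>b\<bar> + \<bar>a\<bar>) powr (s-2) = \<bar>a\<bar> powr (s-2) * (1 + \<bar>b/a\<bar>) powr (s-2)" by (simp add: powr_mult)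
    then show "b\<^sup>2 * (\<bar>b\<bar> + \<bar>a\<bar>) powr (s-2) = \<bar>a\<bar> powr s * ((b/a)\<^sup>2 * (1 + \<bar>b/a\<bar>) powr (s-2))"
      using that by (simp add: powr_diff power_divide)
  qed
  \<comment> \<open>For a = 0 both expressions equal |b|^s, so the constants must lie on the two
    sides of 1.\<close>
  define c' C' where "c' = min c 1" and "C' = max C 1"
  have "c' * (b'\<^sup>2 * (\<bar>b'\<bar> + \<bar>a\<bar>) powr (s-2)) \<le> breg s a b'
     \<and> breg s a b' \<le> C' * (b'\<^sup>2 * (\<bar>b'\<bar> + \<bar>a\<bar>) powr (s-2))" for a b'
  proof (cases "a = 0")
    case True
    have z: "0 \<le> b'\<^sup>2 * \<bar>b'\<bar> powr (s-2)" by simp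
    show ?thesis using e0[of b'] True mult_right_mono[OF _ z, of c' 1] mult_right_mono[OF _ z, of 1 C']
      by (simp add: c'_def C'_def)
  next
    case False
    let ?z = "(b'/a)\<^sup>2 * (1 + \<bar>b'/a\<bar>) powr (s-2)"
    have z: "0 \<le> ?z" by simp
    have "c' * ?z \<le> c * ?z" "C * ?z \<le> C' * ?z" 
      by (rule mult_right_mono[OF _ z]; simp add: c'_def C'_def)+
    then have "c' * ?z \<le> \<bar>1+b'/a\<bar> powr s - 1 - s*(b'/a)" "\<bar>1+b'/a\<bar> powr s - 1 - s*(b'/a) \<le> C' * ?z"
      using b[of "b'/a"] by linarith+
    then have "\<bar>a\<bar> powr s * (c' * ?z) \<le> \<bar>a\<bar> powr s * (\<bar>1+b'/a\<bar> powr s - 1 - s*(b'/a))"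
      "\<bar>a\<bar> powr s * (\<bar>1+b'/a\<bar> powr s - 1 - s*(b'/a)) \<le> \<bar>a\<bar> powr s * (C' * ?z)"
      by (intro mult_left_mono; simp)+
    then show ?thesis unfolding e1[OF False] by (simp only: ac_simps simp_thms)
  qed
  moreover have "0 < c'" "0 < C'" using cC by (auto simp: c'_def C'_def)
  ultimately show ?thesis by blast
qed

section \<open>Remainders of powers of the vector norm\<close>

definition lsum :: "nat \<Rightarrow> real \<Rightarrow> (nat \<Rightarrow> real) \<Rightarrow> real" where
  "lsum n s v = (\<Sum>i<n. \<bar>v i\<bar> powr s)"

text \<open>The sum inside \<open>R2\<close> in rescaled coordinates; each summand has the size of
  \<open>breg s (v i) (w i)\<close>.\<close>

definition tsum :: "nat \<Rightarrow> real \<Rightarrow> (nat \<Rightarrow> real) \<Rightarrow> (nat \<Rightarrow> real) \<Rightarrow> real" where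
  "tsum n s v w = (\<Sum>i<n. (w i)\<^sup>2 * (\<bar>w i\<bar> + \<bar>v i\<bar>) powr (s - 2))"

definition dsum :: "nat \<Rightarrow> real \<Rightarrow> (nat \<Rightarrow> real) \<Rightarrow> (nat \<Rightarrow> real) \<Rightarrow> real" where
  "dsum n s v w = (\<Sum>i<n. (\<bar>v i\<bar> powr (s - 2) * v i) * w i)"

text \<open>The first-order remainder of the p-th power of the s-norm, written through
  \<open>lsum\<close>. The chain rule produces (p/s) * s = p in front of the linear term. At v = 0
  that term is 0, which is the true derivative since p > 1.\<close>

definition vbreg :: "nat \<Rightarrow> real \<Rightarrow> real \<Rightarrow> (nat \<Rightarrow> real) \<Rightarrow> (nat \<Rightarrow> real) \<Rightarrow> real" where
  "vbreg n p s v w = lsum n s (\<lambda>i. v i + w i) powr (p / s) - lsum n s v powr (p / s)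
     - p * (lsum n s v powr (p / s - 1) * dsum n s v w)"

lemma lsum_nonneg: "0 \<le> lsum n s v" by (simp add: lsum_def sum_nonneg)
lemma tsum_nonneg: "0 \<le> tsum n s v w" by (simp add: tsum_def sum_nonneg)

lemma lsum_eq_0_iff: "lsum n s v = 0 \<longleftrightarrow> (\<forall>i<n. v i = 0)"
  by (simp add: lsum_def sum_nonneg_eq_0_iff lessThan_iff Ball_def)

lemma breg_lsum:
  "lsum n s (\<lambda>i. v i + w i) - lsum n s v - s * dsum n s v w = (\<Sum>i<n. breg s (v i) (w i))"
  unfolding lsum_def dsum_def breg_def sum_subtractf sum_distrib_left by (simp only: mult.assoc)

lemma lsum_scale: "lsum n s (\<lambda>i. c * v i) = \<bar>c\<bar> powr s * lsum n s v"
  by (simp add: lsum_def abs_mult powr_mult sum_distrib_left)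

lemma lsum_add_le:
  assumes "0 < s" "0 \<le> t" "t \<le> 1"
  shows "lsum n s (\<lambda>i. v i + t * w i) \<le> 2 powr s * (lsum n s v + lsum n s w)"
proof -
  have "\<bar>v i + t * w i\<bar> powr s \<le> 2 powr s * (\<bar>v i\<bar> powr s + \<bar>w i\<bar> powr s)" for i
  proof -
    have "\<bar>t * w i\<bar> \<le> \<bar>w i\<bar>" using assms by (simp add: abs_mult mult_left_le_one_le)
    then have "\<bar>v i + t * w i\<bar> \<le> 2 * max \<bar>v i\<bar> \<bar>w i\<bar>" by linarith
    then have "\<bar>v i + t * w i\<bar> powr s \<le> (2 * max \<bar>v i\<bar> \<bar>w i\<bar>) powr s" using assms by (intro powr_mono2) auto
    also have "\<dots> = 2 powr s * max \<bar>v i\<bar> \<bar>w i\<bar> powr s" by (simp add: powr_mult)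
    also have "\<dots> \<le> 2 powr s * (\<bar>v i\<bar> powr s + \<bar>w i\<bar> powr s)" by (simp add: max_def)
    finally show ?thesis .
  qed
  then show ?thesis unfolding lsum_def by (simp add: sum.distrib[symmetric] sum_distrib_left sum_mono)
qed

text \<open>Concavity: the graph lies below its tangent at x. After division by x^r this is the
  weighted arithmetic-geometric mean inequality for y/x and 1 with weights r and 1 - r.\<close>

lemma powr_mean_zero_gradient:
  fixes r :: real
  assumes "0 < r" "r \<le> 1" "0 < x" "0 \<le> y"
  shows "y powr r \<le> x powr r + r * (x powr (r - 1) * (y - x))"
proof (cases "y = 0")
  case True
  then show ?thesis using assms by (simp add: powr_diff mult_left_le_one_le)
next
  case False
  have "(y / x) powr r * 1 powr (1 - r) \<le> r * (y / x) + (1 - r) * 1"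
    using assms False by (intro Youngs_inequality_0) auto
  then have "x powr r * ((y / x) powr r) \<le> x powr r * (r * (y / x) + (1 - r))"
    by (intro mult_left_mono) auto
  moreover have "x powr r * ((y / x) powr r) = y powr r"
    using assms by (simp add: powr_mult[symmetric])
  moreover have "x powr r * (r * (y / x) + (1 - r)) = x powr r + r * (x powr (r - 1) * (y - x))"
    using assms by (simp add: powr_diff field_simps)
  ultimately show ?thesis by simp
qed

text \<open>Since p/s \<le> 1 the outer power is concave and lies below its tangent at
  \<open>lsum n s v\<close>. The linear terms cancel, and only the remainder of the separable
  function \<open>lsum\<close> is left.\<close>

lemma vbreg_le:
  assumes "0 < p" "p \<le> s" "0 < lsum n s v"
  shows "vbreg n p s v w \<le> p / s * lsum n s v powr (p / s - 1) * (\<Sum>i<n. breg s (v i) (w i))"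
proof -
  have "lsum n s (\<lambda>i. v i + w i) powr (p/s) \<le>
    lsum n s v powr (p/s) + p/s * (lsum n s v powr (p/s - 1) * (lsum n s (\<lambda>i. v i + w i) - lsum n s v))"
    using assms by (intro powr_mean_zero_gradient) (auto simp: lsum_nonneg)
  then show ?thesis using assms unfolding vbreg_def breg_lsum[symmetric]
    by (simp add: field_simps)
qed

text \<open>A form of Hoelder's inequality with the factor 2 instead of 1, obtained from x^(s-1) y
  \<le> x^s + y^s for normalised coordinates. The factor does not grow with n, which is what matters
  here.\<close>

lemma dsum_le:
  assumes "1 < s"
  shows "\<bar>dsum n s v w\<bar> \<le> 2 * (lsum n s v powr ((s - 1) / s) * lsum n s w powr (1 / s))"
proof (cases "lsum n s v = 0 \<or> lsum n s w = 0")
  case True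
  then have "\<forall>i<n. v i * w i = 0" by (auto simp: lsum_eq_0_iff)
  then have "dsum n s v w = 0" unfolding dsum_def by (intro sum.neutral) auto
  then show ?thesis by simp
next
  case False
  \<comment> \<open>The s-norms of v and w; dividing by them makes both sums of s-th powers equal to
    1, whence the final factor 1 + 1.\<close>
  define P Q where "P = lsum n s v powr (1/s)" and "Q = lsum n s w powr (1/s)"
  have pos: "0 < lsum n s v" "0 < lsum n s w"
    using False lsum_nonneg[of n s v] lsum_nonneg[of n s w] by linarith+
  have PQ: "0 < P" "0 < Q" "P powr s = lsum n s v" "Q powr s = lsum n s w"
    using pos assms by (auto simp: P_def Q_def powr_powr)
  have Pe: "P powr (s - 1) = lsum n s v powr ((s-1)/s)" by (simp add: P_def powr_powr)
  have "\<bar>(\<bar>v i\<bar> powr (s - 2) * v i) * w i\<bar> \<le> P powr (s-1) * Q * (\<bar>v i\<bar> powr s / P powr s + \<bar>w i\<bar> powr s / Q powr s)" for i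
  proof -
    define x y where "x = \<bar>v i\<bar> / P" and "y = \<bar>w i\<bar> / Q"
    have xy: "0 \<le> x" "0 \<le> y" "\<bar>v i\<bar> = P * x" "\<bar>w i\<bar> = Q * y" using PQ by (auto simp: x_def y_def)
    have "x powr (s-1) * y \<le> max x y powr (s-1) * max x y"
      using xy assms by (intro mult_mono powr_mono2) auto
    also have "\<dots> = max x y powr s"
      using powr_add[of "max x y" "s-1" 1] xy by simp
    also have "\<dots> \<le> x powr s + y powr s" by (auto simp: max_def)
    finally have 1: "x powr (s-1) * y \<le> x powr s + y powr s" .
    have "\<bar>(\<bar>v i\<bar> powr (s - 2) * v i) * w i\<bar> = \<bar>v i\<bar> powr (s-2) * \<bar>v i\<bar> powr 1 * \<bar>w i\<bar>"
      by (simp add: abs_mult)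
    also have "\<dots> = \<bar>v i\<bar> powr (s-1) * \<bar>w i\<bar>" by (subst powr_add[symmetric]) simp
    also have "\<dots> = P powr (s-1) * Q * (x powr (s-1) * y)" using xy by (simp add: powr_mult)
    also have "\<dots> \<le> P powr (s-1) * Q * (x powr s + y powr s)"
      using 1 PQ by (intro mult_left_mono) auto
    finally show ?thesis using PQ by (simp add: x_def y_def powr_divide)
  qed
  then have "\<bar>dsum n s v w\<bar> \<le> (\<Sum>i<n. P powr (s-1) * Q * (\<bar>v i\<bar> powr s / P powr s + \<bar>w i\<bar> powr s / Q powr s))"
    unfolding dsum_def by (intro order_trans[OF sum_abs] sum_mono) auto
  also have "\<dots> = P powr (s-1) * Q * (lsum n s v / P powr s + lsum n s w / Q powr s)"
    by (simp add: sum_distrib_left[symmetric] sum.distrib sum_divide_distrib[symmetric] lsum_def)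
  also have "\<dots> = 2 * (P powr (s-1) * Q)" using PQ pos by simp
  finally show ?thesis by (simp add: Pe Q_def)
qed

text \<open>Splits |v|^(s-2) v into sgn(v) |v|^(s/2) times |v|^((s-2)/2). Up to the factor s(s - 1)
  the last sum is the second derivative of \<open>lsum\<close> in direction w, so the square of a
  first derivative is controlled by a second derivative.\<close>

lemma dsum_cauchy_schwarz:
  "(dsum n s v w)\<^sup>2 \<le> lsum n s v * (\<Sum>i<n. \<bar>v i\<bar> powr (s - 2) * (w i)\<^sup>2)"
proof -
  have e: "dsum n s v w = (\<Sum>i<n. (sgn (v i) * \<bar>v i\<bar> powr (s/2)) * (\<bar>v i\<bar> powr ((s-2)/2) * w i))"
  proof -
    have "(\<bar>v i\<bar> powr (s - 2) * v i) * w i = (sgn (v i) * \<bar>v i\<bar> powr (s/2)) * (\<bar>v i\<bar> powr ((s-2)/2) * w i)" for i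
    proof -
      have "\<bar>v i\<bar> powr (s/2) * \<bar>v i\<bar> powr ((s-2)/2) = \<bar>v i\<bar> powr (s - 2) * \<bar>v i\<bar> powr 1"
      proof -
        have "s/2 + (s-2)/2 = s - 2 + 1" by (simp add: field_simps)
        then show ?thesis by (simp only: powr_add[symmetric])
      qed
      then have "sgn (v i) * (\<bar>v i\<bar> powr (s/2) * \<bar>v i\<bar> powr ((s-2)/2)) = \<bar>v i\<bar> powr (s - 2) * v i"
        by (simp add: sgn_real_def)
      then show ?thesis by (metis mult.assoc)
    qed
    then show ?thesis unfolding dsum_def by (intro sum.cong refl) simp
  qed
  have "(dsum n s v w)\<^sup>2 \<le> (\<Sum>i<n. (sgn (v i) * \<bar>v i\<bar> powr (s/2))\<^sup>2) * (\<Sum>i<n. (\<bar>v i\<bar> powr ((s-2)/2) * w i)\<^sup>2)"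
    unfolding e by (rule Cauchy_Schwarz_ineq_sum)
  also have "(\<Sum>i<n. (sgn (v i) * \<bar>v i\<bar> powr (s/2))\<^sup>2) = lsum n s v"
    unfolding lsum_def power_mult_distrib by (intro sum.cong) (auto simp: sgn_real_def power2_eq_square powr_add[symmetric])
  also have "(\<Sum>i<n. (\<bar>v i\<bar> powr ((s-2)/2) * w i)\<^sup>2) = (\<Sum>i<n. \<bar>v i\<bar> powr (s - 2) * (w i)\<^sup>2)"
    unfolding power_mult_distrib by (intro sum.cong) (auto simp: power2_eq_square powr_add[symmetric])
  finally show ?thesis .
qed

text \<open>For s < 2 the derivative of |t|^(s-2) t blows up at 0, so the first derivative along a
  segment is differentiable only away from the finitely many times at which a coordinate changes
  sign. Continuity bridges these times.\<close>

lemma nondecreasing_derivative_off_finite: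
  fixes f :: "real \<Rightarrow> real"
  assumes "finite E" "a \<le> b" "continuous_on {a..b} f"
    and "\<And>t. t \<in> {a<..<b} \<Longrightarrow> t \<notin> E \<Longrightarrow> (f has_real_derivative f' t) (at t)"
    and "\<And>t. t \<in> {a<..<b} \<Longrightarrow> t \<notin> E \<Longrightarrow> 0 \<le> f' t"
  shows "f a \<le> f b"
proof -
  define h where "h = (\<lambda>t. if t \<in> {a<..<b} - E then f' t else 0)"
  have "(h has_integral (f b - f a)) {a..b}"
    using assms by (intro fundamental_theorem_of_calculus_interior_strong[where S=E])
     (auto simp: h_def has_real_derivative_iff_has_vector_derivative)
  moreover have "0 \<le> h t" for t using assms by (auto simp: h_def)
  ultimately have "0 \<le> f b - f a" by (metis has_integral_nonneg)
  then show ?thesis by simp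
qed

lemma has_derivative_signed_powr:
  fixes s x :: real assumes "x \<noteq> 0"
  shows "((\<lambda>x. \<bar>x\<bar> powr (s-2) * x) has_real_derivative (s-1) * \<bar>x\<bar> powr (s-2)) (at x)"
proof (cases "x > 0")
  case True
  have "((\<lambda>x. x powr (s-1)) has_real_derivative (s-1) * x powr (s-1-1)) (at x)"
    using True by (intro has_real_derivative_powr)
  then have "((\<lambda>x. x powr (s-1)) has_real_derivative (s-1) * \<bar>x\<bar> powr (s-2)) (at x)"
    using True by simp
  then show ?thesis
    by (rule has_field_derivative_transform_within[where d=x]) 
       (use True powr_add[of _ "s-2" 1] in \<open>auto simp: dist_real_def\<close>)
next
  case False
  have "((\<lambda>x. (-x) powr (s-1)) has_real_derivative (s-1) * (-x) powr (s-1-of_nat 1) * (-1)) (at x)"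
    using False assms by (intro DERIV_fun_powr) (auto intro!: derivative_eq_intros)
  from DERIV_minus[OF this]
  have "((\<lambda>x. - ((-x) powr (s-1))) has_real_derivative (s-1) * \<bar>x\<bar> powr (s-2)) (at x)"
    using False by simp
  moreover have "- ((-y) powr (s-1)) = \<bar>y\<bar> powr (s-2) * y" if "y < 0" for y
    using that powr_add[of "-y" "s-2" 1] by simp
  ultimately show ?thesis
    by (elim has_field_derivative_transform_within[where d="-x"])
       (use False assms in \<open>auto simp: dist_real_def\<close>)
qed

lemma continuous_signed_powr:
  fixes s :: real assumes "1 < s"
  shows "continuous_on A (\<lambda>x. \<bar>x\<bar> powr (s-2) * x)"
proof -
  have "isCont (\<lambda>x. \<bar>x\<bar> powr (s-2) * x) x" for x :: real
  proof (cases "x = 0")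
    case True
    have "((\<lambda>x::real. \<bar>x\<bar> powr (s-2) * x) \<longlongrightarrow> 0) (at 0)" using assms by real_asymp
    then show ?thesis using True by (simp add: isCont_def)
  next
    case False
    then show ?thesis using DERIV_isCont has_derivative_signed_powr by blast
  qed
  then show ?thesis by (simp add: continuous_at_imp_continuous_on)
qed

lemma lsum_has_derivative:
  assumes "1 < s"
  shows "((\<lambda>t. lsum n s (\<lambda>i. v i + t * w i)) has_real_derivative s * dsum n s (\<lambda>i. v i + t * w i) w) (at t)"
proof -
  have "((\<lambda>t. \<bar>v i + t * w i\<bar> powr s) has_real_derivative s * (\<bar>v i + t * w i\<bar> powr (s-2) * (v i + t * w i)) * w i) (at t)" for i
  proof -
    have "((\<lambda>t. v i + t * w i) has_real_derivative w i) (at t)" by (auto intro!: derivative_eq_intros)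
    from DERIV_chain2[OF has_derivative_abs_powr[OF assms] this] show ?thesis .
  qed
  then have "((\<lambda>t. lsum n s (\<lambda>i. v i + t * w i)) has_real_derivative
     (\<Sum>i<n. s * (\<bar>v i + t * w i\<bar> powr (s-2) * (v i + t * w i)) * w i)) (at t)"
    unfolding lsum_def by (intro DERIV_sum)
  then show ?thesis by (simp add: dsum_def sum_distrib_left mult_ac)
qed

text \<open>Coordinates with \<open>w i = 0\<close> do not move along the line, so only the moving
  ones have to stay away from 0.\<close>

lemma dsum_has_derivative:
  assumes "\<And>i. i < n \<Longrightarrow> w i \<noteq> 0 \<Longrightarrow> v i + t * w i \<noteq> 0"
  shows "((\<lambda>t. dsum n s (\<lambda>i. v i + t * w i) w) has_real_derivative
     (s - 1) * (\<Sum>i<n. \<bar>v i + t * w i\<bar> powr (s - 2) * (w i)\<^sup>2)) (at t)"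
proof -
  have "((\<lambda>t. (\<bar>v i + t * w i\<bar> powr (s-2) * (v i + t * w i)) * w i) has_real_derivative
     ((s-1) * \<bar>v i + t * w i\<bar> powr (s-2) * w i) * w i) (at t)" if "i < n" for i
  proof (cases "w i = 0")
    case False
    have "((\<lambda>t. v i + t * w i) has_real_derivative w i) (at t)" by (auto intro!: derivative_eq_intros)
    from DERIV_chain2[OF has_derivative_signed_powr[OF assms[OF that False]] this]
    show ?thesis by (rule DERIV_cmult_right)
  qed simp
  then have "((\<lambda>t. dsum n s (\<lambda>i. v i + t * w i) w) has_real_derivative
     (\<Sum>i<n. ((s-1) * \<bar>v i + t * w i\<bar> powr (s-2) * w i) * w i)) (at t)"
    unfolding dsum_def by (intro DERIV_sum) auto
  then show ?thesis by (simp add: sum_distrib_left mult_ac power2_eq_square)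
qed

text \<open>By the Cauchy--Schwarz inequality, the second derivative of \<open>L powr (p / s)\<close> along the segment from
  \<open>v\<close> to \<open>v + w\<close>, where \<open>L\<close> is \<open>lsum n s\<close>, exceeds that of \<open>\<kappa> * L\<close>; so the remainder of the former
  is bounded below by \<open>\<kappa>\<close> times the remainder of the separable function \<open>L\<close>.\<close>

lemma vbreg_ge_aux:
  assumes p: "1 < p" "p < s" and nz: "\<And>t. t \<in> {0..1} \<Longrightarrow> 0 < lsum n s (\<lambda>i. v i + t * w i)"
  defines "\<kappa> \<equiv> p * (p - 1) / (s * (s - 1)) * (2 powr s * (lsum n s v + lsum n s w)) powr (p / s - 1)"
  shows "\<kappa> * (\<Sum>i<n. breg s (v i) (w i)) \<le> vbreg n p s v w"
proof -
  define L where "L = (\<lambda>t. lsum n s (\<lambda>i. v i + t * w i))"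
  define D where "D = (\<lambda>t. dsum n s (\<lambda>i. v i + t * w i) w)"
  define S where "S = (\<lambda>t. \<Sum>i<n. \<bar>v i + t * w i\<bar> powr (s - 2) * (w i)\<^sup>2)"
  define B where "B = 2 powr s * (lsum n s v + lsum n s w)"
  \<comment> \<open>The claim says that g(1) lies above the tangent of g at 0. By the mean value
    theorem it is enough that \<open>g'\<close> never falls below its value at 0.\<close>
  define g where "g = (\<lambda>t. L t powr (p/s) - \<kappa> * L t)"
  define g' where "g' = (\<lambda>t. p * (L t powr (p/s - 1) * D t) - \<kappa> * (s * D t))"
  have Lpos: "0 < L t" if "t \<in> {0..1}" for t using nz that by (simp add: L_def)
  have LB: "L t \<le> B" if "t \<in> {0..1}" for t
    using lsum_add_le[of s t n v w] p that by (simp add: L_def B_def)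
  have dL: "(L has_real_derivative s * D t) (at t)" for t
    unfolding L_def D_def using lsum_has_derivative p by simp
  have dg: "(g has_real_derivative g' t) (at t)" if "t \<in> {0..1}" for t
  proof -
    have "((\<lambda>t. L t powr (p/s)) has_real_derivative (p/s) * L t powr (p/s - of_nat 1) * (s * D t)) (at t)"
      using dL Lpos[OF that] by (rule DERIV_fun_powr)
    from DERIV_diff[OF this DERIV_cmult[OF dL, of \<kappa>]]
    show ?thesis unfolding g_def g'_def using p by (simp add: mult_ac)
  qed
  have contL: "continuous_on {0..1} L" using dL by (meson DERIV_continuous continuous_at_imp_continuous_on)
  have contD: "continuous_on {0..1} D" unfolding D_def dsum_def
    by (intro continuous_intros continuous_on_compose2[OF continuous_signed_powr[of s UNIV]]) (use p in auto)
  have contg': "continuous_on {0..1} g'"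
    unfolding g'_def by (intro continuous_intros contL contD) (use Lpos in \<open>metis order_less_irrefl\<close>)
  \<comment> \<open>The times at which a moving coordinate vanishes. A coordinate with
    \<open>w i = 0\<close> contributes the quotient 0, a harmless extra time.\<close>
  define E where "E = (\<lambda>i. - v i / w i) ` {..<n}"
  define g2 where "g2 = (\<lambda>t. p * ((p/s - 1) * L t powr (p/s - 2) * (s * D t) * D t + L t powr (p/s - 1) * ((s-1) * S t)) - \<kappa> * (s * ((s-1) * S t)))"
  have mono: "g' 0 \<le> g' z" if z: "z \<in> {0..1}" for z
  proof (rule nondecreasing_derivative_off_finite[where E=E and f=g' and f'=g2])
    fix t assume t: "t \<in> {0<..<z}" "t \<notin> E"
    have t01: "t \<in> {0..1}" using t z by auto
    have ne: "v i + t * w i \<noteq> 0" if "i < n" "w i \<noteq> 0" for i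
    proof
      assume "v i + t * w i = 0"
      then have "t = - v i / w i" using that by (simp add: field_simps)
      then show False using t that by (auto simp: E_def)
    qed
    have dD: "(D has_real_derivative (s-1) * S t) (at t)"
      unfolding D_def S_def by (rule dsum_has_derivative[OF ne])
    show "(g' has_real_derivative g2 t) (at t)"
    proof -
      have "((\<lambda>t. L t powr (p/s - 1)) has_real_derivative (p/s - 1) * L t powr (p/s - 1 - of_nat 1) * (s * D t)) (at t)"
        using dL Lpos[OF t01] by (rule DERIV_fun_powr)
      from DERIV_diff[OF DERIV_cmult[OF DERIV_mult[OF this dD], of p] DERIV_cmult[OF DERIV_cmult[OF dD, of s], of \<kappa>]]
      moreover have "p * ((p/s - 1) * L t powr (p/s - 1 - of_nat 1) * (s * D t) * D t + (s-1) * S t * L t powr (p/s - 1))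
         - \<kappa> * (s * ((s-1) * S t)) = g2 t" by (simp add: g2_def mult_ac)
      ultimately show ?thesis unfolding g'_def by (simp only:)
    qed
    have cs: "(D t)\<^sup>2 \<le> L t * S t" unfolding D_def L_def S_def by (rule dsum_cauchy_schwarz)
    have S0: "0 \<le> S t" by (simp add: S_def sum_nonneg)
    \<comment> \<open>The concave outer power enters the second derivative with the negative factor
      -(s - p). Cauchy--Schwarz bounds this term by the same quantity that the convex part carries
      with factor s - 1, so that p - 1 remains.\<close>
    have "(s - p) * (L t powr (p/s - 2) * (D t)\<^sup>2) \<le> (s - p) * (L t powr (p/s - 2) * (L t * S t))"
      using cs p by (intro mult_left_mono) auto
    also have "L t powr (p/s - 2) * (L t * S t) = L t powr (p/s - 1) * S t"
      using Lpos[OF t01] by (simp add: powr_diff power2_eq_square field_simps)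
    finally have a: "(s - p) * (L t powr (p/s - 2) * (D t)\<^sup>2) \<le> (s - p) * (L t powr (p/s - 1) * S t)" .
    \<comment> \<open>\<open>L\<close> stays below \<open>B\<close> on the segment and the exponent
      p/s - 1 is negative. This is why \<kappa> is p(p - 1)/(s(s - 1)) times that power of
      \<open>B\<close>: then \<kappa> s(s - 1) S is dominated by what remains.\<close>
    have "B powr (p/s - 1) \<le> L t powr (p/s - 1)"
      using Lpos[OF t01] LB[OF t01] p by (intro powr_mono2') auto
    then have b: "\<kappa> * (s * (s-1)) * S t \<le> p * (p-1) * L t powr (p/s - 1) * S t"
      using p S0 unfolding \<kappa>_def B_def[symmetric] by (intro mult_right_mono) (auto intro!: mult_left_mono)
    have "p * ((p/s - 1) * L t powr (p/s - 2) * (s * D t) * D t + L t powr (p/s - 1) * ((s-1) * S t)) - \<kappa> * (s * ((s-1) * S t))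
      = p * ((s-1) * (L t powr (p/s - 1) * S t) - (s-p) * (L t powr (p/s - 2) * (D t)\<^sup>2)) - \<kappa> * (s * (s-1)) * S t"
      using p by (simp add: field_simps power2_eq_square)
    also have "\<dots> \<ge> p * ((s-1) * (L t powr (p/s - 1) * S t) - (s - p) * (L t powr (p/s - 1) * S t)) - \<kappa> * (s * (s-1)) * S t"
      using a p by (intro diff_right_mono mult_left_mono) auto
    also have "p * ((s-1) * (L t powr (p/s - 1) * S t) - (s - p) * (L t powr (p/s - 1) * S t)) = p * (p-1) * L t powr (p/s - 1) * S t"
      by (simp add: algebra_simps)
    finally show "0 \<le> g2 t" unfolding g2_def using b by linarith
  qed (use z continuous_on_subset[OF contg', of "{0..z}"] in \<open>auto simp: E_def\<close>)
  obtain z where z: "0 < z" "z < 1" "g 1 - g 0 = (1 - 0) * g' z"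
    using MVT2[of 0 1 g g'] dg by auto
  then have "g 1 - g 0 - g' 0 \<ge> 0" using mono[of z] by auto
  then show ?thesis unfolding g_def g'_def L_def D_def vbreg_def breg_lsum[symmetric]
    by (simp add: algebra_simps)
qed

lemma powr_between:
  fixes a x e :: real assumes "0 < a" "a \<le> x" "x \<le> 2 * a"
  shows "min 1 (2 powr e) * a powr e \<le> x powr e" "x powr e \<le> max 1 (2 powr e) * a powr e"
proof -
  have "a powr e \<le> x powr e \<and> x powr e \<le> (2 * a) powr e \<or> (2 * a) powr e \<le> x powr e \<and> x powr e \<le> a powr e"
    using assms powr_mono2[of e a x] powr_mono2[of e x "2*a"] powr_mono2'[of e a x] powr_mono2'[of e x "2*a"]
    by (cases "0 \<le> e") auto
  moreover have "(2 * a) powr e = 2 powr e * a powr e" using assms by (simp add: powr_mult)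
  moreover have "min 1 (2 powr e) * a powr e \<le> 1 * a powr e" "min 1 (2 powr e) * a powr e \<le> 2 powr e * a powr e"
    "1 * a powr e \<le> max 1 (2 powr e) * a powr e" "2 powr e * a powr e \<le> max 1 (2 powr e) * a powr e"
    by (intro mult_right_mono; simp)+
  ultimately show "min 1 (2 powr e) * a powr e \<le> x powr e" "x powr e \<le> max 1 (2 powr e) * a powr e"
    by auto
qed

text \<open>Removes the assumption of \<open>vbreg_ge_aux\<close> that the segment avoids the
  origin. If it meets the origin at time t, then v = -t w, every sum is a multiple of
  \<open>lsum n s w\<close>, and the claim becomes a comparison of the scalar remainders of
  exponents p and s at (-t, 1).\<close>

lemma vbreg_ge:
  fixes p s :: real
  assumes p: "1 < p" "p < s"
  shows "\<exists>c>0. \<forall>n v w. c * (lsum n s v + lsum n s w) powr (p / s - 1) * (\<Sum>i<n. breg s (v i) (w i)) \<le> vbreg n p s v w"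
proof -
  obtain cp Cp where cp: "0 < cp" "\<And>a b. cp * (b\<^sup>2 * (\<bar>b\<bar> + \<bar>a\<bar>) powr (p-2)) \<le> breg p a b"
    using breg_bounds[OF p(1)] by blast
  obtain cs Cs where cs: "0 < cs" "0 < Cs" "\<And>a b. cs * (b\<^sup>2 * (\<bar>b\<bar> + \<bar>a\<bar>) powr (s-2)) \<le> breg s a b"
     "\<And>a b. breg s a b \<le> Cs * (b\<^sup>2 * (\<bar>b\<bar> + \<bar>a\<bar>) powr (s-2))"
    using breg_bounds[of s] p by auto
  have bs0: "0 \<le> breg s a b" for a b
    using cs(3)[of b a] cs(1) by (meson mult_nonneg_nonneg order_trans less_imp_le zero_le_power2 powr_ge_zero)
  \<comment> \<open>\<open>k1\<close> is the constant of \<open>vbreg_ge_aux\<close> with the power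
    of 2 split off. \<open>k2\<close> divides a lower bound for the scalar remainder of exponent p
    by an upper bound for that of exponent s.\<close>
  define k1 where "k1 = p * (p - 1) / (s * (s - 1)) * (2 powr s) powr (p / s - 1)"
  define k2 where "k2 = cp * min 1 (2 powr (p-2)) / (Cs * max 1 (2 powr (s-2)))"
  have k: "0 < k1" "0 < k2" using p cp cs by (auto simp: k1_def k2_def)
  have main: "min k1 k2 * (lsum n s v + lsum n s w) powr (p / s - 1) * (\<Sum>i<n. breg s (v i) (w i)) \<le> vbreg n p s v w"
    for n v w
  proof (cases "\<forall>t\<in>{0..1}. 0 < lsum n s (\<lambda>i. v i + t * w i)")
    case True
    have "min k1 k2 * (lsum n s v + lsum n s w) powr (p / s - 1) * (\<Sum>i<n. breg s (v i) (w i))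
      \<le> k1 * (lsum n s v + lsum n s w) powr (p / s - 1) * (\<Sum>i<n. breg s (v i) (w i))"
      by (intro mult_right_mono) (auto simp: sum_nonneg bs0)
    also have "\<dots> = p * (p - 1) / (s * (s - 1)) * (2 powr s * (lsum n s v + lsum n s w)) powr (p / s - 1) * (\<Sum>i<n. breg s (v i) (w i))"
      by (simp add: k1_def powr_mult lsum_nonneg)
    also have "\<dots> \<le> vbreg n p s v w" using vbreg_ge_aux[OF p] True by blast
    finally show ?thesis .
  next
    case False
    then obtain t where t: "t \<in> {0..1}" "lsum n s (\<lambda>i. v i + t * w i) = 0"
      by (metis lsum_nonneg order_le_less)
    define W where "W = lsum n s w"
    have v: "v i = - t * w i" if "i < n" for i using t that by (simp add: lsum_eq_0_iff add_eq_0_iff)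
    have e1: "lsum n s v = t powr s * W"
      using t lsum_scale[of n s "-t" w] v by (simp add: lsum_def W_def)
    have "lsum n s (\<lambda>i. v i + w i) = lsum n s (\<lambda>i. (1 - t) * w i)"
      unfolding lsum_def using v by (intro sum.cong refl) (simp add: algebra_simps)
    then have e2: "lsum n s (\<lambda>i. v i + w i) = (1 - t) powr s * W"
      using t lsum_scale[of n s "1-t" w] by (simp add: W_def)
    have e3: "dsum n s v w = - (t powr (s - 2) * t) * W"
    proof -
      have "\<bar>v i\<bar> powr (s-2) * v i * w i = - (t powr (s - 2) * t) * \<bar>w i\<bar> powr s" if "i < n" for i
      proof -
        have "\<bar>w i\<bar> powr (s-2) * (w i * w i) = \<bar>w i\<bar> powr s"
          by (cases "w i = 0") (auto simp: powr_diff power2_eq_square)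
        then show ?thesis using t v[OF that] by (simp add: abs_mult powr_mult mult_ac)
      qed
      then show ?thesis by (simp add: dsum_def W_def lsum_def sum_distrib_left)
    qed
    have e4: "(\<Sum>i<n. breg s (v i) (w i)) = W * breg s (-t) 1"
      unfolding breg_lsum[symmetric] e1 e2 e3 using t by (simp add: breg_def W_def[symmetric] algebra_simps)
    have e5: "vbreg n p s v w = W powr (p/s) * breg p (-t) 1"
    proof -
      have W0: "0 \<le> W" by (simp add: W_def lsum_nonneg)
      have "(t powr s * W) powr (p/s - 1) * (t powr (s-2) * t * W) = W powr (p/s) * (t powr (p-2) * t)"
      proof (cases "W = 0 \<or> t = 0")
        case True then show ?thesis by auto
      next
        case False
        then have pos: "0 < W" "0 < t" using W0 t by auto
        have "(t powr s * W) powr (p/s - 1) = t powr (p - s) * W powr (p/s - 1)"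
        proof -
          have "s * (p/s - 1) = p - s" using p by (simp add: field_simps)
          then show ?thesis using pos by (simp add: powr_mult powr_powr)
        qed
        moreover have "t powr (p-s) * t powr (s-2) = t powr (p-2)" by (simp add: powr_add[symmetric])
        moreover have "W powr (p/s - 1) * W = W powr (p/s)" using pos by (simp add: powr_diff)
        ultimately show ?thesis by (metis (no_types, opaque_lifting) mult.assoc mult.commute)
      qed
      then show ?thesis unfolding vbreg_def e1 e2 e3 using p t W0
        by (simp add: breg_def powr_mult powr_powr algebra_simps)
    qed
    show ?thesis
    proof (cases "W = 0")
      case True then show ?thesis unfolding e4 e5 by simp
    next
      case False
      then have W: "0 < W" by (simp add: W_def lsum_nonneg order_less_le)
      \<comment> \<open>Since t lies in [0, 1], the base 1 + t of the scalar estimates lies in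
        [1, 2], and its powers are bounded independently of t.\<close>
      have tt: "0 < (1::real)" "1 \<le> \<bar>1\<bar> + \<bar>-t\<bar>" "\<bar>1\<bar> + \<bar>-t\<bar> \<le> 2 * 1" using t by auto
      have lo: "cp * min 1 (2 powr (p-2)) \<le> breg p (-t) 1"
        using powr_between(1)[OF tt, of "p-2"] mult_left_mono[OF _ less_imp_le[OF cp(1)]] cp(2)[of 1 "-t"] 
        by (simp) (meson order_trans)
      have hi: "breg s (-t) 1 \<le> Cs * max 1 (2 powr (s-2))"
        using powr_between(2)[OF tt, of "s-2"] mult_left_mono[OF _ less_imp_le[OF cs(2)]] cs(4)[of "-t" 1]
        by (simp) (meson order_trans)
      have B: "(lsum n s v + lsum n s w) powr (p / s - 1) \<le> W powr (p/s - 1)"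
        using W p lsum_nonneg[of n s v] by (intro powr_mono2') (auto simp: W_def)
      have "min k1 k2 * (lsum n s v + lsum n s w) powr (p / s - 1) * (W * breg s (-t) 1)
        \<le> k2 * W powr (p/s - 1) * (W * (Cs * max 1 (2 powr (s-2))))"
        using W k B hi bs0[of "-t" 1] by (intro mult_mono) auto
      also have "\<dots> = W powr (p/s) * (k2 * (Cs * max 1 (2 powr (s-2))))"
        using W by (simp add: powr_diff)
      also have "k2 * (Cs * max 1 (2 powr (s-2))) = cp * min 1 (2 powr (p-2))"
        using cs by (simp add: k2_def max_def)
      also have "W powr (p/s) * \<dots> \<le> W powr (p/s) * breg p (-t) 1" using lo by (intro mult_left_mono) auto
      finally show ?thesis unfolding e4 e5 .
    qed
  qed
  have "0 < min k1 k2" using k by simp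
  then show ?thesis using main by blast
qed

text \<open>A coordinate with |w i| \<ge> d |v i| contributes at least a multiple of |w i|^s to
  \<open>tsum\<close>. The others together carry at most half of \<open>lsum n s v\<close>, hence at
  most half of \<open>lsum n s w\<close>, and are absorbed.\<close>

lemma lsum_le_tsum:
  assumes "1 < s"
  shows "\<exists>c>0. \<forall>n v w. lsum n s v \<le> lsum n s w \<longrightarrow> c * lsum n s w \<le> tsum n s v w"
proof -
  \<comment> \<open>Chosen so that d^s = 1/2, the fraction that can be absorbed.\<close>
  define d where "d = (1/2) powr (1/s)"
  have d: "0 < d" "d powr s = 1/2" using assms by (auto simp: d_def powr_powr)
  \<comment> \<open>On the good coordinates t + \<tau> \<le> t(1 + 1/d). If s < 2 the exponent s - 2
    is negative and this costs the power of 1 + 1/d; if s \<ge> 2 the factor 1 is enough.\<close>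
  define K where "K = max 1 ((1 + 1/d) powr (2 - s))"
  have K: "0 < K" by (simp add: K_def)
  have pt: "t powr s \<le> K * (t\<^sup>2 * (t + \<tau>) powr (s-2)) + d powr s * \<tau> powr s" if "0 \<le> t" "0 \<le> \<tau>" for t \<tau> :: real
  proof (cases "t < d * \<tau>")
    case True
    then have "t powr s \<le> (d * \<tau>) powr s" using that assms by (intro powr_mono2) auto
    moreover have "(d * \<tau>) powr s = d powr s * \<tau> powr s" using that d by (simp add: powr_mult)
    moreover have "0 \<le> K * (t\<^sup>2 * (t + \<tau>) powr (s-2))" using K by simp
    ultimately show ?thesis by linarith
  next
    case False
    show ?thesis
    proof (cases "t = 0")
      case True then show ?thesis using d by simp
    next
      case F: False
      then have t: "0 < t" using that by simp
      have "\<tau> \<le> t / d" using False d by (simp add: field_simps)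
      then have le: "t + \<tau> \<le> t * (1 + 1/d)" by (simp add: algebra_simps)
      have "t powr (s-2) \<le> K * (t + \<tau>) powr (s-2)"
      proof (cases "s \<ge> 2")
        case True
        have "t powr (s-2) \<le> (t + \<tau>) powr (s-2)" using True that by (intro powr_mono2) auto
        also have "\<dots> \<le> K * (t + \<tau>) powr (s-2)" 
          using mult_right_mono[of 1 K "(t + \<tau>) powr (s-2)"] by (simp add: K_def)
        finally show ?thesis .
      next
        case False
        have "(t * (1 + 1/d)) powr (s-2) \<le> (t+\<tau>) powr (s-2)" using t that le False by (intro powr_mono2') auto
        then have "(1 + 1/d) powr (2-s) * (t * (1 + 1/d)) powr (s-2) \<le> K * (t+\<tau>) powr (s-2)"
          by (intro mult_mono) (auto simp: K_def)
        also have "(1 + 1/d) powr (2-s) * (t * (1 + 1/d)) powr (s-2) = t powr (s-2)"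
        proof -
          have "0 < 1 + 1/d" using d by (simp add: add_pos_pos)
          then have "(1 + 1/d) powr (2-s) * (1 + 1/d) powr (s-2) = 1" by (simp add: powr_add[symmetric])
          then show ?thesis using t d by (simp add: powr_mult)
        qed
        finally show ?thesis .
      qed
      then have "t\<^sup>2 * t powr (s-2) \<le> t\<^sup>2 * (K * (t + \<tau>) powr (s-2))" by (intro mult_left_mono) auto
      moreover have "t\<^sup>2 * t powr (s-2) = t powr s" using t by (simp add: powr_diff)
      moreover have "0 \<le> d powr s * \<tau> powr s" by simp
      moreover have "t\<^sup>2 * (K * (t + \<tau>) powr (s-2)) = K * (t\<^sup>2 * (t + \<tau>) powr (s-2))" by simp
      ultimately show ?thesis by linarith
    qed
  qed
  have "1/(2*K) * lsum n s w \<le> tsum n s v w" if "lsum n s v \<le> lsum n s w" for n v w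
  proof -
    have "lsum n s w \<le> (\<Sum>i<n. K * ((w i)\<^sup>2 * (\<bar>w i\<bar> + \<bar>v i\<bar>) powr (s-2)) + d powr s * \<bar>v i\<bar> powr s)"
      unfolding lsum_def using pt[of "\<bar>w _\<bar>" "\<bar>v _\<bar>"] by (intro sum_mono) simp
    also have "\<dots> = K * tsum n s v w + 1/2 * lsum n s v"
      by (simp add: sum.distrib tsum_def lsum_def sum_distrib_left d)
    finally have "lsum n s w / 2 \<le> K * tsum n s v w" using that by linarith
    then show ?thesis using K by (simp add: field_simps)
  qed
  moreover have "0 < 1/(2*K)" using K by simp
  ultimately show ?thesis by blast
qed

text \<open>For s < 2 dropping |v i| from the base of the negative power leaves |w i|^s. For s \<ge>
  2 the sum is quadratic in small w: after rescaling w to the norm of v it is at most a multiple of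
  \<open>lsum n s v\<close>, and the square of the scaling factor comes out in front.\<close>

lemma tsum_le:
  assumes "1 < s" "lsum n s w \<le> lsum n s v" "0 < lsum n s v"
  shows "tsum n s v w \<le> 2 * 2 powr s * (lsum n s w powr (min s 2 / s) * lsum n s v powr ((s - min s 2) / s))"
proof (cases "s < 2")
  case True
  have "(w i)\<^sup>2 * (\<bar>w i\<bar> + \<bar>v i\<bar>) powr (s - 2) \<le> \<bar>w i\<bar> powr s" for i
  proof (cases "w i = 0")
    case False
    then have "(\<bar>w i\<bar> + \<bar>v i\<bar>) powr (s - 2) \<le> \<bar>w i\<bar> powr (s-2)" using True by (intro powr_mono2') auto
    then have "(w i)\<^sup>2 * (\<bar>w i\<bar> + \<bar>v i\<bar>) powr (s - 2) \<le> (w i)\<^sup>2 * \<bar>w i\<bar> powr (s-2)" by (intro mult_left_mono) auto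
    then show ?thesis using False by (simp add: powr_diff)
  qed simp
  then have "tsum n s v w \<le> lsum n s w" unfolding tsum_def lsum_def by (intro sum_mono)
  moreover have "1 * lsum n s w \<le> 2 * 2 powr s * lsum n s w" 
    using assms ge_one_powr_ge_zero[of 2 s] by (intro mult_right_mono) (auto simp: lsum_nonneg)
  ultimately show ?thesis using True assms lsum_nonneg[of n s w] by simp
next
  case False
  show ?thesis
  proof (cases "lsum n s w = 0")
    case True
    then have "tsum n s v w = 0" unfolding tsum_def by (intro sum.neutral) (auto simp: lsum_eq_0_iff)
    then show ?thesis by simp
  next
    case F: False
    then have wp: "0 < lsum n s w" by (simp add: lsum_nonneg order_less_le)
    \<comment> \<open>The ratio of the s-norms of w and v, at most 1; w/l has the norm of v.\<close>
    define l where "l = (lsum n s w / lsum n s v) powr (1/s)"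
    have l: "0 < l" "l powr s = lsum n s w / lsum n s v" using wp assms by (auto simp: l_def powr_powr)
    have l1: "l \<le> 1" unfolding l_def using wp assms by (intro powr_le1) auto
    have "(w i)\<^sup>2 * (\<bar>w i\<bar> + \<bar>v i\<bar>) powr (s - 2) \<le> l\<^sup>2 * (2 powr s * (\<bar>w i\<bar> powr s / l powr s + \<bar>v i\<bar> powr s))" for i
    proof -
      define x where "x = \<bar>w i\<bar> / l"
      have x: "0 \<le> x" "\<bar>w i\<bar> = l * x" using l by (auto simp: x_def)
      define m where "m = max x \<bar>v i\<bar>"
      have "l * x \<le> x" using l1 x by (simp add: mult_left_le_one_le l less_imp_le)
      then have "x\<^sup>2 * (\<bar>w i\<bar> + \<bar>v i\<bar>) powr (s-2) \<le> (2*m) powr 2 * (2*m) powr (s-2)"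
      proof (intro mult_mono powr_mono2)
        have m: "0 \<le> m" "x \<le> m" "\<bar>v i\<bar> \<le> m" using x by (auto simp: m_def)
        have "x\<^sup>2 \<le> (2*m)\<^sup>2" using m x by (intro power_mono) auto
        then show "x\<^sup>2 \<le> (2*m) powr 2" using m by simp
        show "\<bar>w i\<bar> + \<bar>v i\<bar> \<le> 2 * m" using m x \<open>l * x \<le> x\<close> by linarith
      qed (use False in auto)
      also have "\<dots> = 2 powr s * m powr s" by (subst powr_add[symmetric]) (simp add: powr_mult)
      also have "\<dots> \<le> 2 powr s * (x powr s + \<bar>v i\<bar> powr s)" by (intro mult_left_mono) (auto simp: m_def max_def)
      finally have "l\<^sup>2 * (x\<^sup>2 * (\<bar>w i\<bar> + \<bar>v i\<bar>) powr (s-2)) \<le> l\<^sup>2 * (2 powr s * (x powr s + \<bar>v i\<bar> powr s))"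
        by (intro mult_left_mono) auto
      moreover have "(w i)\<^sup>2 = l\<^sup>2 * x\<^sup>2" using x by (metis power2_abs power_mult_distrib)
      moreover have "x powr s = \<bar>w i\<bar> powr s / l powr s" using l by (simp add: x_def powr_divide)
      ultimately show ?thesis by (simp add: mult_ac)
    qed
    then have "tsum n s v w \<le> (\<Sum>i<n. l\<^sup>2 * (2 powr s * (\<bar>w i\<bar> powr s / l powr s + \<bar>v i\<bar> powr s)))"
      unfolding tsum_def by (intro sum_mono)
    also have "\<dots> = l\<^sup>2 * (2 powr s * (lsum n s w / l powr s + lsum n s v))"
      by (simp add: sum_distrib_left[symmetric] sum.distrib sum_divide_distrib[symmetric] lsum_def)
    also have "\<dots> = 2 * 2 powr s * (l\<^sup>2 * lsum n s v)" using l wp assms by simp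
    also have "l\<^sup>2 = lsum n s w powr (2/s) / lsum n s v powr (2/s)"
      using wp assms by (simp add: l_def powr_numeral[symmetric] powr_powr powr_divide del: powr_numeral)
    also have "\<dots> * lsum n s v = lsum n s w powr (min s 2 / s) * lsum n s v powr ((s - min s 2) / s)"
      using False assms by (simp add: min_def powr_diff diff_divide_distrib)
    finally show ?thesis .
  qed
qed

text \<open>The algebraic core. Each lower bound is tied to one of the cases X \<le> Y and Y < X.
  The upper bounds are not, because they will be used for \<phi> on regions determined by \<psi>;
  the second one only needs X > 0. The constants are chosen before n, v and w.\<close>

lemma vbreg_two_sided:
  fixes p s :: real
  assumes p: "1 < p" "p < s"
  shows "\<exists>c C. 0 < c \<and> 0 < C \<and> (\<forall>n v w. \<forall>X Y. X = lsum n s v powr (1/s) \<longrightarrow> Y = lsum n s w powr (1/s) \<longrightarrow>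
     (X \<le> Y \<longrightarrow> c * (Y powr min s 2 * (Y + X) powr (p - min s 2)) \<le> vbreg n p s v w) \<and>
     (Y < X \<longrightarrow> c * (X powr (p - s) * tsum n s v w) \<le> vbreg n p s v w) \<and>
     vbreg n p s v w \<le> C * (Y powr min s 2 * (Y + X) powr (p - min s 2)) \<and>
     (0 < X \<longrightarrow> vbreg n p s v w \<le> C * (X powr (p - s) * tsum n s v w)))"
proof -
  define m where "m = min s 2"
  obtain cs Cs where cs: "0 < cs" "0 < Cs" "\<And>a b. cs * (b\<^sup>2 * (\<bar>b\<bar> + \<bar>a\<bar>) powr (s-2)) \<le> breg s a b"
     "\<And>a b. breg s a b \<le> Cs * (b\<^sup>2 * (\<bar>b\<bar> + \<bar>a\<bar>) powr (s-2))"
    using breg_bounds[of s] p by auto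
  obtain k where k: "0 < k" "\<And>n v w. k * (lsum n s v + lsum n s w) powr (p / s - 1) * (\<Sum>i<n. breg s (v i) (w i)) \<le> vbreg n p s v w"
    using vbreg_ge[OF p] by blast
  obtain d where d: "0 < d" "\<And>n v w. lsum n s v \<le> lsum n s w \<Longrightarrow> d * lsum n s w \<le> tsum n s v w"
    using lsum_le_tsum[of s] p by auto
  define a1 A1 where "a1 = min 1 (2 powr (p-m))" and "A1 = max 1 (2 powr (p-m))"
  define b1 where "b1 = min 1 (2 powr (p/s-1))"
  have ab: "0 < a1" "0 < A1" "0 < b1" by (auto simp: a1_def A1_def b1_def)
  \<comment> \<open>The factors of \<open>c1\<close> are those of \<open>kB\<close>
    (\<open>k\<close>, \<open>cs\<close>), the price \<open>b1\<close> of replacing G + H by H, the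
    constant \<open>d\<close> of \<open>lsum_le_tsum\<close>, and \<open>A1\<close> for replacing
    the \<open>R1\<close> expression by Y^p. \<open>C1\<close> below is a maximum because X \<le> Y
    and Y < X lead to different constants.\<close>
  define c1 c2 where "c1 = k * cs * b1 * d / A1" and "c2 = k * cs * b1"
  define C2 where "C2 = p / s * Cs"
  define C1 where "C1 = max (C2 * (2 * 2 powr s) / a1) (((2 * 2 powr s) powr (p/s) + 2 * p) / a1)"
  have pos: "0 < c1" "0 < c2" "0 < C2" "0 < C1" using ab k cs d p by (auto simp: c1_def c2_def C2_def C1_def less_max_iff_disj)
  have res: "(X \<le> Y \<longrightarrow> c1 * (Y powr m * (Y + X) powr (p - m)) \<le> vbreg n p s v w) \<and>
     (Y < X \<longrightarrow> c2 * (X powr (p - s) * tsum n s v w) \<le> vbreg n p s v w) \<and>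
     vbreg n p s v w \<le> C1 * (Y powr m * (Y + X) powr (p - m)) \<and>
     (0 < X \<longrightarrow> vbreg n p s v w \<le> C2 * (X powr (p - s) * tsum n s v w))"
    if XY: "X = lsum n s v powr (1/s)" "Y = lsum n s w powr (1/s)" for n v w X Y
  proof -
    define G H T B where "G = lsum n s v" and "H = lsum n s w" and "T = tsum n s v w" and "B = (\<Sum>i<n. breg s (v i) (w i))"
    have nn: "0 \<le> G" "0 \<le> H" "0 \<le> T" "0 \<le> X" "0 \<le> Y" by (auto simp: G_def H_def T_def XY lsum_nonneg tsum_nonneg)
    have GX: "G = X powr s" "H = Y powr s" using XY p nn by (auto simp: powr_powr G_def H_def)
    have Bl: "cs * T \<le> B" "B \<le> Cs * T" unfolding T_def tsum_def B_def sum_distrib_left using cs by (intro sum_mono; simp)+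
    have powX: "G powr e = X powr (s * e)" "H powr e = Y powr (s * e)" for e by (auto simp: GX powr_powr)
    have pe: "s * (p/s - 1) = p - s" using p by (simp add: field_simps)
    have kB: "k * (G + H) powr (p / s - 1) * (cs * T) \<le> vbreg n p s v w"
    proof -
      have "k * (G + H) powr (p / s - 1) * (cs * T) \<le> k * (G + H) powr (p / s - 1) * B"
        using Bl(1) k(1) by (intro mult_left_mono) auto
      also have "\<dots> \<le> vbreg n p s v w" using k(2)[of n v w] by (simp only: G_def H_def B_def)
      finally show ?thesis .
    qed
    have mono: "X \<le> Y \<longleftrightarrow> G \<le> H"
      using nn p powr_mono2[of s X Y] powr_less_mono2[of s Y X] unfolding GX by linarith
    \<comment> \<open>For X \<le> Y the sum Y + X lies between Y and 2 Y, so the \<open>R1\<close>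
      expression equals Y^p up to constants, whatever the sign of p - m.\<close>
    have R1lo: "a1 * Y powr p \<le> Y powr m * (Y + X) powr (p - m)" "Y powr m * (Y + X) powr (p - m) \<le> A1 * Y powr p" if "X \<le> Y"
    proof -
      have "a1 * Y powr p \<le> Y powr m * (Y + X) powr (p - m) \<and> Y powr m * (Y + X) powr (p - m) \<le> A1 * Y powr p"
      proof (cases "Y = 0")
        case False
        then have y: "0 < Y" "Y \<le> Y + X" "Y + X \<le> 2 * Y" using nn that by auto
        have "Y powr m * (a1 * Y powr (p-m)) \<le> Y powr m * (Y + X) powr (p - m)"
           "Y powr m * (Y + X) powr (p - m) \<le> Y powr m * (A1 * Y powr (p-m))"
          using powr_between[OF y, of "p-m"] unfolding a1_def A1_def by (intro mult_left_mono; simp)+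
        moreover have "Y powr m * Y powr (p-m) = Y powr p" by (simp add: powr_add[symmetric])
        ultimately show ?thesis by (simp add: mult.left_commute)
      qed simp
      then show "a1 * Y powr p \<le> Y powr m * (Y + X) powr (p - m)" "Y powr m * (Y + X) powr (p - m) \<le> A1 * Y powr p" by auto
    qed
    have 1: "c1 * (Y powr m * (Y + X) powr (p - m)) \<le> vbreg n p s v w" if le: "X \<le> Y"
    proof (cases "H = 0")
      case True
      then have Y0: "Y = 0" using GX nn by (simp)
      have "0 \<le> vbreg n p s v w" by (rule order_trans[OF _ kB]) (use k cs nn in auto)
      then show ?thesis using Y0 by simp
    next
      case False
      then have H: "0 < H" "H \<le> G + H" "G + H \<le> 2 * H" using nn le mono by auto
      have "c1 * (Y powr m * (Y + X) powr (p - m)) \<le> c1 * (A1 * Y powr p)"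
        using R1lo(2)[OF le] pos by (intro mult_left_mono) auto
      also have "\<dots> = k * (b1 * H powr (p/s - 1)) * (cs * (d * H))"
      proof -
        have "H powr (p/s - 1) * H = Y powr p" using H p by (simp add: powr_diff powX)
        then show ?thesis using ab by (simp add: c1_def field_simps)
      qed
      also have "\<dots> \<le> k * (G + H) powr (p/s-1) * (cs * T)"
        using powr_between(1)[OF H, of "p/s-1"] d k cs H mono le unfolding b1_def[symmetric]
        using ab by (intro mult_mono) (auto simp: G_def H_def T_def)
      finally show ?thesis using kB by simp
    qed
    have 2: "c2 * (X powr (p - s) * T) \<le> vbreg n p s v w" if lt: "Y < X"
    proof -
      have G: "0 < G" "G \<le> G + H" "G + H \<le> 2 * G" using nn lt mono GX by auto
      have "X powr (p-s) = G powr (p/s-1)" using pe by (simp add: powX)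
      then have "c2 * (X powr (p - s) * T) = k * (b1 * G powr (p/s-1)) * (cs * T)" by (simp add: c2_def)
      also have "\<dots> \<le> k * (G + H) powr (p/s-1) * (cs * T)"
        using powr_between(1)[OF G, of "p/s-1"] k cs nn unfolding b1_def[symmetric]
        by (intro mult_right_mono mult_left_mono) auto
      finally show ?thesis using kB by simp
    qed
    have 4: "vbreg n p s v w \<le> C2 * (X powr (p - s) * T)" if "0 < X"
    proof -
      have "vbreg n p s v w \<le> p / s * G powr (p / s - 1) * B" using vbreg_le[of p s n v w] p that GX by (simp add: G_def B_def)
      also have "\<dots> \<le> p / s * G powr (p / s - 1) * (Cs * T)" using Bl p by (intro mult_left_mono) auto
      also have "G powr (p/s-1) = X powr (p-s)" using pe by (simp add: powX)
      finally show ?thesis by (simp add: C2_def mult_ac)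
    qed
    \<comment> \<open>For X \<le> Y no cancellation has to be exploited: the negative term is
      dropped and the other two are at most multiples of Y^p. For Y < X the \<open>R2\<close> bound
      is combined with \<open>tsum_le\<close>.\<close>
    have 3: "vbreg n p s v w \<le> C1 * (Y powr m * (Y + X) powr (p - m))"
    proof (cases "X \<le> Y")
      case True
      then have GH: "G \<le> H" using mono by simp
      have "lsum n s (\<lambda>i. v i + w i) \<le> 2 powr s * (G + H)" using lsum_add_le[of s 1 n v w] p by (simp add: G_def H_def)
      also have "\<dots> \<le> 2 powr s * (2 * H)" using GH by (intro mult_left_mono) auto
      finally have "lsum n s (\<lambda>i. v i + w i) powr (p/s) \<le> (2 * 2 powr s * H) powr (p/s)"
        using p by (intro powr_mono2) (auto simp: lsum_nonneg)
      also have "\<dots> = (2 * 2 powr s) powr (p/s) * Y powr p" using p nn by (simp add: powr_mult powX)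
      finally have i1: "lsum n s (\<lambda>i. v i + w i) powr (p/s) \<le> (2 * 2 powr s) powr (p/s) * Y powr p" .
      have "G powr (p/s-1) * \<bar>dsum n s v w\<bar> \<le> G powr (p/s-1) * (2 * (G powr ((s - 1) / s) * H powr (1 / s)))"
        using dsum_le[of s n v w] p by (intro mult_left_mono) (auto simp: G_def H_def)
      also have "\<dots> = 2 * (X powr (p - 1) * Y powr 1)"
      proof -
        have "s * (p/s-1) + s * ((s-1)/s) = p - 1" "s * (1/s) = 1" using p by (auto simp: field_simps)
        then have "G powr (p/s-1) * G powr ((s-1)/s) = X powr (p-1)" "H powr (1/s) = Y powr 1"
          by (auto simp only: powX powr_add[symmetric])
        then show ?thesis by (metis mult.assoc mult.left_commute)
      qed
      also have "\<dots> \<le> 2 * (Y powr (p - 1) * Y powr 1)" using True nn p by (intro mult_left_mono mult_right_mono powr_mono2) auto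
      also have "\<dots> = 2 * Y powr p" by (simp only: powr_add[symmetric]) simp
      finally have "p * (G powr (p/s-1) * \<bar>dsum n s v w\<bar>) \<le> p * (2 * Y powr p)" using p by (intro mult_left_mono) auto
      moreover have "- (p * (G powr (p/s-1) * dsum n s v w)) \<le> p * (G powr (p/s-1) * \<bar>dsum n s v w\<bar>)"
        using p by (auto simp: abs_if mult_nonneg_nonneg mult_nonneg_nonpos)
      moreover have "0 \<le> G powr (p/s)" by simp
      ultimately have "vbreg n p s v w \<le> ((2 * 2 powr s) powr (p/s) + 2 * p) * Y powr p"
        using i1 unfolding vbreg_def G_def[symmetric] distrib_right mult.assoc mult.left_commute[of p 2] by linarith
      also have "\<dots> = ((2 * 2 powr s) powr (p/s) + 2 * p) / a1 * (a1 * Y powr p)" using ab by simp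
      also have "\<dots> \<le> C1 * (Y powr m * (Y + X) powr (p - m))"
        using pos ab by (intro mult_mono[OF _ R1lo(1)[OF True]]) (auto simp: C1_def)
      finally show ?thesis .
    next
      case False
      then have X: "0 < X" "X \<le> Y + X" "Y + X \<le> 2 * X" using nn by auto
      have "T \<le> 2 * 2 powr s * (H powr (m / s) * G powr ((s - m) / s))"
        using tsum_le[of s n w v] mono p False X(1) nn GX by (simp add: T_def H_def G_def m_def)
      also have "\<dots> = 2 * 2 powr s * (Y powr m * X powr (s - m))" using p by (simp add: powX)
      finally have Tl: "T \<le> 2 * 2 powr s * (Y powr m * X powr (s - m))" .
      have "vbreg n p s v w \<le> C2 * (X powr (p - s) * T)" using 4 X by simp
      also have "\<dots> \<le> C2 * (X powr (p - s) * (2 * 2 powr s * (Y powr m * X powr (s - m))))"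
        using Tl pos by (intro mult_left_mono) auto
      also have "\<dots> = C2 * (2 * 2 powr s) / a1 * (Y powr m * (a1 * X powr (p-m)))"
      proof -
        have "X powr (p - s) * X powr (s-m) = X powr (p-m)" by (simp add: powr_add[symmetric])
        then show ?thesis using ab by (simp add: mult.left_commute mult.commute)
      qed
      also have "\<dots> \<le> C1 * (Y powr m * (Y + X) powr (p - m))"
        using powr_between(1)[OF X, of "p-m"] pos ab unfolding a1_def[symmetric]
        by (intro mult_mono mult_left_mono) (auto simp: C1_def)
      finally show ?thesis .
    qed
    show ?thesis using 1 2 3 4 by (simp add: T_def)
  qed
  define c C where "c = min c1 c2" and "C = max C1 C2"
  have ge: "c * x \<le> c1 * x" "c * x \<le> c2 * x" "C1 * x \<le> C * x" "C2 * x \<le> C * x" if "0 \<le> x" for x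
    using that by (auto simp: c_def C_def intro: mult_right_mono)
  have cC: "0 < c" "0 < C" using pos by (auto simp: c_def C_def)
  have nn: "0 \<le> (x::real) powr m * y powr (p - m)" "0 \<le> (x::real) powr (p - s) * tsum n s v w" for x y n v w
    by (auto simp: tsum_nonneg)
  show ?thesis unfolding m_def[symmetric]
  proof (rule exI[of _ c], rule exI[of _ C], intro conjI[OF cC(1) conjI[OF cC(2)]] allI impI)
    fix n v w X Y assume XY: "X = lsum n s v powr (1/s)" "Y = lsum n s w powr (1/s)"
    note r = res[OF XY]
    note n1 = nn(1)[of Y "Y + X"] and n2 = nn(2)[of X n v w]
    show "(X \<le> Y \<longrightarrow> c * (Y powr m * (Y + X) powr (p - m)) \<le> vbreg n p s v w) \<and>
     (Y < X \<longrightarrow> c * (X powr (p - s) * tsum n s v w) \<le> vbreg n p s v w) \<and>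
     vbreg n p s v w \<le> C * (Y powr m * (Y + X) powr (p - m)) \<and>
     (0 < X \<longrightarrow> vbreg n p s v w \<le> C * (X powr (p - s) * tsum n s v w))"
      using r ge(1)[OF n1] ge(2)[OF n2] ge(3)[OF n1] ge(4)[OF n2] by linarith
  qed
qed

section \<open>Boxes and the topology of \<open>Rn n\<close>\<close>

abbreviation pts :: "nat \<Rightarrow> pt set" where
  "pts n \<equiv> {..<n} \<rightarrow>\<^sub>E UNIV"

text \<open>The uncompleted product measure. Convolutions and Fubini's theorem are handled here, and
  results are carried to its completion \<open>Leb n\<close> through Borel representatives.\<close>

abbreviation lbo :: "nat \<Rightarrow> pt measure" where
  "lbo n \<equiv> \<Pi>\<^sub>M i\<in>{..<n}. lborel"

text \<open>Balls of the maximum norm. They are products of intervals, so their openness,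
  connectedness and measurability reduce to one coordinate; the closed ones are compact for the same
  reason.\<close>

definition obox :: "nat \<Rightarrow> pt \<Rightarrow> real \<Rightarrow> pt set" where
  "obox n x e = {y \<in> pts n. \<forall>i<n. \<bar>y i - x i\<bar> < e}"

definition clbox :: "nat \<Rightarrow> pt \<Rightarrow> real \<Rightarrow> pt set" where
  "clbox n x e = {y \<in> pts n. \<forall>i<n. \<bar>y i - x i\<bar> \<le> e}"

lemma topspace_Rn: "topspace (Rn n) = pts n" by simp

lemma obox_PiE: "obox n x e = (\<Pi>\<^sub>E i\<in>{..<n}. {x i - e<..<x i + e})"
proof -
  have "\<bar>y - z\<bar> < e \<longleftrightarrow> y \<in> {z - e<..<z + e}" for y z :: real by auto
  then show ?thesis unfolding obox_def by (intro set_eqI) (simp add: PiE_iff Ball_def conj_commute)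
qed

lemma clbox_PiE: "clbox n x e = (\<Pi>\<^sub>E i\<in>{..<n}. {x i - e..x i + e})"
proof -
  have "\<bar>y - z\<bar> \<le> e \<longleftrightarrow> y \<in> {z - e..z + e}" for y z :: real by auto
  then show ?thesis unfolding clbox_def by (intro set_eqI) (simp add: PiE_iff Ball_def conj_commute)
qed

lemma obox_subset_clbox: "obox n x e \<subseteq> clbox n x e" by (auto simp: obox_def clbox_def less_imp_le)
lemma clbox_subset_obox: "e < d \<Longrightarrow> clbox n x e \<subseteq> obox n x d" by (auto simp: obox_def clbox_def intro: le_less_trans)
lemma obox_mono: "e \<le> d \<Longrightarrow> obox n x e \<subseteq> obox n x d" by (auto simp: obox_def intro: less_le_trans)
lemma clbox_mono: "e \<le> d \<Longrightarrow> clbox n x e \<subseteq> clbox n x d" by (auto simp: clbox_def intro: order_trans)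
lemma centre_in_obox: "x \<in> pts n \<Longrightarrow> 0 < e \<Longrightarrow> x \<in> obox n x e" by (simp add: obox_def)
lemma clbox_subset_pts: "clbox n x e \<subseteq> pts n" by (auto simp: clbox_def)

lemma openin_obox: "openin (Rn n) (obox n x e)" by (simp add: obox_PiE openin_PiE)
lemma compactin_clbox: "compactin (Rn n) (clbox n x e)" by (simp add: clbox_PiE compactin_PiE)
lemma connectedin_obox: "connectedin (Rn n) (obox n x e)"
  by (simp add: obox_PiE connectedin_PiE connectedin_iff_connected)

lemma Hausdorff_Rn: "Hausdorff_space (Rn n)"
  by (simp add: Hausdorff_space_product_topology Hausdorff_space_euclidean)

lemma openin_Rn_iff: "openin (Rn n) U \<longleftrightarrow> U \<subseteq> pts n \<and> (\<forall>x\<in>U. \<exists>e>0. obox n x e \<subseteq> U)"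
proof (intro iffI conjI ballI)
  assume U: "openin (Rn n) U"
  then show "U \<subseteq> pts n" using openin_subset topspace_Rn by metis
  fix x assume x: "x \<in> U"
  then obtain W where W: "\<And>i. i < n \<Longrightarrow> open (W i)" "x \<in> PiE {..<n} W" "PiE {..<n} W \<subseteq> U"
  proof -
    obtain W where "\<forall>i\<in>{..<n}. openin euclideanreal (W i)" "x \<in> PiE {..<n} W" "PiE {..<n} W \<subseteq> U"
      using U x unfolding openin_product_topology_alt by blast
    then show ?thesis using that[of W] by auto
  qed
  have "\<exists>e>0. \<forall>y. \<bar>y - x i\<bar> < e \<longrightarrow> y \<in> W i" if "i < n" for i
    using W(1)[OF that] W(2) that unfolding open_dist dist_real_def by (auto simp: PiE_iff)
  then obtain e where e: "\<And>i. i < n \<Longrightarrow> 0 < e i \<and> (\<forall>y. \<bar>y - x i\<bar> < e i \<longrightarrow> y \<in> W i)" by metis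
  define d where "d = Min (insert 1 (e ` {..<n}))"
  have d: "0 < d" "\<And>i. i < n \<Longrightarrow> d \<le> e i" unfolding d_def using e by auto
  have "obox n x d \<subseteq> PiE {..<n} W"
  proof
    fix y assume y: "y \<in> obox n x d"
    have "y i \<in> W i" if "i < n" for i
    proof -
      have "\<bar>y i - x i\<bar> < e i" using y d(2)[OF that] that unfolding obox_def by force
      then show ?thesis using e[OF that] by blast
    qed
    then show "y \<in> PiE {..<n} W" using y unfolding obox_def by (auto simp: PiE_iff)
  qed
  then show "\<exists>e>0. obox n x e \<subseteq> U" using W(3) d by blast
next
  assume U: "U \<subseteq> pts n \<and> (\<forall>x\<in>U. \<exists>e>0. obox n x e \<subseteq> U)"
  show "openin (Rn n) U"
    unfolding openin_subopen[of "Rn n" U] using U openin_obox centre_in_obox by (metis subsetD)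
qed

lemma openin_RnD: "openin (Rn n) U \<Longrightarrow> x \<in> U \<Longrightarrow> \<exists>e>0. obox n x e \<subseteq> U"
  unfolding openin_Rn_iff by simp

lemma compactin_subset_pts: "compactin (Rn n) K \<Longrightarrow> K \<subseteq> pts n"
  using compactin_subset_topspace topspace_Rn by metis

lemma openin_subset_pts: "openin (Rn n) K \<Longrightarrow> K \<subseteq> pts n"
  using openin_subset topspace_Rn by metis

lemma compactin_finite_obox_cover:
  assumes "compactin (Rn n) K" "\<And>x. x \<in> K \<Longrightarrow> 0 < r x"
  shows "\<exists>F. finite F \<and> F \<subseteq> K \<and> K \<subseteq> (\<Union>x\<in>F. obox n x (r x))"
proof -
  have cov: "K \<subseteq> \<Union> ((\<lambda>x. obox n x (r x)) ` K)"
  proof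
    fix x assume "x \<in> K"
    then have "x \<in> obox n x (r x)" using assms compactin_subset_pts centre_in_obox by (metis subsetD)
    then show "x \<in> \<Union> ((\<lambda>x. obox n x (r x)) ` K)" using \<open>x \<in> K\<close> by blast
  qed
  then obtain \<F> where F: "finite \<F>" "\<F> \<subseteq> (\<lambda>x. obox n x (r x)) ` K" "K \<subseteq> \<Union>\<F>"
  proof -
    have "openin (Rn n) U" if "U \<in> (\<lambda>x. obox n x (r x)) ` K" for U using that openin_obox by auto
    from compactinD[OF assms(1) this cov] show ?thesis using that by auto
  qed
  then obtain F where "F \<subseteq> K" "finite F" "\<F> = (\<lambda>x. obox n x (r x)) ` F"
    by (meson finite_subset_image)
  then show ?thesis using F by blast
qed

text \<open>Mollification with radius at most e then cannot carry the support out of K'. Boxes of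
  half the available radius cover K, finitely many suffice, and the smallest of these radii works
  uniformly.\<close>

lemma compactin_neighbourhood:
  assumes K: "compactin (Rn n) K" "K \<subseteq> \<Omega>" and \<Omega>: "openin (Rn n) \<Omega>"
  shows "\<exists>e>0. \<exists>K'. compactin (Rn n) K' \<and> K' \<subseteq> \<Omega> \<and> (\<forall>x\<in>K. clbox n x e \<subseteq> K')"
proof -
  have "\<exists>r>0. clbox n x (2 * r) \<subseteq> \<Omega>" if "x \<in> K" for x
  proof -
    obtain e where e: "e > 0" "obox n x e \<subseteq> \<Omega>" using openin_RnD[OF \<Omega>] K(2) \<open>x \<in> K\<close> by (meson subsetD)
    then have "clbox n x (2 * (e / 3)) \<subseteq> \<Omega>" using clbox_subset_obox[of "2 * (e/3)" e n x] by auto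
    then show ?thesis using e by (intro exI[of _ "e/3"]) auto
  qed
  then obtain r where r: "\<And>x. x \<in> K \<Longrightarrow> 0 < r x" "\<And>x. x \<in> K \<Longrightarrow> clbox n x (2 * r x) \<subseteq> \<Omega>" by metis
  obtain F where F: "finite F" "F \<subseteq> K" "K \<subseteq> (\<Union>x\<in>F. obox n x (r x))"
    using compactin_finite_obox_cover[where r=r, OF K(1) r(1)] that by blast
  \<comment> \<open>Inserting 1 keeps the minimum over a nonempty set when K, and with it the cover,
    is empty.\<close>
  define d where "d = Min (insert 1 (r ` F))"
  have d: "0 < d" "\<And>x. x \<in> F \<Longrightarrow> d \<le> r x" unfolding d_def using F r by auto
  define K' where "K' = (\<Union>x\<in>F. clbox n x (2 * r x))"
  have "compactin (Rn n) K'" unfolding K'_def using F by (intro compactin_Union) (auto simp: compactin_clbox)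
  moreover have "K' \<subseteq> \<Omega>" using r(2) F unfolding K'_def by blast
  moreover have "clbox n x d \<subseteq> K'" if x: "x \<in> K" for x
  proof
    fix y assume y: "y \<in> clbox n x d"
    obtain z where z: "z \<in> F" "x \<in> obox n z (r z)" using F(3) x by auto
    have "\<bar>y i - z i\<bar> \<le> 2 * r z" if "i < n" for i
    proof -
      have "\<bar>y i - x i\<bar> \<le> r z" using y d(2)[OF z(1)] that unfolding clbox_def by force
      moreover have "\<bar>x i - z i\<bar> < r z" using z that unfolding obox_def by auto
      ultimately show ?thesis by linarith
    qed
    then have "y \<in> clbox n z (2 * r z)" using y by (auto simp: clbox_def)
    then show "y \<in> K'" using z by (auto simp: K'_def)
  qed
  ultimately show ?thesis using d by blast
qed

lemma compactin_bounded:
  assumes "compactin (Rn n) K"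
  shows "\<exists>R>0. K \<subseteq> clbox n (\<lambda>i\<in>{..<n}. 0) R"
proof -
  obtain F where F: "finite F" "F \<subseteq> K" "K \<subseteq> (\<Union>x\<in>F. obox n x 1)"
    using compactin_finite_obox_cover[OF assms, of "\<lambda>_. 1"] that zero_less_one by metis
  define R where "R = 1 + (\<Sum>x\<in>F. \<Sum>i<n. \<bar>x i\<bar>)"
  have "\<bar>y i\<bar> \<le> R" if "y \<in> K" "i < n" for y i
  proof -
    obtain x where x: "x \<in> F" "y \<in> obox n x 1" using F(3) \<open>y \<in> K\<close> by auto
    have "\<bar>x i\<bar> \<le> (\<Sum>i<n. \<bar>x i\<bar>)" using that by (intro member_le_sum) auto
    also have "\<dots> \<le> (\<Sum>x\<in>F. \<Sum>i<n. \<bar>x i\<bar>)" using x F by (intro member_le_sum) (auto simp: sum_nonneg)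
    finally have "\<bar>x i\<bar> \<le> (\<Sum>x\<in>F. \<Sum>i<n. \<bar>x i\<bar>)" .
    moreover have "\<bar>y i - x i\<bar> < 1" using x that by (auto simp: obox_def)
    ultimately show ?thesis unfolding R_def by linarith
  qed
  then have "K \<subseteq> clbox n (\<lambda>i\<in>{..<n}. 0) R"
    using compactin_subset_pts[OF assms] by (auto simp: clbox_def)
  moreover have "0 < R" unfolding R_def by (intro add_pos_nonneg sum_nonneg) auto
  ultimately show ?thesis by blast
qed

lemma closedin_compactin: "compactin (Rn n) K \<Longrightarrow> closedin (Rn n) K"
  using compactin_imp_closedin Hausdorff_Rn by blast

lemma cinside_iff:
  assumes "A \<subseteq> pts n"
  shows "cinside n A \<Omega> \<longleftrightarrow> (\<exists>K. compactin (Rn n) K \<and> A \<subseteq> K \<and> K \<subseteq> \<Omega>)"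
proof
  assume c: "cinside n A \<Omega>"
  show "\<exists>K. compactin (Rn n) K \<and> A \<subseteq> K \<and> K \<subseteq> \<Omega>"
  proof (intro exI[of _ "Rn n closure_of A"] conjI)
    show "A \<subseteq> Rn n closure_of A" by (rule closure_of_subset) (use assms topspace_Rn in metis)
    show "compactin (Rn n) (Rn n closure_of A)" "Rn n closure_of A \<subseteq> \<Omega>" using c unfolding cinside_def by simp_all
  qed
next
  assume "\<exists>K. compactin (Rn n) K \<and> A \<subseteq> K \<and> K \<subseteq> \<Omega>"
  then obtain K where K: "compactin (Rn n) K" "A \<subseteq> K" "K \<subseteq> \<Omega>" by blast
  then have "Rn n closure_of A \<subseteq> K" by (simp add: closedin_compactin closure_of_minimal)
  moreover from this have "compactin (Rn n) (Rn n closure_of A)"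
    by (rule closed_compactin[OF K(1) _ closedin_closure_of])
  ultimately show "cinside n A \<Omega>" using K unfolding cinside_def by (meson order_trans)
qed

lemma cont_on_iff:
  assumes "A \<subseteq> pts n"
  shows "cont_on n A f \<longleftrightarrow> (\<forall>x\<in>A. \<forall>e>0. \<exists>d>0. \<forall>y\<in>A \<inter> obox n x d. \<bar>f y - f x\<bar> < e)"
proof -
  have ts: "topspace (subtopology (Rn n) A) = A" unfolding topspace_subtopology topspace_Rn using assms by (rule Int_absorb1)
  show ?thesis
  proof (intro iffI ballI allI impI)
    fix x e assume c: "cont_on n A f" and x: "x \<in> A" and e: "0 < (e::real)"
    have "openin euclideanreal (ball (f x) e)" by simp
    then have "openin (subtopology (Rn n) A) {y \<in> A. f y \<in> ball (f x) e}"
      using openin_continuous_map_preimage[OF c[unfolded cont_on_def], of "ball (f x) e"] unfolding ts by simp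
    then obtain T where T: "openin (Rn n) T" "{y \<in> A. f y \<in> ball (f x) e} = T \<inter> A"
      unfolding openin_subtopology by blast
    have "x \<in> {y \<in> A. f y \<in> ball (f x) e}" using x e by simp
    then have "x \<in> T" unfolding T(2) by simp
    then obtain d where d: "d > 0" "obox n x d \<subseteq> T" using openin_RnD[OF T(1)] by blast
    show "\<exists>d>0. \<forall>y\<in>A \<inter> obox n x d. \<bar>f y - f x\<bar> < e"
    proof (intro exI[of _ d] conjI ballI d(1))
      fix y assume "y \<in> A \<inter> obox n x d"
      then have "y \<in> {y \<in> A. f y \<in> ball (f x) e}" using T(2) d(2) by blast
      then show "\<bar>f y - f x\<bar> < e" by (simp add: dist_real_def abs_minus_commute)
    qed
  next
    assume c: "\<forall>x\<in>A. \<forall>e>0. \<exists>d>0. \<forall>y\<in>A \<inter> obox n x d. \<bar>f y - f x\<bar> < e"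
    have "openin (subtopology (Rn n) A) {y \<in> A. f y \<in> V}" if V: "open V" for V
    proof -
      have "\<exists>d>0. \<forall>y\<in>A \<inter> obox n x d. f y \<in> V" if x: "x \<in> A" "f x \<in> V" for x
      proof -
        obtain e where e: "e > 0" "ball (f x) e \<subseteq> V" using V x open_contains_ball by blast
        then obtain d where "d > 0" "\<forall>y\<in>A \<inter> obox n x d. \<bar>f y - f x\<bar> < e" using c x by blast
        then show ?thesis using e by (intro exI[of _ d]) (auto simp: subset_iff dist_real_def abs_minus_commute)
      qed
      then obtain d where d: "\<And>x. x \<in> A \<Longrightarrow> f x \<in> V \<Longrightarrow> 0 < d x \<and> (\<forall>y\<in>A \<inter> obox n x (d x). f y \<in> V)" by metis
      have "{y \<in> A. f y \<in> V} = (\<Union>x\<in>{x\<in>A. f x \<in> V}. obox n x (d x)) \<inter> A"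
      proof (intro set_eqI iffI)
        fix y assume y: "y \<in> {y \<in> A. f y \<in> V}"
        then have "y \<in> obox n y (d y)" using d centre_in_obox assms by (metis mem_Collect_eq subsetD)
        then show "y \<in> (\<Union>x\<in>{x\<in>A. f x \<in> V}. obox n x (d x)) \<inter> A" using y by fast
      next
        fix y assume "y \<in> (\<Union>x\<in>{x\<in>A. f x \<in> V}. obox n x (d x)) \<inter> A"
        then obtain x where "x \<in> A" "f x \<in> V" "y \<in> obox n x (d x)" "y \<in> A" by fast
        then show "y \<in> {y \<in> A. f y \<in> V}" using d[of x] by simp
      qed
      moreover have "openin (Rn n) (\<Union>x\<in>{x\<in>A. f x \<in> V}. obox n x (d x))"
        by (intro openin_Union) (elim imageE, simp only: openin_obox)
      ultimately show ?thesis unfolding openin_subtopology by (intro exI conjI)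
    qed
    then show "cont_on n A f" unfolding cont_on_def continuous_map_def ts by simp
  qed
qed

lemma cont_on_bounded:
  assumes "cont_on n \<Omega> f" "compactin (Rn n) K" "K \<subseteq> \<Omega>"
  shows "\<exists>B>0. \<forall>x\<in>K. \<bar>f x\<bar> \<le> B"
proof -
  have "compactin (subtopology (Rn n) \<Omega>) K" using assms by (simp add: compactin_subtopology)
  then have "compact (f ` K)" using image_compactin assms(1) unfolding cont_on_def by fastforce
  then obtain B where "\<forall>x\<in>f`K. \<bar>x\<bar> \<le> B" using compact_imp_bounded bounded_iff real_norm_def by metis
  then show ?thesis by (intro exI[of _ "max B 1"]) (auto simp: max_def)
qed

lemma cont_on_subset: "cont_on n A f \<Longrightarrow> B \<subseteq> A \<Longrightarrow> cont_on n B f"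
  unfolding cont_on_def by (rule continuous_map_from_subtopology_mono)

lemma cont_on_cong: "(\<And>x. x \<in> A \<Longrightarrow> f x = g x) \<Longrightarrow> cont_on n A f \<longleftrightarrow> cont_on n A g"
  unfolding cont_on_def by (intro iffI; erule continuous_map_eq) (auto simp only: topspace_subtopology Int_iff)

lemma cont_on_const: "cont_on n A (\<lambda>x. c)" unfolding cont_on_def by simp
lemma cont_on_add: "cont_on n A f \<Longrightarrow> cont_on n A g \<Longrightarrow> cont_on n A (\<lambda>x. f x + g x)"
  unfolding cont_on_def by (rule continuous_map_add)
lemma cont_on_mult: "cont_on n A f \<Longrightarrow> cont_on n A g \<Longrightarrow> cont_on n A (\<lambda>x. f x * g x)"
  unfolding cont_on_def by (rule continuous_map_real_mult)
lemma cont_on_compose: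
  assumes "cont_on n A f" "continuous_on UNIV (g::real\<Rightarrow>real)"
  shows "cont_on n A (\<lambda>x. g (f x))"
  using continuous_map_compose[of _ _ f euclideanreal g] assms unfolding cont_on_def by (simp add: o_def)
text \<open>Boxes with rational centre and rational radius. Countability lets measurability on an
  open set, and almost-everywhere statements on it, be checked on boxes whose closures lie
  inside.\<close>

lemma openin_countable_boxes:
  assumes "openin (Rn n) U"
  shows "\<exists>C. countable C \<and> (\<forall>(x,e)\<in>C. x \<in> pts n \<and> 0 < e \<and> clbox n x e \<subseteq> U) \<and> U = (\<Union>(x,e)\<in>C. obox n x e)"
proof -
  define C where "C = {(x,e). x \<in> (\<Pi>\<^sub>E i\<in>{..<n}. \<rat>) \<and> e \<in> \<rat> \<and> 0 < e \<and> clbox n x e \<subseteq> U}"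
  have "C \<subseteq> (\<Pi>\<^sub>E i\<in>{..<n}. \<rat>) \<times> \<rat>" by (auto simp: C_def)
  moreover have "countable ((\<Pi>\<^sub>E i\<in>{..<n}. \<rat>) \<times> (\<rat>::real set))"
    by (intro countable_SIGMA countable_PiE countable_rat) auto
  ultimately have cC: "countable C" using countable_subset by blast
  have C1: "\<forall>(x,e)\<in>C. x \<in> pts n \<and> 0 < e \<and> clbox n x e \<subseteq> U" by (auto simp: C_def PiE_iff)
  have "U \<subseteq> (\<Union>(x,e)\<in>C. obox n x e)"
  proof
    fix y assume y: "y \<in> U"
    then obtain d where d: "d > 0" "obox n y d \<subseteq> U" "y \<in> pts n"
      using openin_RnD[OF assms y] openin_subset_pts[OF assms] by auto
    obtain e where e: "e \<in> \<rat>" "0 < e" "e < d/2" using Rats_dense_in_real[of 0 "d/2"] d by auto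
    have "\<exists>q\<in>\<rat>. y i < q \<and> q < y i + e" for i using Rats_dense_in_real[of "y i" "y i + e"] e by auto
    then obtain q where q: "\<And>i. q i \<in> \<rat> \<and> y i < q i \<and> q i < y i + e" by metis
    define x where "x = (\<lambda>i\<in>{..<n}. q i)"
    have "clbox n x e \<subseteq> obox n y d"
    proof
      fix z assume z: "z \<in> clbox n x e"
      have "\<bar>z i - y i\<bar> < d" if "i < n" for i
      proof -
        have "\<bar>z i - q i\<bar> \<le> e" using z that by (auto simp: clbox_def x_def)
        then show ?thesis using q[of i] e by linarith
      qed
      then show "z \<in> obox n y d" using z by (auto simp: obox_def clbox_def)
    qed
    moreover have "x \<in> (\<Pi>\<^sub>E i\<in>{..<n}. \<rat>)" using q by (auto simp: x_def)
    ultimately have "(x,e) \<in> C" using e d by (auto simp: C_def)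
    moreover have "y \<in> obox n x e" unfolding obox_def
    proof (intro CollectI conjI allI impI)
      fix i assume "i < n"
      then show "\<bar>y i - x i\<bar> < e" using q[of i] unfolding x_def by (simp add: abs_less_iff)
    qed (use d in simp)
    ultimately show "y \<in> (\<Union>(x,e)\<in>C. obox n x e)" by blast
  qed
  moreover have "(\<Union>(x,e)\<in>C. obox n x e) \<subseteq> U" using C1 obox_subset_clbox by blast
  ultimately show ?thesis using cC C1 by blast
qed

section \<open>Measurability of open and compact sets\<close>

lemma sets_obox: "obox n x e \<in> sets (lbo n)" unfolding obox_PiE by (rule sets_PiM_I_finite) auto
lemma sets_clbox: "clbox n x e \<in> sets (lbo n)" unfolding clbox_PiE by (rule sets_PiM_I_finite) auto

lemma sets_openin: assumes "openin (Rn n) U" shows "U \<in> sets (lbo n)"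
proof -
  obtain C where C: "countable C" "U = (\<Union>(x,e)\<in>C. obox n x e)" using openin_countable_boxes[OF assms] by blast
  have "(\<Union>(x,e)\<in>C. obox n x e) \<in> sets (lbo n)"
    using C(1) by (intro sets.countable_UN'') (auto simp: sets_obox)
  then show ?thesis using C by simp
qed

lemma space_lbo: "space (lbo n) = pts n" by (simp add: space_PiM)

lemma sets_compactin: assumes "compactin (Rn n) K" shows "K \<in> sets (lbo n)"
proof -
  have "openin (Rn n) (pts n - K)" using closedin_compactin[OF assms] unfolding closedin_def topspace_Rn by blast
  then have "space (lbo n) - (pts n - K) \<in> sets (lbo n)" using sets_openin by blast
  moreover have "space (lbo n) - (pts n - K) = K" using compactin_subset_pts[OF assms] space_lbo by blast
  ultimately show ?thesis by simp
qed

lemma emeasure_clbox_finite: "emeasure (lbo n) (clbox n x e) < \<infinity>"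
proof -
  interpret product_sigma_finite "\<lambda>_::nat. lborel::real measure" ..
  have "emeasure (lbo n) (clbox n x e) = (\<Prod>i<n. emeasure lborel {x i - e..x i + e})"
    unfolding clbox_PiE by (subst emeasure_PiM) auto
  also have "\<dots> < \<infinity>" by (auto simp: emeasure_lborel_Icc_eq ennreal_prod_eq_top less_top[symmetric])
  finally show ?thesis .
qed

lemma emeasure_compactin_finite: assumes "compactin (Rn n) K" shows "emeasure (lbo n) K < \<infinity>"
proof -
  obtain R where "K \<subseteq> clbox n (\<lambda>i\<in>{..<n}. 0) R" using compactin_bounded[OF assms] by blast
  then show ?thesis using emeasure_mono[OF _ sets_clbox] emeasure_clbox_finite le_less_trans by metis
qed

lemma cont_on_borel_measurable:
  assumes "openin (Rn n) \<Omega>" "cont_on n \<Omega> f"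
  shows "(\<lambda>x. indicator \<Omega> x * f x) \<in> borel_measurable (lbo n)"
proof -
  have sub: "\<Omega> \<subseteq> pts n" using assms openin_subset_pts by blast
  have "f \<in> borel_measurable (restrict_space (lbo n) \<Omega>)"
  proof (rule borel_measurableI)
    fix S :: "real set" assume "open S"
    have ts: "topspace (subtopology (Rn n) \<Omega>) = \<Omega>" unfolding topspace_subtopology topspace_Rn using sub by (rule Int_absorb1)
    have "openin (subtopology (Rn n) \<Omega>) {x \<in> \<Omega>. f x \<in> S}"
    proof -
      have "openin euclideanreal S" using \<open>open S\<close> by (simp only: open_openin[symmetric])
      from openin_continuous_map_preimage[OF assms(2)[unfolded cont_on_def] this] show ?thesis unfolding ts .
    qed
    then have "openin (Rn n) {x \<in> \<Omega>. f x \<in> S}" by (rule openin_trans_full[OF _ assms(1)])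
    then have "{x \<in> \<Omega>. f x \<in> S} \<in> sets (lbo n)" by (rule sets_openin)
    moreover have "f -` S \<inter> space (restrict_space (lbo n) \<Omega>) = \<Omega> \<inter> {x \<in> \<Omega>. f x \<in> S}"
      using sub by (auto simp: space_restrict_space space_PiM)
    ultimately show "f -` S \<inter> space (restrict_space (lbo n) \<Omega>) \<in> sets (restrict_space (lbo n) \<Omega>)"
      unfolding sets_restrict_space by auto
  qed
  then have "(\<lambda>x. indicator \<Omega> x *\<^sub>R f x) \<in> borel_measurable (lbo n)"
    using sets_openin[OF assms(1)] borel_measurable_restrict_space_iff[of \<Omega> "lbo n" f] sub
    by (simp add: space_PiM Int_absorb2)
  then show ?thesis by simp
qed

subsection \<open>Smooth bump functions on the line\<close>

text \<open>A smooth function supported in [-e, e]. Demanding coinductively that the derivative is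
  again such a function encodes derivatives of all orders without naming them.\<close>

coinductive bump :: "real \<Rightarrow> (real \<Rightarrow> real) \<Rightarrow> bool" for e where
  "(\<And>t. e \<le> \<bar>t\<bar> \<Longrightarrow> f t = 0) \<Longrightarrow> (\<And>t. (f has_real_derivative f' t) (at t)) \<Longrightarrow> bump e f' \<Longrightarrow> bump e f"

text \<open>The flat function exp(-1/t), extended by 0 and multiplied by a polynomial in 1/t.
  Differentiation stays inside this family and sends P to X^2 (P - P').\<close>

definition Hfun :: "real poly \<Rightarrow> real \<Rightarrow> real" where
  "Hfun P t = (if t > 0 then poly P (1 / t) * exp (- (1 / t)) else 0)"

lemma poly_times_exp_tendsto_0: "((\<lambda>x::real. poly P x * exp (- x)) \<longlongrightarrow> 0) at_top"
proof -
  have "((\<lambda>x. \<Sum>i\<le>degree P. coeff P i * (x ^ i / exp x)) \<longlongrightarrow> (\<Sum>i\<le>degree P. coeff P i * 0)) at_top"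
    by (intro tendsto_intros tendsto_power_div_exp_0)
  moreover have "(\<Sum>i\<le>degree P. coeff P i * (x ^ i / exp x)) = poly P x * exp (- x)" for x
    by (simp add: poly_altdef sum_distrib_right exp_minus divide_inverse mult.assoc)
  ultimately show ?thesis by simp
qed

lemma Hfun_has_derivative:
  "(Hfun P has_real_derivative Hfun ([:0, 0, 1:] * (P - pderiv P)) t) (at t)"
proof -
  consider "t > 0" | "t < 0" | "t = 0" by linarith
  then show ?thesis
  proof cases
    case 1
    have "((\<lambda>t. poly P (1 / t) * exp (- (1 / t))) has_real_derivative
       poly (pderiv P) (1/t) * (- (1 / t\<^sup>2)) * exp (- (1/t)) + poly P (1/t) * (exp (- (1/t)) * (1 / t\<^sup>2))) (at t)"
      using 1 by (auto intro!: derivative_eq_intros DERIV_chain2[OF poly_DERIV] simp: power2_eq_square field_simps)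
    then have "((\<lambda>t. poly P (1 / t) * exp (- (1 / t))) has_real_derivative Hfun ([:0, 0, 1:] * (P - pderiv P)) t) (at t)"
      using 1 by (simp add: Hfun_def power2_eq_square field_simps)
    then show ?thesis
      by (rule has_field_derivative_transform_within[where d=t]) (use 1 in \<open>auto simp: dist_real_def Hfun_def\<close>)
  next
    case 2
    have "((\<lambda>t. 0) has_real_derivative Hfun ([:0, 0, 1:] * (P - pderiv P)) t) (at t)"
      using 2 by (simp add: Hfun_def)
    then show ?thesis
      by (rule has_field_derivative_transform_within[where d="-t"]) (use 2 in \<open>auto simp: dist_real_def Hfun_def\<close>)
  next
    case 3
    \<comment> \<open>Dividing \<open>Hfun P h\<close> by h multiplies the polynomial in 1/h by its
      variable, hence \<open>pCons 0 P\<close>; the exponential wins.\<close>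
    have "((\<lambda>h. poly (pCons 0 P) (1 / h) * exp (- (1 / h))) \<longlongrightarrow> 0) (at_right (0::real))"
      using filterlim_compose[OF poly_times_exp_tendsto_0[of "pCons 0 P"] filterlim_inverse_at_top_right]
      by (simp add: inverse_eq_divide)
    moreover have "eventually (\<lambda>h. poly (pCons 0 P) (1 / h) * exp (- (1 / h)) = Hfun P h / h) (at_right (0::real))"
      unfolding eventually_at_right_field by (intro exI[of _ 1]) (auto simp: Hfun_def)
    ultimately have r: "((\<lambda>h. Hfun P h / h) \<longlongrightarrow> 0) (at_right 0)"
      by (rule Lim_transform_eventually)
    have "eventually (\<lambda>h. 0 = Hfun P h / h) (at_left (0::real))"
      unfolding eventually_at_left_field by (intro exI[of _ "-1"]) (auto simp: Hfun_def)
    with tendsto_const have l: "((\<lambda>h. Hfun P h / h) \<longlongrightarrow> 0) (at_left 0)"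
      by (rule Lim_transform_eventually)
    have "((\<lambda>h. Hfun P h / h) \<longlongrightarrow> 0) (at 0)" using l r by (simp add: filterlim_split_at)
    then show ?thesis using 3 by (simp add: DERIV_def Hfun_def)
  qed
qed

text \<open>The first factor is flat at -e, the second at e. The product rule yields two summands of
  this form, so the closure under sums is closed under differentiation and serves as coinduction
  invariant for \<open>bump\<close>; scalars are absorbed into the polynomials.\<close>

inductive hbump :: "real \<Rightarrow> (real \<Rightarrow> real) \<Rightarrow> bool" for e where
  hbump_base: "hbump e (\<lambda>t. Hfun P (1 + t / e) * Hfun Q (1 - t / e))"
| hbump_add: "hbump e f \<Longrightarrow> hbump e g \<Longrightarrow> hbump e (\<lambda>t. f t + g t)"

lemma Hfun_smult: "Hfun (smult c P) t = c * Hfun P t" by (simp add: Hfun_def)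

lemma hbump_derivative:
  assumes "hbump e f" shows "\<exists>f'. hbump e f' \<and> (\<forall>t. (f has_real_derivative f' t) (at t))"
  using assms
proof induction
  case (hbump_base P Q)
  let ?D = "\<lambda>P::real poly. [:0, 0, 1:] * (P - pderiv P)"
  define f' where "f' = (\<lambda>t. Hfun (smult (1/e) (?D P)) (1 + t / e) * Hfun Q (1 - t / e)
     + Hfun P (1 + t / e) * Hfun (smult (- (1/e)) (?D Q)) (1 - t / e))"
  have "((\<lambda>t. Hfun P (1 + t / e) * Hfun Q (1 - t / e)) has_real_derivative f' t) (at t)" for t
  proof -
    have "((\<lambda>t. 1 + t / e) has_real_derivative 1/e) (at t)" by (cases "e = 0") (auto intro!: derivative_eq_intros)
    from DERIV_chain2[OF Hfun_has_derivative this]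
    have 1: "((\<lambda>t. Hfun P (1 + t / e)) has_real_derivative Hfun (?D P) (1 + t / e) * (1/e)) (at t)" .
    have "((\<lambda>t. 1 - t / e) has_real_derivative - (1/e)) (at t)" by (cases "e = 0") (auto intro!: derivative_eq_intros)
    from DERIV_chain2[OF Hfun_has_derivative this]
    have 2: "((\<lambda>t. Hfun Q (1 - t / e)) has_real_derivative Hfun (?D Q) (1 - t / e) * (- (1/e))) (at t)" .
    have eq: "Hfun (?D P) (1 + t / e) * (1/e) * Hfun Q (1 - t / e) + Hfun (?D Q) (1 - t / e) * (- (1/e)) * Hfun P (1 + t / e) = f' t"
      by (simp only: f'_def Hfun_smult) simp
    from DERIV_mult[OF 1 2] show ?thesis unfolding eq .
  qed
  moreover have "hbump e f'" unfolding f'_def by (intro hbump.intros)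
  ultimately show ?case by blast
next
  case (hbump_add f g)
  then obtain f' g' where fg: "hbump e f'" "\<And>t. (f has_real_derivative f' t) (at t)"
    "hbump e g'" "\<And>t. (g has_real_derivative g' t) (at t)" by blast
  show ?case
    using hbump.hbump_add[OF fg(1,3)] DERIV_add[OF fg(2,4)] by (intro exI[of _ "\<lambda>t. f' t + g' t"]) simp
qed

lemma hbump_zero:
  assumes "hbump e f" "0 < e" "e \<le> \<bar>t\<bar>" shows "f t = 0"
  using assms(1)
proof induction
  case (hbump_base P Q)
  have "1 \<le> \<bar>t\<bar> / e" using assms by simp
  then have "\<not> 1 + t / e > 0 \<or> \<not> 1 - t / e > 0" by (cases "t \<ge> 0") (auto simp: abs_if)
  then show ?case by (auto simp: Hfun_def)
qed simp

lemma hbump_imp_bump: "0 < e \<Longrightarrow> hbump e f \<Longrightarrow> bump e f"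
proof (coinduction arbitrary: f)
  case bump
  obtain f' where "hbump e f'" "\<forall>t. (f has_real_derivative f' t) (at t)" using hbump_derivative[OF bump(2)] by blast
  then show ?case using bump hbump_zero by blast
qed

lemma bump_zero: "bump e f \<Longrightarrow> e \<le> \<bar>t\<bar> \<Longrightarrow> f t = 0"
  by (erule bump.cases) auto

lemma bump_derivative: "bump e f \<Longrightarrow> \<exists>f'. bump e f' \<and> (\<forall>t. (f has_real_derivative f' t) (at t))"
  by (erule bump.cases) auto

lemma bump_continuous: "bump e f \<Longrightarrow> continuous_on UNIV f"
  using bump_derivative by (metis DERIV_isCont continuous_at_imp_continuous_on)

lemma bump_bounded: assumes "bump e f" shows "\<exists>B>0. \<forall>t. \<bar>f t\<bar> \<le> B"
proof -
  have "compact (f ` {-e..e})"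
    using bump_continuous[OF assms] by (intro compact_continuous_image) (auto intro: continuous_on_subset)
  then obtain B where B: "\<And>t. t \<in> {-e..e} \<Longrightarrow> \<bar>f t\<bar> \<le> B"
    using compact_imp_bounded bounded_iff by (metis image_eqI real_norm_def)
  have "\<bar>f t\<bar> \<le> \<bar>B\<bar> + 1" for t
  proof (cases "e \<le> \<bar>t\<bar>")
    case True then show ?thesis using bump_zero[OF assms] by simp
  next
    case False
    then have "t \<in> {-e..e}" by auto
    then show ?thesis using B[of t] by linarith
  qed
  then show ?thesis by (intro exI[of _ "\<bar>B\<bar> + 1"]) auto
qed

lemma bounded_derivative_lipschitz:
  fixes f :: "real \<Rightarrow> real"
  assumes "\<And>t. (f has_real_derivative f' t) (at t)" "\<And>t. \<bar>f' t\<bar> \<le> B"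
  shows "\<bar>f s - f t\<bar> \<le> B * \<bar>s - t\<bar>"
proof -
  have "norm (f s - f t) \<le> B * norm (s - t)"
    by (rule field_differentiable_bound[of UNIV f f']) (use assms in auto)
  then show ?thesis by simp
qed

lemma bump_lipschitz: assumes "bump e f" shows "\<exists>L>0. \<forall>s t. \<bar>f s - f t\<bar> \<le> L * \<bar>s - t\<bar>"
  using bump_derivative[OF assms] bump_bounded bounded_derivative_lipschitz by metis

text \<open>The derivative of a bump is Lipschitz because the second derivative is bounded. The
  resulting remainder is uniform in t, which later allows differentiation under the integral sign by
  mere integration of the inequality.\<close>

lemma bump_taylor:
  assumes "\<And>t. (f has_real_derivative f' t) (at t)" "bump e f'"
  shows "\<exists>L>0. \<forall>t h. \<bar>f (t + h) - f t - h * f' t\<bar> \<le> L * h\<^sup>2"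
proof -
  obtain L where L: "L > 0" "\<And>s t. \<bar>f' s - f' t\<bar> \<le> L * \<bar>s - t\<bar>" using bump_lipschitz[OF assms(2)] by blast
  have "\<bar>f (t + h) - f t - h * f' t\<bar> \<le> L * h\<^sup>2" for t h
  proof -
    have *: "\<exists>z. \<bar>z - t\<bar> \<le> \<bar>h\<bar> \<and> f (t + h) - f t = h * f' z"
    proof (cases "h = 0")
      case False
      show ?thesis
      proof (cases "h > 0")
        case True
        obtain z where "t < z" "z < t + h" "f (t+h) - f t = (t + h - t) * f' z"
          using MVT2[of t "t+h" f f'] assms(1) True by auto
        then show ?thesis by (intro exI[of _ z]) auto
      next
        case False
        obtain z where "t + h < z" "z < t" "f t - f (t+h) = (t - (t + h)) * f' z"
          using MVT2[of "t+h" t f f'] assms(1) False \<open>h \<noteq> 0\<close> by auto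
        then show ?thesis by (intro exI[of _ z]) auto
      qed
    qed auto
    then obtain z where z: "\<bar>z - t\<bar> \<le> \<bar>h\<bar>" "f (t + h) - f t = h * f' z" by blast
    have "\<bar>f (t + h) - f t - h * f' t\<bar> = \<bar>h\<bar> * \<bar>f' z - f' t\<bar>" unfolding z abs_mult[symmetric] right_diff_distrib ..
    also have "\<dots> \<le> \<bar>h\<bar> * (L * \<bar>h\<bar>)"
      using L(2)[of z t] z L(1) by (intro mult_left_mono) (auto intro: order_trans mult_left_mono)
    finally show ?thesis by (simp add: power2_eq_square mult_ac)
  qed
  then show ?thesis using L by blast
qed

lemma mollifier_exists:
  assumes e: "0 < e"
  shows "\<exists>\<rho>. bump e \<rho> \<and> (\<forall>t. \<rho> (- t) = \<rho> t) \<and> (\<forall>t. 0 \<le> \<rho> t) \<and> (\<forall>t. \<bar>t\<bar> < e \<longrightarrow> 0 < \<rho> t) \<and>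
     (\<integral>\<^sup>+t. ennreal (\<rho> t) \<partial>lborel) = 1"
proof -
  define b where "b = (\<lambda>t::real. Hfun [:1:] (1 + t / e) * Hfun [:1:] (1 - t / e))"
  have b: "bump e b" unfolding b_def by (rule hbump_imp_bump[OF e hbump_base])
  have b0: "0 \<le> b t" for t by (simp add: b_def Hfun_def)
  have bp: "0 < b t" if "\<bar>t\<bar> < e" for t
  proof -
    have "1 + t / e > 0" "1 - t / e > 0" using that e by (auto simp: field_simps abs_less_iff)
    then show ?thesis by (simp add: b_def Hfun_def)
  qed
  have bm: "b \<in> borel_measurable borel" using bump_continuous[OF b] by (rule borel_measurable_continuous_onI)
  define I where "I = (\<integral>\<^sup>+t. ennreal (b t) \<partial>lborel)"
  obtain B where B: "B > 0" "\<And>t. \<bar>b t\<bar> \<le> B" using bump_bounded[OF b] by blast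
  have "I \<le> (\<integral>\<^sup>+t. ennreal B * indicator {-e..e} t \<partial>lborel)"
    unfolding I_def
  proof (rule nn_integral_mono)
    fix t show "ennreal (b t) \<le> ennreal B * indicator {-e..e} t"
      using B(2)[of t] b0[of t] bump_zero[OF b, of t] by (auto simp: indicator_def intro!: ennreal_leI)
  qed
  also have "\<dots> < \<infinity>" using e by (simp add: nn_integral_cmult_indicator ennreal_mult_less_top)
  finally have Ifin: "I < \<infinity>" .
  have "I \<noteq> 0"
  proof
    assume "I = 0"
    then have "emeasure lborel {t\<in>space lborel. ennreal (b t) \<noteq> 0} = 0"
      unfolding I_def using bm by (subst (asm) nn_integral_0_iff) auto
    moreover have "{-e<..<e} \<subseteq> {t\<in>space lborel. ennreal (b t) \<noteq> 0}"
      using bp by (auto simp: abs_less_iff) (smt (verit) bp ennreal_eq_0_iff)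
    moreover have "{t\<in>space lborel. ennreal (b t) \<noteq> 0} \<in> sets lborel" using bm by measurable
    ultimately have "emeasure lborel {-e<..<e} \<le> 0" using emeasure_mono by metis
    then show False using e by simp
  qed
  define c where "c = enn2real I"
  have c: "0 < c" "I = ennreal c" using Ifin \<open>I \<noteq> 0\<close> by (auto simp: c_def enn2real_positive_iff less_top zero_less_iff_neq_zero)
  \<comment> \<open>The normalising factor 1/c is placed in the polynomial so that the function is
    still literally an \<open>hbump\<close>.\<close>
  define \<rho> where "\<rho> = (\<lambda>t. Hfun [:1/c:] (1 + t / e) * Hfun [:1:] (1 - t / e))"
  have \<rho>b: "\<rho> t = b t / c" for t by (simp add: \<rho>_def b_def Hfun_def)
  have "bump e \<rho>" unfolding \<rho>_def by (rule hbump_imp_bump[OF e hbump_base])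
  moreover have "\<rho> (-t) = \<rho> t" for t by (simp add: \<rho>b b_def mult.commute)
  moreover have "(\<integral>\<^sup>+t. ennreal (\<rho> t) \<partial>lborel) = 1"
  proof -
    have "(\<integral>\<^sup>+t. ennreal (\<rho> t) \<partial>lborel) = (\<integral>\<^sup>+t. ennreal (1/c) * ennreal (b t) \<partial>lborel)"
      using c b0 by (intro nn_integral_cong) (simp add: \<rho>b ennreal_mult[symmetric])
    also have "\<dots> = ennreal (1/c) * I" unfolding I_def using bm by (intro nn_integral_cmult) auto
    also have "\<dots> = 1" using c by (simp add: ennreal_mult[symmetric])
    finally show ?thesis .
  qed
  ultimately show ?thesis using b0 bp c by (intro exI[of _ \<rho>]) (auto simp: \<rho>b)
qed

subsection \<open>Product kernels\<close>

text \<open>Each coordinate has its own profile: differentiation in coordinate i replaces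
  \<open>\<beta> i\<close> by its derivative, and the result must be a kernel of the same
  kind.\<close>

definition pker :: "nat \<Rightarrow> (nat \<Rightarrow> real \<Rightarrow> real) \<Rightarrow> pt \<Rightarrow> pt \<Rightarrow> real" where
  "pker n \<beta> x y = (\<Prod>i<n. \<beta> i (x i - y i))"

definition pconv :: "nat \<Rightarrow> (nat \<Rightarrow> real \<Rightarrow> real) \<Rightarrow> (pt \<Rightarrow> real) \<Rightarrow> pt \<Rightarrow> real" where
  "pconv n \<beta> F x = (\<integral>y. pker n \<beta> x y * F y \<partial>lbo n)"

lemma pker_zero:
  assumes "\<And>i. i < n \<Longrightarrow> bump e (\<beta> i)" "i < n" "e \<le> \<bar>x i - y i\<bar>"
  shows "pker n \<beta> x y = 0"
  unfolding pker_def using assms bump_zero[of e "\<beta> i"] by (intro prod_zero) auto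

lemma pker_bounded:
  assumes "\<And>i. i < n \<Longrightarrow> bump e (\<beta> i)"
  shows "\<exists>B>0. \<forall>x y. \<bar>pker n \<beta> x y\<bar> \<le> B"
proof -
  have "\<forall>i<n. \<exists>B>0. \<forall>t. \<bar>\<beta> i t\<bar> \<le> B" using assms bump_bounded by blast
  then obtain B where B: "\<And>i. i < n \<Longrightarrow> 0 < B i \<and> (\<forall>t. \<bar>\<beta> i t\<bar> \<le> B i)" by metis
  have "\<bar>pker n \<beta> x y\<bar> \<le> (\<Prod>i<n. B i)" for x y
    unfolding pker_def abs_prod using B by (intro prod_mono) auto
  moreover have "0 < (\<Prod>i<n. B i)" using B by (intro prod_pos) auto
  ultimately show ?thesis by blast
qed

lemma pker_lipschitz:
  assumes "\<And>i. i < n \<Longrightarrow> bump e (\<beta> i)"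
  shows "\<exists>L>0. \<forall>x x' y. \<bar>pker n \<beta> x y - pker n \<beta> x' y\<bar> \<le> L * (\<Sum>i<n. \<bar>x i - x' i\<bar>)"
  using assms
proof (induction n)
  case 0
  then show ?case by (intro exI[of _ 1]) (simp add: pker_def)
next
  case (Suc n)
  obtain L where L: "L > 0" "\<And>x x' y. \<bar>pker n \<beta> x y - pker n \<beta> x' y\<bar> \<le> L * (\<Sum>i<n. \<bar>x i - x' i\<bar>)"
    using Suc by force
  obtain B where B: "B > 0" "\<And>x y. \<bar>pker n \<beta> x y\<bar> \<le> B" using pker_bounded[of n e \<beta>] Suc.prems by force
  obtain L' where L': "L' > 0" "\<And>s t. \<bar>\<beta> n s - \<beta> n t\<bar> \<le> L' * \<bar>s - t\<bar>" using bump_lipschitz Suc.prems by blast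
  obtain B' where B': "B' > 0" "\<And>t. \<bar>\<beta> n t\<bar> \<le> B'" using bump_bounded Suc.prems by blast
  define M where "M = max (L * B') (B * L')"
  have "\<bar>pker (Suc n) \<beta> x y - pker (Suc n) \<beta> x' y\<bar> \<le> M * (\<Sum>i<Suc n. \<bar>x i - x' i\<bar>)" for x x' y
  proof -
    have eq: "pker (Suc n) \<beta> x y - pker (Suc n) \<beta> x' y = (pker n \<beta> x y - pker n \<beta> x' y) * \<beta> n (x n - y n)
       + pker n \<beta> x' y * (\<beta> n (x n - y n) - \<beta> n (x' n - y n))"
      by (simp add: pker_def algebra_simps)
    have "\<bar>pker (Suc n) \<beta> x y - pker (Suc n) \<beta> x' y\<bar> \<le> \<bar>pker n \<beta> x y - pker n \<beta> x' y\<bar> * \<bar>\<beta> n (x n - y n)\<bar>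
       + \<bar>pker n \<beta> x' y\<bar> * \<bar>\<beta> n (x n - y n) - \<beta> n (x' n - y n)\<bar>"
      unfolding eq abs_mult[symmetric] by (rule abs_triangle_ineq)
    also have "\<dots> \<le> (L * (\<Sum>i<n. \<bar>x i - x' i\<bar>)) * B' + B * (L' * \<bar>x n - x' n\<bar>)"
    proof (intro add_mono mult_mono)
      show "\<bar>pker n \<beta> x y - pker n \<beta> x' y\<bar> \<le> L * (\<Sum>i<n. \<bar>x i - x' i\<bar>)" by (rule L(2))
      show "\<bar>\<beta> n (x n - y n) - \<beta> n (x' n - y n)\<bar> \<le> L' * \<bar>x n - x' n\<bar>"
        using L'(2)[of "x n - y n" "x' n - y n"] by simp
      show "0 \<le> L * (\<Sum>i<n. \<bar>x i - x' i\<bar>)" using L(1) by (intro mult_nonneg_nonneg sum_nonneg) auto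
    qed (use B B' in auto)
    also have "\<dots> = (L * B') * (\<Sum>i<n. \<bar>x i - x' i\<bar>) + (B * L') * \<bar>x n - x' n\<bar>" by simp
    also have "\<dots> \<le> M * (\<Sum>i<n. \<bar>x i - x' i\<bar>) + M * \<bar>x n - x' n\<bar>"
      by (intro add_mono mult_right_mono) (auto simp: M_def sum_nonneg)
    finally show ?thesis by (simp add: algebra_simps)
  qed
  moreover have "0 < M" using L B' by (simp add: M_def less_max_iff_disj)
  ultimately show ?case by blast
qed

lemma pker_measurable:
  assumes "\<And>i. i < n \<Longrightarrow> bump e (\<beta> i)"
  shows "(\<lambda>y. pker n \<beta> x y) \<in> borel_measurable (lbo n)" "(\<lambda>x. pker n \<beta> x y) \<in> borel_measurable (lbo n)"
    "(\<lambda>z. pker n \<beta> (fst z) (snd z)) \<in> borel_measurable (lbo n \<Otimes>\<^sub>M lbo n)"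
proof -
  have b: "\<beta> i \<in> borel_measurable borel" if "i < n" for i
    using bump_continuous[OF assms[OF that]] by (rule borel_measurable_continuous_onI)
  have c: "(\<lambda>y. y i) \<in> borel_measurable (lbo n)" if "i < n" for i
    using measurable_component_singleton[of i "{..<n}" "\<lambda>_. lborel"] that by simp
  show "(\<lambda>y. pker n \<beta> x y) \<in> borel_measurable (lbo n)"
    unfolding pker_def by (intro borel_measurable_prod measurable_compose[OF _ b] borel_measurable_diff c) auto
  show "(\<lambda>x. pker n \<beta> x y) \<in> borel_measurable (lbo n)"
    unfolding pker_def by (intro borel_measurable_prod measurable_compose[OF _ b] borel_measurable_diff c) auto
  show "(\<lambda>z. pker n \<beta> (fst z) (snd z)) \<in> borel_measurable (lbo n \<Otimes>\<^sub>M lbo n)"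
    unfolding pker_def 
    by (intro borel_measurable_prod measurable_compose[OF _ b] borel_measurable_diff measurable_compose[OF measurable_fst c] measurable_compose[OF measurable_snd c]) auto
qed

lemma pker_integrable:
  assumes "\<And>i. i < n \<Longrightarrow> bump e (\<beta> i)" "integrable (lbo n) F"
  shows "integrable (lbo n) (\<lambda>y. pker n \<beta> x y * F y)"
proof -
  obtain B where B: "B > 0" "\<And>x y. \<bar>pker n \<beta> x y\<bar> \<le> B" using pker_bounded[of n e \<beta>] assms by blast
  show ?thesis
  proof (rule Bochner_Integration.integrable_bound)
    show "integrable (lbo n) (\<lambda>y. B * F y)" using assms(2) by simp
    show "(\<lambda>y. pker n \<beta> x y * F y) \<in> borel_measurable (lbo n)"
      using assms pker_measurable(1)[where \<beta>=\<beta> and e=e] by (intro borel_measurable_times) auto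
    show "AE y in lbo n. norm (pker n \<beta> x y * F y) \<le> norm (B * F y)"
      using B by (auto simp: abs_mult intro!: mult_right_mono)
  qed
qed

lemma pker_upd:
  assumes "i < n"
  shows "pker n \<beta> (x(i := t)) y = \<beta> i (t - y i) * (\<Prod>j\<in>{..<n} - {i}. \<beta> j (x j - y j))"
  unfolding pker_def using assms by (subst prod.remove[of _ i]) (auto intro!: prod.cong)

lemma pker_taylor:
  assumes b: "\<And>i. i < n \<Longrightarrow> bump e (\<beta> i)" and i: "i < n"
    and d: "\<And>t. (\<beta> i has_real_derivative \<beta>' t) (at t)" "bump e \<beta>'"
  shows "\<exists>L>0. \<forall>x y t h. \<bar>pker n \<beta> (x(i := t + h)) y - pker n \<beta> (x(i := t)) y - h * pker n (\<beta>(i := \<beta>')) (x(i := t)) y\<bar> \<le> L * h\<^sup>2"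
proof -
  obtain L where L: "L > 0" "\<And>t h. \<bar>\<beta> i (t + h) - \<beta> i t - h * \<beta>' t\<bar> \<le> L * h\<^sup>2"
    using bump_taylor[OF d] by blast
  have "\<forall>i<n. \<exists>B>0. \<forall>t. \<bar>\<beta> i t\<bar> \<le> B" using b bump_bounded by blast
  then obtain B where B: "\<And>i. i < n \<Longrightarrow> 0 < B i \<and> (\<forall>t. \<bar>\<beta> i t\<bar> \<le> B i)" by metis
  define P where "P = (\<Prod>j\<in>{..<n} - {i}. B j)"
  have P: "0 < P" unfolding P_def using B by (intro prod_pos) auto
  have "\<bar>pker n \<beta> (x(i := t + h)) y - pker n \<beta> (x(i := t)) y - h * pker n (\<beta>(i := \<beta>')) (x(i := t)) y\<bar> \<le> (L * P) * h\<^sup>2" for x y t h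
  proof -
    define q where "q = (\<Prod>j\<in>{..<n} - {i}. \<beta> j (x j - y j))"
    have q: "\<bar>q\<bar> \<le> P" unfolding q_def P_def abs_prod using B by (intro prod_mono) auto
    have "(\<Prod>j\<in>{..<n} - {i}. (\<beta>(i := \<beta>')) j (x j - y j)) = q" unfolding q_def by (intro prod.cong) auto
    then have eq: "pker n \<beta> (x(i := t + h)) y - pker n \<beta> (x(i := t)) y - h * pker n (\<beta>(i := \<beta>')) (x(i := t)) y
      = (\<beta> i ((t - y i) + h) - \<beta> i (t - y i) - h * \<beta>' (t - y i)) * q"
      unfolding pker_upd[OF i] q_def by (simp add: algebra_simps)
    have "\<bar>pker n \<beta> (x(i := t + h)) y - pker n \<beta> (x(i := t)) y - h * pker n (\<beta>(i := \<beta>')) (x(i := t)) y\<bar> \<le> (L * h\<^sup>2) * P"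
      unfolding eq abs_mult using L(2)[of "t - y i" h] q L(1) by (intro mult_mono) auto
    then show ?thesis by (simp add: mult_ac)
  qed
  then show ?thesis using L P by (intro exI[of _ "L * P"]) auto
qed

lemma quadratic_remainder_has_derivative:
  fixes f :: "real \<Rightarrow> real"
  assumes "\<And>h. \<bar>f (t + h) - f t - h * D\<bar> \<le> L * h\<^sup>2"
  shows "(f has_real_derivative D) (at t)"
proof -
  have "((\<lambda>h. (f (t + h) - f t) / h - D) \<longlongrightarrow> 0) (at 0)"
  proof (rule Lim_null_comparison[where g="\<lambda>h. L * \<bar>h\<bar>"])
    have "norm ((f (t + h) - f t) / h - D) \<le> L * \<bar>h\<bar>" if "h \<noteq> 0" for h
    proof -
      have "norm ((f (t + h) - f t) / h - D) = \<bar>f (t + h) - f t - h * D\<bar> / \<bar>h\<bar>"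
        using that by (simp add: abs_divide[symmetric] diff_divide_distrib)
      also have "\<dots> \<le> (L * h\<^sup>2) / \<bar>h\<bar>" using assms by (intro divide_right_mono) auto
      also have "\<dots> = L * \<bar>h\<bar>" using that by (simp add: power2_eq_square abs_if)
      finally show ?thesis .
    qed
    then show "eventually (\<lambda>h. norm ((f (t + h) - f t) / h - D) \<le> L * \<bar>h\<bar>) (at 0)"
      by (auto simp: eventually_at_filter)
    show "((\<lambda>h. L * \<bar>h\<bar>) \<longlongrightarrow> 0) (at 0)" by (auto intro!: tendsto_eq_intros)
  qed
  then show ?thesis by (simp add: DERIV_def LIM_zero_iff)
qed

lemma pker_has_derivative:
  assumes "\<And>i. i < n \<Longrightarrow> bump e (\<beta> i)" "i < n"
    "\<And>t. (\<beta> i has_real_derivative \<beta>' t) (at t)" "bump e \<beta>'"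
  shows "((\<lambda>t. pker n \<beta> (x(i := t)) y) has_real_derivative pker n (\<beta>(i := \<beta>')) (x(i := t)) y) (at t)"
  using pker_taylor[where \<beta>=\<beta> and \<beta>'=\<beta>' and e=e, OF assms] by (metis quadratic_remainder_has_derivative[where f="\<lambda>t. pker n \<beta> (x(i := t)) y"])

text \<open>The quadratic remainder of the kernel is uniform in y. Integrating it against |F| gives
  a quadratic remainder for the convolution.\<close>

lemma pconv_has_derivative:
  assumes b: "\<And>i. i < n \<Longrightarrow> bump e (\<beta> i)" and i: "i < n"
    and d: "\<And>t. (\<beta> i has_real_derivative \<beta>' t) (at t)" "bump e \<beta>'" and F: "integrable (lbo n) F"
  shows "((\<lambda>t. pconv n \<beta> F (x(i := t))) has_real_derivative pconv n (\<beta>(i := \<beta>')) F (x(i := t))) (at t)"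
proof -
  obtain L where L: "L > 0" "\<And>x y t h. \<bar>pker n \<beta> (x(i := t + h)) y - pker n \<beta> (x(i := t)) y - h * pker n (\<beta>(i := \<beta>')) (x(i := t)) y\<bar> \<le> L * h\<^sup>2"
    using pker_taylor[where \<beta>=\<beta> and \<beta>'=\<beta>' and e=e, OF b i d] by metis
  have b': "\<And>j. j < n \<Longrightarrow> bump e ((\<beta>(i := \<beta>')) j)" using b d by auto
  note int = pker_integrable[where \<beta>=\<beta>, OF b F] pker_integrable[where \<beta>="\<beta>(i := \<beta>')", OF b' F]
  have "\<bar>pconv n \<beta> F (x(i := t + h)) - pconv n \<beta> F (x(i := t)) - h * pconv n (\<beta>(i := \<beta>')) F (x(i := t))\<bar>
     \<le> (L * (\<integral>y. \<bar>F y\<bar> \<partial>lbo n)) * h\<^sup>2" for h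
  proof -
    have eq: "pconv n \<beta> F (x(i := t + h)) - pconv n \<beta> F (x(i := t)) - h * pconv n (\<beta>(i := \<beta>')) F (x(i := t))
      = (\<integral>y. (pker n \<beta> (x(i := t + h)) y - pker n \<beta> (x(i := t)) y - h * pker n (\<beta>(i := \<beta>')) (x(i := t)) y) * F y \<partial>lbo n)"
      unfolding pconv_def using int by (simp add: left_diff_distrib mult.assoc)
    have "\<bar>pconv n \<beta> F (x(i := t + h)) - pconv n \<beta> F (x(i := t)) - h * pconv n (\<beta>(i := \<beta>')) F (x(i := t))\<bar>
      \<le> (\<integral>y. (L * h\<^sup>2) * \<bar>F y\<bar> \<partial>lbo n)" unfolding eq
    proof (rule order_trans[OF integral_abs_bound integral_mono])
      show "integrable (lbo n) (\<lambda>y. \<bar>(pker n \<beta> (x(i := t + h)) y - pker n \<beta> (x(i := t)) y - h * pker n (\<beta>(i := \<beta>')) (x(i := t)) y) * F y\<bar>)"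
        using int by (simp add: left_diff_distrib mult.assoc)
      show "integrable (lbo n) (\<lambda>y. (L * h\<^sup>2) * \<bar>F y\<bar>)" using F by simp
    qed (auto simp: abs_mult intro!: mult_right_mono L)
    then show ?thesis by (simp add: mult_ac)
  qed
  then show ?thesis by (rule quadratic_remainder_has_derivative)
qed

lemma lipschitz_cont_on:
  assumes "A \<subseteq> pts n" "\<And>x x'. \<bar>f x - f x'\<bar> \<le> L * (\<Sum>i<n. \<bar>x i - x' i\<bar>)"
  shows "cont_on n A f"
  unfolding cont_on_iff[OF assms(1)]
proof (intro ballI allI impI)
  fix x and e :: real assume "0 < e"
  define d where "d = e / (\<bar>L\<bar> * real n + 1)"
  have p: "0 < \<bar>L\<bar> * real n + 1" by (intro add_nonneg_pos) auto
  then have d: "0 < d" "\<bar>L\<bar> * real n * d < e" using \<open>0 < e\<close> by (auto simp: d_def field_simps)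
  have "\<bar>f y - f x\<bar> < e" if "y \<in> A \<inter> obox n x d" for y
  proof -
    have "(\<Sum>i<n. \<bar>y i - x i\<bar>) \<le> (\<Sum>i<n. d)" using that by (intro sum_mono) (auto simp: obox_def less_imp_le)
    then have "\<bar>L\<bar> * (\<Sum>i<n. \<bar>y i - x i\<bar>) \<le> \<bar>L\<bar> * (real n * d)" by (intro mult_left_mono) auto
    moreover have "L * (\<Sum>i<n. \<bar>y i - x i\<bar>) \<le> \<bar>L\<bar> * (\<Sum>i<n. \<bar>y i - x i\<bar>)" by (intro mult_right_mono) (auto simp: sum_nonneg)
    ultimately show ?thesis using assms(2)[of y x] d by (simp add: mult.assoc)
  qed
  then show "\<exists>d>0. \<forall>y\<in>A \<inter> obox n x d. \<bar>f y - f x\<bar> < e" using d by blast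
qed

lemma pconv_cont_on:
  assumes "\<And>i. i < n \<Longrightarrow> bump e (\<beta> i)" "integrable (lbo n) F" "A \<subseteq> pts n"
  shows "cont_on n A (pconv n \<beta> F)"
proof -
  obtain L where L: "L > 0" "\<And>x x' y. \<bar>pker n \<beta> x y - pker n \<beta> x' y\<bar> \<le> L * (\<Sum>i<n. \<bar>x i - x' i\<bar>)"
    using pker_lipschitz[of n e \<beta>] assms(1) by blast
  note int = pker_integrable[where \<beta>=\<beta>, OF assms(1,2)]
  have "\<bar>pconv n \<beta> F x - pconv n \<beta> F x'\<bar> \<le> (L * (\<integral>y. \<bar>F y\<bar> \<partial>lbo n)) * (\<Sum>i<n. \<bar>x i - x' i\<bar>)" for x x'
  proof -
    have eq: "pconv n \<beta> F x - pconv n \<beta> F x' = (\<integral>y. (pker n \<beta> x y - pker n \<beta> x' y) * F y \<partial>lbo n)"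
      unfolding pconv_def using int by (simp add: left_diff_distrib)
    have "\<bar>pconv n \<beta> F x - pconv n \<beta> F x'\<bar> \<le> (\<integral>y. (L * (\<Sum>i<n. \<bar>x i - x' i\<bar>)) * \<bar>F y\<bar> \<partial>lbo n)" unfolding eq
    proof (rule order_trans[OF integral_abs_bound integral_mono])
      show "integrable (lbo n) (\<lambda>y. \<bar>(pker n \<beta> x y - pker n \<beta> x' y) * F y\<bar>)"
        using int by (simp add: left_diff_distrib)
      show "integrable (lbo n) (\<lambda>y. (L * (\<Sum>i<n. \<bar>x i - x' i\<bar>)) * \<bar>F y\<bar>)" using assms(2) by simp
    qed (auto simp: abs_mult intro!: mult_right_mono L)
    then show ?thesis by (simp add: mult_ac)
  qed
  then show ?thesis by (rule lipschitz_cont_on[OF assms(3)])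
qed

lemma pker_cont_on:
  assumes "\<And>i. i < n \<Longrightarrow> bump e (\<beta> i)" "A \<subseteq> pts n"
  shows "cont_on n A (\<lambda>x. pker n \<beta> x y)"
  using pker_lipschitz[of n e \<beta>] assms(1) lipschitz_cont_on[OF assms(2), of "\<lambda>x. pker n \<beta> x y"] by metis

lemma pconv_partial:
  assumes "\<And>i. i < n \<Longrightarrow> bump e (\<beta> i)" "i < n"
    "\<And>t. (\<beta> i has_real_derivative \<beta>' t) (at t)" "bump e \<beta>'" "integrable (lbo n) F"
  shows "partial i (pconv n \<beta> F) = pconv n (\<beta>(i := \<beta>')) F"
proof
  fix x show "partial i (pconv n \<beta> F) x = pconv n (\<beta>(i := \<beta>')) F x"
    unfolding partial_def using DERIV_imp_deriv[OF pconv_has_derivative[where \<beta>=\<beta> and \<beta>'=\<beta>' and e=e, OF assms, of x "x i"]] by simp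
qed

lemma pker_partial:
  assumes "\<And>i. i < n \<Longrightarrow> bump e (\<beta> i)" "i < n"
    "\<And>t. (\<beta> i has_real_derivative \<beta>' t) (at t)" "bump e \<beta>'"
  shows "partial i (\<lambda>x. pker n \<beta> x y) = (\<lambda>x. pker n (\<beta>(i := \<beta>')) x y)"
proof
  fix x show "partial i (\<lambda>x. pker n \<beta> x y) x = pker n (\<beta>(i := \<beta>')) x y"
    unfolding partial_def using DERIV_imp_deriv[OF pker_has_derivative[where \<beta>=\<beta> and \<beta>'=\<beta>' and e=e, OF assms, of x y "x i"]] by simp
qed

text \<open>The induction ranges over all profiles at once, since a partial derivative of a
  convolution is a convolution with a modified profile.\<close>

lemma pconv_Ck:
  assumes "\<And>i. i < n \<Longrightarrow> bump e (\<beta> i)" "integrable (lbo n) F" "A \<subseteq> pts n"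
  shows "Ck n A k (pconv n \<beta> F)"
  using assms(1)
proof (induction k arbitrary: \<beta>)
  case 0
  then show ?case using pconv_cont_on[where \<beta>=\<beta> and e=e, OF _ assms(2,3)] by simp
next
  case (Suc k)
  have "(\<forall>x\<in>A. (\<lambda>t. pconv n \<beta> F (x(i := t))) differentiable (at (x i))) \<and> Ck n A k (partial i (pconv n \<beta> F))" if "i < n" for i
  proof -
    obtain \<beta>' where b': "bump e \<beta>'" "\<And>t. (\<beta> i has_real_derivative \<beta>' t) (at t)"
      using bump_derivative Suc.prems \<open>i < n\<close> by blast
    have "Ck n A k (partial i (pconv n \<beta> F))"
      unfolding pconv_partial[where \<beta>=\<beta> and \<beta>'=\<beta>' and e=e, OF Suc.prems that b'(2,1) assms(2), simplified] by (rule Suc.IH) (use Suc.prems b' in auto)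
    then show ?thesis
      using pconv_has_derivative[where \<beta>=\<beta> and \<beta>'=\<beta>' and e=e, OF Suc.prems that b'(2,1) assms(2)] real_differentiable_def by blast
  qed
  then show ?case using pconv_cont_on[where \<beta>=\<beta> and e=e, OF Suc.prems assms(2,3)] by simp
qed

lemma pker_Ck:
  assumes "\<And>i. i < n \<Longrightarrow> bump e (\<beta> i)" "A \<subseteq> pts n"
  shows "Ck n A k (\<lambda>x. pker n \<beta> x y)"
  using assms(1)
proof (induction k arbitrary: \<beta>)
  case 0
  then show ?case using pker_cont_on[where \<beta>=\<beta> and e=e, OF _ assms(2)] by simp
next
  case (Suc k)
  have "(\<forall>x\<in>A. (\<lambda>t. pker n \<beta> (x(i := t)) y) differentiable (at (x i))) \<and> Ck n A k (partial i (\<lambda>x. pker n \<beta> x y))" if "i < n" for i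
  proof -
    obtain \<beta>' where b': "bump e \<beta>'" "\<And>t. (\<beta> i has_real_derivative \<beta>' t) (at t)"
      using bump_derivative Suc.prems \<open>i < n\<close> by blast
    have "Ck n A k (partial i (\<lambda>x. pker n \<beta> x y))"
      unfolding pker_partial[where \<beta>=\<beta> and \<beta>'=\<beta>' and e=e, OF Suc.prems that b'(2,1), simplified] by (rule Suc.IH) (use Suc.prems b' in auto)
    then show ?thesis
      using pker_has_derivative[where \<beta>=\<beta> and \<beta>'=\<beta>' and e=e, OF Suc.prems that b'(2,1)] real_differentiable_def by blast
  qed
  then show ?case using pker_cont_on[where \<beta>=\<beta> and e=e, OF Suc.prems assms(2)] by simp
qed

lemma Cc_infI:
  assumes "\<Omega> \<subseteq> pts n" "\<And>k. Ck n \<Omega> k f" "compactin (Rn n) K" "K \<subseteq> \<Omega>" "\<And>x. x \<in> \<Omega> \<Longrightarrow> f x \<noteq> 0 \<Longrightarrow> x \<in> K"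
  shows "f \<in> Cc_inf n \<Omega>"
proof -
  have "{x \<in> \<Omega>. f x \<noteq> 0} \<subseteq> pts n" using subsetD[OF assms(1)] by (intro subsetI) simp
  then have "cinside n {x \<in> \<Omega>. f x \<noteq> 0} \<Omega>"
    unfolding cinside_iff[OF \<open>{x \<in> \<Omega>. f x \<noteq> 0} \<subseteq> pts n\<close>] using assms(3-5) by (intro exI[of _ K]) force
  moreover have "cont_on n \<Omega> f" using assms(2)[of 0] by simp
  ultimately show ?thesis using assms(2) unfolding Cc_inf_def Cc_def by simp
qed

lemma pconv_support:
  assumes "\<And>i. i < n \<Longrightarrow> bump e (\<beta> i)" "\<And>y. y \<notin> K \<Longrightarrow> F y = 0" "pconv n \<beta> F x \<noteq> 0" "x \<in> pts n"
  shows "\<exists>y\<in>K. x \<in> clbox n y e"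
proof (rule ccontr)
  assume a: "\<not> (\<exists>y\<in>K. x \<in> clbox n y e)"
  have "pker n \<beta> x y * F y = 0" for y
  proof (cases "y \<in> K")
    case True
    then obtain i where "i < n" "e < \<bar>x i - y i\<bar>" using a assms(4) unfolding clbox_def by force
    then show ?thesis using pker_zero[of n e \<beta> i x y] assms(1) by simp
  qed (simp add: assms(2))
  then have "(\<lambda>y. pker n \<beta> x y * F y) = (\<lambda>_. 0)" by (rule ext)
  then show False using assms(3) unfolding pconv_def by simp
qed

lemma pconv_Cc_inf:
  assumes "\<And>i. i < n \<Longrightarrow> bump e (\<beta> i)" "integrable (lbo n) F" "\<And>y. y \<notin> K \<Longrightarrow> F y = 0"
    "\<And>y. y \<in> K \<Longrightarrow> clbox n y e \<subseteq> K'" "compactin (Rn n) K'" "K' \<subseteq> \<Omega>" "\<Omega> \<subseteq> pts n"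
  shows "pconv n \<beta> F \<in> Cc_inf n \<Omega>"
proof (rule Cc_infI[OF assms(7) _ assms(5,6)])
  show "Ck n \<Omega> k (pconv n \<beta> F)" for k using pconv_Ck[where \<beta>=\<beta> and e=e, OF assms(1,2,7)] .
  fix x assume "x \<in> \<Omega>" "pconv n \<beta> F x \<noteq> 0"
  then obtain y where "y \<in> K" "x \<in> clbox n y e"
    using pconv_support[where \<beta>=\<beta> and F=F and K=K and e=e and n=n and x=x, OF assms(1,3)] subsetD[OF assms(7)] by auto
  then show "x \<in> K'" using subsetD[OF assms(4)] by simp
qed

lemma pker_Cc_inf:
  assumes "\<And>i. i < n \<Longrightarrow> bump e (\<beta> i)" "clbox n y e \<subseteq> \<Omega>" "\<Omega> \<subseteq> pts n"
  shows "(\<lambda>x. pker n \<beta> x y) \<in> Cc_inf n \<Omega>"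
proof (rule Cc_infI[OF assms(3) _ compactin_clbox assms(2)])
  show "Ck n \<Omega> k (\<lambda>x. pker n \<beta> x y)" for k using pker_Ck[where \<beta>=\<beta> and e=e, OF assms(1,3)] .
  fix x assume x: "x \<in> \<Omega>" "pker n \<beta> x y \<noteq> 0"
  have "\<bar>x i - y i\<bar> \<le> e" if "i < n" for i
  proof (rule ccontr)
    assume "\<not> \<bar>x i - y i\<bar> \<le> e"
    then have "pker n \<beta> x y = 0" by (intro pker_zero[where \<beta>=\<beta>, OF assms(1) that]) auto
    then show False using x by simp
  qed
  then show "x \<in> clbox n y e" using subsetD[OF assms(3) x(1)] unfolding clbox_def by simp
qed

text \<open>Evenness makes mollification symmetric as an operator, unit mass makes it an averaging,
  and positivity inside the interval lets the same kernel act as a cut-off in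
  \<open>fundamental_lemma\<close>.\<close>

definition moll :: "real \<Rightarrow> real \<Rightarrow> real" where
  "moll e = (SOME \<rho>. bump e \<rho> \<and> (\<forall>t. \<rho> (- t) = \<rho> t) \<and> (\<forall>t. 0 \<le> \<rho> t) \<and> (\<forall>t. \<bar>t\<bar> < e \<longrightarrow> 0 < \<rho> t) \<and>
     (\<integral>\<^sup>+t. ennreal (\<rho> t) \<partial>lborel) = 1)"

lemma moll:
  assumes "0 < e"
  shows "bump e (moll e)" "moll e (- t) = moll e t" "0 \<le> moll e t" "\<bar>t\<bar> < e \<Longrightarrow> 0 < moll e t"
    "(\<integral>\<^sup>+t. ennreal (moll e t) \<partial>lborel) = 1"
  using someI_ex[OF mollifier_exists[OF assms]] unfolding moll_def by auto

abbreviation mk :: "nat \<Rightarrow> real \<Rightarrow> pt \<Rightarrow> pt \<Rightarrow> real" where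
  "mk n e \<equiv> pker n (\<lambda>_. moll e)"

lemma mk_nonneg: "0 < e \<Longrightarrow> 0 \<le> mk n e x y" unfolding pker_def by (intro prod_nonneg) (auto simp: moll)

lemma mk_sym: "0 < e \<Longrightarrow> mk n e x y = mk n e y x"
  unfolding pker_def by (intro prod.cong refl) (metis moll(2) minus_diff_eq)

lemma mk_measurable [measurable]:
  assumes "0 < e"
  shows "mk n e x \<in> borel_measurable (lbo n)" "(\<lambda>x. mk n e x y) \<in> borel_measurable (lbo n)"
    "(\<lambda>z. mk n e (fst z) (snd z)) \<in> borel_measurable (lbo n \<Otimes>\<^sub>M lbo n)"
  using pker_measurable[of n e "\<lambda>_. moll e"] moll(1)[OF assms] by auto

lemma nn_integral_mk:
  assumes "0 < e"
  shows "(\<integral>\<^sup>+x. ennreal (mk n e x y) \<partial>lbo n) = 1" "(\<integral>\<^sup>+y. ennreal (mk n e x y) \<partial>lbo n) = 1"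
proof -
  interpret product_sigma_finite "\<lambda>_::nat. lborel::real measure" ..
  have m: "moll e \<in> borel_measurable borel"
    using bump_continuous[OF moll(1)[OF assms]] by (rule borel_measurable_continuous_onI)
  have 1: "(\<integral>\<^sup>+x. ennreal (mk n e x y) \<partial>lbo n) = 1" for y
  proof -
    have "(\<integral>\<^sup>+x. ennreal (mk n e x y) \<partial>lbo n) = (\<integral>\<^sup>+x. (\<Prod>i<n. ennreal (moll e (x i - y i))) \<partial>lbo n)"
      unfolding pker_def by (intro nn_integral_cong) (simp add: prod_ennreal moll(3)[OF assms])
    also have "\<dots> = (\<Prod>i<n. \<integral>\<^sup>+t. ennreal (moll e (t - y i)) \<partial>lborel)"
      using m by (intro product_nn_integral_prod) auto
    also have "\<dots> = (\<Prod>i<n. 1)"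
    proof (intro prod.cong refl)
      fix i
      show "(\<integral>\<^sup>+t. ennreal (moll e (t - y i)) \<partial>lborel) = 1"
        using nn_integral_real_affine[of "\<lambda>t. ennreal (moll e t)" 1 "- y i"] m moll(5)[OF assms]
        by simp
    qed
    finally show ?thesis by simp
  qed
  show "(\<integral>\<^sup>+x. ennreal (mk n e x y) \<partial>lbo n) = 1" by (rule 1)
  show "(\<integral>\<^sup>+y. ennreal (mk n e x y) \<partial>lbo n) = 1" using 1[of x] by (simp add: mk_sym[OF assms, of n x])
qed

subsection \<open>Convergence of mollifications\<close>

lemma sigma_finite_lbo: "sigma_finite_measure (lbo n)"
proof -
  interpret product_sigma_finite "\<lambda>_::nat. lborel::real measure" ..
  interpret finite_product_sigma_finite "\<lambda>_::nat. lborel::real measure" "{..<n}" by standard simp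
  show ?thesis by (rule sigma_finite_measure_axioms)
qed

abbreviation mconv :: "nat \<Rightarrow> real \<Rightarrow> (pt \<Rightarrow> real) \<Rightarrow> pt \<Rightarrow> real" where
  "mconv n e \<equiv> pconv n (\<lambda>_. moll e)"

lemma nn_integral_mk_fst:
  assumes e: "0 < e" and \<phi>: "\<phi> \<in> borel_measurable (lbo n)"
  shows "(\<integral>\<^sup>+z. ennreal (mk n e (fst z) (snd z)) * \<phi> (fst z) \<partial>(lbo n \<Otimes>\<^sub>M lbo n)) = (\<integral>\<^sup>+x. \<phi> x \<partial>lbo n)"
    "(\<integral>\<^sup>+z. ennreal (mk n e (fst z) (snd z)) * \<phi> (snd z) \<partial>(lbo n \<Otimes>\<^sub>M lbo n)) = (\<integral>\<^sup>+x. \<phi> x \<partial>lbo n)"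
proof -
  interpret sigma_finite_measure "lbo n" by (rule sigma_finite_lbo)
  interpret P: pair_sigma_finite "lbo n" "lbo n" ..
  note [measurable] = \<phi> mk_measurable[OF e]
  have "(\<integral>\<^sup>+z. ennreal (mk n e (fst z) (snd z)) * \<phi> (fst z) \<partial>(lbo n \<Otimes>\<^sub>M lbo n)) =
    (\<integral>\<^sup>+x. \<integral>\<^sup>+y. ennreal (mk n e x y) * \<phi> x \<partial>lbo n \<partial>lbo n)"
    by (subst nn_integral_fst[symmetric]) simp_all
  also have "\<dots> = (\<integral>\<^sup>+x. \<phi> x \<partial>lbo n)"
    by (intro nn_integral_cong) (simp add: nn_integral_multc nn_integral_mk[OF e])
  finally show "(\<integral>\<^sup>+z. ennreal (mk n e (fst z) (snd z)) * \<phi> (fst z) \<partial>(lbo n \<Otimes>\<^sub>M lbo n)) = (\<integral>\<^sup>+x. \<phi> x \<partial>lbo n)" .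
  have "(\<integral>\<^sup>+z. ennreal (mk n e (fst z) (snd z)) * \<phi> (snd z) \<partial>(lbo n \<Otimes>\<^sub>M lbo n)) =
    (\<integral>\<^sup>+y. \<integral>\<^sup>+x. ennreal (mk n e x y) * \<phi> y \<partial>lbo n \<partial>lbo n)"
    by (subst P.nn_integral_snd[symmetric]) simp_all
  also have "\<dots> = (\<integral>\<^sup>+x. \<phi> x \<partial>lbo n)"
    by (intro nn_integral_cong) (simp add: nn_integral_multc nn_integral_mk[OF e])
  finally show "(\<integral>\<^sup>+z. ennreal (mk n e (fst z) (snd z)) * \<phi> (snd z) \<partial>(lbo n \<Otimes>\<^sub>M lbo n)) = (\<integral>\<^sup>+x. \<phi> x \<partial>lbo n)" .
qed

text \<open>The kernel has unit mass in each variable separately, so a majorant split as \<phi>(x) +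
  \<psi>(y) makes the double integral absolutely convergent with a bound independent of e. Fubini's
  theorem and the symmetry of the kernel then move the mollifier to the other factor. Fed with
  Young's inequality for products, this takes the place of L^p bounds for convolutions.\<close>

lemma mconv_pairing:
  assumes e: "0 < e" and A: "A \<in> borel_measurable (lbo n)" and F: "F \<in> borel_measurable (lbo n)"
    and \<phi>: "integrable (lbo n) \<phi>" "\<And>x. 0 \<le> \<phi> x" and \<psi>: "integrable (lbo n) \<psi>" "\<And>x. 0 \<le> \<psi> x"
    and bd: "\<And>x y. x \<in> pts n \<Longrightarrow> y \<in> pts n \<Longrightarrow> \<bar>A x * F y\<bar> \<le> \<phi> x + \<psi> y"
  shows "(\<integral>x. A x * mconv n e F x \<partial>lbo n) = (\<integral>y. F y * mconv n e A y \<partial>lbo n)"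
    "\<bar>\<integral>x. A x * mconv n e F x \<partial>lbo n\<bar> \<le> (\<integral>x. \<phi> x \<partial>lbo n) + (\<integral>x. \<psi> x \<partial>lbo n)"
proof -
  interpret sigma_finite_measure "lbo n" by (rule sigma_finite_lbo)
  interpret P: pair_sigma_finite "lbo n" "lbo n" ..
  note [measurable] = A F mk_measurable[OF e] borel_measurable_integrable[OF \<phi>(1)] borel_measurable_integrable[OF \<psi>(1)]
  define f where "f = (\<lambda>x y. A x * (mk n e x y * F y))"
  have meas: "case_prod f \<in> borel_measurable (lbo n \<Otimes>\<^sub>M lbo n)" unfolding f_def case_prod_beta by measurable
  define S where "S = (\<integral>\<^sup>+z. ennreal (norm (case_prod f z)) \<partial>(lbo n \<Otimes>\<^sub>M lbo n))"
  have "S \<le> (\<integral>\<^sup>+z. ennreal (mk n e (fst z) (snd z)) * ennreal (\<phi> (fst z))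
     + ennreal (mk n e (fst z) (snd z)) * ennreal (\<psi> (snd z)) \<partial>(lbo n \<Otimes>\<^sub>M lbo n))"
    unfolding S_def
  proof (rule nn_integral_mono)
    fix z assume "z \<in> space (lbo n \<Otimes>\<^sub>M lbo n)"
    then obtain x y where z: "z = (x, y)" "x \<in> pts n" "y \<in> pts n" by (cases z) (simp add: space_pair_measure space_lbo)
    have "norm (case_prod f z) = mk n e x y * \<bar>A x * F y\<bar>"
      using mk_nonneg[OF e, of n x y] by (simp add: z f_def abs_mult)
    also have "\<dots> \<le> mk n e x y * (\<phi> x + \<psi> y)" using bd[OF z(2,3)] mk_nonneg[OF e, of n x y] by (intro mult_left_mono) auto
    finally have "ennreal (norm (case_prod f z)) \<le> ennreal (mk n e x y * (\<phi> x + \<psi> y))" by (rule ennreal_leI)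
    also have "\<dots> = ennreal (mk n e x y) * ennreal (\<phi> x) + ennreal (mk n e x y) * ennreal (\<psi> y)"
      using mk_nonneg[OF e, of n x y] \<phi>(2) \<psi>(2) by (simp add: ennreal_mult distrib_left)
    finally show "ennreal (norm (case_prod f z)) \<le> ennreal (mk n e (fst z) (snd z)) * ennreal (\<phi> (fst z))
     + ennreal (mk n e (fst z) (snd z)) * ennreal (\<psi> (snd z))" by (simp add: z)
  qed
  also have "\<dots> = (\<integral>\<^sup>+x. ennreal (\<phi> x) \<partial>lbo n) + (\<integral>\<^sup>+x. ennreal (\<psi> x) \<partial>lbo n)"
    by (subst nn_integral_add) (simp_all add: nn_integral_mk_fst(1)[OF e, of "\<lambda>x. ennreal (\<phi> x)"] nn_integral_mk_fst(2)[OF e, of "\<lambda>x. ennreal (\<psi> x)"])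
  also have "\<dots> = ennreal ((\<integral>x. \<phi> x \<partial>lbo n) + (\<integral>x. \<psi> x \<partial>lbo n))"
    using \<phi> \<psi> by (simp add: nn_integral_eq_integral)
  finally have S: "S \<le> ennreal ((\<integral>x. \<phi> x \<partial>lbo n) + (\<integral>x. \<psi> x \<partial>lbo n))" .
  then have int: "integrable (lbo n \<Otimes>\<^sub>M lbo n) (case_prod f)"
    unfolding integrable_iff_bounded S_def[symmetric] using meas le_less_trans[OF S] by (intro conjI) auto
  have e1: "(\<integral>y. f x y \<partial>lbo n) = A x * mconv n e F x" for x unfolding f_def pconv_def by simp
  have e2: "(\<integral>x. f x y \<partial>lbo n) = F y * mconv n e A y" for y
  proof -
    have "(\<lambda>x. f x y) = (\<lambda>x. F y * (mk n e y x * A x))" unfolding f_def by (rule ext) (simp add: mk_sym[OF e, of n y])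
    then show ?thesis unfolding pconv_def by simp
  qed
  show "(\<integral>x. A x * mconv n e F x \<partial>lbo n) = (\<integral>y. F y * mconv n e A y \<partial>lbo n)"
    using P.Fubini_integral[OF int] by (simp only: e1 e2)
  have eq: "(\<integral>x. A x * mconv n e F x \<partial>lbo n) = integral\<^sup>L (lbo n \<Otimes>\<^sub>M lbo n) (case_prod f)"
    using P.integral_fst[OF int] by (simp only: e1)
  show "\<bar>\<integral>x. A x * mconv n e F x \<partial>lbo n\<bar> \<le> (\<integral>x. \<phi> x \<partial>lbo n) + (\<integral>x. \<psi> x \<partial>lbo n)" unfolding eq
  proof -
    have nn: "0 \<le> (\<integral>x. \<phi> x \<partial>lbo n) + (\<integral>x. \<psi> x \<partial>lbo n)" using \<phi> \<psi> by (intro add_nonneg_nonneg integral_nonneg) auto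
    have b: "ennreal (norm (integral\<^sup>L (lbo n \<Otimes>\<^sub>M lbo n) (case_prod f))) \<le> S"
      unfolding S_def by (rule integral_norm_bound_ennreal[OF int])
    show "\<bar>integral\<^sup>L (lbo n \<Otimes>\<^sub>M lbo n) (case_prod f)\<bar> \<le> (\<integral>x. \<phi> x \<partial>lbo n) + (\<integral>x. \<psi> x \<partial>lbo n)"
      using order_trans[OF b S] unfolding ennreal_le_iff[OF nn] real_norm_def .
  qed
qed

text \<open>Continuity at one point only: the functions paired later are cut off by the indicator of
  a compact set, so they may jump at its boundary but not where the other factor lives.\<close>

definition cont_at :: "nat \<Rightarrow> (pt \<Rightarrow> real) \<Rightarrow> pt \<Rightarrow> bool" where
  "cont_at n f y \<longleftrightarrow> (\<forall>e>0. \<exists>d>0. \<forall>x\<in>obox n y d. \<bar>f x - f y\<bar> < e)"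

lemma mk_integrable: "0 < e \<Longrightarrow> integrable (lbo n) (mk n e y)" "0 < e \<Longrightarrow> (\<integral>x. mk n e y x \<partial>lbo n) = 1"
proof -
  assume e: "0 < e"
  have i: "(\<integral>\<^sup>+x. ennreal (mk n e y x) \<partial>lbo n) = 1" by (rule nn_integral_mk(2)[OF e])
  show "integrable (lbo n) (mk n e y)"
    by (rule integrableI_nonneg) (use i mk_nonneg[OF e] mk_measurable(1)[OF e] in auto)
  show "(\<integral>x. mk n e y x \<partial>lbo n) = 1"
    by (subst integral_eq_nn_integral) (use i mk_nonneg[OF e] mk_measurable(1)[OF e] in auto)
qed

lemma mk_bounded_integrable:
  assumes e: "0 < e" and A: "A \<in> borel_measurable (lbo n)" "\<And>x. x \<in> pts n \<Longrightarrow> \<bar>A x\<bar> \<le> B"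
  shows "integrable (lbo n) (\<lambda>x. mk n e y x * A x)"
proof (rule Bochner_Integration.integrable_bound)
  show "integrable (lbo n) (\<lambda>x. B * mk n e y x)" using mk_integrable(1)[OF e] by simp
  show "(\<lambda>x. mk n e y x * A x) \<in> borel_measurable (lbo n)" using A mk_measurable(1)[OF e] by measurable
  show "AE x in lbo n. norm (mk n e y x * A x) \<le> norm (B * mk n e y x)"
  proof (rule AE_I2)
    fix x assume "x \<in> space (lbo n)"
    then have "\<bar>A x\<bar> \<le> \<bar>B\<bar>" using A(2)[of x] by (simp add: space_lbo)
    then show "norm (mk n e y x * A x) \<le> norm (B * mk n e y x)"
      by (simp add: abs_mult mult.commute[of "\<bar>mk n e y x\<bar>"] mult_right_mono)
  qed
qed

lemma mconv_close:
  assumes e: "0 < e" and A: "A \<in> borel_measurable (lbo n)" "\<And>x. x \<in> pts n \<Longrightarrow> \<bar>A x\<bar> \<le> B"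
    and d: "0 \<le> d" "\<And>x. x \<in> obox n y e \<Longrightarrow> \<bar>A x - c\<bar> \<le> d"
  shows "\<bar>mconv n e A y - c\<bar> \<le> d"
proof -
  note i1 = mk_bounded_integrable[OF e A, of y] and i2 = mk_integrable(1)[OF e, of n y]
  have eq: "mconv n e A y - c = (\<integral>x. mk n e y x * (A x - c) \<partial>lbo n)"
    unfolding pconv_def using i1 i2 by (simp add: right_diff_distrib mk_integrable(2)[OF e])
  have "\<bar>mconv n e A y - c\<bar> \<le> (\<integral>x. d * mk n e y x \<partial>lbo n)" unfolding eq
  proof (rule order_trans[OF integral_abs_bound integral_mono])
    show "integrable (lbo n) (\<lambda>x. \<bar>mk n e y x * (A x - c)\<bar>)" using i1 i2 by (simp add: right_diff_distrib)
    show "integrable (lbo n) (\<lambda>x. d * mk n e y x)" using i2 by simp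
    fix x assume x: "x \<in> space (lbo n)"
    show "\<bar>mk n e y x * (A x - c)\<bar> \<le> d * mk n e y x"
    proof (cases "x \<in> obox n y e")
      case True
      then have "mk n e y x * \<bar>A x - c\<bar> \<le> mk n e y x * d" using d(2) mk_nonneg[OF e] by (intro mult_left_mono) auto
      then show ?thesis using mk_nonneg[OF e, of n y x] by (simp add: abs_mult mult.commute)
    next
      case False
      then obtain i where "i < n" "e \<le> \<bar>x i - y i\<bar>" using x by (auto simp: obox_def space_lbo not_less)
      then have "mk n e y x = 0"
        by (intro pker_zero[where \<beta>="\<lambda>_. moll e" and e=e, OF moll(1)[OF e]]) (auto simp: abs_minus_commute)
      then show ?thesis by simp
    qed
  qed
  then show ?thesis by (simp add: mk_integrable(2)[OF e])
qed

definition eps :: "nat \<Rightarrow> real" where "eps k = 1 / (real k + 1)"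

lemma eps_pos: "0 < eps k" by (simp add: eps_def)
lemma eps_tendsto: "eps \<longlonglongrightarrow> 0"
  unfolding eps_def by real_asymp
lemma eventually_eps_less: "0 < d \<Longrightarrow> eventually (\<lambda>k. eps k < d) sequentially"
  using eps_tendsto order_tendstoD(2) by blast

lemma mconv_tendsto:
  assumes A: "A \<in> borel_measurable (lbo n)" "\<And>x. x \<in> pts n \<Longrightarrow> \<bar>A x\<bar> \<le> B" and c: "cont_at n A y"
  shows "(\<lambda>k. mconv n (eps k) A y) \<longlonglongrightarrow> A y"
proof (rule tendstoI)
  fix r :: real assume "0 < r"
  then obtain d where d: "d > 0" "\<And>x. x \<in> obox n y d \<Longrightarrow> \<bar>A x - A y\<bar> < r/2"
    using c unfolding cont_at_def by (meson half_gt_zero)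
  show "eventually (\<lambda>k. dist (mconv n (eps k) A y) (A y) < r) sequentially"
    using eventually_eps_less[OF d(1)]
  proof eventually_elim
    case (elim k)
    have "\<bar>mconv n (eps k) A y - A y\<bar> \<le> r/2"
    proof (rule mconv_close[OF eps_pos A])
      fix x assume "x \<in> obox n y (eps k)"
      then have "x \<in> obox n y d" using obox_mono[of "eps k" d n y] elim by (meson less_imp_le subsetD)
      then show "\<bar>A x - A y\<bar> \<le> r/2" using d(2) by (simp add: less_imp_le)
    qed (use \<open>0 < r\<close> in auto)
    then show ?case using \<open>0 < r\<close> by (simp add: dist_real_def)
  qed
qed

lemma mconv_bounded:
  assumes e: "0 < e" and A: "A \<in> borel_measurable (lbo n)" "\<And>x. x \<in> pts n \<Longrightarrow> \<bar>A x\<bar> \<le> B" "0 \<le> B"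
  shows "\<bar>mconv n e A y\<bar> \<le> B"
proof -
  have "\<bar>mconv n e A y - 0\<bar> \<le> B"
  proof (rule mconv_close[OF e A(1,2) A(3)])
    fix x assume "x \<in> obox n y e"
    then have "x \<in> pts n" by (simp add: obox_def)
    then show "\<bar>A x - 0\<bar> \<le> B" using A(2)[of x] by simp
  qed
  then show ?thesis by simp
qed

lemma mconv_measurable:
  assumes e: "0 < e" and A: "A \<in> borel_measurable (lbo n)"
  shows "mconv n e A \<in> borel_measurable (lbo n)"
proof -
  interpret sigma_finite_measure "lbo n" by (rule sigma_finite_lbo)
  note [measurable] = A mk_measurable[OF e]
  have "(\<lambda>(x,y). mk n e x y * A y) \<in> borel_measurable (lbo n \<Otimes>\<^sub>M lbo n)" unfolding case_prod_beta by measurable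
  then show ?thesis unfolding pconv_def by (rule borel_measurable_lebesgue_integral)
qed

text \<open>F is merely integrable, so its mollifications need not converge pointwise. Moved onto A,
  the mollifier converges at every point where F is nonzero, and B |F| dominates.\<close>

lemma mconv_pairing_tendsto_bounded:
  assumes A: "A \<in> borel_measurable (lbo n)" "\<And>x. x \<in> pts n \<Longrightarrow> \<bar>A x\<bar> \<le> B" "0 \<le> B"
    and F: "integrable (lbo n) F" and c: "\<And>y. y \<in> pts n \<Longrightarrow> F y \<noteq> 0 \<Longrightarrow> cont_at n A y"
  shows "(\<lambda>k. \<integral>x. A x * mconv n (eps k) F x \<partial>lbo n) \<longlonglongrightarrow> (\<integral>x. A x * F x \<partial>lbo n)"
proof -
  have sw: "(\<integral>x. A x * mconv n (eps k) F x \<partial>lbo n) = (\<integral>y. F y * mconv n (eps k) A y \<partial>lbo n)" for k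
  proof (rule mconv_pairing(1)[OF eps_pos A(1) borel_measurable_integrable[OF F], where \<phi>="\<lambda>_. 0" and \<psi>="\<lambda>y. B * \<bar>F y\<bar>"])
    show "\<bar>A x * F y\<bar> \<le> 0 + B * \<bar>F y\<bar>" if "x \<in> pts n" for x y
      using A(2)[OF that] by (simp add: abs_mult mult_right_mono)
  qed (use F A in auto)
  have "(\<lambda>k. \<integral>y. F y * mconv n (eps k) A y \<partial>lbo n) \<longlonglongrightarrow> (\<integral>y. F y * A y \<partial>lbo n)"
  proof (rule integral_dominated_convergence[where w="\<lambda>y. B * \<bar>F y\<bar>"])
    show "(\<lambda>y. F y * A y) \<in> borel_measurable (lbo n)" "(\<lambda>y. F y * mconv n (eps k) A y) \<in> borel_measurable (lbo n)" for k
      using F A(1) mconv_measurable[OF eps_pos A(1)] by auto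
    show "integrable (lbo n) (\<lambda>y. B * \<bar>F y\<bar>)" using F by simp
    show "AE y in lbo n. (\<lambda>k. F y * mconv n (eps k) A y) \<longlonglongrightarrow> F y * A y"
    proof (rule AE_I2)
      fix y assume "y \<in> space (lbo n)"
      then have y: "y \<in> pts n" by (simp add: space_lbo)
      show "(\<lambda>k. F y * mconv n (eps k) A y) \<longlonglongrightarrow> F y * A y"
      proof (cases "F y = 0")
        case False
        then show ?thesis using mconv_tendsto[OF A(1,2) c[OF y]] by (intro tendsto_mult tendsto_const) auto
      qed simp
    qed
    show "AE y in lbo n. norm (F y * mconv n (eps k) A y) \<le> B * \<bar>F y\<bar>" for k
    proof (rule AE_I2)
      fix y
      have "\<bar>mconv n (eps k) A y\<bar> * \<bar>F y\<bar> \<le> B * \<bar>F y\<bar>" by (intro mult_right_mono mconv_bounded[OF eps_pos A]) auto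
      then show "norm (F y * mconv n (eps k) A y) \<le> B * \<bar>F y\<bar>" by (simp add: abs_mult mult.commute)
    qed
  qed
  then show ?thesis by (simp add: sw mult.commute)
qed

subsection \<open>Density of continuous functions\<close>

definition approximable :: "nat \<Rightarrow> (pt \<Rightarrow> real) \<Rightarrow> bool" where
  "approximable n F \<longleftrightarrow> (\<forall>e>0. \<exists>g B. cont_on n (pts n) g \<and> (\<forall>x. \<bar>g x\<bar> \<le> B) \<and> integrable (lbo n) g \<and>
     (\<integral>x. \<bar>F x - g x\<bar> \<partial>lbo n) < e)"

lemma approximable_closure:
  assumes F: "integrable (lbo n) F"
    and "\<And>e. 0 < e \<Longrightarrow> \<exists>F'. approximable n F' \<and> integrable (lbo n) F' \<and> (\<integral>x. \<bar>F x - F' x\<bar> \<partial>lbo n) < e"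
  shows "approximable n F"
  unfolding approximable_def
proof (intro allI impI)
  fix e :: real assume "0 < e"
  then obtain F' where F': "approximable n F'" "integrable (lbo n) F'" "(\<integral>x. \<bar>F x - F' x\<bar> \<partial>lbo n) < e/2"
    using assms(2)[of "e/2"] by auto
  obtain g B where g: "cont_on n (pts n) g" "\<forall>x. \<bar>g x\<bar> \<le> B" "integrable (lbo n) g" "(\<integral>x. \<bar>F' x - g x\<bar> \<partial>lbo n) < e/2"
    using F'(1) \<open>0 < e\<close> unfolding approximable_def by (meson half_gt_zero)
  have "(\<integral>x. \<bar>F x - g x\<bar> \<partial>lbo n) \<le> (\<integral>x. \<bar>F x - F' x\<bar> + \<bar>F' x - g x\<bar> \<partial>lbo n)"
    using F F' g by (intro integral_mono) auto
  also have "\<dots> = (\<integral>x. \<bar>F x - F' x\<bar> \<partial>lbo n) + (\<integral>x. \<bar>F' x - g x\<bar> \<partial>lbo n)"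
    using F F' g by (intro Bochner_Integration.integral_add) auto
  also have "\<dots> < e" using F' g by linarith
  finally show "\<exists>g B. cont_on n (pts n) g \<and> (\<forall>x. \<bar>g x\<bar> \<le> B) \<and> integrable (lbo n) g \<and> (\<integral>x. \<bar>F x - g x\<bar> \<partial>lbo n) < e"
    using g by blast
qed

lemma approximable_lim:
  assumes s: "\<And>k. approximable n (s k)" "\<And>k. integrable (lbo n) (s k)" and F: "F \<in> borel_measurable (lbo n)"
    and lim: "\<And>x. x \<in> pts n \<Longrightarrow> (\<lambda>k. s k x) \<longlonglongrightarrow> F x"
    and w: "integrable (lbo n) w" "\<And>k x. x \<in> pts n \<Longrightarrow> \<bar>s k x\<bar> \<le> w x"
  shows "approximable n F"
proof -
  have Fw: "\<bar>F x\<bar> \<le> w x" if "x \<in> pts n" for x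
    using tendsto_upperbound[OF tendsto_rabs[OF lim[OF that]]] w(2)[OF that] by simp
  have iF: "integrable (lbo n) F"
    by (rule Bochner_Integration.integrable_bound[OF w(1) F]) (use Fw in \<open>force simp: space_lbo\<close>)
  have "(\<lambda>k. \<integral>x. \<bar>F x - s k x\<bar> \<partial>lbo n) \<longlonglongrightarrow> (\<integral>x. 0 \<partial>lbo n)"
  proof (rule integral_dominated_convergence[where w="\<lambda>x. 2 * w x"])
    show "AE x in lbo n. (\<lambda>k. \<bar>F x - s k x\<bar>) \<longlonglongrightarrow> 0"
    proof (rule AE_I2)
      fix x assume "x \<in> space (lbo n)"
      then have "(\<lambda>k. F x - s k x) \<longlonglongrightarrow> F x - F x" using lim by (intro tendsto_intros) (simp add: space_lbo)
      then show "(\<lambda>k. \<bar>F x - s k x\<bar>) \<longlonglongrightarrow> 0" by (simp add: tendsto_rabs_zero)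
    qed
    show "AE x in lbo n. norm \<bar>F x - s k x\<bar> \<le> 2 * w x" for k
    proof (rule AE_I2)
      fix x assume "x \<in> space (lbo n)"
      then show "norm \<bar>F x - s k x\<bar> \<le> 2 * w x" using Fw[of x] w(2)[of x k] by (simp add: space_lbo)
    qed
  qed (use F s(2) w(1) in auto)
  then have l: "(\<lambda>k. \<integral>x. \<bar>F x - s k x\<bar> \<partial>lbo n) \<longlonglongrightarrow> 0" by simp
  show ?thesis
  proof (rule approximable_closure[OF iF])
    fix e :: real assume "0 < e"
    then have "eventually (\<lambda>k. (\<integral>x. \<bar>F x - s k x\<bar> \<partial>lbo n) < e) sequentially" using order_tendstoD(2)[OF l] by blast
    then obtain k where "(\<integral>x. \<bar>F x - s k x\<bar> \<partial>lbo n) < e" by (auto simp: eventually_sequentially)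
    then show "\<exists>F'. approximable n F' \<and> integrable (lbo n) F' \<and> (\<integral>x. \<bar>F x - F' x\<bar> \<partial>lbo n) < e" using s by blast
  qed
qed

definition cutoff :: "nat \<Rightarrow> real \<Rightarrow> pt \<Rightarrow> real" where
  "cutoff n m x = (\<Prod>i<n. max 0 (min 1 (m + 1 - \<bar>x i\<bar>)))"

abbreviation origin :: "nat \<Rightarrow> pt" where "origin n \<equiv> (\<lambda>i\<in>{..<n}. 0)"

lemma cutoff_range: "0 \<le> cutoff n m x" "cutoff n m x \<le> 1"
  unfolding cutoff_def by (auto intro!: prod_nonneg prod_le_1)

lemma cutoff_one: "x \<in> clbox n (origin n) m \<Longrightarrow> cutoff n m x = 1"
  unfolding cutoff_def clbox_def by (intro prod.neutral) auto

lemma cutoff_zero: "x \<in> pts n \<Longrightarrow> x \<notin> clbox n (origin n) (m + 1) \<Longrightarrow> cutoff n m x = 0"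
proof -
  assume "x \<in> pts n" "x \<notin> clbox n (origin n) (m + 1)"
  then obtain i where i: "i < n" "m + 1 < \<bar>x i\<bar>" unfolding clbox_def by (auto simp: not_le)
  have "\<exists>i\<in>{..<n}. max 0 (min 1 (m + 1 - \<bar>x i\<bar>)) = 0" by (rule bexI[of _ i]) (use i in auto)
  then show "cutoff n m x = 0" unfolding cutoff_def by (intro prod_zero) auto
qed

lemma cutoff_cont: "cont_on n (pts n) (cutoff n m)"
  unfolding cutoff_def cont_on_def
  by (intro continuous_map_prod continuous_map_real_max continuous_map_real_min continuous_map_diff continuous_map_real_abs
      continuous_map_from_subtopology continuous_map_product_projection) (auto intro: continuous_map_from_subtopology)

text \<open>Points of \<open>pts n\<close> have all further coordinates frozen at
  \<open>undefined\<close>, so the inclusion into the full function type is continuous. This gives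
  access to the distance function and to the regularity of finite Borel measures on that
  type.\<close>

lemma pts_embedding: "continuous_map (Rn n) (euclidean :: pt topology) (\<lambda>x. x)"
proof -
  have "continuous_map (Rn n) euclideanreal (\<lambda>x. x k)" for k
  proof (cases "k < n")
    case True then show ?thesis by (intro continuous_map_product_projection) simp
  next
    case False
    show ?thesis by (rule continuous_map_eq[of _ _ "\<lambda>_. undefined"]) (use False in \<open>auto simp: PiE_def extensional_def\<close>)
  qed
  then show ?thesis unfolding euclidean_product_topology[symmetric] continuous_map_componentwise_UNIV by blast
qed

lemma continuous_on_imp_cont_on:
  fixes g :: "pt \<Rightarrow> real" assumes "continuous_on UNIV g" shows "cont_on n (pts n) g"
  using continuous_map_compose[OF pts_embedding, of euclideanreal g n] assms
  unfolding cont_on_def by (intro continuous_map_from_subtopology) (simp add: o_def)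

lemma cont_on_pts_measurable: "cont_on n (pts n) g \<Longrightarrow> g \<in> borel_measurable (lbo n)"
proof -
  assume g: "cont_on n (pts n) g"
  have "openin (Rn n) (pts n)" using openin_topspace[of "Rn n"] unfolding topspace_Rn .
  from cont_on_borel_measurable[OF this g]
  show ?thesis by (rule measurable_cong[THEN iffD1, rotated]) (simp add: space_PiM)
qed

lemma approximable_cont:
  assumes "cont_on n (pts n) g" "\<And>x. \<bar>g x\<bar> \<le> B" "integrable (lbo n) g"
  shows "approximable n g"
  unfolding approximable_def
proof (intro allI impI exI conjI)
  fix e :: real assume "0 < e" then show "(\<integral>x. \<bar>g x - g x\<bar> \<partial>lbo n) < e" by simp
qed (use assms in auto)

text \<open>min(1, k dist(x, -U)) converges to the indicator of U, and the cut-off supplies an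
  integrable majorant.\<close>

lemma approximable_open:
  fixes U :: "pt set" assumes U: "open U"
  shows "approximable n (\<lambda>x. indicator U x * cutoff n m x)"
proof -
  \<comment> \<open>\<open>infdist\<close> to the empty set is 0, so U = UNIV needs a value of its
    own.\<close>
  define h where "h = (\<lambda>k::nat. \<lambda>x. if U = UNIV then 1 else min 1 (real k * infdist x (- U)))"
  have hc: "continuous_on UNIV (h k)" for k unfolding h_def by (cases "U = UNIV") (auto intro!: continuous_intros continuous_on_min)
  have h01: "0 \<le> h k x" "h k x \<le> 1" for k x by (auto simp: h_def infdist_nonneg)
  have hl: "(\<lambda>k. h k x) \<longlonglongrightarrow> indicator U x" for x
  proof (cases "x \<in> U \<and> U \<noteq> UNIV")
    case True
    then have pos: "0 < infdist x (- U)" using U by (intro infdist_pos_not_in_closed) auto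
    have "eventually (\<lambda>k. h k x = 1) sequentially"
    proof -
      obtain N :: nat where N: "1 / infdist x (- U) \<le> real N" using real_arch_simple by blast
      have "h k x = 1" if "k \<ge> N" for k
      proof -
        have "1 / infdist x (- U) \<le> real k" using N that by (meson of_nat_mono order_trans)
        then have "1 \<le> real k * infdist x (- U)" using pos by (simp add: field_simps)
        then show ?thesis by (simp add: h_def)
      qed
      then show ?thesis by (auto simp: eventually_sequentially)
    qed
    then show ?thesis using True by (simp add: tendsto_eventually)
  next
    case False
    show ?thesis
    proof (cases "U = UNIV")
      case True then show ?thesis by (simp add: h_def)
    next
      case F: False
      then have "x \<notin> U" using False by blast
      then have "infdist x (- U) = 0" by simp
      then show ?thesis using F \<open>x \<notin> U\<close> by (simp add: h_def)
    qed
  qed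
  define w :: "pt \<Rightarrow> real" where "w = indicator (clbox n (origin n) (m + 1))"
  have w: "integrable (lbo n) w" unfolding w_def using emeasure_clbox_finite sets_clbox by (intro integrable_real_indicator) auto
  have c: "cont_on n (pts n) (\<lambda>x. h k x * cutoff n m x)" for k
    by (intro cont_on_mult cutoff_cont continuous_on_imp_cont_on hc)
  have hw: "\<bar>h k x * cutoff n m x\<bar> \<le> w x" if "x \<in> pts n" for k x
  proof (cases "x \<in> clbox n (origin n) (m + 1)")
    case True
    then show ?thesis using mult_le_one[OF h01(2)[of k x] cutoff_range] h01(1)[of k x] cutoff_range(1)[of n m x] by (simp add: w_def)
  next
    case False then show ?thesis using cutoff_zero[OF that False] by (simp add: w_def)
  qed
  have i: "integrable (lbo n) (\<lambda>x. h k x * cutoff n m x)" for k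
  proof (rule Bochner_Integration.integrable_bound[OF w])
    show "(\<lambda>x. h k x * cutoff n m x) \<in> borel_measurable (lbo n)" by (rule cont_on_pts_measurable[OF c])
    show "AE x in lbo n. norm (h k x * cutoff n m x) \<le> norm (w x)"
    proof (rule AE_I2)
      fix x assume "x \<in> space (lbo n)"
      then show "norm (h k x * cutoff n m x) \<le> norm (w x)" using hw[of x k] by (simp add: space_lbo)
    qed
  qed
  have t: "(\<lambda>k. h k x * cutoff n m x) \<longlonglongrightarrow> indicator U x * cutoff n m x" for x by (intro tendsto_mult hl tendsto_const)
  show ?thesis
  proof (rule approximable_lim[where s="\<lambda>k x. h k x * cutoff n m x", OF _ i _ t w hw])
    show "approximable n (\<lambda>x. h k x * cutoff n m x)" for k
    proof (rule approximable_cont[OF c _ i])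
      fix x show "\<bar>h k x * cutoff n m x\<bar> \<le> 1" using mult_le_one[OF h01(2)[of k x] cutoff_range] h01(1)[of k x] cutoff_range(1)[of n m x] by simp
    qed
    show "(\<lambda>x. indicator U x * cutoff n m x) \<in> borel_measurable (lbo n)"
      by (rule borel_measurable_LIMSEQ_real[OF t]) (rule cont_on_pts_measurable[OF c])
  qed
qed

lemma lbo_borel: "(\<lambda>x. x) \<in> measurable (lbo n) (borel :: pt measure)"
proof (rule measurable_coordinatewise_then_product)
  fix i
  show "(\<lambda>x. x i) \<in> borel_measurable (lbo n)"
  proof (cases "i < n")
    case True then show ?thesis using measurable_component_singleton[of i "{..<n}" "\<lambda>_. lborel"] by simp
  next
    case False
    have "(\<lambda>x. undefined) \<in> borel_measurable (lbo n)" by simp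
    then show ?thesis by (rule measurable_cong[THEN iffD1, rotated]) (use False in \<open>auto simp: space_PiM PiE_def extensional_def\<close>)
  qed
qed

text \<open>Outer regularity of a finite Borel measure on the full function type provides an open
  set exceeding A by little, which reduces the claim to \<open>approximable_open\<close>.\<close>

lemma approximable_bounded_set:
  assumes A: "A \<in> sets (lbo n)" "A \<subseteq> clbox n (origin n) m"
  shows "approximable n (indicator A)"
proof (rule approximable_closure)
  let ?X = "clbox n (origin n) (m + 1)"
  show "integrable (lbo n) (indicator A :: pt \<Rightarrow> real)"
    using emeasure_mono[OF A(2) sets_clbox] emeasure_clbox_finite A(1) by (intro integrable_real_indicator) (auto intro: le_less_trans)
  fix e :: real assume e: "0 < e"
  have rm: "(\<lambda>x. restrict x {..<n}) \<in> measurable (borel :: pt measure) (lbo n)"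
    by (intro measurable_restrict) (simp add: measurable_product_coordinates)
  then have B: "(\<lambda>x. restrict x {..<n}) -` A \<in> sets borel" using measurable_sets[OF rm A(1)] by simp
  \<comment> \<open>Extends A to the full type by ignoring the coordinates from n on; on
    \<open>pts n\<close> it agrees with A.\<close>
  define B where "B = (\<lambda>x::pt. restrict x {..<n}) -` A"
  have Bp: "x \<in> B \<longleftrightarrow> x \<in> A" if "x \<in> pts n" for x
  proof -
    have "restrict x {..<n} = x" using that by (simp add: PiE_restrict)
    then show ?thesis by (simp add: B_def)
  qed
  \<comment> \<open>The measure is confined to a box, hence finite as regularity requires. The box
    has radius m + 1 because the cut-off vanishes outside it.\<close>
  define \<nu> where "\<nu> = distr (density (lbo n) (indicator ?X)) borel (\<lambda>x. x)"
  have \<nu>: "emeasure \<nu> S = emeasure (lbo n) (S \<inter> ?X)" if "S \<in> sets borel" for S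
  proof -
    have m: "(\<lambda>x. x) \<in> measurable (density (lbo n) (indicator ?X)) borel" using lbo_borel by simp
    have "emeasure \<nu> S = emeasure (density (lbo n) (indicator ?X)) (S \<inter> pts n)"
      unfolding \<nu>_def emeasure_distr[OF m that] by (simp add: space_PiM)
    also have "\<dots> = emeasure (lbo n) (?X \<inter> (S \<inter> pts n))"
      using measurable_sets[OF lbo_borel that] sets_clbox by (intro emeasure_restricted) (auto simp: space_PiM)
    also have "?X \<inter> (S \<inter> pts n) = S \<inter> ?X" using clbox_subset_pts by fast
    finally show ?thesis .
  qed
  have fin: "emeasure \<nu> S < \<infinity>" if "S \<in> sets borel" for S
    using \<nu>[OF that] emeasure_mono[OF _ sets_clbox, of "S \<inter> ?X" n] emeasure_clbox_finite by (metis Int_lower2 le_less_trans)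
  have \<nu>s: "sets \<nu> = sets borel" by (simp add: \<nu>_def)
  have spB: "B \<in> sets borel" using B by (simp add: B_def)
  have "emeasure \<nu> B = (INF U \<in> {U. B \<subseteq> U \<and> open U}. emeasure \<nu> U)"
    using fin[of UNIV] spB by (intro outer_regular \<nu>s) (auto simp: \<nu>_def)
  moreover have "emeasure \<nu> B < emeasure \<nu> B + ennreal e" using fin[OF spB] e by (simp add: ennreal_add_left_cancel_less)
  ultimately obtain U where U: "B \<subseteq> U" "open U" "emeasure \<nu> U < emeasure \<nu> B + ennreal e"
    by (metis (mono_tags, lifting) INF_less_iff mem_Collect_eq)
  have oU: "U \<in> sets borel" using U by simp
  have "emeasure \<nu> (U - B) = emeasure \<nu> U - emeasure \<nu> B"
    using fin[OF spB] spB oU U(1) by (intro emeasure_Diff) (auto simp: \<nu>s)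
  also have "\<dots> < ennreal e"
  proof -
    obtain u where u: "0 \<le> u" "emeasure \<nu> U = ennreal u" using fin[OF oU] by (cases "emeasure \<nu> U") auto
    obtain b where b: "0 \<le> b" "emeasure \<nu> B = ennreal b" using fin[OF spB] by (cases "emeasure \<nu> B") auto
    have "ennreal u < ennreal (b + e)" using U(3) u b e by (simp add: ennreal_plus[symmetric] del: ennreal_plus)
    then have "u < b + e" using u by (simp add: ennreal_less_iff)
    then show ?thesis unfolding u(2) b(2) ennreal_minus[OF b(1)] using e by (intro ennreal_lessI) auto
  qed
  finally have d: "emeasure (lbo n) ((U - B) \<inter> ?X) < ennreal e" using \<nu>[of "U - B"] spB oU by simp
  have mD: "(U - B) \<inter> ?X \<in> sets (lbo n)"
  proof -
    have "(U - B) \<inter> pts n \<in> sets (lbo n)" using measurable_sets[OF lbo_borel, of "U - B"] spB oU by (simp add: space_PiM)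
    then have "(U - B) \<inter> pts n \<inter> ?X \<in> sets (lbo n)" by (rule sets.Int) (rule sets_clbox)
    moreover have "(U - B) \<inter> pts n \<inter> ?X = (U - B) \<inter> ?X" using clbox_subset_pts by fast
    ultimately show ?thesis by simp
  qed
  let ?F = "\<lambda>x. indicator U x * cutoff n m x"
  have bd: "\<bar>indicator A x - ?F x\<bar> \<le> indicator ((U - B) \<inter> ?X) x" if x: "x \<in> pts n" for x
  proof (cases "x \<in> A")
    case True
    then have "x \<in> U" "cutoff n m x = 1" using U(1) Bp[OF x] A(2) cutoff_one by auto
    then show ?thesis using True by simp
  next
    case False
    then have "x \<notin> B" using Bp[OF x] by simp
    then show ?thesis using False cutoff_range[of n m x] cutoff_zero[OF x, of m] by (auto simp: indicator_def)
  qed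
  have wi: "integrable (lbo n) (indicator ((U - B) \<inter> ?X) :: pt \<Rightarrow> real)"
    using mD d by (intro integrable_real_indicator) (auto intro: less_trans)
  have Fm: "?F \<in> borel_measurable (lbo n)"
  proof (intro borel_measurable_times borel_measurable_indicator')
    show "cutoff n m \<in> borel_measurable (lbo n)" by (rule cont_on_pts_measurable[OF cutoff_cont])
    have "{x \<in> space (lbo n). x \<in> U} = (\<lambda>x. x) -` U \<inter> space (lbo n)" by auto
    then show "{x \<in> space (lbo n). x \<in> U} \<in> sets (lbo n)" using measurable_sets[OF lbo_borel oU, of n] by (simp only:)
  qed
  have Am: "(indicator A :: pt \<Rightarrow> real) \<in> borel_measurable (lbo n)" using A by simp
  have "integrable (lbo n) (\<lambda>x. indicator A x - ?F x)"
    by (rule Bochner_Integration.integrable_bound[OF wi]) (use Am Fm bd in \<open>auto simp: space_lbo\<close>)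
  note iD = this
  have iA: "integrable (lbo n) (indicator A :: pt \<Rightarrow> real)" by fact
  have "integrable (lbo n) (\<lambda>x. indicator A x - (indicator A x - ?F x))"
    by (rule Bochner_Integration.integrable_diff[OF iA iD])
  then have iF: "integrable (lbo n) ?F" by simp
  have "(\<integral>x. \<bar>indicator A x - ?F x\<bar> \<partial>lbo n) \<le> (\<integral>x. indicator ((U - B) \<inter> ?X) x \<partial>lbo n)"
    using iA iF wi bd by (intro integral_mono) (auto simp: space_lbo)
  also have "\<dots> = measure (lbo n) ((U - B) \<inter> ?X)" using mD sets.sets_into_space[OF mD] by (simp add: Int_absorb2)
  also have "\<dots> < e" using d e by (simp add: measure_def enn2real_less_iff less_trans[OF d ennreal_less_top])
  finally show "\<exists>F'. approximable n F' \<and> integrable (lbo n) F' \<and> (\<integral>x. \<bar>indicator A x - F' x\<bar> \<partial>lbo n) < e"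
    using approximable_open[OF U(2)] iF by blast
qed

text \<open>Induction over integrable functions. A set of finite measure is exhausted by its
  intersections with growing boxes, to which \<open>approximable_bounded_set\<close>
  applies.\<close>

lemma approximable_integrable:
  assumes "integrable (lbo n) F" shows "approximable n F"
  using assms
proof (induction rule: integrable_induct)
  case (base A c)
  have lim: "(\<lambda>k. indicator (A \<inter> clbox n (origin n) (real k)) x) \<longlonglongrightarrow> (indicator A x :: real)" if x: "x \<in> pts n" for x
  proof (rule tendsto_eventually)
    obtain R where R: "\<And>i. i < n \<Longrightarrow> \<bar>x i\<bar> \<le> R"
    proof
      show "\<bar>x i\<bar> \<le> (\<Sum>i<n. \<bar>x i\<bar>)" if "i < n" for i using that by (intro member_le_sum) auto
    qed
    obtain N :: nat where N: "R \<le> real N" using real_arch_simple by blast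
    have "x \<in> clbox n (origin n) (real k)" if "N \<le> k" for k
    proof -
      have "R \<le> real k" using N that by (meson of_nat_mono order_trans)
      then have "\<bar>x i - origin n i\<bar> \<le> real k" if "i < n" for i using R[OF that] that by simp
      then show ?thesis using x unfolding clbox_def by simp
    qed
    then show "eventually (\<lambda>k. indicator (A \<inter> clbox n (origin n) (real k)) x = (indicator A x :: real)) sequentially"
      unfolding eventually_sequentially by (intro exI[of _ N]) (auto simp: indicator_def)
  qed
  have iA: "integrable (lbo n) (indicator A :: pt \<Rightarrow> real)" using base by (intro integrable_real_indicator) auto
  have s: "A \<inter> clbox n (origin n) (real k) \<in> sets (lbo n)" for k using base sets_clbox by auto
  have "approximable n (indicator A)"
  proof (rule approximable_lim[where s="\<lambda>k. indicator (A \<inter> clbox n (origin n) (real k))" and w="indicator A"])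
    show "integrable (lbo n) (indicator (A \<inter> clbox n (origin n) (real k)) :: pt \<Rightarrow> real)" for k
      by (rule Bochner_Integration.integrable_bound[OF iA]) (use s in \<open>auto simp: indicator_def\<close>)
    show "approximable n (indicator (A \<inter> clbox n (origin n) (real k)))" for k
      by (rule approximable_bounded_set[OF s]) auto
  qed (use lim iA base in \<open>auto simp: indicator_def\<close>)
  then have ap: "approximable n (indicator A)" .
  show ?case unfolding approximable_def
  proof (intro allI impI)
    fix e :: real assume e: "0 < e"
    then have e2: "0 < e / (\<bar>c\<bar> + 1)" by (intro divide_pos_pos add_nonneg_pos) auto
    obtain g B where g: "cont_on n (pts n) g" "\<forall>x. \<bar>g x\<bar> \<le> B" "integrable (lbo n) g" "(\<integral>x. \<bar>indicator A x - g x\<bar> \<partial>lbo n) < e / (\<bar>c\<bar> + 1)"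
      using ap[unfolded approximable_def, rule_format, OF e2] by blast
    show "\<exists>g B. cont_on n (pts n) g \<and> (\<forall>x. \<bar>g x\<bar> \<le> B) \<and> integrable (lbo n) g \<and> (\<integral>x. \<bar>indicator A x *\<^sub>R c - g x\<bar> \<partial>lbo n) < e"
    proof (intro exI conjI allI)
      show "cont_on n (pts n) (\<lambda>x. c * g x)" using g by (intro cont_on_mult cont_on_const)
      show "\<bar>c * g x\<bar> \<le> \<bar>c\<bar> * B" for x using g by (simp add: abs_mult mult_left_mono)
      show "integrable (lbo n) (\<lambda>x. c * g x)" using g by simp
      have "(\<integral>x. \<bar>indicator A x *\<^sub>R c - c * g x\<bar> \<partial>lbo n) = (\<integral>x. \<bar>c\<bar> * \<bar>indicator A x - g x\<bar> \<partial>lbo n)"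
      proof (intro Bochner_Integration.integral_cong refl)
        fix x
        have "indicator A x *\<^sub>R c - c * g x = c * (indicator A x - g x)" by (simp add: algebra_simps)
        then show "\<bar>indicator A x *\<^sub>R c - c * g x\<bar> = \<bar>c\<bar> * \<bar>indicator A x - g x\<bar>" by (simp only: abs_mult)
      qed
      also have "\<dots> = \<bar>c\<bar> * (\<integral>x. \<bar>indicator A x - g x\<bar> \<partial>lbo n)" by simp
      also have "\<dots> \<le> \<bar>c\<bar> * (e / (\<bar>c\<bar> + 1))" using g(4) by (intro mult_left_mono) auto
      also have "\<dots> < e" using e by (simp add: field_simps)
      finally show "(\<integral>x. \<bar>indicator A x *\<^sub>R c - c * g x\<bar> \<partial>lbo n) < e" .
    qed
  qed
next
  case (add f g)
  show ?case unfolding approximable_def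
  proof (intro allI impI)
    fix e :: real assume "0 < e"
    then have e2: "0 < e/2" by simp
    obtain f' B where f': "cont_on n (pts n) f'" "\<forall>x. \<bar>f' x\<bar> \<le> B" "integrable (lbo n) f'" "(\<integral>x. \<bar>f x - f' x\<bar> \<partial>lbo n) < e/2"
      using add e2 unfolding approximable_def by meson
    obtain g' C where g': "cont_on n (pts n) g'" "\<forall>x. \<bar>g' x\<bar> \<le> C" "integrable (lbo n) g'" "(\<integral>x. \<bar>g x - g' x\<bar> \<partial>lbo n) < e/2"
      using add e2 unfolding approximable_def by meson
    show "\<exists>h B. cont_on n (pts n) h \<and> (\<forall>x. \<bar>h x\<bar> \<le> B) \<and> integrable (lbo n) h \<and> (\<integral>x. \<bar>f x + g x - h x\<bar> \<partial>lbo n) < e"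
    proof (intro exI conjI allI)
      show "cont_on n (pts n) (\<lambda>x. f' x + g' x)" using f' g' by (intro cont_on_add)
      show "\<bar>f' x + g' x\<bar> \<le> B + C" for x using f'(2) g'(2) by (meson abs_triangle_ineq add_mono order_trans)
      show "integrable (lbo n) (\<lambda>x. f' x + g' x)" using f' g' by simp
      have "(\<integral>x. \<bar>f x + g x - (f' x + g' x)\<bar> \<partial>lbo n) \<le> (\<integral>x. \<bar>f x - f' x\<bar> + \<bar>g x - g' x\<bar> \<partial>lbo n)"
        using add f' g' by (intro integral_mono) auto
      also have "\<dots> = (\<integral>x. \<bar>f x - f' x\<bar> \<partial>lbo n) + (\<integral>x. \<bar>g x - g' x\<bar> \<partial>lbo n)"
        using add f' g' by (intro Bochner_Integration.integral_add) auto
      finally show "(\<integral>x. \<bar>f x + g x - (f' x + g' x)\<bar> \<partial>lbo n) < e" using f' g' by linarith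
    qed
  qed
next
  case (lim f s)
  show ?case
    by (rule approximable_lim[where s=s and w="\<lambda>x. 2 * \<bar>f x\<bar>"]) (use lim in \<open>auto simp: space_lbo\<close>)
qed

section \<open>Density in L^p and pairings of dual exponents\<close>

lemma abs_powr_add_le:
  fixes x y r :: real assumes "0 < r"
  shows "\<bar>x + y\<bar> powr r \<le> 2 powr r * (\<bar>x\<bar> powr r + \<bar>y\<bar> powr r)"
proof -
  have "\<bar>x + y\<bar> powr r \<le> (2 * max \<bar>x\<bar> \<bar>y\<bar>) powr r" using assms by (intro powr_mono2) auto
  also have "\<dots> = 2 powr r * max \<bar>x\<bar> \<bar>y\<bar> powr r" by (simp add: powr_mult)
  also have "\<dots> \<le> 2 powr r * (\<bar>x\<bar> powr r + \<bar>y\<bar> powr r)" by (simp add: max_def)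
  finally show ?thesis .
qed

lemma young_product:
  fixes x y p :: real assumes "1 < p"
  shows "\<bar>x * y\<bar> \<le> \<bar>x\<bar> powr (p / (p - 1)) + \<bar>y\<bar> powr p"
proof -
  have q: "1 < p / (p - 1)" using assms by (simp add: field_simps)
  have "\<bar>x\<bar> * \<bar>y\<bar> \<le> \<bar>x\<bar> powr (p / (p - 1)) / (p / (p - 1)) + \<bar>y\<bar> powr p / p"
    using assms q by (intro Youngs_inequality) (auto simp: field_simps)
  also have "\<dots> \<le> \<bar>x\<bar> powr (p / (p - 1)) + \<bar>y\<bar> powr p"
  proof (intro add_mono)
    show "\<bar>x\<bar> powr (p / (p - 1)) / (p / (p - 1)) \<le> \<bar>x\<bar> powr (p / (p - 1))"
      using divide_left_mono[of 1 "p/(p-1)" "\<bar>x\<bar> powr (p / (p - 1))"] q by simp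
    show "\<bar>y\<bar> powr p / p \<le> \<bar>y\<bar> powr p" using divide_left_mono[of 1 p "\<bar>y\<bar> powr p"] assms by simp
  qed
  finally show ?thesis by (simp add: abs_mult)
qed

definition clip :: "real \<Rightarrow> real \<Rightarrow> real" where "clip M t = max (- M) (min M t)"

lemma clip_bound: "0 \<le> M \<Longrightarrow> \<bar>clip M t\<bar> \<le> M" by (auto simp: clip_def)
lemma clip_lipschitz: "\<bar>clip M a - clip M b\<bar> \<le> \<bar>a - b\<bar>" by (auto simp: clip_def max_def min_def)
lemma clip_id: "\<bar>t\<bar> \<le> M \<Longrightarrow> clip M t = t" by (auto simp: clip_def)
lemma clip_le: "0 \<le> M \<Longrightarrow> \<bar>t - clip M t\<bar> \<le> \<bar>t\<bar>" by (auto simp: clip_def max_def min_def)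
lemma clip_continuous: "continuous_on UNIV (clip M)" unfolding clip_def by (intro continuous_intros)
lemma clip_measurable [measurable]: "clip M \<in> borel_measurable borel"
  using clip_continuous by (rule borel_measurable_continuous_onI)

text \<open>First A is truncated at a high level. Between functions bounded by M the r-th power of a
  difference is at most a constant times the difference itself, so approximation in L^1 is enough;
  clipping the approximation preserves continuity and does not increase the distance.\<close>

lemma Lp_approximation:
  assumes r: "1 \<le> r" and A: "A \<in> borel_measurable (lbo n)" "integrable (lbo n) (\<lambda>x. \<bar>A x\<bar> powr r)"
    and K: "compactin (Rn n) K" "\<And>x. x \<notin> K \<Longrightarrow> A x = 0" and e: "0 < e"
  shows "\<exists>g B. cont_on n (pts n) g \<and> (\<forall>x. \<bar>g x\<bar> \<le> B) \<and> integrable (lbo n) (\<lambda>x. \<bar>A x - g x\<bar> powr r) \<and>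
     (\<integral>x. \<bar>A x - g x\<bar> powr r \<partial>lbo n) < e"
proof -
  note [measurable] = A(1)
  define e1 where "e1 = e / (2 powr r) / 2"
  have e1: "0 < e1" using e by (simp add: e1_def)
  have "(\<lambda>k. \<integral>x. \<bar>A x - clip (real k) (A x)\<bar> powr r \<partial>lbo n) \<longlonglongrightarrow> (\<integral>x. 0 \<partial>lbo n)"
  proof (rule integral_dominated_convergence[where w="\<lambda>x. \<bar>A x\<bar> powr r"])
    show "AE x in lbo n. (\<lambda>k. \<bar>A x - clip (real k) (A x)\<bar> powr r) \<longlonglongrightarrow> 0"
    proof (rule AE_I2, rule tendsto_eventually)
      fix x
      obtain N :: nat where N: "\<bar>A x\<bar> \<le> real N" using real_arch_simple by blast
      show "eventually (\<lambda>k. \<bar>A x - clip (real k) (A x)\<bar> powr r = 0) sequentially"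
        unfolding eventually_sequentially
      proof (intro exI[of _ N] allI impI)
        fix k assume "N \<le> k"
        then have "\<bar>A x\<bar> \<le> real k" using N by (meson of_nat_mono order_trans)
        then show "\<bar>A x - clip (real k) (A x)\<bar> powr r = 0" by (simp add: clip_id)
      qed
    qed
    show "AE x in lbo n. norm (\<bar>A x - clip (real k) (A x)\<bar> powr r) \<le> \<bar>A x\<bar> powr r" for k
      using r by (intro AE_I2) (auto intro!: powr_mono2 clip_le)
  qed (use A in \<open>auto\<close>)
  then have "eventually (\<lambda>k. (\<integral>x. \<bar>A x - clip (real k) (A x)\<bar> powr r \<partial>lbo n) < e1) sequentially"
    using order_tendstoD(2)[OF _ e1] by fastforce
  then obtain k where k: "(\<integral>x. \<bar>A x - clip (real k) (A x)\<bar> powr r \<partial>lbo n) < e1" by (auto simp: eventually_sequentially)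
  define M where "M = real k"
  have M: "0 \<le> M" by (simp add: M_def)
  define H where "H = (\<lambda>x. clip M (A x))"
  have Hm [measurable]: "H \<in> borel_measurable (lbo n)" unfolding H_def by measurable
  have iH: "integrable (lbo n) H"
  proof (rule Bochner_Integration.integrable_bound)
    show "integrable (lbo n) (\<lambda>x. M * indicator K x)"
      using sets_compactin[OF K(1)] emeasure_compactin_finite[OF K(1)] by (intro integrable_mult_right integrable_real_indicator) auto
    show "AE x in lbo n. norm (H x) \<le> norm (M * indicator K x)"
    proof (rule AE_I2)
      fix x show "norm (H x) \<le> norm (M * indicator K x)"
        using K(2)[of x] M clip_bound[OF M, of "A x"] by (cases "x \<in> K") (auto simp: H_def clip_id)
    qed
  qed (rule Hm)
  \<comment> \<open>Both functions compared are bounded by M, so their difference is at most 2 M;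
    the added 1 keeps c positive when M = 0.\<close>
  define c where "c = (2 * M + 1) powr (r - 1)"
  have c: "0 < c" using M by (simp add: c_def)
  obtain g B where g: "cont_on n (pts n) g" "integrable (lbo n) g" "(\<integral>x. \<bar>H x - g x\<bar> \<partial>lbo n) < e1 / c"
    using approximable_integrable[OF iH] e1 c unfolding approximable_def by (meson divide_pos_pos)
  note [measurable] = borel_measurable_integrable[OF g(2)]
  define g' where "g' = (\<lambda>x. clip M (g x))"
  have g'm [measurable]: "g' \<in> borel_measurable (lbo n)" unfolding g'_def by measurable
  have b1: "\<bar>H x - g' x\<bar> powr r \<le> c * \<bar>H x - g x\<bar>" for x
  proof -
    have a: "\<bar>H x - g' x\<bar> \<le> \<bar>H x - g x\<bar>"
    proof -
      have "H x = clip M (H x)" unfolding H_def using clip_id[OF clip_bound[OF M, of "A x"]] by simp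
      then show ?thesis unfolding g'_def using clip_lipschitz[of M "H x" "g x"] by simp
    qed
    have "\<bar>H x - g' x\<bar> \<le> 2 * M + 1" using clip_bound[OF M, of "A x"] clip_bound[OF M, of "g x"] unfolding H_def g'_def by linarith
    then have "\<bar>H x - g' x\<bar> powr (r - 1) \<le> c" unfolding c_def using r by (intro powr_mono2) auto
    then have "\<bar>H x - g' x\<bar> powr (r - 1) * \<bar>H x - g' x\<bar> \<le> c * \<bar>H x - g x\<bar>" using a c by (intro mult_mono) auto
    moreover have "\<bar>H x - g' x\<bar> powr (r - 1) * \<bar>H x - g' x\<bar> = \<bar>H x - g' x\<bar> powr r"
      using powr_add[of "\<bar>H x - g' x\<bar>" "r - 1" 1] by simp
    ultimately show ?thesis by simp
  qed
  have i1: "integrable (lbo n) (\<lambda>x. \<bar>A x - H x\<bar> powr r)"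
    by (rule Bochner_Integration.integrable_bound[OF A(2)]) (use r in \<open>auto simp: H_def intro!: powr_mono2 clip_le M\<close>)
  have i2: "integrable (lbo n) (\<lambda>x. c * \<bar>H x - g x\<bar>)" using iH g by simp
  have b2: "\<bar>A x - g' x\<bar> powr r \<le> 2 powr r * (\<bar>A x - H x\<bar> powr r + c * \<bar>H x - g x\<bar>)" for x
  proof -
    have "\<bar>(A x - H x) + (H x - g' x)\<bar> powr r \<le> 2 powr r * (\<bar>A x - H x\<bar> powr r + \<bar>H x - g' x\<bar> powr r)"
      using r by (intro abs_powr_add_le) simp
    also have "\<dots> \<le> 2 powr r * (\<bar>A x - H x\<bar> powr r + c * \<bar>H x - g x\<bar>)" using b1[of x] by (intro mult_left_mono add_left_mono) auto
    finally show ?thesis by simp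
  qed
  have i3: "integrable (lbo n) (\<lambda>x. 2 powr r * (\<bar>A x - H x\<bar> powr r + c * \<bar>H x - g x\<bar>))" by (rule integrable_mult_right[OF Bochner_Integration.integrable_add[OF i1 i2]])
  have nn: "0 \<le> 2 powr r * (\<bar>A x - H x\<bar> powr r + c * \<bar>H x - g x\<bar>)" for x using c by simp
  have i4: "integrable (lbo n) (\<lambda>x. \<bar>A x - g' x\<bar> powr r)"
  proof (rule Bochner_Integration.integrable_bound[OF i3])
    show "AE x in lbo n. norm (\<bar>A x - g' x\<bar> powr r) \<le> norm (2 powr r * (\<bar>A x - H x\<bar> powr r + c * \<bar>H x - g x\<bar>))"
    proof (rule AE_I2)
      fix x show "norm (\<bar>A x - g' x\<bar> powr r) \<le> norm (2 powr r * (\<bar>A x - H x\<bar> powr r + c * \<bar>H x - g x\<bar>))"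
        unfolding real_norm_def abs_of_nonneg[OF nn] using b2[of x] by simp
    qed
  qed measurable
  have "(\<integral>x. \<bar>A x - g' x\<bar> powr r \<partial>lbo n) \<le> (\<integral>x. 2 powr r * (\<bar>A x - H x\<bar> powr r + c * \<bar>H x - g x\<bar>) \<partial>lbo n)"
    by (rule integral_mono[OF i4 i3 b2])
  also have "\<dots> = 2 powr r * ((\<integral>x. \<bar>A x - H x\<bar> powr r \<partial>lbo n) + c * (\<integral>x. \<bar>H x - g x\<bar> \<partial>lbo n))"
    using i1 Bochner_Integration.integrable_diff[OF iH g(2)] by (simp add: Bochner_Integration.integral_add)
  also have "\<dots> < 2 powr r * (e1 + c * (e1 / c))"
    using k g(3) c unfolding H_def[symmetric] M_def[symmetric]
    by (intro mult_strict_left_mono add_strict_mono) (auto simp: H_def)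
  also have "\<dots> = e" using c by (simp add: e1_def)
  finally have "(\<integral>x. \<bar>A x - g' x\<bar> powr r \<partial>lbo n) < e" .
  moreover have "cont_on n (pts n) g'" unfolding g'_def by (rule cont_on_compose[OF g(1) clip_continuous])
  moreover have "\<forall>x. \<bar>g' x\<bar> \<le> M" unfolding g'_def using clip_bound[OF M] by simp
  ultimately show ?thesis using i4 by blast
qed

lemma cont_on_pts_cont_at: "cont_on n (pts n) g \<Longrightarrow> y \<in> pts n \<Longrightarrow> cont_at n g y"
  unfolding cont_on_iff[OF order_refl] cont_at_def
proof (intro allI impI)
  fix e :: real
  assume a: "\<forall>x\<in>pts n. \<forall>e>0. \<exists>d>0. \<forall>y\<in>pts n \<inter> obox n x d. \<bar>g y - g x\<bar> < e" "y \<in> pts n" "0 < e"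
  then obtain d where d: "d > 0" "\<forall>z\<in>pts n \<inter> obox n y d. \<bar>g z - g y\<bar> < e" by meson
  have "\<bar>g z - g y\<bar> < e" if "z \<in> obox n y d" for z using d(2) that by (simp add: obox_def)
  then show "\<exists>d>0. \<forall>x\<in>obox n y d. \<bar>g x - g y\<bar> < e" using d(1) by blast
qed

text \<open>A is split into a bounded continuous g and an error D small in the dual space. The
  pairing of D, with or without mollification, is small uniformly in k by
  \<open>mconv_pairing\<close> and Young's inequality; the pairing of g converges by the bounded
  case.\<close>

lemma mconv_pairing_tendsto:
  assumes p: "1 < p" and A: "A \<in> borel_measurable (lbo n)" "integrable (lbo n) (\<lambda>x. \<bar>A x\<bar> powr (p / (p - 1)))"
    and F: "F \<in> borel_measurable (lbo n)" "integrable (lbo n) (\<lambda>x. \<bar>F x\<bar> powr p)"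
    and K: "compactin (Rn n) K" "\<And>x. x \<notin> K \<Longrightarrow> A x = 0" "\<And>x. x \<notin> K \<Longrightarrow> F x = 0"
  shows "(\<lambda>k. \<integral>x. A x * mconv n (eps k) F x \<partial>lbo n) \<longlonglongrightarrow> (\<integral>x. A x * F x \<partial>lbo n)"
proof (rule LIMSEQ_I)
  note [measurable] = A(1) F(1) mconv_measurable[OF eps_pos F(1)]
  define q where "q = p / (p - 1)"
  have q: "1 < q" using p by (simp add: q_def field_simps)
  fix r :: real assume r: "0 < r"
  define I where "I = (\<integral>x. \<bar>F x\<bar> powr p \<partial>lbo n)"
  have I: "0 \<le> I" unfolding I_def by (simp add: Bochner_Integration.integral_nonneg)
  \<comment> \<open>Weight in Young's inequality for (D/l)(l F). It is fixed first, so that l^p I <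
    r/5; then g is chosen with error below l^q r/5. The two occurrences of D cost 2r/5 each and the
    part with g costs r/5. Using I + 1 avoids dividing by 0.\<close>
  define l where "l = (r / (5 * (I + 1))) powr (1 / p)"
  have l: "0 < l" "l powr p = r / (5 * (I + 1))" using r I p by (auto simp: l_def powr_powr)
  have lI: "l powr p * I < r / 5"
  proof -
    have "r * I < r * (I + 1)" using r by simp
    then show ?thesis unfolding l(2) using I by (simp add: field_simps)
  qed
  have "0 < l powr q * (r / 5)" using l r by simp
  then obtain g B where g: "cont_on n (pts n) g" "\<forall>x. \<bar>g x\<bar> \<le> B" "integrable (lbo n) (\<lambda>x. \<bar>A x - g x\<bar> powr q)"
     "(\<integral>x. \<bar>A x - g x\<bar> powr q \<partial>lbo n) < l powr q * (r / 5)"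
    using Lp_approximation[OF less_imp_le[OF q] A(1) A(2)[folded q_def] K(1,2)] by blast
  have gm [measurable]: "g \<in> borel_measurable (lbo n)" by (rule cont_on_pts_measurable[OF g(1)])
  have B: "0 \<le> B" using g(2) by (meson abs_ge_zero order_trans)
  have iF: "integrable (lbo n) F"
  proof (rule Bochner_Integration.integrable_bound)
    show "integrable (lbo n) (\<lambda>x. indicator K x + \<bar>F x\<bar> powr p)"
      using sets_compactin[OF K(1)] emeasure_compactin_finite[OF K(1)] F by (intro Bochner_Integration.integrable_add integrable_real_indicator) auto
    show "AE x in lbo n. norm (F x) \<le> norm (indicator K x + \<bar>F x\<bar> powr p)"
    proof (rule AE_I2)
      fix x
      have "\<bar>F x\<bar> \<le> indicator K x + \<bar>F x\<bar> powr p"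
      proof (cases "x \<in> K")
        case True
        have "\<bar>F x\<bar> \<le> 1 + \<bar>F x\<bar> powr p"
        proof (cases "\<bar>F x\<bar> \<le> 1")
          case False
          then have "\<bar>F x\<bar> powr 1 \<le> \<bar>F x\<bar> powr p" using p by (intro powr_mono) auto
          then show ?thesis using False by simp
        qed (simp add: add_increasing2)
        then show ?thesis using True by simp
      qed (simp add: K(3))
      then show "norm (F x) \<le> norm (indicator K x + \<bar>F x\<bar> powr p)" by simp
    qed
  qed (rule F(1))
  define D where "D = (\<lambda>x. A x - g x)"
  have [measurable]: "D \<in> borel_measurable (lbo n)" unfolding D_def by measurable
  define \<phi> where "\<phi> = (\<lambda>x. \<bar>D x\<bar> powr q / l powr q)"
  define \<psi> where "\<psi> = (\<lambda>x. l powr p * \<bar>F x\<bar> powr p)"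
  have yo: "\<bar>D x * F y\<bar> \<le> \<phi> x + \<psi> y" for x y
  proof -
    have "D x * F y = (D x / l) * (l * F y)" using l by simp
    moreover have "\<bar>(D x / l) * (l * F y)\<bar> \<le> \<bar>D x / l\<bar> powr q + \<bar>l * F y\<bar> powr p"
      unfolding q_def by (rule young_product[OF p])
    moreover have "\<bar>D x / l\<bar> powr q = \<phi> x" "\<bar>l * F y\<bar> powr p = \<psi> y"
      unfolding \<phi>_def \<psi>_def using l by (auto simp: abs_mult powr_mult powr_divide)
    ultimately show ?thesis by simp
  qed
  have i\<phi>: "integrable (lbo n) \<phi>" "integrable (lbo n) \<psi>" unfolding \<phi>_def \<psi>_def D_def using g F by auto
  have n\<phi>: "0 \<le> \<phi> x" "0 \<le> \<psi> x" for x unfolding \<phi>_def \<psi>_def by (intro divide_nonneg_nonneg mult_nonneg_nonneg; simp)+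
  have s\<phi>: "(\<integral>x. \<phi> x \<partial>lbo n) + (\<integral>x. \<psi> x \<partial>lbo n) < 2 * r / 5"
  proof -
    have "(\<integral>x. \<phi> x \<partial>lbo n) = (\<integral>x. \<bar>A x - g x\<bar> powr q \<partial>lbo n) / l powr q" by (simp add: \<phi>_def D_def)
    also have "\<dots> < r / 5" using g(4) l by (simp add: field_simps)
    finally show ?thesis using lI by (simp add: \<psi>_def I_def)
  qed
  have e1: "\<bar>\<integral>x. D x * mconv n (eps k) F x \<partial>lbo n\<bar> < 2 * r / 5" for k
    using mconv_pairing(2)[OF eps_pos _ F(1) i\<phi>(1) n\<phi>(1) i\<phi>(2) n\<phi>(2) yo, of k] s\<phi> by simp
  have iDF: "integrable (lbo n) (\<lambda>x. D x * F x)"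
  proof (rule Bochner_Integration.integrable_bound)
    show "integrable (lbo n) (\<lambda>x. \<phi> x + \<psi> x)" using i\<phi> by simp
    show "AE x in lbo n. norm (D x * F x) \<le> norm (\<phi> x + \<psi> x)" using yo n\<phi> by (intro AE_I2) (simp add: abs_of_nonneg)
  qed measurable
  have e2: "\<bar>\<integral>x. D x * F x \<partial>lbo n\<bar> < 2 * r / 5"
  proof -
    have "\<bar>\<integral>x. D x * F x \<partial>lbo n\<bar> \<le> (\<integral>x. \<phi> x + \<psi> x \<partial>lbo n)"
      by (rule order_trans[OF integral_abs_bound integral_mono]) (use iDF i\<phi> yo in auto)
    then show ?thesis using s\<phi> i\<phi> by simp
  qed
  have "(\<lambda>k. \<integral>x. g x * mconv n (eps k) F x \<partial>lbo n) \<longlonglongrightarrow> (\<integral>x. g x * F x \<partial>lbo n)"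
    by (rule mconv_pairing_tendsto_bounded[OF gm _ B iF cont_on_pts_cont_at[OF g(1)]]) (use g(2) in auto)
  then obtain N where N: "\<And>k. k \<ge> N \<Longrightarrow> \<bar>(\<integral>x. g x * mconv n (eps k) F x \<partial>lbo n) - (\<integral>x. g x * F x \<partial>lbo n)\<bar> < r / 5"
    using LIMSEQ_D[of _ _ "r/5"] r by fastforce
  have igF: "integrable (lbo n) (\<lambda>x. g x * F x)"
    by (rule Bochner_Integration.integrable_bound[of _ "\<lambda>x. B * F x"])
       (use iF g(2) B in \<open>auto simp: abs_mult intro!: mult_right_mono\<close>)
  have "norm ((\<integral>x. A x * mconv n (eps k) F x \<partial>lbo n) - (\<integral>x. A x * F x \<partial>lbo n)) < r" if "k \<ge> N" for k
  proof -
    have iF1: "integrable (lbo n) (mconv n (eps k) F)"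
    proof -
      have "(\<integral>\<^sup>+x. ennreal \<bar>mconv n (eps k) F x\<bar> \<partial>lbo n) \<le> (\<integral>\<^sup>+x. \<integral>\<^sup>+y. ennreal (mk n (eps k) x y) * ennreal \<bar>F y\<bar> \<partial>lbo n \<partial>lbo n)"
      proof (rule nn_integral_mono)
        fix x
        have "ennreal (norm (\<integral>y. mk n (eps k) x y * F y \<partial>lbo n)) \<le> (\<integral>\<^sup>+y. ennreal (norm (mk n (eps k) x y * F y)) \<partial>lbo n)"
          by (rule integral_norm_bound_ennreal, rule pker_integrable[where \<beta>="\<lambda>_. moll (eps k)", OF moll(1)[OF eps_pos] iF])
        also have "\<dots> = (\<integral>\<^sup>+y. ennreal (mk n (eps k) x y) * ennreal \<bar>F y\<bar> \<partial>lbo n)"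
          by (intro nn_integral_cong) (simp add: abs_mult ennreal_mult mk_nonneg[OF eps_pos])
        finally show "ennreal \<bar>mconv n (eps k) F x\<bar> \<le> (\<integral>\<^sup>+y. ennreal (mk n (eps k) x y) * ennreal \<bar>F y\<bar> \<partial>lbo n)"
          by (simp add: pconv_def)
      qed
      also have "\<dots> = (\<integral>\<^sup>+z. ennreal (mk n (eps k) (fst z) (snd z)) * ennreal \<bar>F (snd z)\<bar> \<partial>(lbo n \<Otimes>\<^sub>M lbo n))"
      proof -
        interpret sigma_finite_measure "lbo n" by (rule sigma_finite_lbo)
        note [measurable] = mk_measurable[OF eps_pos]
        show ?thesis by (subst nn_integral_fst[symmetric]) simp_all
      qed
      also have "\<dots> = (\<integral>\<^sup>+y. ennreal \<bar>F y\<bar> \<partial>lbo n)" by (rule nn_integral_mk_fst(2)[OF eps_pos]) measurable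
      also have "\<dots> < \<infinity>" using iF unfolding integrable_iff_bounded by simp
      finally show ?thesis unfolding integrable_iff_bounded by simp
    qed
    have igm: "integrable (lbo n) (\<lambda>x. g x * mconv n (eps k) F x)"
      by (rule Bochner_Integration.integrable_bound[of _ "\<lambda>x. B * mconv n (eps k) F x"])
         (use iF1 g(2) B in \<open>auto simp: abs_mult intro!: mult_right_mono\<close>)
    have iAm: "(\<integral>x. A x * mconv n (eps k) F x \<partial>lbo n) = (\<integral>x. D x * mconv n (eps k) F x \<partial>lbo n) + (\<integral>x. g x * mconv n (eps k) F x \<partial>lbo n)
        \<or> \<not> integrable (lbo n) (\<lambda>x. D x * mconv n (eps k) F x)"
      using igm by (cases "integrable (lbo n) (\<lambda>x. D x * mconv n (eps k) F x)")
        (auto simp: D_def Bochner_Integration.integral_add[symmetric] left_diff_distrib)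
    moreover have "integrable (lbo n) (\<lambda>x. D x * mconv n (eps k) F x)"
    proof -
      have bm: "\<exists>C. \<forall>x. \<bar>mconv n (eps k) F x\<bar> \<le> C"
      proof -
        obtain C where C: "\<And>x y. \<bar>mk n (eps k) x y\<bar> \<le> C" using pker_bounded[of n "eps k" "\<lambda>_. moll (eps k)"] moll(1)[OF eps_pos] by blast
        have "\<bar>mconv n (eps k) F x\<bar> \<le> (\<integral>y. C * \<bar>F y\<bar> \<partial>lbo n)" for x unfolding pconv_def
        proof (rule order_trans[OF integral_abs_bound integral_mono])
          show "integrable (lbo n) (\<lambda>y. \<bar>mk n (eps k) x y * F y\<bar>)"
            by (intro integrable_abs pker_integrable[where \<beta>="\<lambda>_. moll (eps k)", OF moll(1)[OF eps_pos] iF])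
        qed (use iF C in \<open>auto simp: abs_mult intro!: mult_right_mono\<close>)
        then show ?thesis by blast
      qed
      then obtain C where C: "\<And>x. \<bar>mconv n (eps k) F x\<bar> \<le> C" by blast
      have iA: "integrable (lbo n) A"
      proof (rule Bochner_Integration.integrable_bound)
        show "integrable (lbo n) (\<lambda>x. \<bar>A x\<bar> powr q + indicator K x)"
          using sets_compactin[OF K(1)] emeasure_compactin_finite[OF K(1)] A(2) unfolding q_def by (intro Bochner_Integration.integrable_add integrable_real_indicator) auto
        show "AE x in lbo n. norm (A x) \<le> norm (\<bar>A x\<bar> powr q + indicator K x)"
        proof (rule AE_I2)
          fix x
          have "\<bar>A x * indicator K x\<bar> \<le> \<bar>A x\<bar> powr q + \<bar>indicator K x\<bar> powr p" unfolding q_def by (rule young_product[OF p])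
          then show "norm (A x) \<le> norm (\<bar>A x\<bar> powr q + indicator K x)" using K(2)[of x] by (cases "x \<in> K") auto
        qed
      qed measurable
      have "integrable (lbo n) (\<lambda>x. A x * mconv n (eps k) F x)"
        by (rule Bochner_Integration.integrable_bound[of _ "\<lambda>x. C * A x"])
           (use iA C in \<open>auto simp: abs_mult mult.commute[of "\<bar>A _\<bar>"] intro!: mult_right_mono order_trans[OF C abs_ge_self]\<close>)
      then show ?thesis using igm by (simp add: D_def left_diff_distrib)
    qed
    ultimately have s1: "(\<integral>x. A x * mconv n (eps k) F x \<partial>lbo n) = (\<integral>x. D x * mconv n (eps k) F x \<partial>lbo n) + (\<integral>x. g x * mconv n (eps k) F x \<partial>lbo n)" by blast
    have s2: "(\<integral>x. A x * F x \<partial>lbo n) = (\<integral>x. D x * F x \<partial>lbo n) + (\<integral>x. g x * F x \<partial>lbo n)"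
      using iDF igF by (subst Bochner_Integration.integral_add[symmetric]) (auto simp: D_def algebra_simps)
    show ?thesis unfolding s1 s2 real_norm_def using e1[of k] e2 N[OF that] by linarith
  qed
  then show "\<exists>N. \<forall>k\<ge>N. norm ((\<integral>x. A x * mconv n (eps k) F x \<partial>lbo n) - (\<integral>x. A x * F x \<partial>lbo n)) < r" by blast
qed

subsection \<open>Local integrability\<close>

lemma Leb_sets: "A \<in> sets (lbo n) \<Longrightarrow> A \<in> sets (Leb n)" by simp

lemma integrable_indicator_compactin:
  assumes "compactin (Rn n) K"
  shows "integrable (lbo n) (indicator K :: pt \<Rightarrow> real)" "integrable (Leb n) (indicator K :: pt \<Rightarrow> real)"
proof -
  show i: "integrable (lbo n) (indicator K :: pt \<Rightarrow> real)"
    using sets_compactin[OF assms] emeasure_compactin_finite[OF assms] by (intro integrable_real_indicator) auto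
  then show "integrable (Leb n) (indicator K :: pt \<Rightarrow> real)"
    using integrable_completion[OF borel_measurable_integrable[OF i]] by simp
qed

lemma Lp_locD:
  assumes "f \<in> Lp_loc n p \<Omega>" "compactin (Rn n) K" "K \<subseteq> \<Omega>"
  shows "set_borel_measurable (Leb n) K f" "set_integrable (Leb n) K (\<lambda>x. \<bar>f x\<bar> powr p)"
  using assms unfolding Lp_loc_def Lp_def by auto

text \<open>Membership in \<open>Lp_loc\<close> speaks only of compact subsets; a countable cover by
  boxes with closure in \<Omega> makes f measurable on \<Omega> itself.\<close>

lemma Lp_loc_measurable:
  assumes "f \<in> Lp_loc n p \<Omega>" "openin (Rn n) \<Omega>"
  shows "set_borel_measurable (Leb n) \<Omega> f"
proof -
  obtain C where C: "countable C" "\<forall>(x,e)\<in>C. x \<in> pts n \<and> 0 < e \<and> clbox n x e \<subseteq> \<Omega>" "\<Omega> = (\<Union>(x,e)\<in>C. obox n x e)"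
    using openin_countable_boxes[OF assms(2)] by blast
  show ?thesis unfolding set_borel_measurable_def
  proof (rule measurableI)
    fix S :: "real set" assume S: "S \<in> sets borel"
    let ?f = "\<lambda>x. indicator \<Omega> x *\<^sub>R f x"
    have piece: "?f -` S \<inter> obox n x e \<in> sets (Leb n)" if z: "(x, e) \<in> C" for x e
    proof -
      have sub: "clbox n x e \<subseteq> \<Omega>" using C(2) z by auto
      have "(\<lambda>y. indicator (clbox n x e) y *\<^sub>R f y) \<in> borel_measurable (Leb n)"
        using Lp_locD(1)[OF assms(1) compactin_clbox sub] unfolding set_borel_measurable_def .
      from measurable_sets[OF this S]
      have "((\<lambda>y. indicator (clbox n x e) y *\<^sub>R f y) -` S \<inter> space (Leb n)) \<inter> obox n x e \<in> sets (Leb n)"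
        by (rule sets.Int) (rule Leb_sets[OF sets_obox])
      moreover have "((\<lambda>y. indicator (clbox n x e) y *\<^sub>R f y) -` S \<inter> space (Leb n)) \<inter> obox n x e = ?f -` S \<inter> obox n x e"
      proof -
        have "y \<in> clbox n x e \<and> y \<in> \<Omega> \<and> y \<in> space (Leb n)" if "y \<in> obox n x e" for y
        proof -
          have "y \<in> clbox n x e" using that obox_subset_clbox by (rule subsetD[rotated])
          then show ?thesis using sub clbox_subset_pts[of n x e] by (auto simp: space_PiM)
        qed
        then show ?thesis by (auto simp: indicator_def)
      qed
      ultimately show ?thesis by simp
    qed
    have "(\<Union>z\<in>C. ?f -` S \<inter> obox n (fst z) (snd z)) \<in> sets (Leb n)"
      using piece C(1) by (intro sets.countable_UN'') auto
    also have "(\<Union>z\<in>C. ?f -` S \<inter> obox n (fst z) (snd z)) = ?f -` S \<inter> (\<Union>(x,e)\<in>C. obox n x e)" by (auto simp: case_prod_beta)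
    finally have a: "?f -` S \<inter> \<Omega> \<in> sets (Leb n)" unfolding C(3)[symmetric] .
    have sp: "space (Leb n) - \<Omega> \<in> sets (Leb n)" using Leb_sets[OF sets_openin[OF assms(2)]] by blast
    have "?f -` S \<inter> space (Leb n) = (?f -` S \<inter> \<Omega>) \<union> (if 0 \<in> S then space (Leb n) - \<Omega> else {})"
      using openin_subset_pts[OF assms(2)] by (auto simp: indicator_def space_PiM split: if_splits)
    then show "?f -` S \<inter> space (Leb n) \<in> sets (Leb n)" using a sp by auto
  qed simp
qed

lemma Lp_loc_1_integrable:
  assumes "f \<in> Lp_loc n 1 \<Omega>" "compactin (Rn n) K" "K \<subseteq> \<Omega>"
  shows "integrable (Leb n) (\<lambda>x. indicator K x * f x)"
proof -
  note m = Lp_locD[OF assms]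
  have "integrable (Leb n) (\<lambda>x. \<bar>indicator K x * f x\<bar>)"
    using m(2) unfolding set_integrable_def by (simp add: abs_mult)
  moreover have "(\<lambda>x. indicator K x * f x) \<in> borel_measurable (Leb n)" using m(1) unfolding set_borel_measurable_def by simp
  ultimately show ?thesis using integrable_abs_iff by blast
qed

lemma Lp_loc_1I:
  assumes "\<And>K. compactin (Rn n) K \<Longrightarrow> K \<subseteq> \<Omega> \<Longrightarrow> integrable (Leb n) (\<lambda>x. indicator K x * f x)"
  shows "f \<in> Lp_loc n 1 \<Omega>"
  unfolding Lp_loc_def Lp_def
proof (intro CollectI allI impI conjI)
  fix K assume K: "compactin (Rn n) K \<and> K \<subseteq> \<Omega>"
  then have i: "integrable (Leb n) (\<lambda>x. indicator K x * f x)" using assms by blast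
  then show "set_borel_measurable (Leb n) K f" unfolding set_borel_measurable_def using borel_measurable_integrable by force
  from integrable_abs[OF i] show "set_integrable (Leb n) K (\<lambda>x. \<bar>f x\<bar> powr 1)"
    unfolding set_integrable_def by (simp add: abs_mult)
qed

lemma cont_on_compact_measurable:
  assumes "openin (Rn n) \<Omega>" "cont_on n \<Omega> f" "compactin (Rn n) K" "K \<subseteq> \<Omega>"
  shows "(\<lambda>x. indicator K x * f x) \<in> borel_measurable (lbo n)"
proof -
  have "(\<lambda>x. indicator K x * (indicator \<Omega> x * f x)) \<in> borel_measurable (lbo n)"
    by (rule borel_measurable_times[OF borel_measurable_indicator[OF sets_compactin[OF assms(3)]] cont_on_borel_measurable[OF assms(1,2)]])
  moreover have "indicator K x * (indicator \<Omega> x * f x) = indicator K x * f x" for x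
    using assms(4) by (auto simp: indicator_def)
  ultimately show ?thesis by simp
qed

lemma Lp_loc_1_mult_cont:
  assumes \<Omega>: "openin (Rn n) \<Omega>" and f: "f \<in> Lp_loc n 1 \<Omega>" and g: "cont_on n \<Omega> g"
  shows "(\<lambda>x. f x * g x) \<in> Lp_loc n 1 \<Omega>"
proof (rule Lp_loc_1I)
  fix K assume K: "compactin (Rn n) K" "K \<subseteq> \<Omega>"
  obtain B where B: "\<forall>x\<in>K. \<bar>g x\<bar> \<le> B" using cont_on_bounded[OF g K] by blast
  note i = Lp_loc_1_integrable[OF f K]
  show "integrable (Leb n) (\<lambda>x. indicator K x * (f x * g x))"
  proof (rule Bochner_Integration.integrable_bound)
    show "integrable (Leb n) (\<lambda>x. B * (indicator K x * f x))" using i by simp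
    have "(\<lambda>x. (indicator K x * f x) * (indicator K x * g x)) \<in> borel_measurable (Leb n)"
      by (rule borel_measurable_times[OF borel_measurable_integrable[OF i] measurable_completion[OF cont_on_compact_measurable[OF \<Omega> g K]]])
    moreover have "(indicator K x * f x) * (indicator K x * g x) = indicator K x * (f x * g x)" for x by (auto simp: indicator_def)
    ultimately show "(\<lambda>x. indicator K x * (f x * g x)) \<in> borel_measurable (Leb n)" by simp
    show "AE x in Leb n. norm (indicator K x * (f x * g x)) \<le> norm (B * (indicator K x * f x))"
    proof (rule AE_I2)
      fix x
      show "norm (indicator K x * (f x * g x)) \<le> norm (B * (indicator K x * f x))"
      proof (cases "x \<in> K")
        case True
        then have "\<bar>g x\<bar> * \<bar>f x\<bar> \<le> \<bar>B\<bar> * \<bar>f x\<bar>" using B by (intro mult_right_mono) (auto intro: order_trans abs_ge_self)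
        then show ?thesis using True by (simp add: abs_mult mult.commute)
      qed simp
    qed
  qed
qed

lemma cont_on_Lp_loc_1:
  assumes \<Omega>: "openin (Rn n) \<Omega>" and g: "cont_on n \<Omega> g"
  shows "g \<in> Lp_loc n 1 \<Omega>"
proof -
  have "(\<lambda>x. 1) \<in> Lp_loc n 1 \<Omega>"
  proof (rule Lp_loc_1I)
    fix K assume "compactin (Rn n) K" "K \<subseteq> \<Omega>"
    then show "integrable (Leb n) (\<lambda>x. indicator K x * 1 :: real)"
      using integrable_indicator_compactin(2) by simp
  qed
  from Lp_loc_1_mult_cont[OF \<Omega> this g] show ?thesis by simp
qed

lemma Lp_loc_1_add:
  assumes "f \<in> Lp_loc n 1 \<Omega>" "g \<in> Lp_loc n 1 \<Omega>" shows "(\<lambda>x. f x + g x) \<in> Lp_loc n 1 \<Omega>"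
proof (rule Lp_loc_1I)
  fix K assume K: "compactin (Rn n) K" "K \<subseteq> \<Omega>"
  have "integrable (Leb n) (\<lambda>x. indicator K x * f x + indicator K x * g x)"
    using Lp_loc_1_integrable[OF assms(1) K] Lp_loc_1_integrable[OF assms(2) K] by simp
  then show "integrable (Leb n) (\<lambda>x. indicator K x * (f x + g x))" by (simp add: distrib_left)
qed

lemma Lp_loc_imp_1:
  assumes "1 \<le> p" "f \<in> Lp_loc n p \<Omega>" shows "f \<in> Lp_loc n 1 \<Omega>"
proof (rule Lp_loc_1I)
  fix K assume K: "compactin (Rn n) K" "K \<subseteq> \<Omega>"
  note m = Lp_locD[OF assms(2) K]
  show "integrable (Leb n) (\<lambda>x. indicator K x * f x)"
  proof (rule Bochner_Integration.integrable_bound)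
    show "integrable (Leb n) (\<lambda>x. indicator K x + indicator K x * \<bar>f x\<bar> powr p)"
      using m(2) integrable_indicator_compactin(2)[OF K(1)] unfolding set_integrable_def
      by (intro Bochner_Integration.integrable_add) auto
    show "(\<lambda>x. indicator K x * f x) \<in> borel_measurable (Leb n)" using m(1) unfolding set_borel_measurable_def by simp
    show "AE x in Leb n. norm (indicator K x * f x) \<le> norm (indicator K x + indicator K x * \<bar>f x\<bar> powr p)"
    proof (rule AE_I2)
      fix x
      have "\<bar>f x\<bar> \<le> 1 + \<bar>f x\<bar> powr p"
      proof (cases "\<bar>f x\<bar> \<le> 1")
        case False
        then have "\<bar>f x\<bar> powr 1 \<le> \<bar>f x\<bar> powr p" using assms by (intro powr_mono) auto
        then show ?thesis using False by simp
      qed (simp add: add_increasing2)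
      then show "norm (indicator K x * f x) \<le> norm (indicator K x + indicator K x * \<bar>f x\<bar> powr p)"
        by (cases "x \<in> K") (auto)
    qed
  qed
qed

subsection \<open>Approximation of continuous functions with compact support\<close>

text \<open>Values outside \<Omega> are arbitrary, whereas a convolution integrates over all of
  \<open>pts n\<close>; they have to be erased first.\<close>

definition zext :: "pt set \<Rightarrow> (pt \<Rightarrow> real) \<Rightarrow> pt \<Rightarrow> real" where
  "zext \<Omega> w x = indicator \<Omega> x * w x"

text \<open>K carries w and K' contains its e-enlargement, so every mollification of radius at most
  e lives in K'. The set U records that K' may be required to lie in a smaller open set, as in the
  localised \<open>fundamental_lemma\<close>.\<close>

locale cc_fun =
  fixes n :: nat and \<Omega> U :: "pt set" and w :: "pt \<Rightarrow> real" and K K' :: "pt set" and e :: real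
  assumes \<Omega>: "openin (Rn n) \<Omega>" and w: "cont_on n \<Omega> w" and K: "compactin (Rn n) K" and K': "compactin (Rn n) K'"
    and U: "K' \<subseteq> U" "U \<subseteq> \<Omega>" and e: "0 < e" and KK': "\<And>y. y \<in> K \<Longrightarrow> clbox n y e \<subseteq> K'"
    and wK: "\<And>x. x \<in> \<Omega> \<Longrightarrow> x \<notin> K \<Longrightarrow> w x = 0"
begin

lemma subK: "K \<subseteq> K'" "K' \<subseteq> \<Omega>" "K \<subseteq> \<Omega>" "\<Omega> \<subseteq> pts n" "K' \<subseteq> pts n"
proof -
  show "K \<subseteq> K'"
  proof
    fix y assume y: "y \<in> K"
    then have "y \<in> clbox n y e" using subsetD[OF compactin_subset_pts[OF K] y] e by (simp add: clbox_def)
    then show "y \<in> K'" using KK'[OF y] by (rule subsetD[rotated])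
  qed
  show "K' \<subseteq> \<Omega>" using U by (rule order_trans)
  with \<open>K \<subseteq> K'\<close> show "K \<subseteq> \<Omega>" by (rule order_trans)
  show "\<Omega> \<subseteq> pts n" by (rule openin_subset_pts[OF \<Omega>])
  show "K' \<subseteq> pts n" by (rule compactin_subset_pts[OF K'])
qed

lemma zext_zero: "x \<notin> K \<Longrightarrow> zext \<Omega> w x = 0"
  using wK by (auto simp: zext_def indicator_def)

lemma zext_measurable: "zext \<Omega> w \<in> borel_measurable (lbo n)"
  unfolding zext_def using cont_on_borel_measurable[OF \<Omega> w] by simp

lemma zext_bounded: "\<exists>B>0. \<forall>x. \<bar>zext \<Omega> w x\<bar> \<le> B"
proof -
  obtain B where B: "B > 0" "\<forall>x\<in>K. \<bar>w x\<bar> \<le> B" using cont_on_bounded[OF w K subK(3)] by blast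
  have "\<bar>zext \<Omega> w x\<bar> \<le> B" for x
    using B zext_zero[of x] by (cases "x \<in> K") (auto simp: zext_def indicator_def)
  then show ?thesis using B by blast
qed

lemma zext_integrable: "integrable (lbo n) (zext \<Omega> w)"
proof -
  obtain B where B: "B > 0" "\<And>x. \<bar>zext \<Omega> w x\<bar> \<le> B" using zext_bounded by blast
  show ?thesis
  proof (rule Bochner_Integration.integrable_bound)
    show "integrable (lbo n) (\<lambda>x. B * indicator K x)"
      using sets_compactin[OF K] emeasure_compactin_finite[OF K] by (intro integrable_mult_right integrable_real_indicator) auto
    show "AE x in lbo n. norm (zext \<Omega> w x) \<le> norm (B * indicator K x)"
    proof (rule AE_I2)
      fix x show "norm (zext \<Omega> w x) \<le> norm (B * indicator K x)"
        using B(1) B(2)[of x] zext_zero[of x] by (cases "x \<in> K") auto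
    qed
  qed (rule zext_measurable)
qed

text \<open>Inside \<Omega> this is continuity of w; elsewhere the complement of the compact set K
  is an open neighbourhood on which the extension is 0.\<close>

lemma zext_cont_at: assumes "y \<in> pts n" shows "cont_at n (zext \<Omega> w) y"
  unfolding cont_at_def
proof (intro allI impI)
  fix r :: real assume r: "0 < r"
  show "\<exists>d>0. \<forall>x\<in>obox n y d. \<bar>zext \<Omega> w x - zext \<Omega> w y\<bar> < r"
  proof (cases "y \<in> \<Omega>")
    case True
    obtain d1 where d1: "d1 > 0" "obox n y d1 \<subseteq> \<Omega>" using openin_RnD[OF \<Omega> True] by blast
    obtain d2 where d2: "d2 > 0" "\<forall>x\<in>\<Omega> \<inter> obox n y d2. \<bar>w x - w y\<bar> < r"
      using w[unfolded cont_on_iff[OF subK(4)], rule_format, OF True r] by blast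
    show ?thesis
    proof (intro exI[of _ "min d1 d2"] conjI ballI)
      fix x assume "x \<in> obox n y (min d1 d2)"
      then have "x \<in> obox n y d1" "x \<in> obox n y d2" by (auto simp: obox_def)
      then have "x \<in> \<Omega>" "\<bar>w x - w y\<bar> < r" using d1(2) d2(2) by auto
      then show "\<bar>zext \<Omega> w x - zext \<Omega> w y\<bar> < r" using True by (simp add: zext_def)
    qed (use d1 d2 in auto)
  next
    case False
    then have y: "y \<in> pts n - K" using assms subK(3) by blast
    have "openin (Rn n) (pts n - K)" using closedin_compactin[OF K] unfolding closedin_def topspace_Rn by simp
    from openin_RnD[OF this y] obtain d where d: "d > 0" "obox n y d \<subseteq> pts n - K" by blast
    then have "zext \<Omega> w x = 0" if "x \<in> obox n y d" for x using zext_zero that by blast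
    moreover have "zext \<Omega> w y = 0" using False by (simp add: zext_def)
    ultimately show ?thesis using d(1) r by (intro exI[of _ d]) auto
  qed
qed

definition app :: "nat \<Rightarrow> pt \<Rightarrow> real" where "app k = mconv n (eps k) (zext \<Omega> w)"

lemma app_Cc_inf: assumes "eps k \<le> e" shows "app k \<in> Cc_inf n \<Omega>"
  unfolding app_def
proof (rule pconv_Cc_inf[where \<beta>="\<lambda>_. moll (eps k)" and e="eps k" and K=K and K'=K', OF moll(1)[OF eps_pos] zext_integrable zext_zero _ K' subK(2,4)])
  fix y assume "y \<in> K"
  then show "clbox n y (eps k) \<subseteq> K'" using KK'[of y] clbox_mono[OF assms, of n y] by (rule_tac order_trans)
qed

lemma mconv_support:
  assumes "eps k \<le> e" "\<And>y. y \<notin> K \<Longrightarrow> F y = 0" "x \<in> pts n" "x \<notin> K'"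
  shows "mconv n (eps k) F x = 0"
proof (rule ccontr)
  assume "mconv n (eps k) F x \<noteq> 0"
  then obtain y where y: "y \<in> K" "x \<in> clbox n y (eps k)"
    using pconv_support[where \<beta>="\<lambda>_. moll (eps k)" and e="eps k" and K=K and F=F and x=x, OF moll(1)[OF eps_pos] assms(2)] assms(3) by blast
  have "x \<in> K'" using subsetD[OF KK'[OF y(1)] subsetD[OF clbox_mono[OF assms(1)] y(2)]] .
  then show False using assms(4) by simp
qed

lemma app_support: "eps k \<le> e \<Longrightarrow> x \<in> pts n \<Longrightarrow> x \<notin> K' \<Longrightarrow> app k x = 0"
  unfolding app_def using mconv_support[of k "zext \<Omega> w"] zext_zero by simp

lemma app_tendsto: assumes "x \<in> pts n" shows "(\<lambda>k. app k x) \<longlonglongrightarrow> zext \<Omega> w x"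
proof -
  obtain B where B: "\<And>x. \<bar>zext \<Omega> w x\<bar> \<le> B" using zext_bounded by blast
  show ?thesis unfolding app_def by (rule mconv_tendsto[OF zext_measurable _ zext_cont_at[OF assms], where B=B]) (rule B)
qed

text \<open>The approximations converge pointwise and stay below the bound of w, so dominated
  convergence works for a factor b that is only locally integrable, such as the potential
  term.\<close>

lemma app_integral_tendsto:
  assumes b: "b \<in> Lp_loc n 1 \<Omega>"
  shows "(\<lambda>k. LINT x:\<Omega>|Leb n. b x * app k x) \<longlonglongrightarrow> (LINT x:\<Omega>|Leb n. b x * w x)"
proof -
  obtain B where B: "B > 0" "\<And>x. \<bar>zext \<Omega> w x\<bar> \<le> B" using zext_bounded by blast
  note ib = Lp_loc_1_integrable[OF b K' subK(2)]
  have am: "app k \<in> borel_measurable (Leb n)" for k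
    unfolding app_def by (rule measurable_completion[OF mconv_measurable[OF eps_pos zext_measurable]])
  have "(\<lambda>k. \<integral>x. (indicator K' x * b x) * app k x \<partial>Leb n) \<longlonglongrightarrow> (\<integral>x. (indicator K' x * b x) * zext \<Omega> w x \<partial>Leb n)"
  proof (rule integral_dominated_convergence[where w="\<lambda>x. B * \<bar>indicator K' x * b x\<bar>"])
    show "(\<lambda>x. (indicator K' x * b x) * zext \<Omega> w x) \<in> borel_measurable (Leb n)"
      by (rule borel_measurable_times[OF borel_measurable_integrable[OF ib] measurable_completion[OF zext_measurable]])
    show "(\<lambda>x. (indicator K' x * b x) * app k x) \<in> borel_measurable (Leb n)" for k
      by (rule borel_measurable_times[OF borel_measurable_integrable[OF ib] am])
    show "integrable (Leb n) (\<lambda>x. B * \<bar>indicator K' x * b x\<bar>)" using ib by (intro integrable_mult_right integrable_abs)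
    show "AE x in Leb n. (\<lambda>k. indicator K' x * b x * app k x) \<longlonglongrightarrow> indicator K' x * b x * zext \<Omega> w x"
      by (intro AE_I2 tendsto_mult tendsto_const app_tendsto) (simp add: space_PiM)
    show "AE x in Leb n. norm (indicator K' x * b x * app k x) \<le> B * \<bar>indicator K' x * b x\<bar>" for k
    proof (rule AE_I2)
      fix x
      have "\<bar>app k x\<bar> \<le> B" unfolding app_def by (rule mconv_bounded[OF eps_pos zext_measurable]) (use B in auto)
      then have "\<bar>indicator K' x * b x\<bar> * \<bar>app k x\<bar> \<le> \<bar>indicator K' x * b x\<bar> * B" by (intro mult_left_mono) auto
      then show "norm (indicator K' x * b x * app k x) \<le> B * \<bar>indicator K' x * b x\<bar>" unfolding real_norm_def abs_mult by (simp add: mult_ac)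
    qed
  qed
  moreover have "(\<integral>x. (indicator K' x * b x) * zext \<Omega> w x \<partial>Leb n) = (LINT x:\<Omega>|Leb n. b x * w x)"
    unfolding set_lebesgue_integral_def
  proof (intro Bochner_Integration.integral_cong refl)
    fix x show "(indicator K' x * b x) * zext \<Omega> w x = indicator \<Omega> x *\<^sub>R (b x * w x)"
      using subK wK[of x] by (cases "x \<in> K") (auto simp: indicator_def zext_def)
  qed
  moreover have "eventually (\<lambda>k. (\<integral>x. (indicator K' x * b x) * app k x \<partial>Leb n) = (LINT x:\<Omega>|Leb n. b x * app k x)) sequentially"
    using eventually_eps_less[OF e]
  proof eventually_elim
    case (elim k)
    show ?case unfolding set_lebesgue_integral_def
    proof (intro Bochner_Integration.integral_cong refl)
      fix x assume "x \<in> space (Leb n)"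
      then have "x \<in> pts n" by (simp add: space_PiM)
      then show "(indicator K' x * b x) * app k x = indicator \<Omega> x *\<^sub>R (b x * app k x)"
        using subK(2) app_support[of k x] elim by (cases "x \<in> K'") (auto simp: indicator_def)
    qed
  qed
  ultimately show ?thesis by (simp only: Lim_transform_eventually)
qed

end

lemma cc_fun_exists:
  assumes \<Omega>: "openin (Rn n) \<Omega>" and w: "cont_on n \<Omega> w" and K: "compactin (Rn n) K" "K \<subseteq> U"
    and U: "openin (Rn n) U" "U \<subseteq> \<Omega>" and wK: "\<And>x. x \<in> \<Omega> \<Longrightarrow> x \<notin> K \<Longrightarrow> w x = 0"
  shows "\<exists>K' e. cc_fun n \<Omega> U w K K' e"
proof -
  obtain e K' where eK: "e > 0" "compactin (Rn n) K'" "K' \<subseteq> U" "\<forall>x\<in>K. clbox n x e \<subseteq> K'"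
    using compactin_neighbourhood[OF K U(1)] by blast
  have "cc_fun n \<Omega> U w K K' e"
    by (rule cc_fun.intro[OF \<Omega> w K(1) eK(2,3) U(2) eK(1)]) (use eK(4) wK in auto)
  then show ?thesis by blast
qed

lemma Cc_support:
  assumes "openin (Rn n) \<Omega>" "w \<in> Cc n \<Omega>"
  shows "\<exists>K. compactin (Rn n) K \<and> K \<subseteq> \<Omega> \<and> (\<forall>x\<in>\<Omega>. x \<notin> K \<longrightarrow> w x = 0)"
proof -
  have s: "{x \<in> \<Omega>. w x \<noteq> 0} \<subseteq> pts n" using openin_subset_pts[OF assms(1)] by (rule order_trans[rotated]) simp
  have "cinside n {x \<in> \<Omega>. w x \<noteq> 0} \<Omega>" using assms(2) unfolding Cc_def by simp
  then obtain K where K: "compactin (Rn n) K" "{x \<in> \<Omega>. w x \<noteq> 0} \<subseteq> K" "K \<subseteq> \<Omega>" unfolding cinside_iff[OF s] by blast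
  then have "\<forall>x\<in>\<Omega>. x \<notin> K \<longrightarrow> w x = 0" by blast
  then show ?thesis using K(1,3) by blast
qed

lemma CcI:
  assumes "openin (Rn n) \<Omega>" "cont_on n \<Omega> w" "compactin (Rn n) K" "K \<subseteq> \<Omega>" "\<And>x. x \<in> \<Omega> \<Longrightarrow> x \<notin> K \<Longrightarrow> w x = 0"
  shows "w \<in> Cc n \<Omega>"
proof -
  have s: "{x \<in> \<Omega>. w x \<noteq> 0} \<subseteq> pts n" using openin_subset_pts[OF assms(1)] by (rule order_trans[rotated]) simp
  have "{x \<in> \<Omega>. w x \<noteq> 0} \<subseteq> K" using assms(5) by blast
  then have "cinside n {x \<in> \<Omega>. w x \<noteq> 0} \<Omega>" unfolding cinside_iff[OF s] using assms(3,4) by blast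
  then show ?thesis using assms(2) by (simp add: Cc_def)
qed

subsection \<open>Uniqueness of weak derivatives\<close>

text \<open>The sign of H would be the ideal test function. Continuous functions approximate it in
  L^1, hence almost everywhere along a subsequence; clipping them to [-1, 1] makes |H| a majorant,
  and the limit of the vanishing integrals is the integral of |H|.\<close>

lemma orthogonal_to_continuous_zero:
  assumes H: "integrable (lbo n) H" and K: "compactin (Rn n) K" "\<And>x. x \<notin> K \<Longrightarrow> H x = 0"
    and orth: "\<And>f B. cont_on n (pts n) f \<Longrightarrow> (\<And>x. \<bar>f x\<bar> \<le> B) \<Longrightarrow> (\<integral>x. H x * f x \<partial>lbo n) = 0"
  shows "AE x in lbo n. H x = 0"
proof -
  note [measurable] = borel_measurable_integrable[OF H] sets_compactin[OF K(1)]
  define F where "F = (\<lambda>x. sgn (H x) * indicator K x)"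
  have Fm [measurable]: "F \<in> borel_measurable (lbo n)" unfolding F_def by measurable
  have F1: "\<bar>F x\<bar> \<le> 1" for x by (auto simp: F_def sgn_real_def indicator_def)
  have iF: "integrable (lbo n) F"
  proof (rule Bochner_Integration.integrable_bound[OF _ Fm])
    show "integrable (lbo n) (indicator K :: pt \<Rightarrow> real)" using emeasure_compactin_finite[OF K(1)] by (intro integrable_real_indicator) auto
  qed (auto simp: F_def sgn_real_def indicator_def)
  have "\<exists>g B. cont_on n (pts n) g \<and> (\<forall>x. \<bar>g x\<bar> \<le> B) \<and> integrable (lbo n) g \<and> (\<integral>x. \<bar>F x - g x\<bar> \<partial>lbo n) < eps k" for k
    using approximable_integrable[OF iF] eps_pos[of k] unfolding approximable_def by blast
  then obtain g where g: "\<And>k. cont_on n (pts n) (g k)" "\<And>k. integrable (lbo n) (g k)" "\<And>k. (\<integral>x. \<bar>F x - g k x\<bar> \<partial>lbo n) < eps k" by metis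
  have gm [measurable]: "g k \<in> borel_measurable (lbo n)" for k using g(2) by (rule borel_measurable_integrable)
  have l: "(\<lambda>k. \<integral>x. norm (F x - g k x) \<partial>lbo n) \<longlonglongrightarrow> 0"
    by (rule tendsto_sandwich[OF _ _ tendsto_const eps_tendsto]) (use g(3) in \<open>auto simp: less_imp_le\<close>)
  have "integrable (lbo n) (\<lambda>x. F x - g k x)" for k using iF g(2) by simp
  from tendsto_L1_AE_subseq[OF this l] obtain r where r: "AE x in lbo n. (\<lambda>k. F x - g (r k) x) \<longlonglongrightarrow> 0" by blast
  have "(\<lambda>k. \<integral>x. H x * clip 1 (g (r k) x) \<partial>lbo n) \<longlonglongrightarrow> (\<integral>x. \<bar>H x\<bar> \<partial>lbo n)"
  proof (rule integral_dominated_convergence[where w="\<lambda>x. \<bar>H x\<bar>"])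
    show "AE x in lbo n. (\<lambda>k. H x * clip 1 (g (r k) x)) \<longlonglongrightarrow> \<bar>H x\<bar>"
      using r
    proof eventually_elim
      case (elim x)
      then have "(\<lambda>k. F x - (F x - g (r k) x)) \<longlonglongrightarrow> F x - 0" by (intro tendsto_diff tendsto_const)
      then have t: "(\<lambda>k. g (r k) x) \<longlonglongrightarrow> F x" by simp
      have "isCont (clip 1) (F x)" using clip_continuous[of 1] by (simp add: continuous_on_eq_continuous_at)
      from isCont_tendsto_compose[OF this t] have "(\<lambda>k. clip 1 (g (r k) x)) \<longlonglongrightarrow> F x" using clip_id[OF F1] by simp
      then have "(\<lambda>k. H x * clip 1 (g (r k) x)) \<longlonglongrightarrow> H x * F x" by (intro tendsto_mult tendsto_const)
      moreover have "H x * F x = \<bar>H x\<bar>" using K(2)[of x] by (cases "x \<in> K") (auto simp: F_def sgn_real_def)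
      ultimately show ?case by simp
    qed
    show "AE x in lbo n. norm (H x * clip 1 (g (r k) x)) \<le> \<bar>H x\<bar>" for k
      using clip_bound[of 1] by (intro AE_I2) (simp add: abs_mult mult_left_le)
  qed (use H in \<open>auto\<close>)
  moreover have "(\<integral>x. H x * clip 1 (g (r k) x) \<partial>lbo n) = 0" for k
    by (rule orth[where B=1]) (use clip_bound[of 1] cont_on_compose[OF g(1) clip_continuous] in auto)
  ultimately have "(\<integral>x. \<bar>H x\<bar> \<partial>lbo n) = 0" using LIMSEQ_unique[OF _ tendsto_const] by force
  then have "AE x in lbo n. \<bar>H x\<bar> = 0" using H by (subst (asm) integral_nonneg_eq_0_iff_AE) auto
  then show ?thesis by simp
qed

lemma AE_countable_boxes:
  assumes "openin (Rn n) U" "\<And>x e. x \<in> pts n \<Longrightarrow> 0 < e \<Longrightarrow> clbox n x e \<subseteq> U \<Longrightarrow> AE y in Leb n. y \<in> obox n x e \<longrightarrow> P y"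
  shows "AE y in Leb n. y \<in> U \<longrightarrow> P y"
proof -
  obtain C where C: "countable C" "\<forall>(x,e)\<in>C. x \<in> pts n \<and> 0 < e \<and> clbox n x e \<subseteq> U" "U = (\<Union>(x,e)\<in>C. obox n x e)"
    using openin_countable_boxes[OF assms(1)] by blast
  have "AE y in Leb n. \<forall>z\<in>C. y \<in> obox n (fst z) (snd z) \<longrightarrow> P y"
    unfolding AE_ball_countable[OF C(1)]
  proof
    fix z assume "z \<in> C"
    then have "fst z \<in> pts n \<and> 0 < snd z \<and> clbox n (fst z) (snd z) \<subseteq> U" using C(2) by (auto simp: case_prod_beta)
    then show "AE y in Leb n. y \<in> obox n (fst z) (snd z) \<longrightarrow> P y" using assms(2) by blast
  qed
  then show ?thesis
  proof eventually_elim
    case (elim y)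
    show ?case
    proof
      assume "y \<in> U"
      then obtain z where "z \<in> C" "y \<in> obox n (fst z) (snd z)" unfolding C(3) by (auto simp: case_prod_beta)
      then show "P y" using elim by blast
    qed
  qed
qed

text \<open>On a box inside U, h is multiplied by a smooth \<theta> supported there. For continuous
  f the product \<theta> f is a limit of admissible test functions, so h \<theta> is orthogonal to
  all bounded continuous functions and vanishes; \<theta> > 0 on the open box gives h = 0. Test
  functions are confined to U so that the lemma also applies off the support of a function.\<close>

lemma fundamental_lemma:
  assumes \<Omega>: "openin (Rn n) \<Omega>" and h: "h \<in> Lp_loc n 1 \<Omega>" and U: "openin (Rn n) U" "U \<subseteq> \<Omega>"
    and orth: "\<And>\<phi> L. \<phi> \<in> Cc_inf n \<Omega> \<Longrightarrow> compactin (Rn n) L \<Longrightarrow> L \<subseteq> U \<Longrightarrow>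
      (\<And>x. x \<in> \<Omega> \<Longrightarrow> x \<notin> L \<Longrightarrow> \<phi> x = 0) \<Longrightarrow> (LINT x:\<Omega>|Leb n. h x * \<phi> x) = 0"
  shows "AE x in Leb n. x \<in> U \<longrightarrow> h x = 0"
proof (rule AE_countable_boxes[OF U(1)])
  fix c e assume c: "c \<in> pts n" "0 < e" "clbox n c e \<subseteq> U"
  let ?K = "clbox n c e"
  have KO: "?K \<subseteq> \<Omega>" using c(3) U(2) by (rule order_trans)
  define \<theta> where "\<theta> = (\<lambda>x. mk n e x c)"
  have \<theta>c: "cont_on n A \<theta>" if "A \<subseteq> pts n" for A
    unfolding \<theta>_def by (rule pker_cont_on[where \<beta>="\<lambda>_. moll e" and e=e, OF moll(1)[OF c(2)] that])
  have \<theta>0: "\<theta> x = 0" if xK: "x \<in> pts n" "x \<notin> ?K" for x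
  proof -
    obtain i where i: "i < n" "\<not> \<bar>x i - c i\<bar> \<le> e" using xK unfolding clbox_def by blast
    from i(2) have "e \<le> \<bar>x i - c i\<bar>" by simp
    with i(1) show ?thesis unfolding \<theta>_def by (rule pker_zero[where \<beta>="\<lambda>_. moll e" and e=e, OF moll(1)[OF c(2)]])
  qed
  have \<theta>p: "0 < \<theta> x" if "x \<in> obox n c e" for x
    unfolding \<theta>_def pker_def using that moll(4)[OF c(2)] by (intro prod_pos) (auto simp: obox_def)
  have int: "(LINT x:\<Omega>|Leb n. h x * (\<theta> x * f x)) = 0" if f: "cont_on n (pts n) f" for f
  proof -
    have cf: "cont_on n \<Omega> (\<lambda>x. \<theta> x * f x)"
      by (intro cont_on_mult \<theta>c openin_subset_pts[OF \<Omega>] cont_on_subset[OF f])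
    have z: "\<theta> x * f x = 0" if "x \<in> \<Omega>" "x \<notin> ?K" for x
      using \<theta>0[OF subsetD[OF openin_subset_pts[OF \<Omega>] that(1)] that(2)] by simp
    obtain K' d where cc: "cc_fun n \<Omega> U (\<lambda>x. \<theta> x * f x) ?K K' d"
      using cc_fun_exists[OF \<Omega> cf compactin_clbox c(3) U z] by blast
    interpret cc_fun n \<Omega> U "\<lambda>x. \<theta> x * f x" ?K K' d by (rule cc)
    have "eventually (\<lambda>k. (LINT x:\<Omega>|Leb n. h x * app k x) = 0) sequentially"
      using eventually_eps_less[OF e]
    proof eventually_elim
      case (elim k)
      show ?case
      proof (rule orth[OF app_Cc_inf K' cc_fun.U(1)[OF cc]])
        show "eps k \<le> d" using elim by simp
        fix x assume x: "x \<in> \<Omega>" "x \<notin> K'"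
        then show "app k x = 0" using app_support[of k x] elim subsetD[OF subK(4) x(1)] by simp
      qed
    qed
    then have "(\<lambda>k. LINT x:\<Omega>|Leb n. h x * app k x) \<longlonglongrightarrow> 0" by (rule tendsto_eventually)
    then show ?thesis using app_integral_tendsto[OF h] LIMSEQ_unique by blast
  qed
  have ih: "integrable (Leb n) (\<lambda>x. indicator ?K x * (h x * \<theta> x))"
    using Lp_loc_1_integrable[OF Lp_loc_1_mult_cont[OF \<Omega> h \<theta>c[OF openin_subset_pts[OF \<Omega>]]] compactin_clbox KO] .
  obtain H' where H': "H' \<in> borel_measurable (lbo n)" "AE x in lbo n. indicator ?K x * (h x * \<theta> x) = H' x"
    using completion_ex_borel_measurable_real[OF borel_measurable_integrable[OF ih]] by blast
  \<comment> \<open>h is measurable only for the completed measure, whereas the density argument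
    takes place in \<open>lbo n\<close>; so a Borel representative, cut to the box, replaces h
    \<theta>.\<close>
  define H where "H = (\<lambda>x. indicator ?K x * H' x)"
  have Hm: "H \<in> borel_measurable (lbo n)" unfolding H_def using H'(1) sets_clbox by (intro borel_measurable_times borel_measurable_indicator)
  have He: "AE x in Leb n. indicator ?K x * (h x * \<theta> x) = H x"
    using AE_completion[OF H'(2)] by eventually_elim (auto simp: H_def indicator_def)
  have iH: "integrable (lbo n) H"
  proof -
    have "integrable (Leb n) H" using ih integrable_cong_AE[OF borel_measurable_integrable[OF ih] measurable_completion[OF Hm] He] by simp
    then show ?thesis using integrable_completion[OF Hm] by simp
  qed
  have "AE x in lbo n. H x = 0"
  proof (rule orthogonal_to_continuous_zero[OF iH compactin_clbox])
    show "x \<notin> ?K \<Longrightarrow> H x = 0" for x by (simp add: H_def)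
    fix f B assume f: "cont_on n (pts n) f" "\<And>x. \<bar>f x\<bar> \<le> (B::real)"
    have Hf: "(\<lambda>x. H x * f x) \<in> borel_measurable (lbo n)" using Hm cont_on_pts_measurable[OF f(1)] by (rule borel_measurable_times)
    have "(\<integral>x. H x * f x \<partial>lbo n) = (\<integral>x. H x * f x \<partial>Leb n)" using integral_completion[OF Hf] by simp
    also have "\<dots> = (\<integral>x. (indicator ?K x * (h x * \<theta> x)) * f x \<partial>Leb n)"
    proof (rule integral_cong_AE)
      show "AE x in Leb n. H x * f x = (indicator ?K x * (h x * \<theta> x)) * f x" using He by eventually_elim simp
      show "(\<lambda>x. (indicator ?K x * (h x * \<theta> x)) * f x) \<in> borel_measurable (Leb n)"
        by (rule borel_measurable_times[OF borel_measurable_integrable[OF ih] measurable_completion[OF cont_on_pts_measurable[OF f(1)]]])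
    qed (rule measurable_completion[OF Hf])
    also have "\<dots> = (LINT x:\<Omega>|Leb n. h x * (\<theta> x * f x))"
      unfolding set_lebesgue_integral_def
    proof (intro Bochner_Integration.integral_cong refl)
      fix x assume "x \<in> space (Leb n)"
      then have "x \<in> pts n" by (simp add: space_PiM)
      then show "(indicator ?K x * (h x * \<theta> x)) * f x = indicator \<Omega> x *\<^sub>R (h x * (\<theta> x * f x))"
        using \<theta>0[of x] KO by (cases "x \<in> ?K") (auto simp: indicator_def)
    qed
    also have "\<dots> = 0" by (rule int[OF f(1)])
    finally show "(\<integral>x. H x * f x \<partial>lbo n) = 0" .
  qed
  from AE_completion[OF this] He show "AE y in Leb n. y \<in> obox n c e \<longrightarrow> h y = 0"
  proof eventually_elim
    case (elim x)
    show ?case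
    proof
      assume x: "x \<in> obox n c e"
      then have "x \<in> ?K" using obox_subset_clbox by (rule subsetD[rotated])
      then show "h x = 0" using elim \<theta>p[OF x] by simp
    qed
  qed
qed

lemma weak_partialD:
  assumes "weak_partial n \<Omega> i f g"
  shows "f \<in> Lp_loc n 1 \<Omega>" "g \<in> Lp_loc n 1 \<Omega>"
    "\<And>\<phi>. \<phi> \<in> Cc_inf n \<Omega> \<Longrightarrow> (LINT x:\<Omega>|Leb n. f x * partial i \<phi> x) = - (LINT x:\<Omega>|Leb n. g x * \<phi> x)"
  using assms unfolding weak_partial_def by blast+

lemma test_integrable:
  assumes "openin (Rn n) \<Omega>" "h \<in> Lp_loc n 1 \<Omega>" "\<phi> \<in> Cc n \<Omega>"
  shows "set_integrable (Leb n) \<Omega> (\<lambda>x. h x * \<phi> x)"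
proof -
  obtain K where K: "compactin (Rn n) K" "K \<subseteq> \<Omega>" "\<And>x. x \<in> \<Omega> \<Longrightarrow> x \<notin> K \<Longrightarrow> \<phi> x = 0"
    using Cc_support[OF assms(1,3)] by blast
  have "cont_on n \<Omega> \<phi>" using assms(3) by (simp add: Cc_def)
  from Lp_loc_1_integrable[OF Lp_loc_1_mult_cont[OF assms(1,2) this] K(1,2)]
  have "integrable (Leb n) (\<lambda>x. indicator K x * (h x * \<phi> x))" .
  moreover have "indicator K x * (h x * \<phi> x) = indicator \<Omega> x *\<^sub>R (h x * \<phi> x)" for x
    using K(2) K(3)[of x] by (auto simp: indicator_def)
  ultimately show ?thesis unfolding set_integrable_def by simp
qed

lemma weak_partial_unique:
  assumes \<Omega>: "openin (Rn n) \<Omega>" and g: "weak_partial n \<Omega> i f g" "weak_partial n \<Omega> i f g'"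
  shows "AE x in Leb n. x \<in> \<Omega> \<longrightarrow> g x = g' x"
proof -
  have m: "(\<lambda>x. g' x * - 1) \<in> Lp_loc n 1 \<Omega>"
    by (rule Lp_loc_1_mult_cont[OF \<Omega> weak_partialD(2)[OF g(2)] cont_on_const])
  have "AE x in Leb n. x \<in> \<Omega> \<longrightarrow> g x + g' x * - 1 = 0"
  proof (rule fundamental_lemma[OF \<Omega> Lp_loc_1_add[OF weak_partialD(2)[OF g(1)] m] \<Omega> order_refl])
    fix \<phi> assume \<phi>: "\<phi> \<in> Cc_inf n \<Omega>"
    then have c: "\<phi> \<in> Cc n \<Omega>" by (simp add: Cc_inf_def)
    have "(LINT x:\<Omega>|Leb n. g x * \<phi> x - g' x * \<phi> x) = (LINT x:\<Omega>|Leb n. g x * \<phi> x) - (LINT x:\<Omega>|Leb n. g' x * \<phi> x)"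
      by (intro set_integral_diff test_integrable[OF \<Omega> _ c] weak_partialD(2)[OF g(1)] weak_partialD(2)[OF g(2)])
    also have "\<dots> = 0" using weak_partialD(3)[OF g(1) \<phi>] weak_partialD(3)[OF g(2) \<phi>] by simp
    finally show "(LINT x:\<Omega>|Leb n. (g x + g' x * - 1) * \<phi> x) = 0" by (simp add: left_diff_distrib)
  qed
  then show ?thesis by eventually_elim auto
qed

subsection \<open>Mollified weak derivatives\<close>

lemma moll_derivative:
  assumes "0 < e"
  shows "\<exists>\<rho>'. bump e \<rho>' \<and> (\<forall>t. (moll e has_real_derivative \<rho>' t) (at t)) \<and> (\<forall>t. \<rho>' (- t) = - \<rho>' t)"
proof -
  obtain \<rho>' where r: "bump e \<rho>'" "\<And>t. (moll e has_real_derivative \<rho>' t) (at t)"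
    using bump_derivative[OF moll(1)[OF assms]] by blast
  have "\<rho>' (- t) = - \<rho>' t" for t
  proof -
    have "((\<lambda>t. moll e (- t)) has_real_derivative \<rho>' (- t) * - 1) (at t)"
      by (rule DERIV_chain2[OF r(2)]) (auto intro!: derivative_eq_intros)
    then have "(moll e has_real_derivative \<rho>' (- t) * - 1) (at t)" by (simp add: moll(2)[OF assms])
    from DERIV_unique[OF this r(2)] show ?thesis by simp
  qed
  then show ?thesis using r by blast
qed

text \<open>The bridge from the completed measure back to the product measure, with the zero
  extension off K made exact rather than almost everywhere.\<close>

lemma borel_representative:
  fixes g :: "pt \<Rightarrow> real"
  assumes K: "compactin (Rn n) K" and g: "set_borel_measurable (Leb n) K g"
  shows "\<exists>g0. g0 \<in> borel_measurable (lbo n) \<and> (AE x in Leb n. indicator K x * g x = g0 x) \<and> (\<forall>x. x \<notin> K \<longrightarrow> g0 x = 0)"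
proof -
  have "(\<lambda>x. indicator K x * g x) \<in> borel_measurable (Leb n)" using g unfolding set_borel_measurable_def by simp
  then obtain h where h: "h \<in> borel_measurable (lbo n)" "AE x in lbo n. indicator K x * g x = h x"
    using completion_ex_borel_measurable_real by blast
  have "(\<lambda>x. indicator K x * h x) \<in> borel_measurable (lbo n)"
    by (rule borel_measurable_times[OF borel_measurable_indicator[OF sets_compactin[OF K]] h(1)])
  moreover have "AE x in Leb n. indicator K x * g x = indicator K x * h x"
    using AE_completion[OF h(2)] by eventually_elim (auto simp: indicator_def)
  ultimately show ?thesis by (intro exI[of _ "\<lambda>x. indicator K x * h x"]) auto
qed

lemma integral_Leb_lbo:
  fixes f g :: "pt \<Rightarrow> real"
  assumes "f \<in> borel_measurable (Leb n)" "g \<in> borel_measurable (lbo n)" "AE x in Leb n. f x = g x"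
  shows "(\<integral>x. f x \<partial>Leb n) = (\<integral>x. g x \<partial>lbo n)" "integrable (Leb n) f \<longleftrightarrow> integrable (lbo n) g"
proof -
  show "(\<integral>x. f x \<partial>Leb n) = (\<integral>x. g x \<partial>lbo n)"
    using integral_cong_AE[OF assms(1) measurable_completion[OF assms(2)] assms(3)] integral_completion[OF assms(2)] by simp
  show "integrable (Leb n) f \<longleftrightarrow> integrable (lbo n) g"
    using integrable_cong_AE[OF assms(1) measurable_completion[OF assms(2)] assms(3)] integrable_completion[OF assms(2)] by simp
qed

lemma measurable_Leb_cong_AE:
  assumes "f \<in> borel_measurable (Leb n)" "AE x in Leb n. f x = (g x :: real)"
  shows "g \<in> borel_measurable (Leb n)"
proof (rule measurableI)
  fix S :: "real set" assume S: "S \<in> sets borel"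
  show "g -` S \<inter> space (Leb n) \<in> sets (Leb n)"
  proof (rule completion.in_sets_AE)
    show "AE x in Leb n. x \<in> f -` S \<inter> space (Leb n) \<longleftrightarrow> x \<in> g -` S \<inter> space (Leb n)"
      using assms(2) by eventually_elim auto
  qed (use measurable_sets[OF assms(1) S] in auto)
qed simp

section \<open>Classical partial derivatives on an open set\<close>

lemma line_in_open:
  assumes "openin (Rn n) V" "x \<in> V" "j < n"
  shows "eventually (\<lambda>t. x(j := t) \<in> V) (nhds (x j))"
proof -
  obtain d where d: "d > 0" "obox n x d \<subseteq> V" using openin_RnD[OF assms(1,2)] by blast
  have x: "x \<in> pts n" using openin_subset_pts[OF assms(1)] assms(2) by (rule subsetD)
  have "x(j := t) \<in> V" if t: "dist t (x j) < d" for t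
  proof -
    have "x(j := t) \<in> pts n" using x assms(3) by (auto simp: PiE_def extensional_def)
    then have "x(j := t) \<in> obox n x d" using t d(1) by (auto simp: obox_def dist_real_def)
    then show ?thesis using d(2) by (rule subsetD[rotated])
  qed
  then show ?thesis unfolding eventually_nhds_metric using d(1) by blast
qed

lemma partial_cong:
  assumes "openin (Rn n) V" "x \<in> V" "j < n" "\<And>y. y \<in> V \<Longrightarrow> f y = g y"
  shows "partial j f x = partial j g x"
  unfolding partial_def
proof (rule deriv_cong_ev[OF _ refl])
  show "eventually (\<lambda>t. f (x(j := t)) = g (x(j := t))) (nhds (x j))"
    using line_in_open[OF assms(1-3)] by eventually_elim (rule assms(4))
qed

lemma partial_zero_off_support:
  assumes "openin (Rn n) \<Omega>" "compactin (Rn n) K" "x \<in> \<Omega>" "x \<notin> K" "j < n" "\<And>y. y \<in> \<Omega> \<Longrightarrow> y \<notin> K \<Longrightarrow> f y = 0"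
  shows "partial j f x = 0"
proof -
  have o: "openin (Rn n) (\<Omega> - K)" using assms(1) closedin_compactin[OF assms(2)] by (rule openin_diff)
  have "partial j f x = partial j (\<lambda>_. 0) x"
    by (rule partial_cong[OF o _ assms(5)]) (use assms(3,4,6) in auto)
  then show ?thesis by (simp add: partial_def)
qed

lemma differentiable_cong_line:
  fixes f g :: "pt \<Rightarrow> real"
  assumes "openin (Rn n) V" "x \<in> V" "j < n" "\<And>y. y \<in> V \<Longrightarrow> f y = g y"
    "(\<lambda>t. f (x(j := t))) differentiable (at (x j))"
  shows "(\<lambda>t. g (x(j := t))) differentiable (at (x j))"
proof -
  obtain D where D: "((\<lambda>t. f (x(j := t))) has_real_derivative D) (at (x j))"
    using assms(5) real_differentiable_def by blast
  have "eventually (\<lambda>t. f (x(j := t)) = g (x(j := t))) (nhds (x j))"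
    using line_in_open[OF assms(1-3)] by eventually_elim (rule assms(4))
  from iffD1[OF DERIV_cong_ev[OF refl this refl] D]
  have "((\<lambda>t. g (x(j := t))) has_real_derivative D) (at (x j))" .
  then show ?thesis using real_differentiable_def by blast
qed

lemma Ck_cong:
  assumes \<Omega>: "openin (Rn n) \<Omega>"
  shows "(\<And>x. x \<in> \<Omega> \<Longrightarrow> f x = g x) \<Longrightarrow> Ck n \<Omega> k f \<Longrightarrow> Ck n \<Omega> k g"
proof (induction k arbitrary: f g)
  case 0
  then show ?case using cont_on_cong[of \<Omega> f g n] by simp
next
  case (Suc k)
  have "(\<forall>x\<in>\<Omega>. (\<lambda>t. g (x(i := t))) differentiable (at (x i))) \<and> Ck n \<Omega> k (partial i g)" if i: "i < n" for i
  proof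
    show "\<forall>x\<in>\<Omega>. (\<lambda>t. g (x(i := t))) differentiable (at (x i))"
    proof
      fix x assume x: "x \<in> \<Omega>"
      show "(\<lambda>t. g (x(i := t))) differentiable (at (x i))"
        by (rule differentiable_cong_line[where f=f, OF \<Omega> x i Suc.prems(1)]) (use Suc.prems(2) i x in auto)
    qed
    show "Ck n \<Omega> k (partial i g)"
    proof (rule Suc.IH[of "partial i f"])
      show "partial i f x = partial i g x" if "x \<in> \<Omega>" for x
        by (rule partial_cong[where f=f and g=g, OF \<Omega> that i Suc.prems(1)])
    qed (use Suc.prems(2) i in auto)
  qed
  moreover have "cont_on n \<Omega> g" using cont_on_cong[of \<Omega> f g n] Suc.prems by simp
  ultimately show ?case by simp
qed

lemma Ck_Suc_imp: "Ck n \<Omega> (Suc k) f \<Longrightarrow> Ck n \<Omega> k f"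
  by (induction k arbitrary: f) auto

lemma partial_has_derivative:
  assumes "(\<lambda>t. f (x(i := t))) differentiable (at (x i))"
  shows "((\<lambda>t. f (x(i := t))) has_real_derivative partial i f x) (at (x i))"
  using assms unfolding partial_def by (simp add: DERIV_deriv_iff_real_differentiable)

lemma partial_add:
  assumes "(\<lambda>t. f (x(i := t))) differentiable (at (x i))" "(\<lambda>t. g (x(i := t))) differentiable (at (x i))"
  shows "partial i (\<lambda>x. f x + g x) x = partial i f x + partial i g x"
  using DERIV_imp_deriv[OF DERIV_add[OF partial_has_derivative[OF assms(1)] partial_has_derivative[OF assms(2)]]]
  unfolding partial_def .

lemma partial_mult:
  assumes "(\<lambda>t. f (x(i := t))) differentiable (at (x i))" "(\<lambda>t. g (x(i := t))) differentiable (at (x i))"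
  shows "partial i (\<lambda>x. f x * g x) x = partial i f x * g x + f x * partial i g x"
proof -
  have "deriv (\<lambda>t. f (x(i := t)) * g (x(i := t))) (x i) = partial i f x * g (x(i := x i)) + partial i g x * f (x(i := x i))"
    by (rule DERIV_imp_deriv[OF DERIV_mult[OF partial_has_derivative[OF assms(1)] partial_has_derivative[OF assms(2)]]])
  then show ?thesis unfolding partial_def[of i "\<lambda>x. f x * g x"] by (simp add: mult.commute)
qed

lemma Ck_add:
  assumes \<Omega>: "openin (Rn n) \<Omega>"
  shows "Ck n \<Omega> k f \<Longrightarrow> Ck n \<Omega> k g \<Longrightarrow> Ck n \<Omega> k (\<lambda>x. f x + g x)"
proof (induction k arbitrary: f g)
  case 0 then show ?case by (simp add: cont_on_add)
next
  case (Suc k)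
  have "(\<forall>x\<in>\<Omega>. (\<lambda>t. f (x(i := t)) + g (x(i := t))) differentiable (at (x i))) \<and> Ck n \<Omega> k (partial i (\<lambda>x. f x + g x))" if i: "i < n" for i
  proof
    have d: "(\<lambda>t. f (x(i := t))) differentiable (at (x i))" "(\<lambda>t. g (x(i := t))) differentiable (at (x i))" if "x \<in> \<Omega>" for x
      using Suc.prems i that by auto
    show "\<forall>x\<in>\<Omega>. (\<lambda>t. f (x(i := t)) + g (x(i := t))) differentiable (at (x i))"
      using d by (intro ballI differentiable_add)
    show "Ck n \<Omega> k (partial i (\<lambda>x. f x + g x))"
      by (rule Ck_cong[OF \<Omega> _ Suc.IH[of "partial i f" "partial i g"]])
         (use partial_add[where f=f and g=g, OF d] Suc.prems i in auto)
  qed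
  then show ?case using Suc.prems by (simp add: cont_on_add)
qed

lemma Ck_mult:
  assumes \<Omega>: "openin (Rn n) \<Omega>"
  shows "Ck n \<Omega> k f \<Longrightarrow> Ck n \<Omega> k g \<Longrightarrow> Ck n \<Omega> k (\<lambda>x. f x * g x)"
proof (induction k arbitrary: f g)
  case 0 then show ?case by (simp add: cont_on_mult)
next
  case (Suc k)
  have "(\<forall>x\<in>\<Omega>. (\<lambda>t. f (x(i := t)) * g (x(i := t))) differentiable (at (x i))) \<and> Ck n \<Omega> k (partial i (\<lambda>x. f x * g x))" if i: "i < n" for i
  proof
    have d: "(\<lambda>t. f (x(i := t))) differentiable (at (x i))" "(\<lambda>t. g (x(i := t))) differentiable (at (x i))" if "x \<in> \<Omega>" for x
      using Suc.prems i that by auto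
    show "\<forall>x\<in>\<Omega>. (\<lambda>t. f (x(i := t)) * g (x(i := t))) differentiable (at (x i))"
      using d by (intro ballI differentiable_mult)
    have "Ck n \<Omega> k (\<lambda>x. partial i f x * g x)" "Ck n \<Omega> k (\<lambda>x. f x * partial i g x)"
      using Suc.IH Suc.prems Ck_Suc_imp[OF Suc.prems(1)] Ck_Suc_imp[OF Suc.prems(2)] i by auto
    from Ck_add[OF \<Omega> this] show "Ck n \<Omega> k (partial i (\<lambda>x. f x * g x))"
      by (rule Ck_cong[OF \<Omega> _, rotated]) (simp add: partial_mult[where f=f and g=g, OF d])
  qed
  then show ?case using Suc.prems by (simp add: cont_on_mult)
qed

lemma Cc_infD:
  assumes "\<phi> \<in> Cc_inf n \<Omega>"
  shows "\<phi> \<in> Cc n \<Omega>" "cont_on n \<Omega> \<phi>" "Ck n \<Omega> k \<phi>"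
    "i < n \<Longrightarrow> x \<in> \<Omega> \<Longrightarrow> (\<lambda>t. \<phi> (x(i := t))) differentiable (at (x i))"
proof -
  show "\<phi> \<in> Cc n \<Omega>" "cont_on n \<Omega> \<phi>" and k: "Ck n \<Omega> k \<phi>" for k
    using assms unfolding Cc_inf_def Cc_def by auto
  show "i < n \<Longrightarrow> x \<in> \<Omega> \<Longrightarrow> (\<lambda>t. \<phi> (x(i := t))) differentiable (at (x i))" using k[of "Suc 0"] by simp
qed

lemma Cc_mult:
  assumes \<Omega>: "openin (Rn n) \<Omega>" and "f \<in> Cc n \<Omega>" "cont_on n \<Omega> g"
  shows "(\<lambda>x. g x * f x) \<in> Cc n \<Omega>"
proof -
  obtain K where K: "compactin (Rn n) K" "K \<subseteq> \<Omega>" "\<And>x. x \<in> \<Omega> \<Longrightarrow> x \<notin> K \<Longrightarrow> f x = 0"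
    using Cc_support[OF \<Omega> assms(2)] by blast
  have "cont_on n \<Omega> (\<lambda>x. g x * f x)" using assms(2,3) by (intro cont_on_mult) (auto simp: Cc_def)
  then show ?thesis by (rule CcI[OF \<Omega> _ K(1,2)]) (simp add: K(3))
qed

lemma Cc_inf_mult:
  assumes \<Omega>: "openin (Rn n) \<Omega>" and f: "f \<in> Cc_inf n \<Omega>" and g: "g \<in> Cc_inf n \<Omega>"
  shows "(\<lambda>x. f x * g x) \<in> Cc_inf n \<Omega>"
  using Cc_mult[OF \<Omega> Cc_infD(1)[OF g] Cc_infD(2)[OF f]] Ck_mult[OF \<Omega> Cc_infD(3)[OF f] Cc_infD(3)[OF g]]
  by (simp add: Cc_inf_def)

lemma partial_Cc:
  assumes \<Omega>: "openin (Rn n) \<Omega>" and f: "f \<in> Cc_inf n \<Omega>" and j: "j < n"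
  shows "partial j f \<in> Cc n \<Omega>"
proof -
  obtain K where K: "compactin (Rn n) K" "K \<subseteq> \<Omega>" "\<And>x. x \<in> \<Omega> \<Longrightarrow> x \<notin> K \<Longrightarrow> f x = 0"
    using Cc_support[OF \<Omega> Cc_infD(1)[OF f]] by blast
  have "cont_on n \<Omega> (partial j f)" using Cc_infD(3)[OF f, of "Suc 0"] j by simp
  then show ?thesis
    by (rule CcI[OF \<Omega> _ K(1,2)]) (rule partial_zero_off_support[OF \<Omega> K(1) _ _ j K(3)])
qed

section \<open>Mollification commutes with weak differentiation\<close>

context cc_fun
begin

text \<open>A test function supported in \<Omega> - K has zero derivatives on K, and w is zero off
  K. Their pairing vanishes, so the fundamental lemma applies on \<Omega> - K.\<close>

lemma weak_partial_support:
  assumes g: "weak_partial n \<Omega> j w g" and j: "j < n"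
  shows "AE x in Leb n. x \<in> \<Omega> - K \<longrightarrow> g x = 0"
proof (rule fundamental_lemma[OF \<Omega> weak_partialD(2)[OF g]])
  show "openin (Rn n) (\<Omega> - K)" using \<Omega> closedin_compactin[OF K] by (rule openin_diff)
  show "\<Omega> - K \<subseteq> \<Omega>" by (rule Diff_subset)
  fix \<phi> L assume \<phi>: "\<phi> \<in> Cc_inf n \<Omega>" and L: "compactin (Rn n) L" "L \<subseteq> \<Omega> - K" "\<And>x. x \<in> \<Omega> \<Longrightarrow> x \<notin> L \<Longrightarrow> \<phi> x = 0"
  have "w x * partial j \<phi> x = 0" if x: "x \<in> \<Omega>" for x
  proof (cases "x \<in> K")
    case True
    then have "x \<notin> L" using L(2) by blast
    then have "partial j \<phi> x = 0" by (rule partial_zero_off_support[OF \<Omega> L(1) x _ j L(3)])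
    then show ?thesis by simp
  qed (simp add: wK[OF x])
  then have "(LINT x:\<Omega>|Leb n. w x * partial j \<phi> x) = (LINT x:\<Omega>|Leb n. 0)"
    unfolding set_lebesgue_integral_def by (intro Bochner_Integration.integral_cong refl) (auto simp: indicator_def)
  then have "(LINT x:\<Omega>|Leb n. w x * partial j \<phi> x) = 0" unfolding set_lebesgue_integral_def by simp
  then show "(LINT x:\<Omega>|Leb n. g x * \<phi> x) = 0" using weak_partialD(3)[OF g \<phi>] by simp
qed

lemma weak_partial_representative:
  assumes g: "weak_partial n \<Omega> j w g" and j: "j < n"
  shows "\<exists>g0. g0 \<in> borel_measurable (lbo n) \<and> integrable (lbo n) g0 \<and> (\<forall>x. x \<notin> K \<longrightarrow> g0 x = 0) \<and>
     (AE x in Leb n. indicator \<Omega> x * g x = g0 x)"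
proof -
  note i = Lp_loc_1_integrable[OF weak_partialD(2)[OF g] K subK(3)]
  have "set_borel_measurable (Leb n) K g" using borel_measurable_integrable[OF i] unfolding set_borel_measurable_def by simp
  then obtain g0 where g0: "g0 \<in> borel_measurable (lbo n)" "AE x in Leb n. indicator K x * g x = g0 x" "\<forall>x. x \<notin> K \<longrightarrow> g0 x = 0"
    using borel_representative[OF K] by blast
  have "AE x in Leb n. indicator \<Omega> x * g x = g0 x"
    using g0(2) weak_partial_support[OF g j]
  proof eventually_elim
    case (elim x)
    then show ?case using subK(3) by (cases "x \<in> K") (auto simp: indicator_def split: if_splits)
  qed
  moreover have "integrable (lbo n) g0" using integral_Leb_lbo(2)[OF borel_measurable_integrable[OF i] g0(1,2)] i by simp
  ultimately show ?thesis using g0 by blast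
qed

text \<open>For fixed x the kernel is a test function in its other variable, provided the eps-box
  around x stays in \<Omega>. This holds when x is within eps of K, because 2 eps \<le> e; if x is
  farther from K, both sides are 0.\<close>

lemma app_partial:
  assumes g: "weak_partial n \<Omega> j w g" and j: "j < n" and g0: "g0 \<in> borel_measurable (lbo n)"
    "\<And>x. x \<notin> K \<Longrightarrow> g0 x = 0" "AE x in Leb n. indicator \<Omega> x * g x = g0 x" and k: "2 * eps k \<le> e" and x: "x \<in> pts n"
  shows "partial j (app k) x = mconv n (eps k) g0 x"
proof -
  let ?e = "eps k"
  note ep = eps_pos[of k]
  obtain \<rho>' where r: "bump ?e \<rho>'" "\<And>t. (moll ?e has_real_derivative \<rho>' t) (at t)" "\<And>t. \<rho>' (- t) = - \<rho>' t"
    using moll_derivative[OF ep] by blast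
  let ?\<beta> = "(\<lambda>_::nat. moll ?e)"
  let ?\<gamma> = "?\<beta>(j := \<rho>')"
  have b: "bump ?e (?\<beta> i)" for i using moll(1)[OF ep] .
  have pa: "partial j (app k) = pconv n ?\<gamma> (zext \<Omega> w)"
    unfolding app_def by (rule pconv_partial[where \<beta>="?\<beta>" and \<beta>'=\<rho>' and e="?e", OF b j r(2) r(1) zext_integrable])
  \<comment> \<open>The derived profile is odd and the others are even. Exchanging the variables
    therefore changes the sign, which cancels the minus sign in the definition of the weak
    derivative.\<close>
  have odd: "pker n ?\<gamma> x y = - pker n ?\<gamma> y x" for y
  proof -
    have "(\<Prod>i\<in>{..<n} - {j}. ?\<gamma> i (x i - y i)) = (\<Prod>i\<in>{..<n} - {j}. ?\<gamma> i (y i - x i))"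
      using moll(2)[OF ep, of "x _ - y _"] by (intro prod.cong refl) auto
    moreover have "?\<gamma> j (x j - y j) = - ?\<gamma> j (y j - x j)" using r(3)[of "x j - y j"] by simp
    ultimately show ?thesis unfolding pker_def using j by (simp add: prod.remove[of "{..<n}" j])
  qed
  show ?thesis
  proof (cases "\<exists>y\<in>K. x \<in> clbox n y ?e")
    case True
    then obtain y where y: "y \<in> K" "x \<in> clbox n y ?e" by blast
    have sub: "clbox n x ?e \<subseteq> \<Omega>"
    proof
      fix z assume z: "z \<in> clbox n x ?e"
      have "\<bar>z i - y i\<bar> \<le> e" if i: "i < n" for i
      proof -
        have "\<bar>z i - x i\<bar> \<le> ?e" "\<bar>x i - y i\<bar> \<le> ?e" using z y i unfolding clbox_def by auto
        then show ?thesis using k by linarith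
      qed
      then have "z \<in> clbox n y e" using z unfolding clbox_def by simp
      then show "z \<in> \<Omega>" using subsetD[OF subK(2) subsetD[OF KK'[OF y(1)]]] by blast
    qed
    define \<phi> where "\<phi> = (\<lambda>z. mk n ?e z x)"
    have \<phi>: "\<phi> \<in> Cc_inf n \<Omega>" unfolding \<phi>_def by (rule pker_Cc_inf[where \<beta>="?\<beta>" and e="?e", OF b sub subK(4)])
    have dp: "partial j \<phi> = (\<lambda>z. pker n ?\<gamma> z x)"
      unfolding \<phi>_def by (rule pker_partial[where \<beta>="?\<beta>" and \<beta>'=\<rho>' and e="?e", OF b j r(2) r(1)])
    have mg: "bump ?e (?\<gamma> i)" for i using b r(1) by simp
    have m1: "(\<lambda>z. pker n ?\<gamma> x z * zext \<Omega> w z) \<in> borel_measurable (lbo n)"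
      by (rule borel_measurable_times[OF pker_measurable(1)[where \<beta>="?\<gamma>" and e="?e", OF mg] zext_measurable])
    have "pconv n ?\<gamma> (zext \<Omega> w) x = (\<integral>z. pker n ?\<gamma> x z * zext \<Omega> w z \<partial>Leb n)"
      unfolding pconv_def using integral_completion[OF m1] by simp
    also have "\<dots> = (\<integral>z. - (indicator \<Omega> z *\<^sub>R (w z * partial j \<phi> z)) \<partial>Leb n)"
      by (intro Bochner_Integration.integral_cong refl) (simp add: odd dp zext_def)
    also have "\<dots> = - (LINT z:\<Omega>|Leb n. w z * partial j \<phi> z)" unfolding set_lebesgue_integral_def by simp
    also have "\<dots> = (LINT z:\<Omega>|Leb n. g z * \<phi> z)" using weak_partialD(3)[OF g \<phi>] by simp
    also have "\<dots> = (\<integral>z. mk n ?e x z * g0 z \<partial>lbo n)"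
      unfolding set_lebesgue_integral_def
    proof (rule integral_Leb_lbo(1))
      have "set_integrable (Leb n) \<Omega> (\<lambda>z. g z * \<phi> z)"
        by (rule test_integrable[OF \<Omega> weak_partialD(2)[OF g] Cc_infD(1)[OF \<phi>]])
      then show "(\<lambda>z. indicator \<Omega> z *\<^sub>R (g z * \<phi> z)) \<in> borel_measurable (Leb n)"
        unfolding set_integrable_def by (rule borel_measurable_integrable)
      show "(\<lambda>z. mk n ?e x z * g0 z) \<in> borel_measurable (lbo n)"
        by (rule borel_measurable_times[OF mk_measurable(1)[OF ep] g0(1)])
      show "AE z in Leb n. indicator \<Omega> z *\<^sub>R (g z * \<phi> z) = mk n ?e x z * g0 z"
        using g0(3)
      proof eventually_elim
        case (elim z)
        show ?case unfolding elim[symmetric] \<phi>_def by (simp add: mk_sym[OF ep, of n x z])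
      qed
    qed
    finally show ?thesis unfolding pa by (simp add: pconv_def)
  next
    case False
    have mg: "bump ?e (?\<gamma> i)" for i using b r(1) by simp
    have "pconv n ?\<gamma> (zext \<Omega> w) x = 0"
      using pconv_support[where \<beta>="?\<gamma>" and e="?e" and K=K and F="zext \<Omega> w" and x=x, OF mg zext_zero _ x] False by blast
    moreover have "mconv n ?e g0 x = 0"
      using pconv_support[where \<beta>="?\<beta>" and e="?e" and K=K and F=g0 and x=x, OF b g0(2) _ x] False by blast
    ultimately show ?thesis unfolding pa by simp
  qed
qed

text \<open>K' contains a full box around each point of K, so cutting A off at K' does not disturb
  its continuity there.\<close>

lemma cont_at_interior:
  assumes A: "cont_on n \<Omega> A" and y: "y \<in> K"
  shows "cont_at n (\<lambda>x. indicator K' x * A x) y"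
  unfolding cont_at_def
proof (intro allI impI)
  fix r :: real assume r: "0 < r"
  have y\<Omega>: "y \<in> \<Omega>" using subsetD[OF subK(3) y] .
  obtain d where d: "d > 0" "\<forall>x\<in>\<Omega> \<inter> obox n y d. \<bar>A x - A y\<bar> < r"
    using A[unfolded cont_on_iff[OF subK(4)], rule_format, OF y\<Omega> r] by blast
  show "\<exists>d>0. \<forall>x\<in>obox n y d. \<bar>indicator K' x * A x - indicator K' y * A y\<bar> < r"
  proof (intro exI[of _ "min d e"] conjI ballI)
    fix x assume "x \<in> obox n y (min d e)"
    then have x: "x \<in> obox n y d" "x \<in> clbox n y e" by (auto simp: obox_def clbox_def)
    have "x \<in> K'" using subsetD[OF KK'[OF y] x(2)] .
    moreover have "y \<in> K'" using subsetD[OF subK(1) y] .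
    moreover have "x \<in> \<Omega>" using subsetD[OF subK(2) \<open>x \<in> K'\<close>] .
    ultimately show "\<bar>indicator K' x * A x - indicator K' y * A y\<bar> < r" using d(2) x(1) by simp
  qed (use d(1) e in auto)
qed

lemma app_partial_integral:
  fixes A A0 :: "pt \<Rightarrow> real"
  assumes g: "weak_partial n \<Omega> j w g" and j: "j < n" and g0: "g0 \<in> borel_measurable (lbo n)"
    "\<And>x. x \<notin> K \<Longrightarrow> g0 x = 0" "AE x in Leb n. indicator \<Omega> x * g x = g0 x" and k: "2 * eps k \<le> e"
    and A0: "A0 \<in> borel_measurable (lbo n)" "AE x in Leb n. indicator K' x * A x = A0 x" "set_borel_measurable (Leb n) K' A"
  shows "(LINT x:\<Omega>|Leb n. A x * partial j (app k) x) = (\<integral>x. A0 x * mconv n (eps k) g0 x \<partial>lbo n)"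
proof -
  have z: "partial j (app k) x = 0" if x: "x \<in> pts n" "x \<notin> K'" for x
  proof -
    have "eps k \<le> e" using k eps_pos[of k] by linarith
    from mconv_support[where F=g0, OF this g0(2) x] show ?thesis using app_partial[OF g j g0 k x(1)] by simp
  qed
  have "(LINT x:\<Omega>|Leb n. A x * partial j (app k) x) = (\<integral>x. (indicator K' x * A x) * mconv n (eps k) g0 x \<partial>Leb n)"
    unfolding set_lebesgue_integral_def
  proof (intro Bochner_Integration.integral_cong refl)
    fix x assume "x \<in> space (Leb n)"
    then have x: "x \<in> pts n" by (simp add: space_PiM)
    show "indicator \<Omega> x *\<^sub>R (A x * partial j (app k) x) = (indicator K' x * A x) * mconv n (eps k) g0 x"
      using z[OF x] app_partial[OF g j g0 k x] subK(2) by (cases "x \<in> K'") (auto simp: indicator_def)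
  qed
  also have "\<dots> = (\<integral>x. A0 x * mconv n (eps k) g0 x \<partial>lbo n)"
  proof (rule integral_Leb_lbo(1))
    note mm = mconv_measurable[OF eps_pos[of k] g0(1)]
    have "(\<lambda>x. indicator K' x * A x) \<in> borel_measurable (Leb n)" using A0(3) unfolding set_borel_measurable_def by simp
    then show "(\<lambda>x. (indicator K' x * A x) * mconv n (eps k) g0 x) \<in> borel_measurable (Leb n)"
      by (rule borel_measurable_times[OF _ measurable_completion[OF mm]])
    show "(\<lambda>x. A0 x * mconv n (eps k) g0 x) \<in> borel_measurable (lbo n)" by (rule borel_measurable_times[OF A0(1) mm])
    show "AE x in Leb n. (indicator K' x * A x) * mconv n (eps k) g0 x = A0 x * mconv n (eps k) g0 x"
      using A0(2) by eventually_elim simp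
  qed
  finally show ?thesis .
qed

lemma limit_integral:
  fixes g g0 A A0 :: "pt \<Rightarrow> real"
  assumes g0: "g0 \<in> borel_measurable (lbo n)" "\<And>x. x \<notin> K \<Longrightarrow> g0 x = 0" "AE x in Leb n. indicator \<Omega> x * g x = g0 x"
    and g: "set_borel_measurable (Leb n) \<Omega> g"
    and A0: "A0 \<in> borel_measurable (lbo n)" "AE x in Leb n. indicator K' x * A x = A0 x" "set_borel_measurable (Leb n) K' A"
  shows "(\<integral>x. A0 x * g0 x \<partial>lbo n) = (LINT x:\<Omega>|Leb n. A x * g x)"
proof -
  have ae: "AE x in Leb n. indicator \<Omega> x *\<^sub>R (A x * g x) = A0 x * g0 x"
    using g0(3) A0(2)
  proof eventually_elim
    case (elim x)
    show ?case
    proof (cases "x \<in> K")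
      case True
      then have "x \<in> K'" "x \<in> \<Omega>" using subsetD[OF subK(1) True] subsetD[OF subK(3) True] by auto
      then have "g x = g0 x" "A x = A0 x" using elim by simp_all
      then show ?thesis using \<open>x \<in> \<Omega>\<close> by simp
    next
      case False
      then show ?thesis using elim(1) g0(2)[OF False] by (auto simp: indicator_def split: if_splits)
    qed
  qed
  have m: "(\<lambda>x. A0 x * g0 x) \<in> borel_measurable (lbo n)" by (rule borel_measurable_times[OF A0(1) g0(1)])
  have "(\<integral>x. A0 x * g0 x \<partial>lbo n) = (\<integral>x. A0 x * g0 x \<partial>Leb n)" using integral_completion[OF m] by simp
  also have "\<dots> = (\<integral>x. (indicator K' x * A x) * (indicator \<Omega> x * g x) \<partial>Leb n)"
  proof (rule integral_cong_AE[OF measurable_completion[OF m]])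
    have "(\<lambda>x. indicator K' x * A x) \<in> borel_measurable (Leb n)" "(\<lambda>x. indicator \<Omega> x * g x) \<in> borel_measurable (Leb n)"
      using A0(3) g unfolding set_borel_measurable_def by auto
    then show "(\<lambda>x. (indicator K' x * A x) * (indicator \<Omega> x * g x)) \<in> borel_measurable (Leb n)"
      by (rule borel_measurable_times)
    show "AE x in Leb n. A0 x * g0 x = (indicator K' x * A x) * (indicator \<Omega> x * g x)"
      using g0(3) A0(2) by eventually_elim simp
  qed
  also have "\<dots> = (LINT x:\<Omega>|Leb n. A x * g x)"
    unfolding set_lebesgue_integral_def
  proof (rule integral_cong_AE)
    show m': "(\<lambda>x. (indicator K' x * A x) * (indicator \<Omega> x * g x)) \<in> borel_measurable (Leb n)"
    proof (rule borel_measurable_times)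
      show "(\<lambda>x. indicator K' x * A x) \<in> borel_measurable (Leb n)" using A0(3) unfolding set_borel_measurable_def by simp
      show "(\<lambda>x. indicator \<Omega> x * g x) \<in> borel_measurable (Leb n)" using g unfolding set_borel_measurable_def by simp
    qed
    show e: "AE x in Leb n. (indicator K' x * A x) * (indicator \<Omega> x * g x) = indicator \<Omega> x *\<^sub>R (A x * g x)"
      using ae g0(3) A0(2) by eventually_elim simp
    show "(\<lambda>x. indicator \<Omega> x *\<^sub>R (A x * g x)) \<in> borel_measurable (Leb n)"
      by (rule measurable_Leb_cong_AE[OF m' e])
  qed
  finally show ?thesis .
qed

end

context cc_fun
begin

lemma eventually_small: "eventually (\<lambda>k. 2 * eps k \<le> e) sequentially"
proof (rule eventually_mono)
  show "eventually (\<lambda>k. eps k < e / 2) sequentially" using e by (intro eventually_eps_less) simp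
qed simp

text \<open>A continuous factor tolerates a derivative that is only locally integrable; this is the
  version behind the product rule.\<close>

lemma app_partial_tendsto_cont:
  assumes g: "weak_partial n \<Omega> j w g" and j: "j < n" and A: "cont_on n \<Omega> A"
  shows "(\<lambda>k. LINT x:\<Omega>|Leb n. A x * partial j (app k) x) \<longlonglongrightarrow> (LINT x:\<Omega>|Leb n. A x * g x)"
proof -
  obtain g0 where g0: "g0 \<in> borel_measurable (lbo n)" "integrable (lbo n) g0" "\<And>x. x \<notin> K \<Longrightarrow> g0 x = 0"
     "AE x in Leb n. indicator \<Omega> x * g x = g0 x"
    using weak_partial_representative[OF g j] by blast
  let ?A = "\<lambda>x. indicator K' x * A x"
  have Am: "?A \<in> borel_measurable (lbo n)" by (rule cont_on_compact_measurable[OF \<Omega> A K' subK(2)])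
  have As: "set_borel_measurable (Leb n) K' A" unfolding set_borel_measurable_def using measurable_completion[OF Am] by simp
  have gs: "set_borel_measurable (Leb n) \<Omega> g" by (rule Lp_loc_measurable[OF weak_partialD(2)[OF g] \<Omega>])
  obtain B where B: "B > 0" "\<forall>x\<in>K'. \<bar>A x\<bar> \<le> B" using cont_on_bounded[OF A K' subK(2)] by blast
  have AB: "\<bar>?A x\<bar> \<le> B" for x using B by (cases "x \<in> K'") auto
  have "(\<lambda>k. \<integral>x. ?A x * mconv n (eps k) g0 x \<partial>lbo n) \<longlonglongrightarrow> (\<integral>x. ?A x * g0 x \<partial>lbo n)"
  proof (rule mconv_pairing_tendsto_bounded[OF Am AB less_imp_le[OF B(1)] g0(2)])
    fix y assume "g0 y \<noteq> 0"
    then have "y \<in> K" using g0(3) by blast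
    then show "cont_at n ?A y" by (rule cont_at_interior[OF A])
  qed
  moreover have "(\<integral>x. ?A x * g0 x \<partial>lbo n) = (LINT x:\<Omega>|Leb n. A x * g x)"
    by (rule limit_integral[OF g0(1,3,4) gs Am _ As]) (assumption | rule AE_I2 refl)+
  moreover have "eventually (\<lambda>k. (\<integral>x. ?A x * mconv n (eps k) g0 x \<partial>lbo n) = (LINT x:\<Omega>|Leb n. A x * partial j (app k) x)) sequentially"
    using eventually_small
  proof eventually_elim
    case (elim k)
    show ?case by (rule app_partial_integral[OF g j g0(1,3,4) elim Am _ As, symmetric]) (assumption | rule AE_I2 refl)+
  qed
  ultimately show ?thesis by (simp only: Lim_transform_eventually)
qed

text \<open>The version for dual exponents, which pairs the flux of u with the weak gradient of the
  test function.\<close>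

lemma app_partial_tendsto_Lp:
  assumes g: "weak_partial n \<Omega> j w g" and j: "j < n" and p: "1 < p"
    and A: "A \<in> Lp_loc n (p / (p - 1)) \<Omega>" and gp: "g \<in> Lp_loc n p \<Omega>"
  shows "(\<lambda>k. LINT x:\<Omega>|Leb n. A x * partial j (app k) x) \<longlonglongrightarrow> (LINT x:\<Omega>|Leb n. A x * g x)"
proof -
  obtain g0 where g0: "g0 \<in> borel_measurable (lbo n)" "integrable (lbo n) g0" "\<And>x. x \<notin> K \<Longrightarrow> g0 x = 0"
     "AE x in Leb n. indicator \<Omega> x * g x = g0 x"
    using weak_partial_representative[OF g j] by blast
  note As = Lp_locD(1)[OF A K' subK(2)]
  obtain A0 where A0: "A0 \<in> borel_measurable (lbo n)" "AE x in Leb n. indicator K' x * A x = A0 x" "\<And>x. x \<notin> K' \<Longrightarrow> A0 x = 0"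
    using borel_representative[OF K' As] by blast
  have gs: "set_borel_measurable (Leb n) \<Omega> g" by (rule Lp_loc_measurable[OF weak_partialD(2)[OF g] \<Omega>])
  have iA: "integrable (lbo n) (\<lambda>x. \<bar>A0 x\<bar> powr (p / (p - 1)))"
  proof -
    have i: "integrable (Leb n) (\<lambda>x. indicator K' x *\<^sub>R \<bar>A x\<bar> powr (p / (p - 1)))"
      using Lp_locD(2)[OF A K' subK(2)] unfolding set_integrable_def .
    have m: "(\<lambda>x. \<bar>A0 x\<bar> powr (p / (p - 1))) \<in> borel_measurable (lbo n)" using A0(1) by measurable
    have "AE x in Leb n. indicator K' x *\<^sub>R \<bar>A x\<bar> powr (p / (p - 1)) = \<bar>A0 x\<bar> powr (p / (p - 1))"
      using A0(2)
    proof eventually_elim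
      case (elim x)
      show ?case unfolding elim[symmetric] by (cases "x \<in> K'") auto
    qed
    from integral_Leb_lbo(2)[OF borel_measurable_integrable[OF i] m this] show ?thesis using i by simp
  qed
  have ig: "integrable (lbo n) (\<lambda>x. \<bar>g0 x\<bar> powr p)"
  proof -
    have i: "integrable (Leb n) (\<lambda>x. indicator K' x *\<^sub>R \<bar>g x\<bar> powr p)"
      using Lp_locD(2)[OF gp K' subK(2)] unfolding set_integrable_def .
    have m: "(\<lambda>x. \<bar>g0 x\<bar> powr p) \<in> borel_measurable (lbo n)" using g0(1) by measurable
    have "AE x in Leb n. indicator K' x *\<^sub>R \<bar>g x\<bar> powr p = \<bar>g0 x\<bar> powr p"
      using g0(4)
    proof eventually_elim
      case (elim x)
      show ?case
      proof (cases "x \<in> K'")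
        case True
        then have "x \<in> \<Omega>" using subsetD[OF subK(2)] by blast
        then show ?thesis using elim True by simp
      next
        case False
        then have "g0 x = 0" using g0(3) subsetD[OF subK(1)] by blast
        then show ?thesis using False by simp
      qed
    qed
    from integral_Leb_lbo(2)[OF borel_measurable_integrable[OF i] m this] show ?thesis using i by simp
  qed
  have gz: "g0 x = 0" if "x \<notin> K'" for x using g0(3) subsetD[OF subK(1)] that by blast
  have "(\<lambda>k. \<integral>x. A0 x * mconv n (eps k) g0 x \<partial>lbo n) \<longlonglongrightarrow> (\<integral>x. A0 x * g0 x \<partial>lbo n)"
    by (rule mconv_pairing_tendsto[OF p A0(1) iA g0(1) ig K' A0(3) gz])
  moreover have "(\<integral>x. A0 x * g0 x \<partial>lbo n) = (LINT x:\<Omega>|Leb n. A x * g x)"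
    by (rule limit_integral[OF g0(1,3,4) gs A0(1,2) As])
  moreover have "eventually (\<lambda>k. (\<integral>x. A0 x * mconv n (eps k) g0 x \<partial>lbo n) = (LINT x:\<Omega>|Leb n. A x * partial j (app k) x)) sequentially"
    using eventually_small
  proof eventually_elim
    case (elim k)
    show ?case by (rule app_partial_integral[OF g j g0(1,3,4) elim A0(1,2) As, symmetric])
  qed
  ultimately show ?thesis by (simp only: Lim_transform_eventually)
qed

lemma eventually_app_Cc_inf: "eventually (\<lambda>k. app k \<in> Cc_inf n \<Omega>) sequentially"
  using eventually_eps_less[OF e] by eventually_elim (rule app_Cc_inf, simp)

end

lemma Cc_cc_fun:
  assumes "openin (Rn n) \<Omega>" "w \<in> Cc n \<Omega>"
  shows "\<exists>K K' e. cc_fun n \<Omega> \<Omega> w K K' e"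
proof -
  obtain K where K: "compactin (Rn n) K" "K \<subseteq> \<Omega>" "\<And>x. x \<in> \<Omega> \<Longrightarrow> x \<notin> K \<Longrightarrow> w x = 0" using Cc_support[OF assms] by blast
  have "cont_on n \<Omega> w" using assms(2) by (simp add: Cc_def)
  from cc_fun_exists[OF assms(1) this K(1,2) assms(1) order_refl K(3)] show ?thesis by blast
qed

text \<open>The equation holds for the mollifications of w and passes to the limit term by term: the
  fields A by duality with the gradients, the zeroth-order term by bounded pointwise
  convergence.\<close>

lemma test_extension:
  assumes \<Omega>: "openin (Rn n) \<Omega>" and p: "1 < p" and w: "w \<in> Cc n \<Omega>"
    and G: "\<And>i. i < n \<Longrightarrow> weak_partial n \<Omega> i w (G i)" "\<And>i. i < n \<Longrightarrow> G i \<in> Lp_loc n p \<Omega>"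
    and A: "\<And>i. i < n \<Longrightarrow> A i \<in> Lp_loc n (p / (p - 1)) \<Omega>" and b: "b \<in> Lp_loc n 1 \<Omega>"
    and eq: "\<And>\<phi>. \<phi> \<in> Cc_inf n \<Omega> \<Longrightarrow> (\<Sum>i<n. LINT x:\<Omega>|Leb n. A i x * partial i \<phi> x) + (LINT x:\<Omega>|Leb n. b x * \<phi> x) = 0"
  shows "(\<Sum>i<n. LINT x:\<Omega>|Leb n. A i x * G i x) + (LINT x:\<Omega>|Leb n. b x * w x) = 0"
proof -
  obtain K K' e where cc: "cc_fun n \<Omega> \<Omega> w K K' e" using Cc_cc_fun[OF \<Omega> w] by blast
  interpret cc_fun n \<Omega> \<Omega> w K K' e by (rule cc)
  have lim: "(\<lambda>k. (\<Sum>i<n. LINT x:\<Omega>|Leb n. A i x * partial i (app k) x) + (LINT x:\<Omega>|Leb n. b x * app k x))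
    \<longlonglongrightarrow> (\<Sum>i<n. LINT x:\<Omega>|Leb n. A i x * G i x) + (LINT x:\<Omega>|Leb n. b x * w x)"
    by (intro tendsto_add tendsto_sum app_integral_tendsto[OF b] app_partial_tendsto_Lp[OF G(1) _ p A G(2)]) auto
  have "eventually (\<lambda>k. (\<Sum>i<n. LINT x:\<Omega>|Leb n. A i x * partial i (app k) x) + (LINT x:\<Omega>|Leb n. b x * app k x) = 0) sequentially"
    using eventually_app_Cc_inf by eventually_elim (rule eq)
  then show ?thesis by (rule LIMSEQ_unique[OF lim tendsto_eventually])
qed

subsection \<open>Calculus of weak derivatives\<close>

text \<open>Two stages. For a smooth test function \<phi> the product v \<phi> has the expected weak
  derivative. Being continuous with compact support, it can then be mollified and inserted into the
  defining identity of the weak derivative of u. Continuity of u and v and local integrability of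
  the derivatives suffice.\<close>

lemma weak_partial_product:
  assumes \<Omega>: "openin (Rn n) \<Omega>" and j: "j < n" and u: "cont_on n \<Omega> u" "weak_partial n \<Omega> j u gu"
    and v: "cont_on n \<Omega> v" "weak_partial n \<Omega> j v gv"
  shows "weak_partial n \<Omega> j (\<lambda>x. u x * v x) (\<lambda>x. u x * gv x + v x * gu x)"
  unfolding weak_partial_def
proof (intro conjI ballI)
  note gu = weak_partialD(2)[OF u(2)] and gv = weak_partialD(2)[OF v(2)]
  show "(\<lambda>x. u x * v x) \<in> Lp_loc n 1 \<Omega>" by (intro cont_on_Lp_loc_1 \<Omega> cont_on_mult u v)
  have i1: "(\<lambda>x. u x * gv x) \<in> Lp_loc n 1 \<Omega>" "(\<lambda>x. v x * gu x) \<in> Lp_loc n 1 \<Omega>"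
    using Lp_loc_1_mult_cont[OF \<Omega> gv u(1)] Lp_loc_1_mult_cont[OF \<Omega> gu v(1)] by (simp_all add: mult.commute)
  then show "(\<lambda>x. u x * gv x + v x * gu x) \<in> Lp_loc n 1 \<Omega>" by (rule Lp_loc_1_add)
  fix \<phi> assume \<phi>: "\<phi> \<in> Cc_inf n \<Omega>"
  note \<phi>c = Cc_infD(1,2)[OF \<phi>] and d\<phi> = partial_Cc[OF \<Omega> \<phi> j]
  have d\<phi>c: "cont_on n \<Omega> (partial j \<phi>)" using d\<phi> by (simp add: Cc_def)
  let ?g = "\<lambda>x. gv x * \<phi> x + v x * partial j \<phi> x"
  \<comment> \<open>Both \<phi> and \<theta> are smooth here, so the classical product rule for
    \<phi> \<theta> reduces the claim to the weak derivative of v tested with \<phi>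
    \<theta>.\<close>
  have w: "weak_partial n \<Omega> j (\<lambda>x. v x * \<phi> x) ?g"
    unfolding weak_partial_def
  proof (intro conjI ballI)
    show "(\<lambda>x. v x * \<phi> x) \<in> Lp_loc n 1 \<Omega>" by (intro cont_on_Lp_loc_1 \<Omega> cont_on_mult v \<phi>c)
    have i2: "(\<lambda>x. gv x * \<phi> x) \<in> Lp_loc n 1 \<Omega>" by (rule Lp_loc_1_mult_cont[OF \<Omega> gv \<phi>c(2)])
    have i3: "(\<lambda>x. v x * partial j \<phi> x) \<in> Lp_loc n 1 \<Omega>" by (intro cont_on_Lp_loc_1 \<Omega> cont_on_mult v d\<phi>c)
    show "?g \<in> Lp_loc n 1 \<Omega>" by (rule Lp_loc_1_add[OF i2 i3])
    fix \<theta> assume \<theta>: "\<theta> \<in> Cc_inf n \<Omega>"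
    note \<theta>c = Cc_infD(1,2)[OF \<theta>] and d\<theta> = partial_Cc[OF \<Omega> \<theta> j]
    have "(LINT x:\<Omega>|Leb n. (v x * \<phi> x) * partial j \<theta> x)
      = (LINT x:\<Omega>|Leb n. v x * partial j (\<lambda>x. \<phi> x * \<theta> x) x - (v x * partial j \<phi> x) * \<theta> x)"
      unfolding set_lebesgue_integral_def
    proof (intro Bochner_Integration.integral_cong refl)
      fix x
      show "indicator \<Omega> x *\<^sub>R ((v x * \<phi> x) * partial j \<theta> x) = indicator \<Omega> x *\<^sub>R (v x * partial j (\<lambda>x. \<phi> x * \<theta> x) x - (v x * partial j \<phi> x) * \<theta> x)"
      proof (cases "x \<in> \<Omega>")
        case True
        have "partial j (\<lambda>x. \<phi> x * \<theta> x) x = partial j \<phi> x * \<theta> x + \<phi> x * partial j \<theta> x"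
          by (rule partial_mult[where f=\<phi> and g=\<theta>, OF Cc_infD(4)[OF \<phi> j True] Cc_infD(4)[OF \<theta> j True]])
        then show ?thesis by (simp add: algebra_simps)
      qed simp
    qed
    also have "\<dots> = (LINT x:\<Omega>|Leb n. v x * partial j (\<lambda>x. \<phi> x * \<theta> x) x) - (LINT x:\<Omega>|Leb n. (v x * partial j \<phi> x) * \<theta> x)"
      by (intro set_integral_diff test_integrable[OF \<Omega> cont_on_Lp_loc_1[OF \<Omega> v(1)] partial_Cc[OF \<Omega> Cc_inf_mult[OF \<Omega> \<phi> \<theta>] j]]
          test_integrable[OF \<Omega> i3 \<theta>c(1)])
    also have "(LINT x:\<Omega>|Leb n. v x * partial j (\<lambda>x. \<phi> x * \<theta> x) x) = - (LINT x:\<Omega>|Leb n. gv x * (\<phi> x * \<theta> x))"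
      by (rule weak_partialD(3)[OF v(2) Cc_inf_mult[OF \<Omega> \<phi> \<theta>]])
    also have "- (LINT x:\<Omega>|Leb n. gv x * (\<phi> x * \<theta> x)) - (LINT x:\<Omega>|Leb n. (v x * partial j \<phi> x) * \<theta> x)
      = - ((LINT x:\<Omega>|Leb n. (gv x * \<phi> x) * \<theta> x) + (LINT x:\<Omega>|Leb n. (v x * partial j \<phi> x) * \<theta> x))" by (simp add: mult.assoc)
    also have "(LINT x:\<Omega>|Leb n. (gv x * \<phi> x) * \<theta> x) + (LINT x:\<Omega>|Leb n. (v x * partial j \<phi> x) * \<theta> x)
      = (LINT x:\<Omega>|Leb n. (gv x * \<phi> x) * \<theta> x + (v x * partial j \<phi> x) * \<theta> x)"
      by (rule set_integral_add(2)[symmetric, OF test_integrable[OF \<Omega> i2 \<theta>c(1)] test_integrable[OF \<Omega> i3 \<theta>c(1)]])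
    finally show "(LINT x:\<Omega>|Leb n. (v x * \<phi> x) * partial j \<theta> x) = - (LINT x:\<Omega>|Leb n. ?g x * \<theta> x)"
      by (simp add: distrib_right)
  qed
  obtain K K' e where cc: "cc_fun n \<Omega> \<Omega> (\<lambda>x. v x * \<phi> x) K K' e"
    using Cc_cc_fun[OF \<Omega> Cc_mult[OF \<Omega> \<phi>c(1) v(1)]] by blast
  interpret cc: cc_fun n \<Omega> \<Omega> "\<lambda>x. v x * \<phi> x" K K' e by (rule cc)
  have lim: "(\<lambda>k. (LINT x:\<Omega>|Leb n. u x * partial j (cc.app k) x) + (LINT x:\<Omega>|Leb n. gu x * cc.app k x))
     \<longlonglongrightarrow> (LINT x:\<Omega>|Leb n. u x * ?g x) + (LINT x:\<Omega>|Leb n. gu x * (v x * \<phi> x))"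
    by (intro tendsto_add cc.app_partial_tendsto_cont[OF w j u(1)] cc.app_integral_tendsto[OF gu])
  have "eventually (\<lambda>k. (LINT x:\<Omega>|Leb n. u x * partial j (cc.app k) x) + (LINT x:\<Omega>|Leb n. gu x * cc.app k x) = 0) sequentially"
    using cc.eventually_app_Cc_inf
  proof eventually_elim
    case (elim k)
    then show ?case using weak_partialD(3)[OF u(2) elim] by simp
  qed
  then have z: "(LINT x:\<Omega>|Leb n. u x * ?g x) + (LINT x:\<Omega>|Leb n. gu x * (v x * \<phi> x)) = 0"
    by (rule LIMSEQ_unique[OF lim tendsto_eventually])
  have j1: "set_integrable (Leb n) \<Omega> (\<lambda>x. (u x * gv x) * \<phi> x)" by (rule test_integrable[OF \<Omega> i1(1) \<phi>c(1)])
  have j2: "set_integrable (Leb n) \<Omega> (\<lambda>x. (v x * gu x) * \<phi> x)" by (rule test_integrable[OF \<Omega> i1(2) \<phi>c(1)])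
  have j3: "set_integrable (Leb n) \<Omega> (\<lambda>x. (u x * v x) * partial j \<phi> x)"
    by (intro test_integrable[OF \<Omega> _ d\<phi>] cont_on_Lp_loc_1 \<Omega> cont_on_mult u v)
  have e1: "(LINT x:\<Omega>|Leb n. u x * ?g x) = (LINT x:\<Omega>|Leb n. (u x * gv x) * \<phi> x) + (LINT x:\<Omega>|Leb n. (u x * v x) * partial j \<phi> x)"
    unfolding set_integral_add(2)[OF j1 j3, symmetric] by (simp add: distrib_left mult.assoc)
  have e2: "(LINT x:\<Omega>|Leb n. gu x * (v x * \<phi> x)) = (LINT x:\<Omega>|Leb n. (v x * gu x) * \<phi> x)" by (simp add: mult_ac)
  have e3: "(LINT x:\<Omega>|Leb n. (u x * gv x + v x * gu x) * \<phi> x) = (LINT x:\<Omega>|Leb n. (u x * gv x) * \<phi> x) + (LINT x:\<Omega>|Leb n. (v x * gu x) * \<phi> x)"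
    unfolding set_integral_add(2)[OF j1 j2, symmetric] by (simp add: distrib_right)
  show "(LINT x:\<Omega>|Leb n. (u x * v x) * partial j \<phi> x) = - (LINT x:\<Omega>|Leb n. (u x * gv x + v x * gu x) * \<phi> x)"
    using z unfolding e1 e2 e3 by linarith
qed

lemma weak_partial_add:
  assumes \<Omega>: "openin (Rn n) \<Omega>" and j: "j < n" and u: "weak_partial n \<Omega> j u gu" and v: "weak_partial n \<Omega> j v gv"
  shows "weak_partial n \<Omega> j (\<lambda>x. u x + v x) (\<lambda>x. gu x + gv x)"
  unfolding weak_partial_def
proof (intro conjI ballI)
  note du = weak_partialD[OF u] and dv = weak_partialD[OF v]
  show "(\<lambda>x. u x + v x) \<in> Lp_loc n 1 \<Omega>" "(\<lambda>x. gu x + gv x) \<in> Lp_loc n 1 \<Omega>" by (intro Lp_loc_1_add du dv)+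
  fix \<phi> assume \<phi>: "\<phi> \<in> Cc_inf n \<Omega>"
  note \<phi>c = Cc_infD(1)[OF \<phi>] and d\<phi> = partial_Cc[OF \<Omega> \<phi> j]
  show "(LINT x:\<Omega>|Leb n. (u x + v x) * partial j \<phi> x) = - (LINT x:\<Omega>|Leb n. (gu x + gv x) * \<phi> x)"
    unfolding distrib_right set_integral_add(2)[OF test_integrable[OF \<Omega> du(1) d\<phi>] test_integrable[OF \<Omega> dv(1) d\<phi>]]
      set_integral_add(2)[OF test_integrable[OF \<Omega> du(2) \<phi>c] test_integrable[OF \<Omega> dv(2) \<phi>c]]
    using du(3)[OF \<phi>] dv(3)[OF \<phi>] by simp
qed

lemma weak_partial_cmult:
  assumes \<Omega>: "openin (Rn n) \<Omega>" and u: "weak_partial n \<Omega> j u gu"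
  shows "weak_partial n \<Omega> j (\<lambda>x. c * u x) (\<lambda>x. c * gu x)"
  unfolding weak_partial_def
proof (intro conjI ballI)
  note du = weak_partialD[OF u]
  show "(\<lambda>x. c * u x) \<in> Lp_loc n 1 \<Omega>" "(\<lambda>x. c * gu x) \<in> Lp_loc n 1 \<Omega>"
    using Lp_loc_1_mult_cont[OF \<Omega> du(1) cont_on_const[of n \<Omega> c]] Lp_loc_1_mult_cont[OF \<Omega> du(2) cont_on_const[of n \<Omega> c]]
    by (simp_all add: mult.commute)
  fix \<phi> assume \<phi>: "\<phi> \<in> Cc_inf n \<Omega>"
  show "(LINT x:\<Omega>|Leb n. (c * u x) * partial j \<phi> x) = - (LINT x:\<Omega>|Leb n. (c * gu x) * \<phi> x)"
    using du(3)[OF \<phi>] by (simp add: mult.assoc)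
qed

lemma weak_partial_zero: "openin (Rn n) \<Omega> \<Longrightarrow> weak_partial n \<Omega> j (\<lambda>x. 0) (\<lambda>x. 0)"
  unfolding weak_partial_def using cont_on_Lp_loc_1[OF _ cont_on_const[of n \<Omega> 0]] by (simp add: set_lebesgue_integral_def)

lemma weak_partial_power:
  assumes \<Omega>: "openin (Rn n) \<Omega>" and j: "j < n" and u: "cont_on n \<Omega> u" "weak_partial n \<Omega> j u g"
  shows "weak_partial n \<Omega> j (\<lambda>x. u x ^ Suc m) (\<lambda>x. real (Suc m) * u x ^ m * g x) \<and> cont_on n \<Omega> (\<lambda>x. u x ^ Suc m)"
proof (induction m)
  case 0 then show ?case using u by simp
next
  case (Suc m)
  have c: "cont_on n \<Omega> (\<lambda>x. u x ^ Suc m * u x)" using Suc u by (intro cont_on_mult) auto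
  have "weak_partial n \<Omega> j (\<lambda>x. u x ^ Suc m * u x) (\<lambda>x. u x ^ Suc m * g x + u x * (real (Suc m) * u x ^ m * g x))"
    using Suc by (intro weak_partial_product[OF \<Omega> j _ _ u]) auto
  moreover have "u x ^ Suc m * g x + u x * (real (Suc m) * u x ^ m * g x) = real (Suc (Suc m)) * u x ^ Suc m * g x" for x
    by (simp add: algebra_simps)
  moreover have "u x ^ Suc m * u x = u x ^ Suc (Suc m)" for x by simp
  ultimately show ?case using c by (simp only: simp_thms)
qed

lemma weak_partial_sum:
  assumes \<Omega>: "openin (Rn n) \<Omega>" and j: "j < n" and "\<And>i. i \<in> S \<Longrightarrow> weak_partial n \<Omega> j (u i) (g i)" "finite S"
  shows "weak_partial n \<Omega> j (\<lambda>x. \<Sum>i\<in>S. u i x) (\<lambda>x. \<Sum>i\<in>S. g i x)"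
  using assms(4,3)
proof (induction S rule: finite_induct)
  case empty then show ?case using weak_partial_zero[OF \<Omega>] by simp
next
  case (insert i S)
  then show ?case using weak_partial_add[OF \<Omega> j, of "u i" "g i"] by simp
qed

lemma bounded_limit_Lp_loc_1:
  assumes \<Omega>: "openin (Rn n) \<Omega>" and s: "\<And>k. (\<lambda>x. s k x * g x) \<in> Lp_loc n 1 \<Omega>" and g: "g \<in> Lp_loc n 1 \<Omega>"
    and b: "\<And>k x. x \<in> \<Omega> \<Longrightarrow> \<bar>s k x\<bar> \<le> C" and l: "\<And>x. x \<in> \<Omega> \<Longrightarrow> (\<lambda>k. s k x) \<longlonglongrightarrow> S x"
  shows "(\<lambda>x. S x * g x) \<in> Lp_loc n 1 \<Omega>"
proof (rule Lp_loc_1I)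
  fix K assume K: "compactin (Rn n) K" "K \<subseteq> \<Omega>"
  note i = Lp_loc_1_integrable[OF g K]
  have SC: "\<bar>S x\<bar> \<le> C" if "x \<in> \<Omega>" for x
    using tendsto_upperbound[OF tendsto_rabs[OF l[OF that]]] b[OF that] by simp
  show "integrable (Leb n) (\<lambda>x. indicator K x * (S x * g x))"
  proof (rule Bochner_Integration.integrable_bound)
    show "integrable (Leb n) (\<lambda>x. C * (indicator K x * g x))" using i by simp
    show "(\<lambda>x. indicator K x * (S x * g x)) \<in> borel_measurable (Leb n)"
    proof (rule borel_measurable_LIMSEQ_real)
      show "(\<lambda>x. indicator K x * (s k x * g x)) \<in> borel_measurable (Leb n)" for k
        using Lp_loc_1_integrable[OF s K] by (rule borel_measurable_integrable)
      fix x show "(\<lambda>k. indicator K x * (s k x * g x)) \<longlonglongrightarrow> indicator K x * (S x * g x)"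
      proof (cases "x \<in> K")
        case True
        then show ?thesis using l[OF subsetD[OF K(2) True]] by (intro tendsto_intros)
      qed simp
    qed
    show "AE x in Leb n. norm (indicator K x * (S x * g x)) \<le> norm (C * (indicator K x * g x))"
    proof (rule AE_I2)
      fix x show "norm (indicator K x * (S x * g x)) \<le> norm (C * (indicator K x * g x))"
      proof (cases "x \<in> K")
        case True
        then have "\<bar>S x\<bar> * \<bar>g x\<bar> \<le> \<bar>C\<bar> * \<bar>g x\<bar>" using SC[OF subsetD[OF K(2) True]] by (intro mult_right_mono) auto
        then show ?thesis using True by (simp add: abs_mult)
      qed simp
    qed
  qed
qed

lemma bounded_limit_integral:
  assumes \<Omega>: "openin (Rn n) \<Omega>" and s: "\<And>k. (\<lambda>x. s k x * g x) \<in> Lp_loc n 1 \<Omega>" and g: "g \<in> Lp_loc n 1 \<Omega>"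
    and b: "\<And>k x. x \<in> \<Omega> \<Longrightarrow> \<bar>s k x\<bar> \<le> C" and l: "\<And>x. x \<in> \<Omega> \<Longrightarrow> (\<lambda>k. s k x) \<longlonglongrightarrow> S x" and f: "f \<in> Cc n \<Omega>"
  shows "(\<lambda>k. LINT x:\<Omega>|Leb n. (s k x * g x) * f x) \<longlonglongrightarrow> (LINT x:\<Omega>|Leb n. (S x * g x) * f x)"
  unfolding set_lebesgue_integral_def
proof (rule integral_dominated_convergence[where w="\<lambda>x. C * \<bar>indicator \<Omega> x *\<^sub>R (g x * f x)\<bar>"])
  have m: "(\<lambda>x. indicator \<Omega> x *\<^sub>R (h x * f x)) \<in> borel_measurable (Leb n)" if "h \<in> Lp_loc n 1 \<Omega>" for h
    using test_integrable[OF \<Omega> that f] unfolding set_integrable_def by (rule borel_measurable_integrable)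
  show "(\<lambda>x. indicator \<Omega> x *\<^sub>R ((S x * g x) * f x)) \<in> borel_measurable (Leb n)" by (rule m[OF bounded_limit_Lp_loc_1[OF \<Omega> s g b l]])
  show "(\<lambda>x. indicator \<Omega> x *\<^sub>R ((s k x * g x) * f x)) \<in> borel_measurable (Leb n)" for k by (rule m[OF s])
  show "integrable (Leb n) (\<lambda>x. C * \<bar>indicator \<Omega> x *\<^sub>R (g x * f x)\<bar>)"
    using test_integrable[OF \<Omega> g f] unfolding set_integrable_def by (intro integrable_mult_right integrable_abs)
  show "AE x in Leb n. (\<lambda>k. indicator \<Omega> x *\<^sub>R ((s k x * g x) * f x)) \<longlonglongrightarrow> indicator \<Omega> x *\<^sub>R ((S x * g x) * f x)"
  proof (rule AE_I2)
    fix x show "(\<lambda>k. indicator \<Omega> x *\<^sub>R ((s k x * g x) * f x)) \<longlonglongrightarrow> indicator \<Omega> x *\<^sub>R ((S x * g x) * f x)"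
    proof (cases "x \<in> \<Omega>")
      case True then show ?thesis using l[OF True] by (intro tendsto_intros)
    qed simp
  qed
  show "AE x in Leb n. norm (indicator \<Omega> x *\<^sub>R ((s k x * g x) * f x)) \<le> C * \<bar>indicator \<Omega> x *\<^sub>R (g x * f x)\<bar>" for k
  proof (rule AE_I2)
    fix x show "norm (indicator \<Omega> x *\<^sub>R ((s k x * g x) * f x)) \<le> C * \<bar>indicator \<Omega> x *\<^sub>R (g x * f x)\<bar>"
    proof (cases "x \<in> \<Omega>")
      case True
      have "\<bar>s k x\<bar> * \<bar>g x * f x\<bar> \<le> C * \<bar>g x * f x\<bar>" using b[OF True] by (intro mult_right_mono) auto
      then show ?thesis using True by (simp add: abs_mult mult.assoc)
    qed simp
  qed
qed

text \<open>All derivatives have the form \<open>h k x * g x\<close> with one fixed g and bounded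
  factors. Domination by C |g| therefore turns pointwise convergence of f and h into convergence of
  both sides of the defining identity.\<close>

lemma weak_partial_limit:
  assumes \<Omega>: "openin (Rn n) \<Omega>" and j: "j < n" and g: "g \<in> Lp_loc n 1 \<Omega>"
    and w: "\<And>k. weak_partial n \<Omega> j (f k) (\<lambda>x. h k x * g x)"
    and b: "\<And>k x. x \<in> \<Omega> \<Longrightarrow> \<bar>f k x\<bar> \<le> C" "\<And>k x. x \<in> \<Omega> \<Longrightarrow> \<bar>h k x\<bar> \<le> C"
    and l: "\<And>x. x \<in> \<Omega> \<Longrightarrow> (\<lambda>k. f k x) \<longlonglongrightarrow> F x" "\<And>x. x \<in> \<Omega> \<Longrightarrow> (\<lambda>k. h k x) \<longlonglongrightarrow> H x"
  shows "weak_partial n \<Omega> j F (\<lambda>x. H x * g x)"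
  unfolding weak_partial_def
proof (intro conjI ballI)
  have one: "(\<lambda>x. 1) \<in> Lp_loc n 1 \<Omega>" by (rule cont_on_Lp_loc_1[OF \<Omega> cont_on_const])
  have f1: "(\<lambda>x. f k x * 1) \<in> Lp_loc n 1 \<Omega>" for k using weak_partialD(1)[OF w] by simp
  show "F \<in> Lp_loc n 1 \<Omega>" using bounded_limit_Lp_loc_1[OF \<Omega> f1 one b(1) l(1)] by simp
  show "(\<lambda>x. H x * g x) \<in> Lp_loc n 1 \<Omega>" by (rule bounded_limit_Lp_loc_1[OF \<Omega> weak_partialD(2)[OF w] g b(2) l(2)])
  fix \<phi> assume \<phi>: "\<phi> \<in> Cc_inf n \<Omega>"
  have "(\<lambda>k. LINT x:\<Omega>|Leb n. (f k x * 1) * partial j \<phi> x) \<longlonglongrightarrow> (LINT x:\<Omega>|Leb n. (F x * 1) * partial j \<phi> x)"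
    by (rule bounded_limit_integral[OF \<Omega> f1 one b(1) l(1) partial_Cc[OF \<Omega> \<phi> j]])
  moreover have "(\<lambda>k. - (LINT x:\<Omega>|Leb n. (h k x * g x) * \<phi> x)) \<longlonglongrightarrow> - (LINT x:\<Omega>|Leb n. (H x * g x) * \<phi> x)"
    by (rule tendsto_minus[OF bounded_limit_integral[OF \<Omega> weak_partialD(2)[OF w] g b(2) l(2) Cc_infD(1)[OF \<phi>]]])
  ultimately show "(LINT x:\<Omega>|Leb n. F x * partial j \<phi> x) = - (LINT x:\<Omega>|Leb n. (H x * g x) * \<phi> x)"
    using weak_partialD(3)[OF w \<phi>] LIMSEQ_unique by simp
qed

lemma powr_has_derivative_at_nonneg:
  fixes q t :: real assumes "1 < q" "0 \<le> t"
  shows "((\<lambda>t. \<bar>t\<bar> powr q) has_real_derivative q * t powr (q - 1)) (at t)"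
proof -
  have "\<bar>t\<bar> powr (q - 2) * t = t powr (q - 1)" using assms powr_add[of t "q-2" 1] by (cases "t = 0") auto
  then show ?thesis using has_derivative_abs_powr[OF assms(1), of t] by simp
qed

text \<open>Chain rule by polynomial approximation. It is the derivative q t^(q-1) that is
  approximated uniformly on [0, B], since uniform approximation of t^q itself would say nothing
  about derivatives; the antiderivatives vanishing at 0 then approximate t^q. Polynomials in u are
  covered by the product rule.\<close>

lemma weak_partial_powr:
  assumes \<Omega>: "openin (Rn n) \<Omega>" and j: "j < n" and u: "cont_on n \<Omega> u" "weak_partial n \<Omega> j u g"
    and b: "\<And>x. x \<in> \<Omega> \<Longrightarrow> 0 \<le> u x \<and> u x \<le> B" and q: "1 < q" and B: "0 < B"
  shows "weak_partial n \<Omega> j (\<lambda>x. u x powr q) (\<lambda>x. (q * u x powr (q - 1)) * g x)"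
proof -
  define G' where "G' = (\<lambda>t::real. q * t powr (q - 1))"
  have cG: "continuous_on {0..B} G'" unfolding G'_def using q by (intro continuous_intros continuous_on_powr') auto
  have "\<exists>P. real_polynomial_function P \<and> (\<forall>t\<in>{0..B}. \<bar>G' t - P t\<bar> < eps k)" for k
  proof -
    obtain Q where "real_polynomial_function Q" "\<And>t. t \<in> {0..B} \<Longrightarrow> \<bar>G' t - Q t\<bar> < eps k"
      using Stone_Weierstrass_real_polynomial_function[OF compact_Icc cG eps_pos] by blast
    then show ?thesis by blast
  qed
  then obtain P where P: "\<And>k. real_polynomial_function (P k)" "\<And>k t. t \<in> {0..B} \<Longrightarrow> \<bar>G' t - P k t\<bar> < eps k" by metis
  have "\<forall>k. \<exists>a N. P k = (\<lambda>t. \<Sum>i\<le>N. a i * t ^ i)" using P(1) real_polynomial_function_iff_sum by blast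
  then obtain a N where aN: "\<And>k. P k = (\<lambda>t. \<Sum>i\<le>N k. a k i * t ^ i)" by metis
  define I where "I = (\<lambda>k t. \<Sum>i\<le>N k. a k i / real (Suc i) * t ^ Suc i)"
  have dI: "(I k has_real_derivative P k t) (at t)" for k t
  proof -
    have "((\<lambda>t. a k i / real (Suc i) * t ^ Suc i) has_real_derivative a k i * t ^ i) (at t)" for i
    proof -
      have "((\<lambda>t. t ^ Suc i) has_real_derivative real (Suc i) * t ^ i) (at t)" using DERIV_pow[of "Suc i" t] by simp
      from DERIV_cmult[OF this, of "a k i / real (Suc i)"] show ?thesis by simp
    qed
    then show ?thesis unfolding I_def aN by (intro DERIV_sum)
  qed
  have I0: "I k 0 = 0" for k by (simp add: I_def)
  \<comment> \<open>Both functions vanish at 0, so the mean value theorem turns the error of the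
    derivatives into B times that error.\<close>
  have close: "\<bar>t powr q - I k t\<bar> \<le> B * eps k" if t: "t \<in> {0..B}" for k t
  proof (cases "t = 0")
    case True then show ?thesis using B eps_pos[of k] by (simp add: I0)
  next
    case False
    then have tp: "0 < t" using t by simp
    have d: "((\<lambda>t. \<bar>t\<bar> powr q - I k t) has_real_derivative G' s - P k s) (at s)" if "0 \<le> s" for s
      using DERIV_diff[OF powr_has_derivative_at_nonneg[OF q that] dI] by (simp add: G'_def)
    obtain z where z: "0 < z" "z < t" "(\<bar>t\<bar> powr q - I k t) - (\<bar>0\<bar> powr q - I k 0) = (t - 0) * (G' z - P k z)"
      using MVT2[OF tp, of "\<lambda>t. \<bar>t\<bar> powr q - I k t" "\<lambda>s. G' s - P k s"] d by auto
    have "\<bar>t powr q - I k t\<bar> = t * \<bar>G' z - P k z\<bar>" using z(3) tp I0 by (simp add: abs_mult)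
    also have "\<dots> \<le> B * eps k" using P(2)[of z k] z t by (intro mult_mono) auto
    finally show ?thesis .
  qed
  obtain C0 where C0: "\<And>t. t \<in> {0..B} \<Longrightarrow> \<bar>G' t\<bar> \<le> C0"
  proof -
    obtain c where "\<forall>x\<in>G' ` {0..B}. norm x \<le> c"
      using compact_imp_bounded[OF compact_continuous_image[OF cG compact_Icc]] unfolding bounded_iff by blast
    then have "\<bar>G' t\<bar> \<le> c" if "t \<in> {0..B}" for t using that by simp
    then show ?thesis using that by blast
  qed
  have e1: "eps k \<le> 1" for k by (simp add: eps_def)
  define C where "C = B powr q + B + \<bar>C0\<bar> + 1"
  have inB: "u x \<in> {0..B}" if "x \<in> \<Omega>" for x using b[OF that] by simp
  have "weak_partial n \<Omega> j (\<lambda>x. u x powr q) (\<lambda>x. G' (u x) * g x)"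
  proof (rule weak_partial_limit[OF \<Omega> j weak_partialD(2)[OF u(2)], where f="\<lambda>k x. I k (u x)" and h="\<lambda>k x. P k (u x)" and C=C])
    fix k
    have "weak_partial n \<Omega> j (\<lambda>x. \<Sum>i\<le>N k. a k i / real (Suc i) * u x ^ Suc i) (\<lambda>x. \<Sum>i\<le>N k. a k i / real (Suc i) * (real (Suc i) * u x ^ i * g x))"
      using weak_partial_power[OF \<Omega> j u] by (intro weak_partial_sum[OF \<Omega> j] weak_partial_cmult[OF \<Omega>]) auto
    moreover have "a k i / real (Suc i) * (real (Suc i) * u x ^ i * g x) = a k i * u x ^ i * g x" for i x by simp
    ultimately show "weak_partial n \<Omega> j (\<lambda>x. I k (u x)) (\<lambda>x. P k (u x) * g x)"
      unfolding I_def aN by (simp only: sum_distrib_right)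
    fix x assume x: "x \<in> \<Omega>"
    have "u x powr q \<le> B powr q" using b[OF x] q by (intro powr_mono2) auto
    moreover have "B * eps k \<le> B" using e1[of k] B by simp
    moreover have "0 \<le> u x powr q" by simp
    ultimately show "\<bar>I k (u x)\<bar> \<le> C" using close[OF inB[OF x], of k] unfolding C_def by linarith
    have "0 \<le> B powr q" by simp
    then show "\<bar>P k (u x)\<bar> \<le> C" using P(2)[OF inB[OF x], of k] C0[OF inB[OF x]] e1[of k] B unfolding C_def by linarith
  next
    fix x assume x: "x \<in> \<Omega>"
    have "(\<lambda>k. I k (u x) - u x powr q) \<longlonglongrightarrow> 0"
    proof (rule Lim_null_comparison)
      show "eventually (\<lambda>k. norm (I k (u x) - u x powr q) \<le> B * eps k) sequentially"
        using close[OF inB[OF x]] by (simp add: abs_minus_commute)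
      show "(\<lambda>k. B * eps k) \<longlonglongrightarrow> 0" using tendsto_mult[OF tendsto_const eps_tendsto, of B] by simp
    qed
    then show "(\<lambda>k. I k (u x)) \<longlonglongrightarrow> u x powr q" by (rule LIM_zero_cancel)
    have "(\<lambda>k. P k (u x) - G' (u x)) \<longlonglongrightarrow> 0"
    proof (rule Lim_null_comparison[OF _ eps_tendsto])
      show "eventually (\<lambda>k. norm (P k (u x) - G' (u x)) \<le> eps k) sequentially"
        using P(2)[OF inB[OF x]] by (simp add: abs_minus_commute less_imp_le)
    qed
    then show "(\<lambda>k. P k (u x)) \<longlonglongrightarrow> G' (u x)" by (rule LIM_zero_cancel)
  qed
  then show ?thesis by (simp add: G'_def)
qed

text \<open>The powers u^(1 + eps) tend to u, while the factors (1 + eps) u^eps in their derivatives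
  tend to 1 where u > 0 and equal 0 where u = 0. So g with its values on the zero set erased is also
  a weak derivative of u, and uniqueness finishes.\<close>

lemma weak_partial_zero_set:
  assumes \<Omega>: "openin (Rn n) \<Omega>" and j: "j < n" and u: "cont_on n \<Omega> u" "weak_partial n \<Omega> j u g"
    and b: "\<And>x. x \<in> \<Omega> \<Longrightarrow> 0 \<le> u x \<and> u x \<le> B" and B: "1 \<le> B"
  shows "AE x in Leb n. x \<in> \<Omega> \<longrightarrow> u x = 0 \<longrightarrow> g x = 0"
proof -
  have e1: "0 < eps k" "eps k \<le> 1" for k by (auto simp: eps_def)
  have "weak_partial n \<Omega> j u (\<lambda>x. (if u x = 0 then 0 else 1) * g x)"
  proof (rule weak_partial_limit[OF \<Omega> j weak_partialD(2)[OF u(2)], where f="\<lambda>k x. u x powr (1 + eps k)"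
        and h="\<lambda>k x. (1 + eps k) * u x powr (1 + eps k - 1)" and C="2 * B powr 2"])
    show "weak_partial n \<Omega> j (\<lambda>x. u x powr (1 + eps k)) (\<lambda>x. (1 + eps k) * u x powr (1 + eps k - 1) * g x)" for k
      using e1[of k] B by (intro weak_partial_powr[OF \<Omega> j u b]) auto
    fix k x assume x: "x \<in> \<Omega>"
    have p: "u x powr r \<le> B powr 2" if "0 \<le> r" "r \<le> 2" for r
    proof -
      have "u x powr r \<le> B powr r" using b[OF x] that by (intro powr_mono2) auto
      also have "\<dots> \<le> B powr 2" using B that by (intro powr_mono) auto
      finally show ?thesis .
    qed
    show "\<bar>u x powr (1 + eps k)\<bar> \<le> 2 * B powr 2" unfolding abs_of_nonneg[OF powr_ge_zero] using p[of "1 + eps k"] e1[of k] powr_ge_zero[of B 2] by linarith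
    have "(1 + eps k) * u x powr (1 + eps k - 1) \<le> 2 * B powr 2" using p[of "eps k"] e1[of k] by (intro mult_mono) auto
    then show "\<bar>(1 + eps k) * u x powr (1 + eps k - 1)\<bar> \<le> 2 * B powr 2" using e1[of k] by simp
  next
    fix x assume x: "x \<in> \<Omega>"
    have l0: "(\<lambda>k. 1 + eps k) \<longlonglongrightarrow> 1 + 0" by (intro tendsto_add tendsto_const eps_tendsto)
    show "(\<lambda>k. u x powr (1 + eps k)) \<longlonglongrightarrow> u x"
    proof (cases "u x = 0")
      case False
      then have "(\<lambda>k. u x powr (1 + eps k)) \<longlonglongrightarrow> u x powr (1 + 0)" by (intro tendsto_powr tendsto_const l0)
      then show ?thesis using b[OF x] False by simp
    qed simp
    show "(\<lambda>k. (1 + eps k) * u x powr (1 + eps k - 1)) \<longlonglongrightarrow> (if u x = 0 then 0 else 1)"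
    proof (cases "u x = 0")
      case False
      then have "(\<lambda>k. (1 + eps k) * u x powr (eps k)) \<longlonglongrightarrow> (1 + 0) * u x powr 0"
        by (intro tendsto_mult l0 tendsto_powr tendsto_const eps_tendsto)
      then show ?thesis using False by simp
    qed simp
  qed
  from weak_partial_unique[OF \<Omega> this u(2)] show ?thesis by eventually_elim auto
qed

subsection \<open>Local integrability of powers\<close>

text \<open>Turns measurability on a subset into ordinary measurability in a restricted space, where
  products, powers and sums are handled automatically.\<close>

lemma set_measurable_iff_restrict:
  fixes f :: "pt \<Rightarrow> real"
  assumes "A \<in> sets (Leb n)"
  shows "set_borel_measurable (Leb n) A f \<longleftrightarrow> f \<in> borel_measurable (restrict_space (Leb n) A)"
proof -
  have "A \<inter> space (Leb n) \<in> sets (Leb n)" using assms by auto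
  from borel_measurable_restrict_space_iff[OF this, of f] show ?thesis unfolding set_borel_measurable_def by simp
qed

lemma Leb_openin: "openin (Rn n) \<Omega> \<Longrightarrow> \<Omega> \<in> sets (Leb n)" by (rule Leb_sets[OF sets_openin])
lemma Leb_compactin: "compactin (Rn n) K \<Longrightarrow> K \<in> sets (Leb n)" by (rule Leb_sets[OF sets_compactin])

lemma set_measurable_subset:
  fixes f :: "pt \<Rightarrow> real"
  assumes "set_borel_measurable (Leb n) A f" "B \<subseteq> A" "B \<in> sets (Leb n)"
  shows "set_borel_measurable (Leb n) B f"
proof -
  have "(\<lambda>x. indicator B x * (indicator A x *\<^sub>R f x)) \<in> borel_measurable (Leb n)"
    by (rule borel_measurable_times[OF borel_measurable_indicator[OF assms(3)] assms(1)[unfolded set_borel_measurable_def]])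
  moreover have "(\<lambda>x. indicator B x * (indicator A x *\<^sub>R f x)) = (\<lambda>x. indicator B x *\<^sub>R f x)"
  proof
    fix x show "indicator B x * (indicator A x *\<^sub>R f x) = indicator B x *\<^sub>R f x"
      using subsetD[OF assms(2), of x] by (simp add: indicator_def)
  qed
  ultimately show ?thesis unfolding set_borel_measurable_def by (simp only:)
qed

lemma Lp_locI:
  assumes "openin (Rn n) \<Omega>" "set_borel_measurable (Leb n) \<Omega> f" "(\<lambda>x. \<bar>f x\<bar> powr p) \<in> Lp_loc n 1 \<Omega>"
  shows "f \<in> Lp_loc n p \<Omega>"
  unfolding Lp_loc_def Lp_def
proof (intro CollectI allI impI conjI)
  fix K assume K: "compactin (Rn n) K \<and> K \<subseteq> \<Omega>"
  then show "set_borel_measurable (Leb n) K f" using set_measurable_subset[OF assms(2)] Leb_compactin by blast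
  show "set_integrable (Leb n) K (\<lambda>x. \<bar>f x\<bar> powr p)"
    using Lp_loc_1_integrable[OF assms(3)] K unfolding set_integrable_def by simp
qed

lemma Lp_loc_powr:
  assumes "f \<in> Lp_loc n p \<Omega>" shows "(\<lambda>x. \<bar>f x\<bar> powr p) \<in> Lp_loc n 1 \<Omega>"
proof (rule Lp_loc_1I)
  fix K assume "compactin (Rn n) K" "K \<subseteq> \<Omega>"
  from Lp_locD(2)[OF assms this] show "integrable (Leb n) (\<lambda>x. indicator K x * \<bar>f x\<bar> powr p)"
    unfolding set_integrable_def by simp
qed

text \<open>The constant may depend on the compact set and the bound may fail on a null set, exactly
  as the weights require.\<close>

lemma Lp_loc_1_bound:
  assumes \<Omega>: "openin (Rn n) \<Omega>" and g: "g \<in> Lp_loc n 1 \<Omega>" and f: "set_borel_measurable (Leb n) \<Omega> f"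
    and b: "\<And>K. compactin (Rn n) K \<Longrightarrow> K \<subseteq> \<Omega> \<Longrightarrow> \<exists>C. AE x in Leb n. x \<in> K \<longrightarrow> \<bar>f x\<bar> \<le> C * \<bar>g x\<bar>"
  shows "f \<in> Lp_loc n 1 \<Omega>"
proof (rule Lp_loc_1I)
  fix K assume K: "compactin (Rn n) K" "K \<subseteq> \<Omega>"
  obtain C where C: "AE x in Leb n. x \<in> K \<longrightarrow> \<bar>f x\<bar> \<le> C * \<bar>g x\<bar>" using b[OF K] by blast
  show "integrable (Leb n) (\<lambda>x. indicator K x * f x)"
  proof (rule Bochner_Integration.integrable_bound)
    show "integrable (Leb n) (\<lambda>x. C * \<bar>indicator K x * g x\<bar>)"
      by (intro integrable_mult_right integrable_abs Lp_loc_1_integrable[OF g K])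
    show "(\<lambda>x. indicator K x * f x) \<in> borel_measurable (Leb n)"
      using set_measurable_subset[OF f K(2) Leb_compactin[OF K(1)]] unfolding set_borel_measurable_def by simp
    show "AE x in Leb n. norm (indicator K x * f x) \<le> norm (C * \<bar>indicator K x * g x\<bar>)"
      using C
    proof eventually_elim
      case (elim x)
      have "C * \<bar>g x\<bar> \<le> \<bar>C\<bar> * \<bar>g x\<bar>" by (rule mult_right_mono) auto
      then show ?case using elim by (cases "x \<in> K") (auto simp: abs_mult)
    qed
  qed
qed

lemma Lp_loc_cong_AE:
  assumes \<Omega>: "openin (Rn n) \<Omega>" and f: "f \<in> Lp_loc n p \<Omega>" and e: "AE x in Leb n. x \<in> \<Omega> \<longrightarrow> f x = g x"
  shows "g \<in> Lp_loc n p \<Omega>"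
proof (rule Lp_locI[OF \<Omega>])
  show m: "set_borel_measurable (Leb n) \<Omega> g"
    unfolding set_borel_measurable_def
  proof (rule measurable_Leb_cong_AE)
    show "(\<lambda>x. indicator \<Omega> x *\<^sub>R f x) \<in> borel_measurable (Leb n)"
      using Lp_loc_measurable[OF f \<Omega>] unfolding set_borel_measurable_def .
    show "AE x in Leb n. indicator \<Omega> x *\<^sub>R f x = indicator \<Omega> x *\<^sub>R g x" using e by eventually_elim (auto simp: indicator_def)
  qed
  have mr: "g \<in> borel_measurable (restrict_space (Leb n) \<Omega>)" using m set_measurable_iff_restrict[OF Leb_openin[OF \<Omega>]] by blast
  have "(\<lambda>x. \<bar>g x\<bar> powr p) \<in> borel_measurable (restrict_space (Leb n) \<Omega>)" using mr by measurable
  then have m': "set_borel_measurable (Leb n) \<Omega> (\<lambda>x. \<bar>g x\<bar> powr p)" using set_measurable_iff_restrict[OF Leb_openin[OF \<Omega>]] by blast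
  show "(\<lambda>x. \<bar>g x\<bar> powr p) \<in> Lp_loc n 1 \<Omega>"
  proof (rule Lp_loc_1_bound[OF \<Omega> Lp_loc_powr[OF f] m'])
    fix K assume K: "compactin (Rn n) K" "K \<subseteq> \<Omega>"
    have "AE x in Leb n. x \<in> K \<longrightarrow> \<bar>\<bar>g x\<bar> powr p\<bar> \<le> 1 * \<bar>\<bar>f x\<bar> powr p\<bar>"
      using e
    proof eventually_elim
      case (elim x)
      show ?case
      proof
        assume "x \<in> K"
        then have "f x = g x" using elim subsetD[OF K(2)] by blast
        then show "\<bar>\<bar>g x\<bar> powr p\<bar> \<le> 1 * \<bar>\<bar>f x\<bar> powr p\<bar>" by simp
      qed
    qed
    then show "\<exists>C. AE x in Leb n. x \<in> K \<longrightarrow> \<bar>\<bar>g x\<bar> powr p\<bar> \<le> C * \<bar>\<bar>f x\<bar> powr p\<bar>" by blast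
  qed
qed

lemma Lp_loc_restrict_measurable:
  assumes "openin (Rn n) \<Omega>" "f \<in> Lp_loc n p \<Omega>"
  shows "f \<in> borel_measurable (restrict_space (Leb n) \<Omega>)"
  using Lp_loc_measurable[OF assms(2,1)] set_measurable_iff_restrict[OF Leb_openin[OF assms(1)]] by blast

lemma cont_on_restrict_measurable:
  assumes "openin (Rn n) \<Omega>" "cont_on n \<Omega> f"
  shows "f \<in> borel_measurable (restrict_space (Leb n) \<Omega>)"
  by (rule Lp_loc_restrict_measurable[OF assms(1) cont_on_Lp_loc_1[OF assms]])

lemma Lp_loc_mult_cont:
  assumes \<Omega>: "openin (Rn n) \<Omega>" and p: "0 < p" and f: "f \<in> Lp_loc n p \<Omega>" and h: "cont_on n \<Omega> h"
  shows "(\<lambda>x. h x * f x) \<in> Lp_loc n p \<Omega>"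
proof (rule Lp_locI[OF \<Omega>])
  note mf = Lp_loc_restrict_measurable[OF \<Omega> f] and mh = cont_on_restrict_measurable[OF \<Omega> h]
  have m: "(\<lambda>x. h x * f x) \<in> borel_measurable (restrict_space (Leb n) \<Omega>)" using mf mh by measurable
  then show "set_borel_measurable (Leb n) \<Omega> (\<lambda>x. h x * f x)" using set_measurable_iff_restrict[OF Leb_openin[OF \<Omega>]] by blast
  have m': "set_borel_measurable (Leb n) \<Omega> (\<lambda>x. \<bar>h x * f x\<bar> powr p)"
    unfolding set_measurable_iff_restrict[OF Leb_openin[OF \<Omega>]] using m by measurable
  show "(\<lambda>x. \<bar>h x * f x\<bar> powr p) \<in> Lp_loc n 1 \<Omega>"
  proof (rule Lp_loc_1_bound[OF \<Omega> Lp_loc_powr[OF f] m'])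
    fix K assume K: "compactin (Rn n) K" "K \<subseteq> \<Omega>"
    obtain B where B: "B > 0" "\<forall>x\<in>K. \<bar>h x\<bar> \<le> B" using cont_on_bounded[OF h K] by blast
    have "\<bar>\<bar>h x * f x\<bar> powr p\<bar> \<le> B powr p * \<bar>\<bar>f x\<bar> powr p\<bar>" if "x \<in> K" for x
      using B that p by (auto simp: abs_mult powr_mult intro!: mult_right_mono powr_mono2)
    then show "\<exists>C. AE x in Leb n. x \<in> K \<longrightarrow> \<bar>\<bar>h x * f x\<bar> powr p\<bar> \<le> C * \<bar>\<bar>f x\<bar> powr p\<bar>"
      by (intro exI[of _ "B powr p"] AE_I2) blast
  qed
qed

lemma Lp_loc_add:
  assumes \<Omega>: "openin (Rn n) \<Omega>" and p: "0 < p" and f: "f \<in> Lp_loc n p \<Omega>" and g: "g \<in> Lp_loc n p \<Omega>"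
  shows "(\<lambda>x. f x + g x) \<in> Lp_loc n p \<Omega>"
proof (rule Lp_locI[OF \<Omega>])
  note mf = Lp_loc_restrict_measurable[OF \<Omega> f] and mg = Lp_loc_restrict_measurable[OF \<Omega> g]
  have m: "(\<lambda>x. f x + g x) \<in> borel_measurable (restrict_space (Leb n) \<Omega>)" using mf mg by measurable
  then show "set_borel_measurable (Leb n) \<Omega> (\<lambda>x. f x + g x)" using set_measurable_iff_restrict[OF Leb_openin[OF \<Omega>]] by blast
  have m': "set_borel_measurable (Leb n) \<Omega> (\<lambda>x. \<bar>f x + g x\<bar> powr p)"
    unfolding set_measurable_iff_restrict[OF Leb_openin[OF \<Omega>]] using m by measurable
  show "(\<lambda>x. \<bar>f x + g x\<bar> powr p) \<in> Lp_loc n 1 \<Omega>"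
  proof (rule Lp_loc_1_bound[OF \<Omega> Lp_loc_1_add[OF Lp_loc_powr[OF f] Lp_loc_powr[OF g]] m'])
    fix K
    have "\<bar>\<bar>f x + g x\<bar> powr p\<bar> \<le> 2 powr p * \<bar>\<bar>f x\<bar> powr p + \<bar>g x\<bar> powr p\<bar>" for x
      using abs_powr_add_le[OF p, of "f x" "g x"] by simp
    then show "\<exists>C. AE x in Leb n. x \<in> K \<longrightarrow> \<bar>\<bar>f x + g x\<bar> powr p\<bar> \<le> C * \<bar>\<bar>f x\<bar> powr p + \<bar>g x\<bar> powr p\<bar>"
      by (intro exI[of _ "2 powr p"] AE_I2) blast
  qed
qed

lemma Lp_loc_product:
  assumes \<Omega>: "openin (Rn n) \<Omega>" and p: "1 < p" and f: "f \<in> Lp_loc n (p / (p - 1)) \<Omega>" and g: "g \<in> Lp_loc n p \<Omega>"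
  shows "(\<lambda>x. f x * g x) \<in> Lp_loc n 1 \<Omega>"
proof (rule Lp_loc_1_bound[OF \<Omega> Lp_loc_1_add[OF Lp_loc_powr[OF f] Lp_loc_powr[OF g]]])
  note mf = Lp_loc_restrict_measurable[OF \<Omega> f] and mg = Lp_loc_restrict_measurable[OF \<Omega> g]
  show "set_borel_measurable (Leb n) \<Omega> (\<lambda>x. f x * g x)"
    unfolding set_measurable_iff_restrict[OF Leb_openin[OF \<Omega>]] using mf mg by measurable
  fix K
  have "\<bar>f x * g x\<bar> \<le> 1 * \<bar>\<bar>f x\<bar> powr (p / (p - 1)) + \<bar>g x\<bar> powr p\<bar>" for x
    using young_product[OF p, of "f x" "g x"] by simp
  then show "\<exists>C. AE x in Leb n. x \<in> K \<longrightarrow> \<bar>f x * g x\<bar> \<le> C * \<bar>\<bar>f x\<bar> powr (p / (p - 1)) + \<bar>g x\<bar> powr p\<bar>"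
    by (intro exI[of _ 1] AE_I2) blast
qed

lemma Lp_loc_1_sum:
  assumes "openin (Rn n) \<Omega>" "finite S" "\<And>i. i \<in> S \<Longrightarrow> f i \<in> Lp_loc n 1 \<Omega>"
  shows "(\<lambda>x. \<Sum>i\<in>S. f i x) \<in> Lp_loc n 1 \<Omega>"
  using assms(2,3)
proof (induction S rule: finite_induct)
  case empty
  show ?case using cont_on_Lp_loc_1[OF assms(1) cont_on_const[of n \<Omega> 0]] by simp
next
  case (insert i S)
  then show ?case using Lp_loc_1_add[of "f i" n \<Omega>] by simp
qed

lemma support_integrable:
  assumes \<Omega>: "openin (Rn n) \<Omega>" and f: "f \<in> Lp_loc n 1 \<Omega>" and K: "compactin (Rn n) K" "K \<subseteq> \<Omega>"
    and z: "AE x in Leb n. x \<in> \<Omega> \<longrightarrow> x \<notin> K \<longrightarrow> f x = 0"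
  shows "set_integrable (Leb n) \<Omega> f"
proof -
  note i = Lp_loc_1_integrable[OF f K]
  have e: "AE x in Leb n. indicator K x * f x = indicator \<Omega> x *\<^sub>R f x"
    using z
  proof eventually_elim
    case (elim x)
    then show ?case using subsetD[OF K(2), of x] by (auto simp: indicator_def)
  qed
  have m: "(\<lambda>x. indicator \<Omega> x *\<^sub>R f x) \<in> borel_measurable (Leb n)"
    by (rule measurable_Leb_cong_AE[OF borel_measurable_integrable[OF i] e])
  show ?thesis unfolding set_integrable_def
    using integrable_cong_AE[OF borel_measurable_integrable[OF i] m e] i by simp
qed

lemma cover_set_integrable:
  fixes f :: "pt \<Rightarrow> real"
  assumes K: "compactin (Rn n) K" "K \<subseteq> \<Omega>"
    and loc: "\<And>x. x \<in> \<Omega> \<Longrightarrow> \<exists>r>0. set_integrable (Leb n) (clbox n x r) f"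
  shows "set_integrable (Leb n) K f"
proof -
  obtain r where r: "\<And>x. x \<in> \<Omega> \<Longrightarrow> 0 < r x" "\<And>x. x \<in> \<Omega> \<Longrightarrow> set_integrable (Leb n) (clbox n x (r x)) f" using loc by metis
  have rp: "0 < r x" if "x \<in> K" for x using r(1) subsetD[OF K(2) that] .
  obtain F where F: "finite F" "F \<subseteq> K" "K \<subseteq> (\<Union>x\<in>F. obox n x (r x))"
    using compactin_finite_obox_cover[where r=r, OF K(1) rp] by blast
  have "set_integrable (Leb n) (\<Union>x\<in>F. clbox n x (r x)) f"
  proof (rule set_integrable_UN[OF F(1)])
    fix x assume "x \<in> F"
    then have "x \<in> \<Omega>" using F(2) K(2) by (meson subsetD)
    then show "set_integrable (Leb n) (clbox n x (r x)) f" by (rule r(2))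
    show "clbox n x (r x) \<in> sets (Leb n)" by (rule Leb_sets[OF sets_clbox])
  qed
  moreover have "K \<subseteq> (\<Union>x\<in>F. clbox n x (r x))"
    by (rule order_trans[OF F(3)]) (rule UN_mono[OF order_refl obox_subset_clbox])
  ultimately show ?thesis by (rule set_integrable_subset[OF _ Leb_compactin[OF K(1)]])
qed

lemma obox_domain:
  assumes "x \<in> pts n" "0 < r" "clbox n x r \<subseteq> \<Omega>"
  shows "is_domain n (obox n x r)" "cinside n (obox n x r) \<Omega>"
proof -
  show "is_domain n (obox n x r)"
    unfolding is_domain_def using centre_in_obox[OF assms(1,2)] by (intro conjI openin_obox connectedin_obox) auto
  have "obox n x r \<subseteq> pts n" by (auto simp: obox_def)
  then show "cinside n (obox n x r) \<Omega>"
    unfolding cinside_iff[OF \<open>obox n x r \<subseteq> pts n\<close>]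
    by (intro exI[of _ "clbox n x r"] conjI compactin_clbox obox_subset_clbox assms(3))
qed

lemma openin_clbox:
  assumes "openin (Rn n) \<Omega>" "x \<in> \<Omega>" shows "\<exists>r>0. clbox n x r \<subseteq> \<Omega>"
proof -
  obtain d where d: "d > 0" "obox n x d \<subseteq> \<Omega>" using openin_RnD[OF assms] by blast
  have "clbox n x (d/2) \<subseteq> obox n x d" using d(1) by (intro clbox_subset_obox) simp
  then show ?thesis using d by (intro exI[of _ "d/2"]) (auto intro: order_trans)
qed

text \<open>The Morrey condition speaks of domains \<omega> inside \<Omega>. Open boxes are such
  domains, and finitely many closed boxes inside them cover a compact set.\<close>

lemma morrey_loc_Lp_loc_1:
  assumes \<Omega>: "openin (Rn n) \<Omega>" and V: "V \<in> morrey_loc n q p \<Omega>"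
  shows "V \<in> Lp_loc n 1 \<Omega>"
proof (rule Lp_loc_1I)
  fix K assume K: "compactin (Rn n) K" "K \<subseteq> \<Omega>"
  have "set_integrable (Leb n) K V"
  proof (rule cover_set_integrable[OF K])
    fix x assume x: "x \<in> \<Omega>"
    obtain r where r: "r > 0" "clbox n x r \<subseteq> \<Omega>" using openin_clbox[OF \<Omega> x] by blast
    have xp: "x \<in> pts n" using subsetD[OF openin_subset_pts[OF \<Omega>] x] .
    have m: "V \<in> morrey n q p (obox n x r)" using V obox_domain[OF xp r] unfolding morrey_loc_def by blast
    \<comment> \<open>For p \<le> n the condition only gives local integrability in the open box, so
      one retreats to a smaller closed box.\<close>
    have sub: "clbox n x (r/2) \<subseteq> obox n x r" using r(1) by (intro clbox_subset_obox) simp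
    have "integrable (Leb n) (\<lambda>y. indicator (clbox n x (r/2)) y * V y)"
    proof (cases "p \<le> real n")
      case True
      then have "V \<in> Lp_loc n 1 (obox n x r)" using m unfolding morrey_def by (auto split: if_splits)
      then show ?thesis by (rule Lp_loc_1_integrable[OF _ compactin_clbox sub])
    next
      case False
      then have l: "V \<in> Lp n 1 (obox n x r)" using m unfolding morrey_def by auto
      have "V \<in> Lp_loc n 1 (obox n x r)"
        unfolding Lp_loc_def
      proof (intro CollectI allI impI)
        fix L assume L: "compactin (Rn n) L \<and> L \<subseteq> obox n x r"
        then show "V \<in> Lp n 1 L"
          using l set_measurable_subset[OF _ _ Leb_compactin, of n "obox n x r" V L] set_integrable_subset[of "Leb n" "obox n x r" "\<lambda>x. \<bar>V x\<bar> powr 1" L, OF _ Leb_compactin]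
          unfolding Lp_def by blast
      qed
      then show ?thesis by (rule Lp_loc_1_integrable[OF _ compactin_clbox sub])
    qed
    then show "\<exists>r>0. set_integrable (Leb n) (clbox n x r) V"
      unfolding set_integrable_def using r(1) by (intro exI[of _ "r/2"]) simp
  qed
  then show "integrable (Leb n) (\<lambda>x. indicator K x * V x)" unfolding set_integrable_def by simp
qed

text \<open>The bounds are given on subdomains; a finite cover by boxes and the sum of their
  constants serve a compact set.\<close>

lemma weight_bounded:
  assumes \<Omega>: "openin (Rn n) \<Omega>" and a: "weight n \<Omega> a" and K: "compactin (Rn n) K" "K \<subseteq> \<Omega>"
  shows "\<exists>C>0. AE x in Leb n. x \<in> K \<longrightarrow> (\<forall>i<n. a i x \<le> C)"
proof -
  have "\<forall>x\<in>\<Omega>. \<exists>rC. 0 < fst rC \<and> 0 < snd rC \<and> (AE y in Leb n. y \<in> obox n x (fst rC) \<longrightarrow> (\<forall>i<n. a i y \<le> snd rC))"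
  proof
    fix x assume x: "x \<in> \<Omega>"
    obtain r where r: "r > 0" "clbox n x r \<subseteq> \<Omega>" using openin_clbox[OF \<Omega> x] by blast
    have xp: "x \<in> pts n" using subsetD[OF openin_subset_pts[OF \<Omega>] x] .
    obtain c C where C: "0 < c" "c \<le> C" "\<forall>i<n. AE y in Leb n. y \<in> obox n x r \<longrightarrow> c \<le> a i y \<and> a i y \<le> C"
      using a obox_domain[OF xp r] unfolding weight_def by blast
    have "AE y in Leb n. \<forall>i\<in>{..<n}. y \<in> obox n x r \<longrightarrow> c \<le> a i y \<and> a i y \<le> C"
      using C(3) by (intro AE_finite_allI) auto
    then have "AE y in Leb n. y \<in> obox n x r \<longrightarrow> (\<forall>i<n. a i y \<le> C)" by eventually_elim auto
    then show "\<exists>rC. 0 < fst rC \<and> 0 < snd rC \<and> (AE y in Leb n. y \<in> obox n x (fst rC) \<longrightarrow> (\<forall>i<n. a i y \<le> snd rC))"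
      using r(1) C(1,2) by (intro exI[of _ "(r, C)"]) simp
  qed
  from bchoice[OF this] obtain h where h: "\<forall>x\<in>\<Omega>. 0 < fst (h x) \<and> 0 < snd (h x) \<and> (AE y in Leb n. y \<in> obox n x (fst (h x)) \<longrightarrow> (\<forall>i<n. a i y \<le> snd (h x)))" ..
  define r C where "r = (\<lambda>x. fst (h x))" and "C = (\<lambda>x. snd (h x))"
  have rC: "0 < r x \<and> 0 < C x \<and> (AE y in Leb n. y \<in> obox n x (r x) \<longrightarrow> (\<forall>i<n. a i y \<le> C x))" if "x \<in> \<Omega>" for x
    using h that by (simp add: r_def C_def)
  have rp: "0 < r x" if "x \<in> K" for x using rC[OF subsetD[OF K(2) that]] by simp
  obtain F where F: "finite F" "F \<subseteq> K" "K \<subseteq> (\<Union>x\<in>F. obox n x (r x))"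
    using compactin_finite_obox_cover[where r=r, OF K(1) rp] by blast
  have F\<Omega>: "x \<in> \<Omega>" if "x \<in> F" for x using that F(2) K(2) by (meson subsetD)
  define D where "D = 1 + (\<Sum>x\<in>F. C x)"
  have DC: "C x \<le> D" if "x \<in> F" for x
    unfolding D_def using member_le_sum[of x F C] that F(1) rC[OF F\<Omega>] by (simp add: less_imp_le)
  have "0 < D" unfolding D_def using rC[OF F\<Omega>] by (intro add_pos_nonneg sum_nonneg) (auto simp: less_imp_le)
  moreover have "AE y in Leb n. \<forall>x\<in>F. y \<in> obox n x (r x) \<longrightarrow> (\<forall>i<n. a i y \<le> C x)"
    by (rule AE_finite_allI[OF F(1)]) (simp add: rC[OF F\<Omega>])
  then have "AE y in Leb n. y \<in> K \<longrightarrow> (\<forall>i<n. a i y \<le> D)"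
  proof eventually_elim
    case (elim y)
    show ?case
    proof
      assume "y \<in> K"
      then obtain x where "x \<in> F" "y \<in> obox n x (r x)" using F(3) by auto
      then show "\<forall>i<n. a i y \<le> D" using elim DC by (meson order_trans)
    qed
  qed
  ultimately show ?thesis by blast
qed

text \<open>A crude comparison whose factor grows with n. It serves integrability only and does not
  enter the constants of the theorem.\<close>

lemma lsum_powr_le:
  assumes "0 < p" "p \<le> s"
  shows "lsum n s v powr (p / s) \<le> real n powr (p / s) * (\<Sum>i<n. \<bar>v i\<bar> powr p)"
proof -
  define S where "S = (\<Sum>i<n. \<bar>v i\<bar> powr p)"
  have S: "0 \<le> S" by (simp add: S_def sum_nonneg)
  have "\<bar>v i\<bar> powr s \<le> S powr (s / p)" if "i < n" for i
  proof -
    have "\<bar>v i\<bar> powr p \<le> S" unfolding S_def using that by (intro member_le_sum) auto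
    then have "(\<bar>v i\<bar> powr p) powr (s / p) \<le> S powr (s / p)" using assms by (intro powr_mono2) auto
    then show ?thesis using assms by (simp add: powr_powr)
  qed
  then have "lsum n s v \<le> (\<Sum>i<n. S powr (s / p))" unfolding lsum_def by (intro sum_mono) auto
  then have "lsum n s v powr (p / s) \<le> (real n * S powr (s / p)) powr (p / s)"
    using assms by (intro powr_mono2) (auto simp: lsum_nonneg)
  also have "\<dots> = real n powr (p / s) * S" using assms S by (simp add: powr_mult powr_powr)
  finally show ?thesis by (simp add: S_def)
qed

subsection \<open>Weighted norms in rescaled coordinates\<close>

text \<open>The coordinates \<xi>' of the statement. They absorb the weights, so the weight-free
  vector estimates apply at each point with constants that do not depend on a.\<close>

definition sc :: "real \<Rightarrow> (nat \<Rightarrow> pt \<Rightarrow> real) \<Rightarrow> pt \<Rightarrow> (nat \<Rightarrow> real) \<Rightarrow> nat \<Rightarrow> real" where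
  "sc s a x \<xi> = (\<lambda>i. a i x powr (1 / s) * \<xi> i)"

definition pos_at :: "nat \<Rightarrow> (nat \<Rightarrow> pt \<Rightarrow> real) \<Rightarrow> pt \<Rightarrow> bool" where
  "pos_at n a x \<longleftrightarrow> (\<forall>i<n. 0 < a i x)"

lemma anorm_sc:
  assumes "0 < s" "pos_at n a x"
  shows "anorm n s a x \<xi> = lsum n s (sc s a x \<xi>) powr (1 / s)"
proof -
  have "a i x * \<bar>\<xi> i\<bar> powr s = \<bar>a i x powr (1 / s) * \<xi> i\<bar> powr s" if "i < n" for i
    using assms that by (auto simp: pos_at_def abs_mult powr_mult powr_powr powr_one less_imp_le)
  then have "(\<Sum>i<n. a i x * \<bar>\<xi> i\<bar> powr s) = (\<Sum>i<n. \<bar>a i x powr (1 / s) * \<xi> i\<bar> powr s)" by (intro sum.cong) auto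
  then show ?thesis by (simp add: anorm_def lsum_def sc_def)
qed

lemma R2_sc: "R2 n p s a x \<xi> \<eta> = anorm n s a x \<xi> powr (p - s) * tsum n s (sc s a x \<xi>) (sc s a x \<eta>)"
  by (simp add: R2_def tsum_def sc_def Let_def)

lemma anorm_nonneg: "0 \<le> anorm n s a x \<xi>" by (simp add: anorm_def)

lemma anorm_cong: "(\<And>i. i < n \<Longrightarrow> \<xi> i = \<eta> i) \<Longrightarrow> anorm n s a x \<xi> = anorm n s a x \<eta>"
  by (simp add: anorm_def)

lemma anorm_eq_0:
  assumes "0 < s" "pos_at n a x"
  shows "anorm n s a x \<xi> = 0 \<longleftrightarrow> (\<forall>i<n. \<xi> i = 0)"
  using assms by (fastforce simp: anorm_sc[OF assms] lsum_eq_0_iff sc_def pos_at_def)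

lemma anorm_powr:
  assumes "0 < s" "pos_at n a x"
  shows "anorm n s a x \<xi> powr s = (\<Sum>i<n. a i x * \<bar>\<xi> i\<bar> powr s)"
proof -
  have "0 \<le> (\<Sum>i<n. a i x * \<bar>\<xi> i\<bar> powr s)" using assms by (intro sum_nonneg) (auto simp: pos_at_def less_imp_le)
  then show ?thesis using assms by (simp add: anorm_def powr_powr)
qed

lemma anorm_scale:
  assumes "0 < s" "pos_at n a x" "0 \<le> t"
  shows "anorm n s a x (\<lambda>i. t * \<xi> i) = t * anorm n s a x \<xi>"
proof -
  have "(\<Sum>i<n. a i x * \<bar>t * \<xi> i\<bar> powr s) = t powr s * (\<Sum>i<n. a i x * \<bar>\<xi> i\<bar> powr s)"
    unfolding sum_distrib_left using assms by (intro sum.cong) (auto simp: abs_mult powr_mult)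
  moreover have "0 \<le> (\<Sum>i<n. a i x * \<bar>\<xi> i\<bar> powr s)" using assms by (intro sum_nonneg) (auto simp: pos_at_def less_imp_le)
  ultimately show ?thesis using assms by (simp add: anorm_def powr_mult powr_powr powr_one)
qed

lemma signed_powr_mult_self: "\<bar>t\<bar> powr (s - 2) * t * t = \<bar>t\<bar> powr s" for t :: real
proof (cases "t = 0")
  case False
  have "t * t = \<bar>t\<bar> powr 2" using False by (simp add: power2_eq_square)
  then have "\<bar>t\<bar> powr (s - 2) * t * t = \<bar>t\<bar> powr (s - 2) * \<bar>t\<bar> powr 2" by (simp only: mult.assoc)
  then show ?thesis by (simp only: powr_add[symmetric]) simp
qed simp

text \<open>The exponents of b add up to (s - 2)/s + 1/s + 1/s = 1, so rescaling all coordinates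
  restores exactly one factor b.\<close>

lemma sc_flux:
  fixes s b t r :: real
  assumes "0 < s" "0 < b"
  shows "(\<bar>b powr (1 / s) * t\<bar> powr (s - 2) * (b powr (1 / s) * t)) * (b powr (1 / s) * r) = b * \<bar>t\<bar> powr (s - 2) * t * r"
proof -
  have "(s - 2) / s + 1 / s + 1 / s = 1" using assms by (simp add: field_simps)
  then have "b powr ((s - 2) / s) * b powr (1 / s) * b powr (1 / s) = b powr 1" by (simp only: powr_add[symmetric])
  then have e: "b powr ((s - 2) / s) * b powr (1 / s) * b powr (1 / s) = b" using assms by simp
  have "\<bar>b powr (1 / s) * t\<bar> powr (s - 2) = b powr ((s - 2) / s) * \<bar>t\<bar> powr (s - 2)"
    by (simp add: abs_mult powr_mult powr_powr)
  then have "(\<bar>b powr (1 / s) * t\<bar> powr (s - 2) * (b powr (1 / s) * t)) * (b powr (1 / s) * r)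
    = (b powr ((s - 2) / s) * b powr (1 / s) * b powr (1 / s)) * \<bar>t\<bar> powr (s - 2) * t * r" by (simp only: ac_simps)
  then show ?thesis unfolding e .
qed

lemma vbreg_sc:
  assumes "0 < s" and a: "pos_at n a x"
  shows "vbreg n p s (sc s a x \<xi>) (sc s a x \<eta>) = anorm n s a x (\<lambda>i. \<xi> i + \<eta> i) powr p - anorm n s a x \<xi> powr p
    - p * (anorm n s a x \<xi> powr (p - s) * (\<Sum>i<n. a i x * \<bar>\<xi> i\<bar> powr (s - 2) * \<xi> i * \<eta> i))"
proof -
  have 1: "lsum n s (sc s a x \<zeta>) powr (p / s) = anorm n s a x \<zeta> powr p" for \<zeta>
    using assms by (simp add: anorm_sc powr_powr)
  have 2: "lsum n s (sc s a x \<xi>) powr (p / s - 1) = anorm n s a x \<xi> powr (p - s)"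
    using assms by (simp add: anorm_sc powr_powr diff_divide_distrib)
  have 3: "dsum n s (sc s a x \<xi>) (sc s a x \<eta>) = (\<Sum>i<n. a i x * \<bar>\<xi> i\<bar> powr (s - 2) * \<xi> i * \<eta> i)"
    unfolding dsum_def sc_def using a[unfolded pos_at_def] sc_flux[OF assms(1)] by (intro sum.cong) auto
  have 4: "(\<lambda>i. sc s a x \<xi> i + sc s a x \<eta> i) = sc s a x (\<lambda>i. \<xi> i + \<eta> i)" by (simp add: sc_def algebra_simps)
  show ?thesis unfolding vbreg_def 4 1 2 3 ..
qed

text \<open>The partial derivative in \<xi>_i of the p-th power of the weighted norm divided by p,
  that is, the field paired with the gradient of the test function in the equation.\<close>

definition flux :: "nat \<Rightarrow> real \<Rightarrow> real \<Rightarrow> (nat \<Rightarrow> pt \<Rightarrow> real) \<Rightarrow> pt \<Rightarrow> (nat \<Rightarrow> real) \<Rightarrow> nat \<Rightarrow> real" where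
  "flux n p s a x \<xi> i = anorm n s a x \<xi> powr (p - s) * (a i x * \<bar>\<xi> i\<bar> powr (s - 2) * \<xi> i)"

text \<open>As p < s, the factor N^(p-s) is singular at small gradients; it is compensated by
  |\<xi>_i|^(s-1), which is at most a weight factor times N^(s-1). The net power N^(p-1) places the
  flux in the space dual to L^p.\<close>

lemma flux_bound:
  assumes p: "1 < p" "p < s" and a: "pos_at n a x" and i: "i < n"
  shows "\<bar>flux n p s a x \<xi> i\<bar> \<le> a i x powr (1 / s) * anorm n s a x \<xi> powr (p - 1)"
proof (cases "\<xi> i = 0")
  case False
  define N where "N = anorm n s a x \<xi>"
  have s: "0 < s" using p by simp
  have N: "0 < N" unfolding N_def using anorm_nonneg[of n s a x \<xi>] anorm_eq_0[OF s a, of \<xi>] False i by (auto simp: less_le)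
  have b: "0 < a i x" using a i by (simp add: pos_at_def)
  have "a i x * \<bar>\<xi> i\<bar> powr s \<le> (\<Sum>i<n. a i x * \<bar>\<xi> i\<bar> powr s)"
    using member_le_sum[of i "{..<n}" "\<lambda>i. a i x * \<bar>\<xi> i\<bar> powr s"] i a by (auto simp: pos_at_def less_imp_le)
  then have "(a i x * \<bar>\<xi> i\<bar> powr s) powr ((s - 1) / s) \<le> (N powr s) powr ((s - 1) / s)"
    unfolding N_def anorm_powr[OF s a] using p b by (intro powr_mono2) auto
  then have le: "a i x powr ((s - 1) / s) * \<bar>\<xi> i\<bar> powr (s - 1) \<le> N powr (s - 1)"
    using s by (simp add: powr_mult powr_powr)
  have e1: "\<bar>\<xi> i\<bar> powr (s - 2) * \<bar>\<xi> i\<bar> = \<bar>\<xi> i\<bar> powr (s - 1)"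
    using powr_add[of "\<bar>\<xi> i\<bar>" "s - 2" 1] False by simp
  have "1 / s + (s - 1) / s = 1" using s by (simp add: field_simps)
  then have e2: "a i x powr (1 / s) * a i x powr ((s - 1) / s) = a i x" using b unfolding powr_add[symmetric] by simp
  have "\<bar>flux n p s a x \<xi> i\<bar> = N powr (p - s) * (a i x * (\<bar>\<xi> i\<bar> powr (s - 2) * \<bar>\<xi> i\<bar>))"
    unfolding flux_def N_def[symmetric] using b by (simp add: abs_mult)
  then have eq: "\<bar>flux n p s a x \<xi> i\<bar> = N powr (p - s) * (a i x powr (1 / s) * (a i x powr ((s - 1) / s) * \<bar>\<xi> i\<bar> powr (s - 1)))"
    unfolding e1 using e2 by (metis mult.assoc)
  have "\<bar>flux n p s a x \<xi> i\<bar> \<le> N powr (p - s) * (a i x powr (1 / s) * N powr (s - 1))"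
    unfolding eq using le by (intro mult_left_mono) auto
  then have "\<bar>flux n p s a x \<xi> i\<bar> \<le> a i x powr (1 / s) * (N powr (p - s) * N powr (s - 1))" by (simp only: ac_simps)
  then show ?thesis unfolding powr_add[symmetric] N_def by simp
qed (simp add: flux_def)

text \<open>Picone's identity: \<open>\<nabla>(u\<psi>)\<close> is the sum of \<open>\<psi>\<nabla>u\<close> and \<open>u\<nabla>\<psi>\<close>, and the remainder of the first-order expansion
  of the \<open>p\<close>-th power of the norm between them is that power of \<open>\<nabla>(u\<psi>)\<close> minus the flux of \<open>u\<close> paired with
  \<open>\<nabla>(u\<psi>\<^sup>p)\<close>.\<close>

lemma vbreg_picone:
  assumes p: "1 < p" "p < s" and a: "pos_at n a x" and t: "0 \<le> t"
  shows "vbreg n p s (sc s a x (\<lambda>i. t * U i)) (sc s a x (\<lambda>i. r * \<Psi> i)) =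
    anorm n s a x (\<lambda>i. t * U i + r * \<Psi> i) powr p
    - (\<Sum>i<n. flux n p s a x U i * (r * ((p * t powr (p - 1)) * \<Psi> i) + t powr p * U i))"
proof -
  define N where "N = anorm n s a x U"
  have s: "0 < s" using p by simp
  have N: "0 \<le> N" unfolding N_def by (rule anorm_nonneg)
  have scale: "anorm n s a x (\<lambda>i. t * U i) = t * N" unfolding N_def by (rule anorm_scale[OF s a t])
  define W where "W = (\<Sum>i<n. a i x * \<bar>U i\<bar> powr (s - 2) * U i * \<Psi> i)"
  have S1: "(\<Sum>i<n. a i x * \<bar>t * U i\<bar> powr (s - 2) * (t * U i) * (r * \<Psi> i)) = t powr (s - 2) * t * r * W"
    unfolding W_def sum_distrib_left using t by (intro sum.cong) (simp_all add: abs_mult powr_mult ac_simps)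
  \<comment> \<open>The flux of U paired with U is N^p; multiplied by t^p it is the zeroth-order
    term of the remainder.\<close>
  have S0: "(\<Sum>i<n. a i x * \<bar>U i\<bar> powr (s - 2) * U i * U i) = N powr s"
  proof -
    have "(\<Sum>i<n. a i x * \<bar>U i\<bar> powr (s - 2) * U i * U i) = (\<Sum>i<n. a i x * (\<bar>U i\<bar> powr (s - 2) * U i * U i))"
      by (simp only: mult.assoc)
    also have "\<dots> = N powr s" unfolding signed_powr_mult_self N_def anorm_powr[OF s a] ..
    finally show ?thesis .
  qed
  have "(\<Sum>i<n. flux n p s a x U i * (r * ((p * t powr (p - 1)) * \<Psi> i) + t powr p * U i))
    = (\<Sum>i<n. N powr (p - s) * (r * p * t powr (p - 1)) * (a i x * \<bar>U i\<bar> powr (s - 2) * U i * \<Psi> i)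
        + N powr (p - s) * t powr p * (a i x * \<bar>U i\<bar> powr (s - 2) * U i * U i))"
    unfolding flux_def N_def[symmetric] by (intro sum.cong refl) (simp only: distrib_left ac_simps)
  also have "\<dots> = N powr (p - s) * (r * p * t powr (p - 1)) * W + N powr (p - s) * t powr p * N powr s"
    unfolding sum.distrib sum_distrib_left[symmetric] S0 W_def ..
  also have "N powr (p - s) * t powr p * N powr s = t powr p * (N powr (p - s) * N powr s)" by (simp only: ac_simps)
  also have "N powr (p - s) * N powr s = N powr p" unfolding powr_add[symmetric] by simp
  finally have S2: "(\<Sum>i<n. flux n p s a x U i * (r * ((p * t powr (p - 1)) * \<Psi> i) + t powr p * U i))
    = N powr (p - s) * (r * p * t powr (p - 1)) * W + t powr p * N powr p" .
  \<comment> \<open>Scaling the norm gives t^(p-s) and the signed powers give t^(s-1). Together they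
    are t^(p-1), the power that the derivative of \<psi>^p supplies on the other side.\<close>
  have S3: "p * ((t * N) powr (p - s) * (t powr (s - 2) * t * r * W)) = N powr (p - s) * (r * p * t powr (p - 1)) * W"
  proof (cases "t = 0")
    case False
    then have "t powr (p - s) * (t powr (s - 2) * t) = t powr (p - s) * (t powr (s - 2) * t powr 1)" using t by simp
    also have "\<dots> = t powr (p - 1)" unfolding powr_add[symmetric] by (simp add: algebra_simps)
    finally have e: "t powr (p - s) * (t powr (s - 2) * t) = t powr (p - 1)" .
    have "p * ((t * N) powr (p - s) * (t powr (s - 2) * t * r * W)) = N powr (p - s) * (r * p * (t powr (p - s) * (t powr (s - 2) * t))) * W"
      using t N by (simp add: powr_mult ac_simps)
    then show ?thesis unfolding e .
  qed simp
  show ?thesis unfolding vbreg_sc[OF s a] scale S1 S2 S3 using t N by (simp add: powr_mult)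
qed

subsection \<open>Weak gradients of the functions involved\<close>

lemma wgrad_weak:
  assumes "weak_partial n \<Omega> i f g" shows "weak_partial n \<Omega> i f (\<lambda>x. wgrad n \<Omega> f x i)"
  unfolding wgrad_def by (rule someI[of "weak_partial n \<Omega> i f", OF assms])

lemma wgrad_AE:
  assumes "openin (Rn n) \<Omega>" "weak_partial n \<Omega> i f g"
  shows "AE x in Leb n. x \<in> \<Omega> \<longrightarrow> g x = wgrad n \<Omega> f x i"
  by (rule weak_partial_unique[OF assms(1,2) wgrad_weak[OF assms(2)]])

lemma Lp_imp_Lp_loc:
  assumes "f \<in> Lp n p \<Omega>" shows "f \<in> Lp_loc n p \<Omega>"
  unfolding Lp_loc_def
proof (intro CollectI allI impI)
  fix K assume K: "compactin (Rn n) K \<and> K \<subseteq> \<Omega>"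
  show "f \<in> Lp n p K" unfolding Lp_def
  proof (intro CollectI conjI)
    show "set_borel_measurable (Leb n) K f"
      by (rule set_measurable_subset[of _ \<Omega>]) (use assms K Leb_compactin in \<open>auto simp: Lp_def\<close>)
    show "set_integrable (Leb n) K (\<lambda>x. \<bar>f x\<bar> powr p)"
      by (rule set_integrable_subset[of _ \<Omega>]) (use assms K Leb_compactin in \<open>auto simp: Lp_def\<close>)
  qed
qed

lemma W1p_imp_W1p_loc: "f \<in> W1p n p \<Omega> \<Longrightarrow> f \<in> W1p_loc n p \<Omega>"
  unfolding W1p_def W1p_loc_def using Lp_imp_Lp_loc by blast

lemma W1p_loc_wgrad:
  assumes "openin (Rn n) \<Omega>" "f \<in> W1p_loc n p \<Omega>" "i < n"
  shows "weak_partial n \<Omega> i f (\<lambda>x. wgrad n \<Omega> f x i)" "(\<lambda>x. wgrad n \<Omega> f x i) \<in> Lp_loc n p \<Omega>"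
proof -
  obtain g where g: "g \<in> Lp_loc n p \<Omega>" "weak_partial n \<Omega> i f g" using assms(2,3) unfolding W1p_loc_def by blast
  show "weak_partial n \<Omega> i f (\<lambda>x. wgrad n \<Omega> f x i)" by (rule wgrad_weak[OF g(2)])
  show "(\<lambda>x. wgrad n \<Omega> f x i) \<in> Lp_loc n p \<Omega>" by (rule Lp_loc_cong_AE[OF assms(1) g(1) wgrad_AE[OF assms(1) g(2)]])
qed

text \<open>On the nonnegative half-line t^q is the restriction of |t|^(q-1) t, whose continuity on
  the whole line, 0 included, is already available.\<close>

lemma cont_on_powr:
  assumes f: "cont_on n \<Omega> f" "\<And>x. x \<in> \<Omega> \<Longrightarrow> 0 \<le> f x" and q: "0 < q"
  shows "cont_on n \<Omega> (\<lambda>x. f x powr q)"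
proof -
  have "continuous_on UNIV (\<lambda>x::real. \<bar>x\<bar> powr ((q + 1) - 2) * x)" using q by (intro continuous_signed_powr) simp
  from cont_on_compose[OF f(1) this] have c: "cont_on n \<Omega> (\<lambda>x. \<bar>f x\<bar> powr ((q + 1) - 2) * f x)" .
  have "\<bar>f x\<bar> powr ((q + 1) - 2) * f x = f x powr q" if "x \<in> \<Omega>" for x
    using powr_add[of "f x" "q - 1" 1] f(2)[OF that] by (cases "f x = 0") simp_all
  then show ?thesis using c cont_on_cong[of \<Omega> "\<lambda>x. \<bar>f x\<bar> powr ((q + 1) - 2) * f x" "\<lambda>x. f x powr q" n] by blast
qed

lemma weight_measurable:
  assumes "openin (Rn n) \<Omega>" "weight n \<Omega> a" "i < n"
  shows "a i \<in> borel_measurable (restrict_space (Leb n) \<Omega>)"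
  using assms set_measurable_iff_restrict[OF Leb_openin[OF assms(1)], of "a i"] unfolding weight_def by blast

lemma weight_pos: "weight n \<Omega> a \<Longrightarrow> x \<in> \<Omega> \<Longrightarrow> pos_at n a x" unfolding weight_def pos_at_def by blast

lemma anorm_measurable:
  assumes "openin (Rn n) \<Omega>" "weight n \<Omega> a"
    and "\<And>i. i < n \<Longrightarrow> (\<lambda>x. v x i) \<in> borel_measurable (restrict_space (Leb n) \<Omega>)"
  shows "(\<lambda>x. anorm n s a x (v x)) \<in> borel_measurable (restrict_space (Leb n) \<Omega>)"
proof -
  have "(\<lambda>x. \<Sum>i<n. a i x * \<bar>v x i\<bar> powr s) \<in> borel_measurable (restrict_space (Leb n) \<Omega>)"
  proof (rule borel_measurable_sum)
    fix i assume "i \<in> {..<n}"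
    then have i: "i < n" by simp
    note assms(3)[OF i, measurable] weight_measurable[OF assms(1,2) i, measurable]
    show "(\<lambda>x. a i x * \<bar>v x i\<bar> powr s) \<in> borel_measurable (restrict_space (Leb n) \<Omega>)" by measurable
  qed
  then show ?thesis unfolding anorm_def by measurable
qed

lemma anorm_powr_Lp_loc:
  assumes \<Omega>: "openin (Rn n) \<Omega>" and a: "weight n \<Omega> a" and p: "1 < p" "p < s"
    and v: "\<And>i. i < n \<Longrightarrow> (\<lambda>x. v x i) \<in> Lp_loc n p \<Omega>"
  shows "(\<lambda>x. anorm n s a x (v x) powr p) \<in> Lp_loc n 1 \<Omega>"
proof (rule Lp_loc_1_bound[OF \<Omega>, where g="\<lambda>x. \<Sum>i<n. \<bar>v x i\<bar> powr p"])
  show "(\<lambda>x. \<Sum>i<n. \<bar>v x i\<bar> powr p) \<in> Lp_loc n 1 \<Omega>"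
    by (rule Lp_loc_1_sum[OF \<Omega>]) (auto intro: Lp_loc_powr v)
  have "(\<lambda>x. anorm n s a x (v x)) \<in> borel_measurable (restrict_space (Leb n) \<Omega>)"
    by (rule anorm_measurable[OF \<Omega> a Lp_loc_restrict_measurable[OF \<Omega> v]])
  then show "set_borel_measurable (Leb n) \<Omega> (\<lambda>x. anorm n s a x (v x) powr p)"
    unfolding set_measurable_iff_restrict[OF Leb_openin[OF \<Omega>]] by measurable
  fix K assume K: "compactin (Rn n) K" "K \<subseteq> \<Omega>"
  obtain C where C: "0 < C" "AE x in Leb n. x \<in> K \<longrightarrow> (\<forall>i<n. a i x \<le> C)" using weight_bounded[OF \<Omega> a K] by blast
  define B where "B = real n powr (p / s) * C powr (p / s)"
  from C(2) have "AE x in Leb n. x \<in> K \<longrightarrow> \<bar>anorm n s a x (v x) powr p\<bar> \<le> B * \<bar>\<Sum>i<n. \<bar>v x i\<bar> powr p\<bar>"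
  proof eventually_elim
    case (elim x)
    show ?case
    proof
      assume x: "x \<in> K"
      have s: "0 < s" using p by simp
      note ax = weight_pos[OF a subsetD[OF K(2) x]]
      have aC: "\<forall>i<n. a i x \<le> C" using elim x by blast
      have tm: "\<bar>sc s a x (v x) i\<bar> powr p \<le> C powr (p / s) * \<bar>v x i\<bar> powr p" if "i < n" for i
      proof -
        have "\<bar>sc s a x (v x) i\<bar> powr p = a i x powr (p / s) * \<bar>v x i\<bar> powr p"
          unfolding sc_def by (simp add: abs_mult powr_mult powr_powr)
        moreover have "a i x powr (p / s) \<le> C powr (p / s)" using ax aC p s \<open>i < n\<close> by (intro powr_mono2) (auto simp: pos_at_def less_imp_le)
        ultimately show ?thesis by (simp add: mult_right_mono)
      qed
      have "anorm n s a x (v x) powr p = lsum n s (sc s a x (v x)) powr (p / s)"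
        by (simp add: anorm_sc[OF s ax] powr_powr)
      also have "\<dots> \<le> real n powr (p / s) * (\<Sum>i<n. \<bar>sc s a x (v x) i\<bar> powr p)" using p by (intro lsum_powr_le) auto
      also have "\<dots> \<le> real n powr (p / s) * (\<Sum>i<n. C powr (p / s) * \<bar>v x i\<bar> powr p)"
        using tm by (intro mult_left_mono sum_mono) auto
      also have "\<dots> = B * (\<Sum>i<n. \<bar>v x i\<bar> powr p)" by (simp add: B_def sum_distrib_left mult.assoc)
      finally show "\<bar>anorm n s a x (v x) powr p\<bar> \<le> B * \<bar>\<Sum>i<n. \<bar>v x i\<bar> powr p\<bar>" by (simp add: sum_nonneg)
    qed
  qed
  then show "\<exists>C. AE x in Leb n. x \<in> K \<longrightarrow> \<bar>anorm n s a x (v x) powr p\<bar> \<le> C * \<bar>\<Sum>i<n. \<bar>v x i\<bar> powr p\<bar>" by blast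
qed

lemma flux_Lp_loc:
  assumes \<Omega>: "openin (Rn n) \<Omega>" and a: "weight n \<Omega> a" and p: "1 < p" "p < s"
    and v: "\<And>i. i < n \<Longrightarrow> (\<lambda>x. v x i) \<in> Lp_loc n p \<Omega>" and i: "i < n"
  shows "(\<lambda>x. flux n p s a x (v x) i) \<in> Lp_loc n (p / (p - 1)) \<Omega>"
proof (rule Lp_locI[OF \<Omega>])
  note [measurable] = anorm_measurable[OF \<Omega> a Lp_loc_restrict_measurable[OF \<Omega> v], where s=s]
    weight_measurable[OF \<Omega> a i] Lp_loc_restrict_measurable[OF \<Omega> v[OF i]]
  have m: "(\<lambda>x. flux n p s a x (v x) i) \<in> borel_measurable (restrict_space (Leb n) \<Omega>)"
    unfolding flux_def by measurable
  then show "set_borel_measurable (Leb n) \<Omega> (\<lambda>x. flux n p s a x (v x) i)"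
    unfolding set_measurable_iff_restrict[OF Leb_openin[OF \<Omega>]] .
  have m': "set_borel_measurable (Leb n) \<Omega> (\<lambda>x. \<bar>flux n p s a x (v x) i\<bar> powr (p / (p - 1)))"
    unfolding set_measurable_iff_restrict[OF Leb_openin[OF \<Omega>]] using m by measurable
  show "(\<lambda>x. \<bar>flux n p s a x (v x) i\<bar> powr (p / (p - 1))) \<in> Lp_loc n 1 \<Omega>"
  proof (rule Lp_loc_1_bound[OF \<Omega> anorm_powr_Lp_loc[OF \<Omega> a p v] m'])
    fix K assume K: "compactin (Rn n) K" "K \<subseteq> \<Omega>"
    obtain C where C: "0 < C" "AE x in Leb n. x \<in> K \<longrightarrow> (\<forall>i<n. a i x \<le> C)" using weight_bounded[OF \<Omega> a K] by blast
    define B where "B = (C powr (1 / s)) powr (p / (p - 1))"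
    from C(2) have "AE x in Leb n. x \<in> K \<longrightarrow> \<bar>\<bar>flux n p s a x (v x) i\<bar> powr (p / (p - 1))\<bar> \<le> B * \<bar>anorm n s a x (v x) powr p\<bar>"
    proof eventually_elim
      case (elim x)
      show ?case
      proof
        assume x: "x \<in> K"
        note ax = weight_pos[OF a subsetD[OF K(2) x]]
        have "a i x \<le> C" using elim x i by blast
        then have aC: "a i x powr (1 / s) \<le> C powr (1 / s)" using ax i p by (intro powr_mono2) (auto simp: pos_at_def less_imp_le)
        have "\<bar>flux n p s a x (v x) i\<bar> \<le> C powr (1 / s) * anorm n s a x (v x) powr (p - 1)"
          by (rule order_trans[OF flux_bound[OF p ax i] mult_right_mono[OF aC]]) simp
        then have "\<bar>flux n p s a x (v x) i\<bar> powr (p / (p - 1)) \<le> (C powr (1 / s) * anorm n s a x (v x) powr (p - 1)) powr (p / (p - 1))"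
          using p by (intro powr_mono2) auto
        then show "\<bar>\<bar>flux n p s a x (v x) i\<bar> powr (p / (p - 1))\<bar> \<le> B * \<bar>anorm n s a x (v x) powr p\<bar>"
          using p by (simp add: B_def powr_mult powr_powr)
      qed
    qed
    then show "\<exists>C. AE x in Leb n. x \<in> K \<longrightarrow> \<bar>\<bar>flux n p s a x (v x) i\<bar> powr (p / (p - 1))\<bar> \<le> C * \<bar>anorm n s a x (v x) powr p\<bar>" by blast
  qed
qed

subsection \<open>Comparison of extended integrals\<close>

lemma nint_measurable:
  assumes \<Omega>: "openin (Rn n) \<Omega>" and f: "f \<in> borel_measurable (restrict_space (Leb n) \<Omega>)" and A: "A \<in> sets (Leb n)" "A \<subseteq> \<Omega>"
  shows "(\<lambda>x. ennreal (f x) * indicator A x) \<in> borel_measurable (Leb n)"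
proof -
  have s: "\<Omega> \<inter> space (Leb n) \<in> sets (Leb n)" using Leb_openin[OF \<Omega>] by auto
  have "(\<lambda>x. ennreal (f x)) \<in> borel_measurable (restrict_space (Leb n) \<Omega>)" using f by measurable
  then have "(\<lambda>x. ennreal (f x) * indicator \<Omega> x) \<in> borel_measurable (Leb n)"
    by (rule borel_measurable_restrict_space_iff_ennreal[OF s, THEN iffD1])
  then have "(\<lambda>x. (ennreal (f x) * indicator \<Omega> x) * indicator A x) \<in> borel_measurable (Leb n)"
    by (rule borel_measurable_times_ennreal[OF _ borel_measurable_indicator[OF A(1)]])
  moreover have "(\<lambda>x. (ennreal (f x) * indicator \<Omega> x) * indicator A x) = (\<lambda>x. ennreal (f x) * indicator A x)"
  proof
    fix x show "(ennreal (f x) * indicator \<Omega> x) * indicator A x = ennreal (f x) * indicator A x"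
      using subsetD[OF A(2), of x] by (simp add: indicator_def)
  qed
  ultimately show ?thesis by (simp only:)
qed

lemma enn2ereal_combination:
  assumes "0 \<le> c" shows "ereal c * enn2ereal I + ereal c * enn2ereal J = enn2ereal (ennreal c * I + ennreal c * J)"
  using assms by (simp add: times_ennreal.rep_eq plus_ennreal.rep_eq)

text \<open>Collects two possibly infinite integrals over different sets into one, so that
  comparisons can be made on integrands.\<close>

lemma nint_combination:
  assumes \<Omega>: "openin (Rn n) \<Omega>" and c: "0 \<le> c"
    and f: "f \<in> borel_measurable (restrict_space (Leb n) \<Omega>)" "A \<in> sets (Leb n)" "A \<subseteq> \<Omega>"
    and g: "g \<in> borel_measurable (restrict_space (Leb n) \<Omega>)" "B \<in> sets (Leb n)" "B \<subseteq> \<Omega>"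
  shows "ereal c * nint n A f + ereal c * nint n B g =
    enn2ereal (\<integral>\<^sup>+x. ennreal (c * f x) * indicator A x + ennreal (c * g x) * indicator B x \<partial>Leb n)"
proof -
  note mf = nint_measurable[OF \<Omega> f] and mg = nint_measurable[OF \<Omega> g]
  have "(\<integral>\<^sup>+x. ennreal (c * f x) * indicator A x + ennreal (c * g x) * indicator B x \<partial>Leb n)
    = (\<integral>\<^sup>+x. ennreal c * (ennreal (f x) * indicator A x) + ennreal c * (ennreal (g x) * indicator B x) \<partial>Leb n)"
    using c by (simp add: ennreal_mult' mult.assoc)
  also have "\<dots> = (\<integral>\<^sup>+x. ennreal c * (ennreal (f x) * indicator A x) \<partial>Leb n) + (\<integral>\<^sup>+x. ennreal c * (ennreal (g x) * indicator B x) \<partial>Leb n)"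
    by (intro nn_integral_add borel_measurable_times_ennreal mf mg borel_measurable_const)
  also have "\<dots> = ennreal c * (\<integral>\<^sup>+x\<in>A. ennreal (f x) \<partial>Leb n) + ennreal c * (\<integral>\<^sup>+x\<in>B. ennreal (g x) \<partial>Leb n)"
    unfolding nn_integral_cmult[OF mf] nn_integral_cmult[OF mg] ..
  finally show ?thesis unfolding nint_def enn2ereal_combination[OF c] by simp
qed

lemma nint_set_integral:
  assumes "set_integrable (Leb n) \<Omega> h" "\<And>x. x \<in> \<Omega> \<Longrightarrow> 0 \<le> h x"
  shows "nint n \<Omega> h = ereal (LINT x:\<Omega>|Leb n. h x)"
proof -
  have "(\<integral>\<^sup>+x\<in>\<Omega>. ennreal (h x) \<partial>Leb n) = (\<integral>\<^sup>+x. ennreal (indicator \<Omega> x *\<^sub>R h x) \<partial>Leb n)"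
    by (intro nn_integral_cong) (simp add: indicator_def)
  also have "\<dots> = ennreal (LINT x|Leb n. indicator \<Omega> x *\<^sub>R h x)"
    using assms unfolding set_integrable_def by (intro nn_integral_eq_integral AE_I2) (auto simp: indicator_def)
  finally have "nint n \<Omega> h = enn2ereal (ennreal (LINT x:\<Omega>|Leb n. h x))" unfolding nint_def set_lebesgue_integral_def by simp
  moreover have "0 \<le> (LINT x:\<Omega>|Leb n. h x)" unfolding set_lebesgue_integral_def
    using assms(2) by (intro integral_nonneg_AE AE_I2) (auto simp: indicator_def)
  ultimately show ?thesis by simp
qed

subsection \<open>The defect representation of the functional\<close>

lemma set_integral_sum':
  fixes f :: "'i \<Rightarrow> 'b \<Rightarrow> real"
  assumes "\<And>i. i \<in> S \<Longrightarrow> set_integrable M A (f i)"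
  shows "(LINT x:A|M. \<Sum>i\<in>S. f i x) = (\<Sum>i\<in>S. LINT x:A|M. f i x)" "set_integrable M A (\<lambda>x. \<Sum>i\<in>S. f i x)"
  using assms by (simp_all add: set_lebesgue_integral_def set_integrable_def sum_distrib_left)

lemma nonneg_testsD:
  assumes "\<psi> \<in> nonneg_tests n p \<Omega>"
  shows "\<psi> \<in> Cc n \<Omega>" "cont_on n \<Omega> \<psi>" "\<psi> \<in> W1p_loc n p \<Omega>" "\<And>x. x \<in> \<Omega> \<Longrightarrow> 0 \<le> \<psi> x"
  using assms W1p_imp_W1p_loc unfolding nonneg_tests_def Cc_def by auto

lemma Cc_upper_bound:
  assumes \<Omega>: "openin (Rn n) \<Omega>" and f: "f \<in> Cc n \<Omega>"
  shows "\<exists>B\<ge>1. \<forall>x\<in>\<Omega>. f x \<le> B"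
proof -
  obtain K where K: "compactin (Rn n) K" "K \<subseteq> \<Omega>" "\<forall>x\<in>\<Omega>. x \<notin> K \<longrightarrow> f x = 0" using Cc_support[OF \<Omega> f] by blast
  have "cont_on n \<Omega> f" using f by (simp add: Cc_def)
  from cont_on_bounded[OF this K(1,2)] obtain B where B: "B > 0" "\<forall>x\<in>K. \<bar>f x\<bar> \<le> B" by blast
  have "f x \<le> B + 1" if "x \<in> \<Omega>" for x
  proof (cases "x \<in> K")
    case True
    then show ?thesis using B(2) by (force dest!: bspec)
  next
    case False
    then show ?thesis using K(3) that B(1) by simp
  qed
  then show ?thesis using B(1) by (intro exI[of _ "B + 1"]) simp
qed

lemma wgrad_zero_set:
  assumes \<Omega>: "openin (Rn n) \<Omega>" and \<psi>: "\<psi> \<in> nonneg_tests n p \<Omega>"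
  shows "AE x in Leb n. x \<in> \<Omega> \<longrightarrow> \<psi> x = 0 \<longrightarrow> (\<forall>i<n. wgrad n \<Omega> \<psi> x i = 0)"
proof -
  note t = nonneg_testsD[OF \<psi>]
  obtain B where B: "1 \<le> B" "\<forall>x\<in>\<Omega>. \<psi> x \<le> B" using Cc_upper_bound[OF \<Omega> t(1)] by blast
  have b: "\<And>x. x \<in> \<Omega> \<Longrightarrow> 0 \<le> \<psi> x \<and> \<psi> x \<le> B" using t(4) B(2) by blast
  have "AE x in Leb n. x \<in> \<Omega> \<longrightarrow> \<psi> x = 0 \<longrightarrow> wgrad n \<Omega> \<psi> x i = 0" if i: "i < n" for i
    by (rule weak_partial_zero_set[OF \<Omega> i t(2) W1p_loc_wgrad(1)[OF \<Omega> t(3) i] b B(1)])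
  then have "AE x in Leb n. \<forall>i\<in>{..<n}. x \<in> \<Omega> \<longrightarrow> \<psi> x = 0 \<longrightarrow> wgrad n \<Omega> \<psi> x i = 0"
    by (intro AE_finite_allI) auto
  then show ?thesis by eventually_elim auto
qed

definition defect :: "nat \<Rightarrow> real \<Rightarrow> real \<Rightarrow> (nat \<Rightarrow> pt \<Rightarrow> real) \<Rightarrow> pt set \<Rightarrow> (pt \<Rightarrow> real) \<Rightarrow> (pt \<Rightarrow> real) \<Rightarrow> pt \<Rightarrow> real" where
  "defect n p s a \<Omega> u \<psi> x = vbreg n p s (sc s a x (cgrad n \<Omega> \<psi> u x)) (sc s a x (cgrad n \<Omega> u \<psi> x))"

locale positive_solution_setting =
  fixes n :: nat and p s :: real and \<Omega> a V u
  assumes p: "1 < p" "p < s" and \<Omega>: "openin (Rn n) \<Omega>" and a: "weight n \<Omega> a" and V: "V \<in> Lp_loc n 1 \<Omega>"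
    and u: "positive_solution n p s a V \<Omega> u" and uc: "cont_on n \<Omega> u"
begin

lemma u_W1p_loc: "u \<in> W1p_loc n p \<Omega>" using u unfolding positive_solution_def by blast

lemmas U = W1p_loc_wgrad[OF \<Omega> u_W1p_loc]

lemma flux_u: "i < n \<Longrightarrow> (\<lambda>x. flux n p s a x (wgrad n \<Omega> u x) i) \<in> Lp_loc n (p / (p - 1)) \<Omega>"
  by (rule flux_Lp_loc[OF \<Omega> a p U(2)])

lemma potential_term: "(\<lambda>x. V x * (\<bar>u x\<bar> powr (p - 2) * u x)) \<in> Lp_loc n 1 \<Omega>"
  by (rule Lp_loc_1_mult_cont[OF \<Omega> V cont_on_compose[OF uc continuous_signed_powr[OF p(1)]]])

lemma equation:
  assumes \<phi>: "\<phi> \<in> Cc_inf n \<Omega>"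
  shows "(\<Sum>i<n. LINT x:\<Omega>|Leb n. flux n p s a x (wgrad n \<Omega> u x) i * partial i \<phi> x)
    + (LINT x:\<Omega>|Leb n. (V x * (\<bar>u x\<bar> powr (p - 2) * u x)) * \<phi> x) = 0"
proof -
  have p': "1 \<le> p / (p - 1)" using p by simp
  have int: "set_integrable (Leb n) \<Omega> (\<lambda>x. flux n p s a x (wgrad n \<Omega> u x) i * partial i \<phi> x)" if "i \<in> {..<n}" for i
    using that by (intro test_integrable[OF \<Omega> Lp_loc_imp_1[OF p' flux_u] partial_Cc[OF \<Omega> \<phi>]]) auto
  have "(\<Sum>i<n. LINT x:\<Omega>|Leb n. flux n p s a x (wgrad n \<Omega> u x) i * partial i \<phi> x)
    = (LINT x:\<Omega>|Leb n. \<Sum>i<n. flux n p s a x (wgrad n \<Omega> u x) i * partial i \<phi> x)"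
    by (rule set_integral_sum'(1)[OF int, symmetric])
  also have "\<dots> = (LINT x:\<Omega>|Leb n. anorm n s a x (wgrad n \<Omega> u x) powr (p - s) *
       (\<Sum>i<n. a i x * \<bar>wgrad n \<Omega> u x i\<bar> powr (s - 2) * wgrad n \<Omega> u x i * partial i \<phi> x))"
    unfolding flux_def sum_distrib_left by (simp only: mult.assoc)
  finally have "(\<Sum>i<n. LINT x:\<Omega>|Leb n. flux n p s a x (wgrad n \<Omega> u x) i * partial i \<phi> x) = \<dots>" .
  moreover have "(LINT x:\<Omega>|Leb n. anorm n s a x (wgrad n \<Omega> u x) powr (p - s) *
       (\<Sum>i<n. a i x * \<bar>wgrad n \<Omega> u x i\<bar> powr (s - 2) * wgrad n \<Omega> u x i * partial i \<phi> x))
      + (LINT x:\<Omega>|Leb n. V x * \<bar>u x\<bar> powr (p - 2) * u x * \<phi> x) = 0"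
    using u \<phi> unfolding positive_solution_def by blast
  ultimately show ?thesis by (simp only: mult.assoc)
qed

context
  fixes \<psi> assumes \<psi>: "\<psi> \<in> nonneg_tests n p \<Omega>"
begin

lemmas \<psi>D = nonneg_testsD[OF \<psi>]
lemmas \<Psi> = W1p_loc_wgrad[OF \<Omega> \<psi>D(3)]

text \<open>With v = u\<psi> this is Picone's test function v^p / u^(p-1), which makes the potential
  term of the equation equal to V |u\<psi>|^p.\<close>

definition "test x = u x * \<psi> x powr p"
definition "testgrad i x = u x * ((p * \<psi> x powr (p - 1)) * wgrad n \<Omega> \<psi> x i) + \<psi> x powr p * wgrad n \<Omega> u x i"

lemma psi_powr_cont: "0 < q \<Longrightarrow> cont_on n \<Omega> (\<lambda>x. \<psi> x powr q)"
  by (rule cont_on_powr[OF \<psi>D(2,4)])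

lemma test_Cc: "test \<in> Cc n \<Omega>"
proof -
  obtain K where K: "compactin (Rn n) K" "K \<subseteq> \<Omega>" "\<forall>x\<in>\<Omega>. x \<notin> K \<longrightarrow> \<psi> x = 0" using Cc_support[OF \<Omega> \<psi>D(1)] by blast
  have "cont_on n \<Omega> test" unfolding test_def[abs_def] using p by (intro cont_on_mult uc psi_powr_cont) simp
  then show ?thesis by (rule CcI[OF \<Omega> _ K(1,2)]) (simp add: test_def K(3))
qed

lemma testgrad_weak:
  assumes i: "i < n" shows "weak_partial n \<Omega> i test (testgrad i)"
proof -
  obtain B where B: "1 \<le> B" "\<forall>x\<in>\<Omega>. \<psi> x \<le> B" using Cc_upper_bound[OF \<Omega> \<psi>D(1)] by blast
  have b: "\<And>x. x \<in> \<Omega> \<Longrightarrow> 0 \<le> \<psi> x \<and> \<psi> x \<le> B" using \<psi>D(4) B(2) by blast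
  have "weak_partial n \<Omega> i (\<lambda>x. \<psi> x powr p) (\<lambda>x. (p * \<psi> x powr (p - 1)) * wgrad n \<Omega> \<psi> x i)"
    using B(1) by (intro weak_partial_powr[OF \<Omega> i \<psi>D(2) \<Psi>(1)[OF i] b p(1)]) auto
  from weak_partial_product[OF \<Omega> i uc U(1)[OF i] psi_powr_cont this] p
  show ?thesis unfolding test_def[abs_def] testgrad_def[abs_def] by simp
qed

lemma testgrad_Lp_loc:
  assumes i: "i < n" shows "testgrad i \<in> Lp_loc n p \<Omega>"
proof -
  have p0: "0 < p" "0 < p - 1" using p by auto
  note c = cont_on_mult[OF cont_on_const[of n \<Omega> p] psi_powr_cont[OF p0(2)]]
  show ?thesis unfolding testgrad_def[abs_def]
    by (rule Lp_loc_add[OF \<Omega> p0(1) Lp_loc_mult_cont[OF \<Omega> p0(1) Lp_loc_mult_cont[OF \<Omega> p0(1) \<Psi>(2)[OF i] c] uc]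
      Lp_loc_mult_cont[OF \<Omega> p0(1) U(2)[OF i] psi_powr_cont[OF p0(1)]]])
qed

lemma equation_tested:
  "(\<Sum>i<n. LINT x:\<Omega>|Leb n. flux n p s a x (wgrad n \<Omega> u x) i * testgrad i x)
    + (LINT x:\<Omega>|Leb n. (V x * (\<bar>u x\<bar> powr (p - 2) * u x)) * test x) = 0"
  by (rule test_extension[OF \<Omega> p(1) test_Cc testgrad_weak testgrad_Lp_loc flux_u potential_term equation])

lemma defect_eq:
  assumes x: "x \<in> \<Omega>"
  shows "defect n p s a \<Omega> u \<psi> x = anorm n s a x (\<lambda>i. \<psi> x * wgrad n \<Omega> u x i + u x * wgrad n \<Omega> \<psi> x i) powr p
    - (\<Sum>i<n. flux n p s a x (wgrad n \<Omega> u x) i * testgrad i x)"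
  unfolding defect_def cgrad_def testgrad_def by (rule vbreg_picone[OF p weight_pos[OF a x] \<psi>D(4)[OF x]])

lemma wgrad_product_AE:
  "AE x in Leb n. x \<in> \<Omega> \<longrightarrow> (\<forall>i<n. wgrad n \<Omega> (\<lambda>x. u x * \<psi> x) x i = \<psi> x * wgrad n \<Omega> u x i + u x * wgrad n \<Omega> \<psi> x i)"
proof -
  have "AE x in Leb n. x \<in> \<Omega> \<longrightarrow> u x * wgrad n \<Omega> \<psi> x i + \<psi> x * wgrad n \<Omega> u x i = wgrad n \<Omega> (\<lambda>x. u x * \<psi> x) x i" if i: "i < n" for i
    by (rule wgrad_AE[OF \<Omega> weak_partial_product[OF \<Omega> i uc U(1)[OF i] \<psi>D(2) \<Psi>(1)[OF i]]])
  then have "AE x in Leb n. \<forall>i\<in>{..<n}. x \<in> \<Omega> \<longrightarrow> u x * wgrad n \<Omega> \<psi> x i + \<psi> x * wgrad n \<Omega> u x i = wgrad n \<Omega> (\<lambda>x. u x * \<psi> x) x i"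
    by (intro AE_finite_allI) auto
  then show ?thesis by eventually_elim (auto simp: add.commute)
qed

text \<open>\<open>?E\<close> is the gradient term of the functional, \<open>?F\<close> the flux
  pairing and \<open>?W\<close> the potential term. Each is integrable over \<Omega> because of the
  compact support of \<psi>; the tested equation trades \<open>?W\<close> for minus the sum of
  \<open>?F\<close>, and Picone's identity recognises the rest.\<close>

lemma defect_integral:
  "set_integrable (Leb n) \<Omega> (defect n p s a \<Omega> u \<psi>)"
  "Q_fun n p s a V \<Omega> (\<lambda>x. u x * \<psi> x) = (LINT x:\<Omega>|Leb n. defect n p s a \<Omega> u \<psi> x)"
proof -
  let ?E = "\<lambda>x. anorm n s a x (\<lambda>i. \<psi> x * wgrad n \<Omega> u x i + u x * wgrad n \<Omega> \<psi> x i) powr p"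
  let ?F = "\<lambda>i x. flux n p s a x (wgrad n \<Omega> u x) i * testgrad i x"
  let ?W = "\<lambda>x. (V x * (\<bar>u x\<bar> powr (p - 2) * u x)) * test x"
  obtain K where K: "compactin (Rn n) K" "K \<subseteq> \<Omega>" and K0: "\<forall>x\<in>\<Omega>. x \<notin> K \<longrightarrow> \<psi> x = 0" using Cc_support[OF \<Omega> \<psi>D(1)] by blast
  have p0: "0 < p" using p by simp
  have grad: "(\<lambda>x. \<psi> x * wgrad n \<Omega> u x i + u x * wgrad n \<Omega> \<psi> x i) \<in> Lp_loc n p \<Omega>" if "i < n" for i
    by (rule Lp_loc_add[OF \<Omega> p0 Lp_loc_mult_cont[OF \<Omega> p0 U(2)[OF that] \<psi>D(2)] Lp_loc_mult_cont[OF \<Omega> p0 \<Psi>(2)[OF that] uc]])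
  \<comment> \<open>Off K the function \<psi> vanishes, but its chosen weak gradient is known to
    vanish only almost everywhere, by \<open>wgrad_zero_set\<close>.\<close>
  have E0: "AE x in Leb n. x \<in> \<Omega> \<longrightarrow> x \<notin> K \<longrightarrow> ?E x = 0"
    using wgrad_zero_set[OF \<Omega> \<psi>]
  proof eventually_elim
    case (elim x)
    show ?case
    proof (intro impI)
      assume x: "x \<in> \<Omega>" "x \<notin> K"
      then have "\<psi> x = 0" using K0 by blast
      moreover from this have "\<forall>i<n. wgrad n \<Omega> \<psi> x i = 0" using elim x by blast
      ultimately show "?E x = 0" by (simp add: anorm_def)
    qed
  qed
  have iE: "set_integrable (Leb n) \<Omega> ?E"
    by (rule support_integrable[OF \<Omega> anorm_powr_Lp_loc[OF \<Omega> a p grad] K E0])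
  have iF: "set_integrable (Leb n) \<Omega> (?F i)" if "i \<in> {..<n}" for i
  proof (rule support_integrable[OF \<Omega> Lp_loc_product[OF \<Omega> p(1) flux_u testgrad_Lp_loc] K])
    show "AE x in Leb n. x \<in> \<Omega> \<longrightarrow> x \<notin> K \<longrightarrow> ?F i x = 0"
      using K0 by (intro AE_I2) (simp add: testgrad_def)
  qed (use that in auto)
  note iS = set_integral_sum'[where f="?F" and S="{..<n}", OF iF]
  have iW: "set_integrable (Leb n) \<Omega> ?W" by (rule test_integrable[OF \<Omega> potential_term test_Cc])
  have iD: "set_integrable (Leb n) \<Omega> (\<lambda>x. ?E x - (\<Sum>i<n. ?F i x))" by (rule set_integral_diff(1)[OF iE iS(2)])
  have Deq: "set_integrable (Leb n) \<Omega> (defect n p s a \<Omega> u \<psi>) \<longleftrightarrow> set_integrable (Leb n) \<Omega> (\<lambda>x. ?E x - (\<Sum>i<n. ?F i x))"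
    using defect_eq by (intro set_integrable_cong) auto
  then show "set_integrable (Leb n) \<Omega> (defect n p s a \<Omega> u \<psi>)" using iD by blast
  have W: "V x * \<bar>u x * \<psi> x\<bar> powr p = ?W x" if x: "x \<in> \<Omega>" for x
  proof -
    have "\<bar>u x\<bar> powr (p - 2) * u x * u x = \<bar>u x\<bar> powr p" by (rule signed_powr_mult_self)
    moreover have "\<bar>u x * \<psi> x\<bar> powr p = \<bar>u x\<bar> powr p * \<psi> x powr p" using \<psi>D(4)[OF x] by (simp add: abs_mult powr_mult)
    ultimately show ?thesis unfolding test_def by (metis mult.assoc)
  qed
  have iEW: "set_integrable (Leb n) \<Omega> (\<lambda>x. ?E x + ?W x)" by (rule set_integral_add(1)[OF iE iW])
  \<comment> \<open>The functional uses a chosen representative of the weak gradient of u\<psi>,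
    which obeys the product rule only almost everywhere.\<close>
  have ae: "AE x in Leb n. indicator \<Omega> x *\<^sub>R (?E x + ?W x) = indicator \<Omega> x *\<^sub>R
      (anorm n s a x (wgrad n \<Omega> (\<lambda>x. u x * \<psi> x) x) powr p + V x * \<bar>u x * \<psi> x\<bar> powr p)"
    using wgrad_product_AE
  proof eventually_elim
    case (elim x)
    show ?case
    proof (cases "x \<in> \<Omega>")
      case True
      then have "anorm n s a x (wgrad n \<Omega> (\<lambda>x. u x * \<psi> x) x) = anorm n s a x (\<lambda>i. \<psi> x * wgrad n \<Omega> u x i + u x * wgrad n \<Omega> \<psi> x i)"
        using elim by (intro anorm_cong) blast
      then show ?thesis using W[OF True] by (simp only:)
    qed simp
  qed
  have m: "(\<lambda>x. indicator \<Omega> x *\<^sub>R (?E x + ?W x)) \<in> borel_measurable (Leb n)"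
    using iEW unfolding set_integrable_def by (rule borel_measurable_integrable)
  have "Q_fun n p s a V \<Omega> (\<lambda>x. u x * \<psi> x) = (LINT x:\<Omega>|Leb n. ?E x + ?W x)"
    unfolding Q_fun_def set_lebesgue_integral_def
    by (rule integral_cong_AE[OF m measurable_Leb_cong_AE[OF m ae] ae, symmetric])
  also have "\<dots> = (LINT x:\<Omega>|Leb n. ?E x) + (LINT x:\<Omega>|Leb n. ?W x)" by (rule set_integral_add(2)[OF iE iW])
  \<comment> \<open>Here the equation for u is used, and the potential disappears.\<close>
  also have "(LINT x:\<Omega>|Leb n. ?W x) = - (LINT x:\<Omega>|Leb n. \<Sum>i<n. ?F i x)"
  proof -
    have "(LINT x:\<Omega>|Leb n. \<Sum>i<n. ?F i x) = (\<Sum>i<n. LINT x:\<Omega>|Leb n. ?F i x)" by (rule iS(1))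
    then show ?thesis using equation_tested by linarith
  qed
  also have "(LINT x:\<Omega>|Leb n. ?E x) + - (LINT x:\<Omega>|Leb n. \<Sum>i<n. ?F i x) = (LINT x:\<Omega>|Leb n. ?E x - (\<Sum>i<n. ?F i x))"
    using set_integral_diff(2)[OF iE iS(2)] by linarith
  also have "\<dots> = (LINT x:\<Omega>|Leb n. defect n p s a \<Omega> u \<psi> x)"
    using defect_eq Leb_openin[OF \<Omega>] by (intro set_lebesgue_integral_cong) auto
  finally show "Q_fun n p s a V \<Omega> (\<lambda>x. u x * \<psi> x) = (LINT x:\<Omega>|Leb n. defect n p s a \<Omega> u \<psi> x)" .
qed

lemma cgrad_measurable:
  assumes "i < n"
  shows "(\<lambda>x. cgrad n \<Omega> \<psi> u x i) \<in> borel_measurable (restrict_space (Leb n) \<Omega>)"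
    "(\<lambda>x. cgrad n \<Omega> u \<psi> x i) \<in> borel_measurable (restrict_space (Leb n) \<Omega>)"
proof -
  note [measurable] = Lp_loc_restrict_measurable[OF \<Omega> U(2)[OF assms]] Lp_loc_restrict_measurable[OF \<Omega> \<Psi>(2)[OF assms]]
    cont_on_restrict_measurable[OF \<Omega> \<psi>D(2)] cont_on_restrict_measurable[OF \<Omega> uc]
  show "(\<lambda>x. cgrad n \<Omega> \<psi> u x i) \<in> borel_measurable (restrict_space (Leb n) \<Omega>)" unfolding cgrad_def by measurable
  show "(\<lambda>x. cgrad n \<Omega> u \<psi> x i) \<in> borel_measurable (restrict_space (Leb n) \<Omega>)" unfolding cgrad_def by measurable
qed

lemmas X_measurable [measurable] = anorm_measurable[OF \<Omega> a cgrad_measurable(1), where s=s]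
lemmas Y_measurable [measurable] = anorm_measurable[OF \<Omega> a cgrad_measurable(2), where s=s]

lemma R1_measurable: "(\<lambda>x. R1 n p s a l x (cgrad n \<Omega> \<psi> u x) (cgrad n \<Omega> u \<psi> x)) \<in> borel_measurable (restrict_space (Leb n) \<Omega>)"
  unfolding R1_def by measurable

lemma R2_measurable: "(\<lambda>x. R2 n p s a x (cgrad n \<Omega> \<psi> u x) (cgrad n \<Omega> u \<psi> x)) \<in> borel_measurable (restrict_space (Leb n) \<Omega>)"
proof -
  have "(\<lambda>x. tsum n s (sc s a x (cgrad n \<Omega> \<psi> u x)) (sc s a x (cgrad n \<Omega> u \<psi> x))) \<in> borel_measurable (restrict_space (Leb n) \<Omega>)"
    unfolding tsum_def sc_def
  proof (rule borel_measurable_sum)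
    fix i assume "i \<in> {..<n}"
    then have i: "i < n" by simp
    note [measurable] = cgrad_measurable[OF i] weight_measurable[OF \<Omega> a i]
    show "(\<lambda>x. (a i x powr (1 / s) * cgrad n \<Omega> u \<psi> x i)\<^sup>2 *
      (\<bar>a i x powr (1 / s) * cgrad n \<Omega> u \<psi> x i\<bar> + \<bar>a i x powr (1 / s) * cgrad n \<Omega> \<psi> u x i\<bar>) powr (s - 2))
      \<in> borel_measurable (restrict_space (Leb n) \<Omega>)" by measurable
  qed
  note [measurable] = this
  show ?thesis unfolding R2_sc by measurable
qed

lemma Omega_sets: "Omega1 n s a \<Omega> u \<psi> \<in> sets (Leb n)" "Omega2 n s a \<Omega> u \<psi> \<in> sets (Leb n)"
proof -
  have s: "S \<in> sets (Leb n)" if "S \<in> sets (restrict_space (Leb n) \<Omega>)" for S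
    using that sets_restrict_space_iff[of \<Omega> "Leb n" S] Leb_openin[OF \<Omega>] by auto
  have sp: "space (restrict_space (Leb n) \<Omega>) = \<Omega>"
    using sets.sets_into_space[OF Leb_openin[OF \<Omega>]] by (simp add: space_restrict_space Int_absorb2)
  from s[OF borel_measurable_le[OF X_measurable Y_measurable]]
  show "Omega1 n s a \<Omega> u \<psi> \<in> sets (Leb n)" unfolding Omega1_def sp .
  from s[OF borel_measurable_less[OF Y_measurable X_measurable]]
  show "Omega2 n s a \<Omega> u \<psi> \<in> sets (Leb n)" unfolding Omega2_def sp .
qed

lemma zero_set_sets: "zero_set n \<Omega> u \<psi> \<in> sets (Leb n)"
proof -
  have sp: "space (restrict_space (Leb n) \<Omega>) = \<Omega>"
    using sets.sets_into_space[OF Leb_openin[OF \<Omega>]] by (simp add: space_restrict_space Int_absorb2)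
  have s0: "0 < s" using p by simp
  have "{x \<in> space (restrict_space (Leb n) \<Omega>). anorm n s a x (cgrad n \<Omega> \<psi> u x) = 0} \<in> sets (restrict_space (Leb n) \<Omega>)"
    by measurable
  moreover have "{x \<in> \<Omega>. anorm n s a x (cgrad n \<Omega> \<psi> u x) = 0} = zero_set n \<Omega> u \<psi>"
    unfolding zero_set_def using anorm_eq_0[OF s0 weight_pos[OF a]] by blast
  ultimately show ?thesis unfolding sp using sets_restrict_space_iff[of \<Omega> "Leb n"] Leb_openin[OF \<Omega>] by auto
qed

end
end

section \<open>Comparison of the functional with \<open>R1\<close> and \<open>R2\<close>\<close>

context positive_solution_setting
begin

text \<open>The constants are assumed here rather than obtained, because they have to be fixed
  before the data of the locale.\<close>

context
  fixes c C :: real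
  assumes cC: "0 < c" "0 < C"
    and B: "\<forall>n v w. \<forall>X Y. X = lsum n s v powr (1/s) \<longrightarrow> Y = lsum n s w powr (1/s) \<longrightarrow>
      (X \<le> Y \<longrightarrow> c * (Y powr min s 2 * (Y+X) powr (p - min s 2)) \<le> vbreg n p s v w) \<and>
      (Y < X \<longrightarrow> c * (X powr (p-s) * tsum n s v w) \<le> vbreg n p s v w) \<and>
      vbreg n p s v w \<le> C * (Y powr min s 2 * (Y+X) powr (p - min s 2)) \<and>
      (0 < X \<longrightarrow> vbreg n p s v w \<le> C * (X powr (p-s) * tsum n s v w))"
begin

lemma defect_bounds:
  fixes \<psi> :: "pt \<Rightarrow> real"
  assumes x: "x \<in> \<Omega>"
  defines "\<xi> \<equiv> cgrad n \<Omega> \<psi> u x" and "\<eta> \<equiv> cgrad n \<Omega> u \<psi> x"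
  shows "x \<in> Omega1 n s a \<Omega> u \<psi> \<Longrightarrow> c * R1 n p s a (min s 2) x \<xi> \<eta> \<le> defect n p s a \<Omega> u \<psi> x"
    and "x \<in> Omega2 n s a \<Omega> u \<psi> \<Longrightarrow> c * R2 n p s a x \<xi> \<eta> \<le> defect n p s a \<Omega> u \<psi> x"
    and "defect n p s a \<Omega> u \<psi> x \<le> C * R1 n p s a (min s 2) x \<xi> \<eta>"
    and "0 < anorm n s a x \<xi> \<Longrightarrow> defect n p s a \<Omega> u \<psi> x \<le> C * R2 n p s a x \<xi> \<eta>"
    and "0 \<le> defect n p s a \<Omega> u \<psi> x"
proof -
  have s: "0 < s" using p by simp
  note an = anorm_sc[OF s weight_pos[OF a x]]
  note b = B[rule_format, OF an[of \<xi>] an[of \<eta>], folded R2_sc, folded R1_def]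
  have d: "defect n p s a \<Omega> u \<psi> x = vbreg n p s (sc s a x \<xi>) (sc s a x \<eta>)" by (simp add: defect_def \<xi>_def \<eta>_def)
  have r: "0 \<le> R1 n p s a (min s 2) x \<xi> \<eta>" "0 \<le> R2 n p s a x \<xi> \<eta>"
    by (simp_all add: R1_def R2_sc tsum_nonneg)
  show "x \<in> Omega1 n s a \<Omega> u \<psi> \<Longrightarrow> c * R1 n p s a (min s 2) x \<xi> \<eta> \<le> defect n p s a \<Omega> u \<psi> x"
    unfolding d using b by (simp add: Omega1_def \<xi>_def \<eta>_def)
  show "x \<in> Omega2 n s a \<Omega> u \<psi> \<Longrightarrow> c * R2 n p s a x \<xi> \<eta> \<le> defect n p s a \<Omega> u \<psi> x"
    unfolding d using b by (simp add: Omega2_def \<xi>_def \<eta>_def)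
  show "defect n p s a \<Omega> u \<psi> x \<le> C * R1 n p s a (min s 2) x \<xi> \<eta>" unfolding d using b by blast
  show "0 < anorm n s a x \<xi> \<Longrightarrow> defect n p s a \<Omega> u \<psi> x \<le> C * R2 n p s a x \<xi> \<eta>" unfolding d using b by blast
  show "0 \<le> defect n p s a \<Omega> u \<psi> x"
  proof (cases "anorm n s a x \<xi> \<le> anorm n s a x \<eta>")
    case True
    then have "c * R1 n p s a (min s 2) x \<xi> \<eta> \<le> defect n p s a \<Omega> u \<psi> x" unfolding d using b by blast
    then show ?thesis using mult_nonneg_nonneg[OF less_imp_le[OF cC(1)] r(1)] by linarith
  next
    case False
    then have "c * R2 n p s a x \<xi> \<eta> \<le> defect n p s a \<Omega> u \<psi> x" unfolding d using b by (meson not_le)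
    then show ?thesis using mult_nonneg_nonneg[OF less_imp_le[OF cC(1)] r(2)] by linarith
  qed
qed

text \<open>Nonnegativity of the remainder lets the real integral be read as an extended one, so the
  comparison can take place in \<open>ereal\<close>, where the other side may be infinite.\<close>

lemma Q_nint:
  assumes \<psi>: "\<psi> \<in> nonneg_tests n p \<Omega>"
  shows "ereal (Q_fun n p s a V \<Omega> (\<lambda>x. u x * \<psi> x)) = nint n \<Omega> (defect n p s a \<Omega> u \<psi>)"
  unfolding defect_integral(2)[OF \<psi>] by (rule nint_set_integral[OF defect_integral(1)[OF \<psi>] defect_bounds(5), symmetric])

lemma Omega_subset: "Omega1 n s a \<Omega> u \<psi> \<subseteq> \<Omega>" "Omega2 n s a \<Omega> u \<psi> \<subseteq> \<Omega>"
  by (auto simp: Omega1_def Omega2_def)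

lemma lower_bound:
  assumes \<psi>: "\<psi> \<in> nonneg_tests n p \<Omega>"
  shows "ereal c * int_R1 n p s a \<Omega> u (Omega1 n s a \<Omega> u \<psi>) \<psi> + ereal c * int_R2 n p s a \<Omega> u (Omega2 n s a \<Omega> u \<psi>) \<psi>
    \<le> ereal (Q_fun n p s a V \<Omega> (\<lambda>x. u x * \<psi> x))"
proof -
  let ?f = "\<lambda>x. R1 n p s a (min s 2) x (cgrad n \<Omega> \<psi> u x) (cgrad n \<Omega> u \<psi> x)"
  let ?g = "\<lambda>x. R2 n p s a x (cgrad n \<Omega> \<psi> u x) (cgrad n \<Omega> u \<psi> x)"
  let ?A = "Omega1 n s a \<Omega> u \<psi>" let ?B = "Omega2 n s a \<Omega> u \<psi>" let ?h = "defect n p s a \<Omega> u \<psi>"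
  have "ereal c * nint n ?A ?f + ereal c * nint n ?B ?g =
    enn2ereal (\<integral>\<^sup>+x. ennreal (c * ?f x) * indicator ?A x + ennreal (c * ?g x) * indicator ?B x \<partial>Leb n)"
    using cC by (intro nint_combination[OF \<Omega> _ R1_measurable[OF \<psi>] _ _ R2_measurable[OF \<psi>]] Omega_sets[OF \<psi>] Omega_subset) simp
  also have "\<dots> \<le> enn2ereal (\<integral>\<^sup>+x\<in>\<Omega>. ennreal (?h x) \<partial>Leb n)"
  proof -
    have "ennreal (c * ?f x) * indicator ?A x + ennreal (c * ?g x) * indicator ?B x \<le> ennreal (?h x) * indicator \<Omega> x" for x
    proof (cases "x \<in> \<Omega>")
      case True
      show ?thesis
      proof (cases "x \<in> ?A")
        case True
        then have "x \<notin> ?B" by (simp add: Omega1_def Omega2_def)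
        then show ?thesis using True \<open>x \<in> \<Omega>\<close> ennreal_leI[OF defect_bounds(1)[OF \<open>x \<in> \<Omega>\<close> True]] by simp
      next
        case False
        then have "x \<in> ?B" using \<open>x \<in> \<Omega>\<close> by (simp add: Omega1_def Omega2_def)
        then show ?thesis using False \<open>x \<in> \<Omega>\<close> ennreal_leI[OF defect_bounds(2)[OF \<open>x \<in> \<Omega>\<close> \<open>x \<in> ?B\<close>]] by simp
      qed
    next
      case False
      then have "x \<notin> ?A" "x \<notin> ?B" using Omega_subset by (simp_all add: Omega1_def Omega2_def)
      then show ?thesis by simp
    qed
    then show ?thesis unfolding less_eq_ennreal.rep_eq[symmetric] by (rule nn_integral_mono)
  qed
  finally show ?thesis unfolding Q_nint[OF \<psi>] int_R1_def int_R2_def nint_def[of n \<Omega>] .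
qed

text \<open>The regions belong to \<psi> and the integrand to \<phi>, so the bounds are used without
  their size conditions: the one by \<open>R1\<close> holds everywhere, the one by \<open>R2\<close>
  wherever \<phi>\<nabla>u is nonzero. The points removed from the second region carry no remainder,
  up to a null set.\<close>

lemma upper_bound:
  assumes \<psi>: "\<psi> \<in> nonneg_tests n p \<Omega>" and \<phi>: "\<phi> \<in> nonneg_tests n p \<Omega>"
  shows "ereal (Q_fun n p s a V \<Omega> (\<lambda>x. u x * \<phi> x)) \<le> ereal C * int_R1 n p s a \<Omega> u (Omega1 n s a \<Omega> u \<psi>) \<phi>
    + ereal C * int_R2 n p s a \<Omega> u (Omega2 n s a \<Omega> u \<psi> - zero_set n \<Omega> u \<phi>) \<phi>"
proof -
  let ?f = "\<lambda>x. R1 n p s a (min s 2) x (cgrad n \<Omega> \<phi> u x) (cgrad n \<Omega> u \<phi> x)"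
  let ?g = "\<lambda>x. R2 n p s a x (cgrad n \<Omega> \<phi> u x) (cgrad n \<Omega> u \<phi> x)"
  let ?A = "Omega1 n s a \<Omega> u \<psi>" let ?B = "Omega2 n s a \<Omega> u \<psi> - zero_set n \<Omega> u \<phi>" let ?h = "defect n p s a \<Omega> u \<phi>"
  have s: "0 < s" using p by simp
  have "enn2ereal (\<integral>\<^sup>+x\<in>\<Omega>. ennreal (?h x) \<partial>Leb n)
    \<le> enn2ereal (\<integral>\<^sup>+x. ennreal (C * ?f x) * indicator ?A x + ennreal (C * ?g x) * indicator ?B x \<partial>Leb n)"
  proof -
    have "AE x in Leb n. ennreal (?h x) * indicator \<Omega> x \<le> ennreal (C * ?f x) * indicator ?A x + ennreal (C * ?g x) * indicator ?B x"
      using wgrad_zero_set[OF \<Omega> \<phi>]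
    proof eventually_elim
      case (elim x)
      show ?case
      proof (cases "x \<in> \<Omega>")
        case x: True
        note ax = weight_pos[OF a x]
        have "x \<in> ?A \<or> x \<in> Omega2 n s a \<Omega> u \<psi>" using x by (auto simp: Omega1_def Omega2_def)
        then consider "x \<in> ?A" | "x \<in> ?B" | "x \<in> Omega2 n s a \<Omega> u \<psi>" "x \<in> zero_set n \<Omega> u \<phi>" by blast
        then show ?thesis
        proof cases
          case 1
          then have "x \<notin> ?B" by (simp add: Omega1_def Omega2_def)
          then show ?thesis using 1 x ennreal_leI[OF defect_bounds(3)[OF x, of \<phi>]] by simp
        next
          case 2
          then have "\<not> (\<forall>i<n. cgrad n \<Omega> \<phi> u x i = 0)" using x unfolding zero_set_def by blast
          then have pos: "0 < anorm n s a x (cgrad n \<Omega> \<phi> u x)"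
            using anorm_nonneg[of n s a x "cgrad n \<Omega> \<phi> u x"] anorm_eq_0[OF s ax, of "cgrad n \<Omega> \<phi> u x"] by (metis order_less_le)
          have "x \<notin> ?A" using 2 by (simp add: Omega1_def Omega2_def)
          then show ?thesis using 2 x ennreal_leI[OF defect_bounds(4)[OF x pos]] by simp
        next
          \<comment> \<open>Membership in \<open>Omega2\<close> for \<psi> forces \<nabla>u \<noteq>
            0, so \<phi>\<nabla>u = 0 means \<phi> = 0. Almost everywhere there \<nabla>\<phi> = 0
            as well, and the bound by \<open>R1\<close> gives a remainder of at most 0.\<close>
          case 3
          have "0 < anorm n s a x (cgrad n \<Omega> \<psi> u x)"
            using 3(1) anorm_nonneg[of n s a x "cgrad n \<Omega> u \<psi> x"] by (simp add: Omega2_def)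
          then obtain i where i: "i < n" "cgrad n \<Omega> \<psi> u x i \<noteq> 0"
            using anorm_eq_0[OF s ax, of "cgrad n \<Omega> \<psi> u x"] by fastforce
          then have "wgrad n \<Omega> u x i \<noteq> 0" by (auto simp: cgrad_def)
          moreover have "cgrad n \<Omega> \<phi> u x i = 0" using 3(2) i(1) by (simp add: zero_set_def)
          ultimately have "\<phi> x = 0" by (simp add: cgrad_def)
          then have "\<forall>i<n. wgrad n \<Omega> \<phi> x i = 0" using elim x by blast
          then have "anorm n s a x (cgrad n \<Omega> u \<phi> x) = 0" unfolding anorm_eq_0[OF s ax] by (simp add: cgrad_def)
          then have "?f x = 0" by (simp add: R1_def)
          then have "?h x \<le> 0" using defect_bounds(3)[OF x, of \<phi>] by simp
          then show ?thesis by (simp add: ennreal_neg)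
        qed
      qed simp
    qed
    then show ?thesis unfolding less_eq_ennreal.rep_eq[symmetric] by (rule nn_integral_mono_AE)
  qed
  also have "\<dots> = ereal C * nint n ?A ?f + ereal C * nint n ?B ?g"
  proof (intro nint_combination[OF \<Omega> _ R1_measurable[OF \<phi>] _ _ R2_measurable[OF \<phi>], symmetric])
    show "?B \<in> sets (Leb n)" by (intro sets.Diff Omega_sets[OF \<psi>] zero_set_sets[OF \<phi>])
    show "?B \<subseteq> \<Omega>" using Omega_subset(2)[of \<psi>] by (rule subset_trans[OF Diff_subset])
    show "0 \<le> C" using cC(2) by simp
    show "?A \<in> sets (Leb n)" by (rule Omega_sets(1)[OF \<psi>])
    show "?A \<subseteq> \<Omega>" by (rule Omega_subset(1))
  qed
  finally show ?thesis unfolding Q_nint[OF \<phi>] int_R1_def int_R2_def nint_def[of n \<Omega>] .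
qed

text \<open>For a single function the strict inequality defining \<open>Omega2\<close> already
  excludes \<psi>\<nabla>u = 0, so removing the zero set changes nothing and both earlier bounds
  speak of the same regions.\<close>

lemma E_fun_bounds:
  assumes \<psi>: "\<psi> \<in> nonneg_tests n p \<Omega>"
  shows "ereal c * E_fun n p s a \<Omega> u \<psi> \<le> ereal (Q_fun n p s a V \<Omega> (\<lambda>x. u x * \<psi> x))"
    and "ereal (Q_fun n p s a V \<Omega> (\<lambda>x. u x * \<psi> x)) \<le> ereal (max c C) * E_fun n p s a \<Omega> u \<psi>"
proof -
  have s: "0 < s" using p by simp
  have "x \<notin> zero_set n \<Omega> u \<psi>" if x: "x \<in> Omega2 n s a \<Omega> u \<psi>" for x
  proof
    assume "x \<in> zero_set n \<Omega> u \<psi>"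
    then have "anorm n s a x (cgrad n \<Omega> \<psi> u x) = 0" using anorm_eq_0[OF s weight_pos[OF a]] by (simp add: zero_set_def)
    then show False using x anorm_nonneg[of n s a x "cgrad n \<Omega> u \<psi> x"] by (simp add: Omega2_def)
  qed
  then have e: "Omega2 n s a \<Omega> u \<psi> - zero_set n \<Omega> u \<psi> = Omega2 n s a \<Omega> u \<psi>" by blast
  have nn: "0 \<le> nint n A f" for A f by (simp add: nint_def)
  have dist: "ereal d * E_fun n p s a \<Omega> u \<psi> = ereal d * int_R1 n p s a \<Omega> u (Omega1 n s a \<Omega> u \<psi>) \<psi>
      + ereal d * int_R2 n p s a \<Omega> u (Omega2 n s a \<Omega> u \<psi>) \<psi>" for d
    unfolding E_fun_def e by (rule ereal_right_distrib) (simp_all add: int_R1_def int_R2_def nn)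
  show "ereal c * E_fun n p s a \<Omega> u \<psi> \<le> ereal (Q_fun n p s a V \<Omega> (\<lambda>x. u x * \<psi> x))"
    unfolding dist by (rule lower_bound[OF \<psi>])
  have "ereal (Q_fun n p s a V \<Omega> (\<lambda>x. u x * \<psi> x)) \<le> ereal C * E_fun n p s a \<Omega> u \<psi>"
    unfolding dist using upper_bound[OF \<psi> \<psi>] unfolding e .
  also have "\<dots> \<le> ereal (max c C) * E_fun n p s a \<Omega> u \<psi>"
    by (rule ereal_mult_right_mono) (simp_all add: E_fun_def int_R1_def int_R2_def nn)
  finally show "ereal (Q_fun n p s a V \<Omega> (\<lambda>x. u x * \<psi> x)) \<le> ereal (max c C) * E_fun n p s a \<Omega> u \<psi>" .
qed

end
end

theorem lemma3p20:
  fixes p s :: real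
  assumes "1 < p" and "p < s"
  shows "\<exists>c C c' C' :: real. 0 < c \<and> 0 < C \<and> 0 < c' \<and> c' \<le> C' \<and>
    (\<forall>(n::nat) (q::real) \<Omega> a V u.
       2 \<le> n \<longrightarrow> is_domain n \<Omega> \<longrightarrow> weight n \<Omega> a \<longrightarrow>
       morrey_exponent n q p \<longrightarrow> V \<in> morrey_loc n q p \<Omega> \<longrightarrow>
       (\<forall>\<phi>\<in>Cc_inf n \<Omega>. 0 \<le> Q_fun n p s a V \<Omega> \<phi>) \<longrightarrow>
       positive_solution n p s a V \<Omega> u \<longrightarrow> cont_on n \<Omega> u \<longrightarrow>
       (\<forall>\<psi>\<in>nonneg_tests n p \<Omega>. \<forall>\<phi>\<in>nonneg_tests n p \<Omega>.
          ereal (Q_fun n p s a V \<Omega> (\<lambda>x. u x * \<psi> x)) \<ge>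
            ereal c * int_R1 n p s a \<Omega> u (Omega1 n s a \<Omega> u \<psi>) \<psi> +
            ereal c * int_R2 n p s a \<Omega> u (Omega2 n s a \<Omega> u \<psi>) \<psi> \<and>
          ereal (Q_fun n p s a V \<Omega> (\<lambda>x. u x * \<phi> x)) \<le>
            ereal C * int_R1 n p s a \<Omega> u (Omega1 n s a \<Omega> u \<psi>) \<phi> +
            ereal C * int_R2 n p s a \<Omega> u (Omega2 n s a \<Omega> u \<psi> - zero_set n \<Omega> u \<phi>) \<phi>) \<and>
       (\<forall>\<psi>\<in>nonneg_tests n p \<Omega>.
          ereal c' * E_fun n p s a \<Omega> u \<psi> \<le> ereal (Q_fun n p s a V \<Omega> (\<lambda>x. u x * \<psi> x)) \<and>
          ereal (Q_fun n p s a V \<Omega> (\<lambda>x. u x * \<psi> x)) \<le> ereal C' * E_fun n p s a \<Omega> u \<psi>))"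
proof -
  obtain c C where cC: "0 < c" "0 < C" "\<forall>n v w. \<forall>X Y. X = lsum n s v powr (1/s) \<longrightarrow> Y = lsum n s w powr (1/s) \<longrightarrow>
      (X \<le> Y \<longrightarrow> c * (Y powr min s 2 * (Y+X) powr (p - min s 2)) \<le> vbreg n p s v w) \<and>
      (Y < X \<longrightarrow> c * (X powr (p-s) * tsum n s v w) \<le> vbreg n p s v w) \<and>
      vbreg n p s v w \<le> C * (Y powr min s 2 * (Y+X) powr (p - min s 2)) \<and>
      (0 < X \<longrightarrow> vbreg n p s v w \<le> C * (X powr (p-s) * tsum n s v w))"
    using vbreg_two_sided[OF assms] by blast
  show ?thesis
  \<comment> \<open>The last witness is \<open>max c C\<close> so that the two constants of the
    final estimate are ordered; enlarging C is harmless because \<open>E_fun\<close> is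
    nonnegative.\<close>
  proof (rule exI[of _ c], rule exI[of _ C], rule exI[of _ c], rule exI[of _ "max c C"], intro conjI allI impI ballI)
    fix n :: nat and q :: real and \<Omega> :: "pt set" and a V u and \<psi>
    assume h: "is_domain n \<Omega>" "weight n \<Omega> a" "V \<in> morrey_loc n q p \<Omega>"
      "positive_solution n p s a V \<Omega> u" "cont_on n \<Omega> u"
    have \<Omega>: "openin (Rn n) \<Omega>" using h(1) by (simp add: is_domain_def)
    interpret positive_solution_setting n p s \<Omega> a V u
      by unfold_locales (use assms h \<Omega> morrey_loc_Lp_loc_1[OF \<Omega> h(3)] in auto)
    assume \<psi>: "\<psi> \<in> nonneg_tests n p \<Omega>"
    show "ereal c * int_R1 n p s a \<Omega> u (Omega1 n s a \<Omega> u \<psi>) \<psi> + ereal c * int_R2 n p s a \<Omega> u (Omega2 n s a \<Omega> u \<psi>) \<psi>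
        \<le> ereal (Q_fun n p s a V \<Omega> (\<lambda>x. u x * \<psi> x))"
      by (rule lower_bound[OF cC \<psi>])
    show "ereal c * E_fun n p s a \<Omega> u \<psi> \<le> ereal (Q_fun n p s a V \<Omega> (\<lambda>x. u x * \<psi> x))"
      "ereal (Q_fun n p s a V \<Omega> (\<lambda>x. u x * \<psi> x)) \<le> ereal (max c C) * E_fun n p s a \<Omega> u \<psi>"
      by (rule E_fun_bounds[OF cC \<psi>])+
    fix \<phi> assume \<phi>: "\<phi> \<in> nonneg_tests n p \<Omega>"
    show "ereal (Q_fun n p s a V \<Omega> (\<lambda>x. u x * \<phi> x)) \<le> ereal C * int_R1 n p s a \<Omega> u (Omega1 n s a \<Omega> u \<psi>) \<phi>
        + ereal C * int_R2 n p s a \<Omega> u (Omega2 n s a \<Omega> u \<psi> - zero_set n \<Omega> u \<phi>) \<phi>"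
      by (rule upper_bound[OF cC \<psi> \<phi>])
  qed (use cC in auto)
qed

end
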